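(* For OMQs $Q=(\mathcal{O},\Sigma,q)$ with $\mathcal{O}$ an $\mathcal{EL}$-ontology and $q$ an arbitrary CQ, single-testing minimal partial answers (given $Q$, a $\Sigma$-database $\mathcal{D}$ and a candidate tuple, decide whether it is a minimal partial answer) is DP-complete in combined complexity. This holds both for a single wildcard and for multi-wildcards, and the same holds when $\mathcal{O}$ ranges over $\mathcal{ELH}$-ontologies.
   Context: $\mathcal{EL}$-concepts: $C,D::=\top\mid A\mid C\sqcap D\mid\exists r.C$ ($r$ a role name). An $\mathcal{EL}$-ontology is a finite set of concept inclusions between $\mathcal{EL}$-concepts; $\mathcal{ELH}$-ontologies may also contain role inclusions $r\sqsubseteq s$. Databases are finite sets of facts $A(c)$, $r(c,c')$; standard names assumption. $q(\mathcal{I})$ is the set of $h(\bar x)$ for homomorphisms $h$ from $q(\bar x)$ to $\mathcal{I}$. An OMQ $Q(\bar x)=(\mathcal{O},\Sigma,q)$ is evaluated on $\Sigma$-databases. Single wildcard: tuples over $\mathsf{adom}(\mathcal{D})\cup\{\ast\}$ with $\bar c\preceq\bar c'$ iff $c'_i\in\{c_i,\ast\}$ for all $i$. Multi-wildcards: tuples over $\mathsf{adom}(\mathcal{D})\cup\{\ast_1,\ast_2,\dots\}$ where $\ast_j$ ($j>1$) appears only after an earlier occurrence of $\ast_{j-1}$, with $\bar c\preceq\bar c'$ iff for all $i$ ($c_i=c'_i$ or $c'_i$ is a wildcard) and $c'_i=c'_j$ implies $c_i=c_j$. In both cases a partial answer to $Q$ on $\mathcal{D}$ is such a tuple $\bar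 c$ of length $|\bar x|$ such that every model $\mathcal{I}$ of $\mathcal{O}$ and $\mathcal{D}$ has some $\bar c'\in q(\mathcal{I})$ with $\bar c'\preceq\bar c$, and it is minimal if no partial answer $\bar c''\neq\bar c$ satisfies $\bar c''\preceq\bar c$. DP is the class of languages $L_1\cap L_2$ with $L_1\in\mathrm{NP}$ and $L_2\in\mathrm{coNP}$. *)

theory Defs
  imports Main
begin

section \<open>Polynomial time, NP, and DP\<close>

text \<open>Deterministic Turing machines with finitely many two-way infinite tapes. The working
  control states are \<open>{..<states M}\<close>, state 0 is initial, and \<open>states M\<close> is the only halting state.
  Tape symbols are the numbers below \<open>symbols M\<close>: 0 is the blank, 1 and 2 are the bits. Tape 0
  carries the input and tape 1 the output. The values of \<open>delta M\<close> outside the finite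
  range constrained by \<open>wf_tm\<close> are never used.\<close>

datatype dir = ToLeft | Stay | ToRight

record tm =
  tapes :: nat
  symbols :: nat
  states :: nat
  delta :: "nat \<Rightarrow> nat list \<Rightarrow> nat \<times> (nat \<times> dir) list"

definition wf_tm :: "tm \<Rightarrow> bool" where
  "wf_tm M \<longleftrightarrow> 2 \<le> tapes M \<and> 3 \<le> symbols M \<and>
    (\<forall>q < states M. \<forall>ss. length ss = tapes M \<and> set ss \<subseteq> {..<symbols M} \<longrightarrow>
      fst (delta M q ss) \<le> states M \<and>
      length (snd (delta M q ss)) = tapes M \<and>
      fst ` set (snd (delta M q ss)) \<subseteq> {..<symbols M})"

type_synonym tape = "int \<times> (int \<Rightarrow> nat)"  \<comment> \<open>head position and contents\<close>
type_synonym config = "nat \<times> tape list"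

fun read :: "tape \<Rightarrow> nat" where
  "read (p, f) = f p"

fun shift :: "dir \<Rightarrow> int" where
  "shift ToLeft = -1"
| "shift Stay = 0"
| "shift ToRight = 1"

fun act :: "nat \<times> dir \<Rightarrow> tape \<Rightarrow> tape" where
  "act (s, d) (p, f) = (p + shift d, f(p := s))"

fun step :: "tm \<Rightarrow> config \<Rightarrow> config" where
  "step M (q, ts) =
    (if q < states M
     then (case delta M q (map read ts) of (q', as) \<Rightarrow> (q', map2 act as ts))
     else (q, ts))"

definition word_cells :: "bool list \<Rightarrow> int \<Rightarrow> nat" where
  "word_cells w i =
    (if 0 \<le> i \<and> i < int (length w) then (if w ! nat i then 2 else 1) else 0)"

definition init_config :: "tm \<Rightarrow> bool list \<Rightarrow> config" where
  "init_config M w = (0, (0, word_cells w) # replicate (tapes M - 1) (0, \<lambda>_. 0))"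

text \<open>The output is the word that starts in cell 0 of tape 1 and extends to the first blank.\<close>

definition halts_with :: "tm \<Rightarrow> config \<Rightarrow> bool list \<Rightarrow> bool" where
  "halts_with M cfg w \<longleftrightarrow> fst cfg = states M \<and>
    (\<forall>i. 0 \<le> i \<and> i \<le> int (length w) \<longrightarrow> snd (snd cfg ! 1) i = word_cells w i)"

definition polytime :: "(bool list \<Rightarrow> bool list) \<Rightarrow> bool" where
  "polytime f \<longleftrightarrow> (\<exists>M c d. wf_tm M \<and>
    (\<forall>w. \<exists>t \<le> c * length w ^ d + c. halts_with M ((step M ^^ t) (init_config M w)) (f w)))"

type_synonym language = "bool list set"

definition self_delim :: "bool list \<Rightarrow> bool list" where
  "self_delim w = concat (map (\<lambda>b. [True, b]) w) @ [False]"

definition pair_word :: "bool list \<Rightarrow> bool list \<Rightarrow> bool list" where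
  "pair_word x y = self_delim x @ y"

definition NP :: "language set" where
  "NP = {L. \<exists>V c d. polytime V \<and>
    (\<forall>x. x \<in> L \<longleftrightarrow> (\<exists>y. length y \<le> c * length x ^ d + c \<and> V (pair_word x y) = [True]))}"

definition coNP :: "language set" where
  "coNP = {L. - L \<in> NP}"

definition DP :: "language set" where
  "DP = {L1 \<inter> L2 | L1 L2. L1 \<in> NP \<and> L2 \<in> coNP}"

definition poly_reducible :: "language \<Rightarrow> language \<Rightarrow> bool" (infix "\<le>\<^sub>p" 50) where
  "L \<le>\<^sub>p K \<longleftrightarrow> (\<exists>f. polytime f \<and> (\<forall>x. x \<in> L \<longleftrightarrow> f x \<in> K))"

definition DP_complete :: "language \<Rightarrow> bool" where
  "DP_complete K \<longleftrightarrow> K \<in> DP \<and> (\<forall>L \<in> DP. L \<le>\<^sub>p K)"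


section \<open>Ontologies, databases, and queries\<close>

text \<open>Concept names, role names, constants, and variables are drawn from four disjoint countable
  sets, each represented by \<open>nat\<close>. Finite sets that are part of a problem input are given as
  lists; the semantics depends only on the set of list elements.\<close>

datatype 'd elem = Const nat | Anon 'd

datatype 'a atom = CAtom nat 'a | RAtom nat 'a 'a

datatype concept = Top | Name nat | And concept concept | Ex nat concept

datatype inclusion = CI concept concept | RI nat nat

type_synonym ontology = "inclusion list"

type_synonym database = "nat atom list"

definition EL :: "ontology set" where
  "EL = {Ont. \<forall>a \<in> set Ont. \<exists>C D. a = CI C D}"

definition ELH :: "ontology set" where
  "ELH = {Ont. \<forall>a \<in> set Ont. (\<exists>C D. a = CI C D) \<or> (\<exists>r s. a = RI r s)}"

record 'e interp =
  domain :: "'e set"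
  cext :: "nat \<Rightarrow> 'e set"
  rext :: "nat \<Rightarrow> ('e \<times> 'e) set"

definition wf_interp :: "'e interp \<Rightarrow> bool" where
  "wf_interp I \<longleftrightarrow> domain I \<noteq> {} \<and> (\<forall>A. cext I A \<subseteq> domain I) \<and>
    (\<forall>r. rext I r \<subseteq> domain I \<times> domain I)"

fun ext :: "'e interp \<Rightarrow> concept \<Rightarrow> 'e set" where
  "ext I Top = domain I"
| "ext I (Name A) = cext I A"
| "ext I (And C D) = ext I C \<inter> ext I D"
| "ext I (Ex r C) = {d \<in> domain I. \<exists>e \<in> ext I C. (d, e) \<in> rext I r}"

fun sat_inclusion :: "'e interp \<Rightarrow> inclusion \<Rightarrow> bool" where
  "sat_inclusion I (CI C D) \<longleftrightarrow> ext I C \<subseteq> ext I D"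
| "sat_inclusion I (RI r s) \<longleftrightarrow> rext I r \<subseteq> rext I s"

fun sat_atom :: "'e interp \<Rightarrow> 'e atom \<Rightarrow> bool" where
  "sat_atom I (CAtom A d) \<longleftrightarrow> d \<in> cext I A"
| "sat_atom I (RAtom r d e) \<longleftrightarrow> (d, e) \<in> rext I r"

definition adom :: "database \<Rightarrow> nat set" where
  "adom D = (\<Union>a \<in> set D. set_atom a)"

text \<open>Standard names: a constant \<open>c\<close> is interpreted as the element \<open>Const c\<close>.\<close>

definition model :: "ontology \<Rightarrow> database \<Rightarrow> 'd elem interp \<Rightarrow> bool" where
  "model Ont D I \<longleftrightarrow> wf_interp I \<and> (\<forall>a \<in> set Ont. sat_inclusion I a) \<and>
    (\<forall>a \<in> set D. sat_atom I (map_atom Const a))"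

record cq =
  ans :: "nat list"
  body :: "nat atom list"

definition qvars :: "cq \<Rightarrow> nat set" where
  "qvars q = set (ans q) \<union> (\<Union>a \<in> set (body q). set_atom a)"

definition query_hom :: "(nat \<Rightarrow> 'e) \<Rightarrow> cq \<Rightarrow> 'e interp \<Rightarrow> bool" where
  "query_hom h q I \<longleftrightarrow> h ` qvars q \<subseteq> domain I \<and> (\<forall>a \<in> set (body q). sat_atom I (map_atom h a))"

definition answers :: "cq \<Rightarrow> 'e interp \<Rightarrow> 'e list set" where
  "answers q I = {map h (ans q) | h. query_hom h q I}"

record omq =
  onto :: ontology
  csig :: "nat list"
  rsig :: "nat list"
  query :: cq

fun atom_over :: "nat set \<Rightarrow> nat set \<Rightarrow> 'a atom \<Rightarrow> bool" where
  "atom_over As rs (CAtom A x) \<longleftrightarrow> A \<in> As"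
| "atom_over As rs (RAtom r x y) \<longleftrightarrow> r \<in> rs"

definition sig_database :: "omq \<Rightarrow> database \<Rightarrow> bool" where
  "sig_database Q D \<longleftrightarrow> (\<forall>a \<in> set D. atom_over (set (csig Q)) (set (rsig Q)) a)"


section \<open>Minimal partial answers\<close>

datatype 'a swild = SVal 'a | Star

text \<open>\<open>Wild j\<close> stands for the wildcard with index \<open>j + 1\<close>.\<close>

datatype 'a mwild = MVal 'a | Wild nat

definition sle :: "'a swild list \<Rightarrow> 'a swild list \<Rightarrow> bool" where
  "sle c c' \<longleftrightarrow> length c = length c' \<and> (\<forall>i < length c. c' ! i \<in> {c ! i, Star})"

definition mle :: "'a mwild list \<Rightarrow> 'a mwild list \<Rightarrow> bool" where
  "mle c c' \<longleftrightarrow> length c = length c' \<and>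
    (\<forall>i < length c. c ! i = c' ! i \<or> (\<exists>j. c' ! i = Wild j)) \<and>
    (\<forall>i < length c. \<forall>j < length c. c' ! i = c' ! j \<longrightarrow> c ! i = c ! j)"

definition stuple :: "database \<Rightarrow> nat swild list \<Rightarrow> bool" where
  "stuple D c \<longleftrightarrow> (\<forall>i < length c. c ! i = Star \<or> c ! i \<in> SVal ` adom D)"

definition mtuple :: "database \<Rightarrow> nat mwild list \<Rightarrow> bool" where
  "mtuple D c \<longleftrightarrow> (\<forall>i < length c. (\<exists>j. c ! i = Wild j) \<or> c ! i \<in> MVal ` adom D) \<and>
    (\<forall>i < length c. \<forall>j. c ! i = Wild (Suc j) \<longrightarrow> (\<exists>k < i. c ! k = Wild j))"

text \<open>The type argument fixes the supply of domain elements other than constants. Since it is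
  arbitrary, no bound is imposed on the cardinality of models.\<close>

definition partial_answer_s :: "'d itself \<Rightarrow> omq \<Rightarrow> database \<Rightarrow> nat swild list \<Rightarrow> bool" where
  "partial_answer_s T Q D c \<longleftrightarrow> length c = length (ans (query Q)) \<and> stuple D c \<and>
    (\<forall>I :: 'd elem interp. model (onto Q) D I \<longrightarrow>
      (\<exists>a \<in> answers (query Q) I. sle (map SVal a) (map (map_swild Const) c)))"

definition partial_answer_m :: "'d itself \<Rightarrow> omq \<Rightarrow> database \<Rightarrow> nat mwild list \<Rightarrow> bool" where
  "partial_answer_m T Q D c \<longleftrightarrow> length c = length (ans (query Q)) \<and> mtuple D c \<and>
    (\<forall>I :: 'd elem interp. model (onto Q) D I \<longrightarrow>
      (\<exists>a \<in> answers (query Q) I. mle (map MVal a) (map (map_mwild Const) c)))"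

definition minimal_partial_answer_s ::
    "'d itself \<Rightarrow> omq \<Rightarrow> database \<Rightarrow> nat swild list \<Rightarrow> bool" where
  "minimal_partial_answer_s T Q D c \<longleftrightarrow> partial_answer_s T Q D c \<and>
    \<not> (\<exists>c'. partial_answer_s T Q D c' \<and> c' \<noteq> c \<and> sle c' c)"

definition minimal_partial_answer_m ::
    "'d itself \<Rightarrow> omq \<Rightarrow> database \<Rightarrow> nat mwild list \<Rightarrow> bool" where
  "minimal_partial_answer_m T Q D c \<longleftrightarrow> partial_answer_m T Q D c \<and>
    \<not> (\<exists>c'. partial_answer_m T Q D c' \<and> c' \<noteq> c \<and> mle c' c)"


section \<open>Encoding of inputs\<close>

text \<open>Names are written in binary (least significant bit first); all codes are prefix-free, so that
  concatenation encodes tuples.\<close>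

fun bits :: "nat \<Rightarrow> bool list" where
  "bits n = (if n = 0 then [] else odd n # bits (n div 2))"

declare bits.simps [simp del]

definition enc_nat :: "nat \<Rightarrow> bool list" where
  "enc_nat n = self_delim (bits n)"

definition enc_list :: "('a \<Rightarrow> bool list) \<Rightarrow> 'a list \<Rightarrow> bool list" where
  "enc_list e xs = concat (map (\<lambda>x. True # e x) xs) @ [False]"

fun enc_concept :: "concept \<Rightarrow> bool list" where
  "enc_concept Top = [False, False]"
| "enc_concept (Name A) = [False, True] @ enc_nat A"
| "enc_concept (And C D) = [True, False] @ enc_concept C @ enc_concept D"
| "enc_concept (Ex r C) = [True, True] @ enc_nat r @ enc_concept C"

fun enc_inclusion :: "inclusion \<Rightarrow> bool list" where
  "enc_inclusion (CI C D) = False # enc_concept C @ enc_concept D"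
| "enc_inclusion (RI r s) = True # enc_nat r @ enc_nat s"

fun enc_atom :: "nat atom \<Rightarrow> bool list" where
  "enc_atom (CAtom A x) = False # enc_nat A @ enc_nat x"
| "enc_atom (RAtom r x y) = True # enc_nat r @ enc_nat x @ enc_nat y"

fun enc_swild :: "nat swild \<Rightarrow> bool list" where
  "enc_swild (SVal c) = False # enc_nat c"
| "enc_swild Star = [True]"

fun enc_mwild :: "nat mwild \<Rightarrow> bool list" where
  "enc_mwild (MVal c) = False # enc_nat c"
| "enc_mwild (Wild j) = True # enc_nat j"

definition enc_cq :: "cq \<Rightarrow> bool list" where
  "enc_cq q = enc_list enc_nat (ans q) @ enc_list enc_atom (body q)"

definition enc_omq :: "omq \<Rightarrow> bool list" where
  "enc_omq Q = enc_list enc_inclusion (onto Q) @ enc_list enc_nat (csig Q) @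
    enc_list enc_nat (rsig Q) @ enc_cq (query Q)"

definition enc_input :: "('w \<Rightarrow> bool list) \<Rightarrow> omq \<Rightarrow> database \<Rightarrow> 'w list \<Rightarrow> bool list" where
  "enc_input e Q D c = enc_omq Q @ enc_list enc_atom D @ enc_list e c"

definition prefix_free :: "('a \<Rightarrow> bool list) \<Rightarrow> bool" where
  "prefix_free e \<longleftrightarrow> (\<forall>x y u v. e x @ u = e y @ v \<longrightarrow> x = y \<and> u = v)"

lemma prefix_freeD: "prefix_free e \<Longrightarrow> e x @ u = e y @ v \<longleftrightarrow> x = y \<and> u = v"
  unfolding prefix_free_def by blast

lemma prefix_free_list:
  assumes "prefix_free e"
  shows "prefix_free (enc_list e)"
proof -
  have "enc_list e xs @ u = enc_list e ys @ v \<Longrightarrow> xs = ys \<and> u = v" for xs ys u v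
  proof (induction xs arbitrary: ys)
    case Nil
    then show ?case by (cases ys) (auto simp: enc_list_def)
  next
    case (Cons x xs)
    from Cons.prems obtain y ys' where ys: "ys = y # ys'"
      by (cases ys) (auto simp: enc_list_def)
    have "e x @ (enc_list e xs @ u) = e y @ (enc_list e ys' @ v)"
      using Cons.prems by (simp add: ys enc_list_def)
    with assms have "x = y" "enc_list e xs @ u = enc_list e ys' @ v"
      by (auto simp: prefix_freeD)
    with Cons.IH ys show ?case by blast
  qed
  then show ?thesis unfolding prefix_free_def by blast
qed

lemma self_delim_eq_enc_list: "self_delim = enc_list (\<lambda>b. [b])"
  by (rule ext) (simp add: self_delim_def enc_list_def)

lemma prefix_free_self_delim: "prefix_free self_delim"
  unfolding self_delim_eq_enc_list by (rule prefix_free_list) (simp add: prefix_free_def)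

lemma bits_inject: "bits m = bits n \<Longrightarrow> m = n"
proof (induction m arbitrary: n rule: less_induct)
  case (less m)
  show ?case
  proof (cases "m = 0 \<or> n = 0")
    case True
    with less.prems show ?thesis
      by (subst (asm) (1 2) bits.simps) (auto split: if_splits)
  next
    case False
    with less.prems have eq: "odd m = odd n" "bits (m div 2) = bits (n div 2)"
      by (subst (asm) (1 2) bits.simps, simp)+
    from False have "m div 2 < m" by simp
    with less.IH eq(2) have "m div 2 = n div 2" by blast
    with eq(1) show ?thesis by presburger
  qed
qed

lemma prefix_free_nat: "prefix_free enc_nat"
  using prefix_free_self_delim bits_inject unfolding prefix_free_def enc_nat_def by blast

lemmas enc_nat_append = prefix_freeD [OF prefix_free_nat]

lemma prefix_free_concept: "prefix_free enc_concept"
proof -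
  have "enc_concept C @ u = enc_concept D @ v \<Longrightarrow> C = D \<and> u = v" for C D u v
  proof (induction C arbitrary: D u v)
    case Top
    then show ?case by (cases D) auto
  next
    case (Name A)
    then show ?case by (cases D) (auto simp: enc_nat_append)
  next
    case (And C1 C2)
    from And.prems obtain D1 D2 where D: "D = And D1 D2" by (cases D) auto
    from And.prems have eq: "enc_concept C1 @ (enc_concept C2 @ u) = enc_concept D1 @ (enc_concept D2 @ v)"
      unfolding D by (simp only: enc_concept.simps append_assoc append_Cons append_Nil list.inject)
    from And.IH(1) [OF eq] have "C1 = D1" and eq2: "enc_concept C2 @ u = enc_concept D2 @ v"
      by blast+
    with And.IH(2) [OF eq2] D show ?case by blast
  next
    case (Ex r C)
    from Ex.prems obtain s D' where D: "D = Ex s D'" by (cases D) auto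
    from Ex.prems have "enc_nat r @ (enc_concept C @ u) = enc_nat s @ (enc_concept D' @ v)"
      unfolding D by (simp only: enc_concept.simps append_assoc append_Cons append_Nil list.inject)
    then have "r = s" and eq: "enc_concept C @ u = enc_concept D' @ v"
      by (simp_all only: enc_nat_append)
    with Ex.IH [OF eq] D show ?case by blast
  qed
  then show ?thesis unfolding prefix_free_def by blast
qed

lemmas enc_concept_append = prefix_freeD [OF prefix_free_concept]

lemma prefix_free_inclusion: "prefix_free enc_inclusion"
  unfolding prefix_free_def
proof (intro allI impI)
  fix x y u v
  assume "enc_inclusion x @ u = enc_inclusion y @ v"
  then show "x = y \<and> u = v"
    by (cases x; cases y) (auto simp: enc_nat_append enc_concept_append)
qed

lemma prefix_free_atom: "prefix_free enc_atom"
  unfolding prefix_free_def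
proof (intro allI impI)
  fix x y u v
  assume "enc_atom x @ u = enc_atom y @ v"
  then show "x = y \<and> u = v"
    by (cases x; cases y) (auto simp: enc_nat_append)
qed

lemma prefix_free_swild: "prefix_free enc_swild"
  unfolding prefix_free_def
proof (intro allI impI)
  fix x y u v
  assume "enc_swild x @ u = enc_swild y @ v"
  then show "x = y \<and> u = v"
    by (cases x; cases y) (auto simp: enc_nat_append)
qed

lemma prefix_free_mwild: "prefix_free enc_mwild"
  unfolding prefix_free_def
proof (intro allI impI)
  fix x y u v
  assume "enc_mwild x @ u = enc_mwild y @ v"
  then show "x = y \<and> u = v"
    by (cases x; cases y) (auto simp: enc_nat_append)
qed

lemma enc_input_inject:
  assumes "prefix_free e" and "enc_input e Q D c = enc_input e Q' D' c'"
  shows "Q = Q' \<and> D = D' \<and> c = c'"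
proof -
  note pf = prefix_free_list [OF prefix_free_inclusion] prefix_free_list [OF prefix_free_nat]
    prefix_free_list [OF prefix_free_atom]
  have "enc_list e c = enc_list e c' \<longleftrightarrow> c = c'"
    using prefix_freeD [OF prefix_free_list [OF assms(1)], of c "[]" c' "[]"] by simp
  with assms(2) show ?thesis
    by (auto simp: enc_input_def enc_omq_def enc_cq_def pf [THEN prefix_freeD])
qed


section \<open>The decision problems\<close>

text \<open>Words that do not encode an OMQ with an ontology from the given class, a database over its
  signature, and a candidate tuple are no-instances.\<close>

definition single_testing_s :: "'d itself \<Rightarrow> ontology set \<Rightarrow> language" where
  "single_testing_s T \<O> = {enc_input enc_swild Q D c | Q D c.
    onto Q \<in> \<O> \<and> sig_database Q D \<and> minimal_partial_answer_s T Q D c}"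

definition single_testing_m :: "'d itself \<Rightarrow> ontology set \<Rightarrow> language" where
  "single_testing_m T \<O> = {enc_input enc_mwild Q D c | Q D c.
    onto Q \<in> \<O> \<and> sig_database Q D \<and> minimal_partial_answer_m T Q D c}"

end

theory Submission
  imports Defs "HOL-Library.Countable"
begin

text \<open>Membership. An ontology and a database have a universal model whose facts about the constants and
  about the anonymous elements are consequences that can be derived, in polynomially many steps, from the
  subconcepts of the input. A tuple is a partial answer iff the query has a suitable match in this model,
  and a match involves only polynomially many elements, each of which can be named by its parent and an
  edge. Hence being a partial answer is in NP, and so is the existence of a strictly smaller partial
  answer; a minimal partial answer is one with the first property and without the second.

  Hardness. By a tableau argument, a language in NP reduces to the constraint satisfaction problem of a
  fixed template, which in turn is the problem of matching a query in a fixed database of the allowed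
  tuples. For \<open>L1 \<inter> L2\<close> with \<open>L1\<close> and the complement of \<open>L2\<close> in NP, the query is the union of the two
  resulting queries, and its answer variable is the root of the second one. The second query also maps into an
  anonymous path, generated by a single concept inclusion, so that a lone wildcard is a partial
  answer iff the input is in \<open>L1\<close>; it can be improved to a constant iff the second query matches in the database,
  that is, iff the input is moreover not in \<open>L2\<close>.\<close>

section \<open>Stack programs\<close>

text \<open>Polynomial time refers to concrete Turing machines, so every function in the proof must
  be shown computable by one. Programs over stacks of bits are therefore compiled to machines once,
  and a predicate \<open>pt\<close> on functions between encoded types is closed under pairing,
  branching, folds and bounded quantifiers; verifier and reductions are ordinary functions within
  this closure. The universal model is infinite in general, and a part of the query without
  constants can match far down a path. What lies below a node depends only on the last concept of
  its path, however, so any anonymous node can be replaced by a fresh root for its concept, and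
  short descriptions of nodes suffice. In the hardness proof only the query depends on the input;
  database and ontology are fixed. The labels on the path begin at its second element, so that the
  root of the second query falls on an anonymous element. If they began one step earlier, the
  constant generating the path could be the root, and the wildcard could always be improved.\<close>

datatype com = Skip | Push nat bool | Seq com com | Pop nat com com com | While nat com com

type_synonym store = "nat \<Rightarrow> bool list"

text \<open>The count is the exact number of instructions that the compiled code executes, which is
  why even \<open>Skip\<close> costs one unit. \<open>Pop\<close> and \<open>While\<close> consume
  the bit that they test.\<close>

inductive exec :: "com \<Rightarrow> store \<Rightarrow> nat \<Rightarrow> store \<Rightarrow> bool" where
  Skip: "exec Skip s 1 s"
| Push: "exec (Push r b) s 1 (s(r := b # s r))"
| Seq: "exec c s t s' \<Longrightarrow> exec d s' u s'' \<Longrightarrow> exec (Seq c d) s (t + u) s''"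
| PopE: "s r = [] \<Longrightarrow> exec c s t s' \<Longrightarrow> exec (Pop r c d e) s (Suc t) s'"
| PopF: "s r = False # w \<Longrightarrow> exec d (s(r := w)) t s' \<Longrightarrow> exec (Pop r c d e) s (Suc t) s'"
| PopT: "s r = True # w \<Longrightarrow> exec e (s(r := w)) t s' \<Longrightarrow> exec (Pop r c d e) s (Suc t) s'"
| WhileE: "s r = [] \<Longrightarrow> exec (While r c d) s 1 s"
| WhileF: "s r = False # w \<Longrightarrow> exec c (s(r := w)) t s' \<Longrightarrow> exec (While r c d) s' u s''
    \<Longrightarrow> exec (While r c d) s (Suc (t + u)) s''"
| WhileT: "s r = True # w \<Longrightarrow> exec d (s(r := w)) t s' \<Longrightarrow> exec (While r c d) s' u s''
    \<Longrightarrow> exec (While r c d) s (Suc (t + u)) s''"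

fun regs :: "com \<Rightarrow> nat set" where
  "regs Skip = {}"
| "regs (Push r b) = {r}"
| "regs (Seq c d) = regs c \<union> regs d"
| "regs (Pop r c d e) = insert r (regs c \<union> regs d \<union> regs e)"
| "regs (While r c d) = insert r (regs c \<union> regs d)"

lemma finite_regs: "finite (regs c)"
  by (induction c) auto

text \<open>Every instruction names its successors, so that all branches of a command can share one
  exit without extra jumps.\<close>

datatype instr = INop nat | IPush nat bool nat | IPop nat nat nat nat

fun csize :: "com \<Rightarrow> nat" where
  "csize Skip = 1"
| "csize (Push r b) = 1"
| "csize (Seq c d) = csize c + csize d"
| "csize (Pop r c d e) = 1 + csize c + csize d + csize e"
| "csize (While r c d) = 1 + csize c + csize d"

text \<open>\<open>compile c a e\<close> is the code of \<open>c\<close> placed at address \<open>a\<close>; it leaves to address \<open>e\<close>.\<close>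

fun compile :: "com \<Rightarrow> nat \<Rightarrow> nat \<Rightarrow> instr list" where
  "compile Skip a e = [INop e]"
| "compile (Push r b) a e = [IPush r b e]"
| "compile (Seq c d) a e = compile c a (a + csize c) @ compile d (a + csize c) e"
| "compile (Pop r x y z) a e =
    IPop r (a + 1) (a + 1 + csize x) (a + 1 + csize x + csize y) #
    compile x (a + 1) e @ compile y (a + 1 + csize x) e @ compile z (a + 1 + csize x + csize y) e"
| "compile (While r y z) a e =
    IPop r e (a + 1) (a + 1 + csize y) #
    compile y (a + 1) a @ compile z (a + 1 + csize y) a"

lemma length_compile [simp]: "length (compile c a e) = csize c"
  by (induction c arbitrary: a e) auto

fun ireg :: "instr \<Rightarrow> nat set" where
  "ireg (INop n) = {}"
| "ireg (IPush r b n) = {r}"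
| "ireg (IPop r x y z) = {r}"

fun targets :: "instr \<Rightarrow> nat set" where
  "targets (INop n) = {n}"
| "targets (IPush r b n) = {n}"
| "targets (IPop r x y z) = {x, y, z}"

lemma compile_ireg: "i \<in> set (compile c a e) \<Longrightarrow> ireg i \<subseteq> regs c"
  by (induction c arbitrary: a e) fastforce+

lemma compile_targets: "i \<in> set (compile c a e) \<Longrightarrow> targets i \<subseteq> insert e {a..a + csize c}"
proof (induction c arbitrary: a e)
  case (Seq c d)
  from Seq.prems consider "i \<in> set (compile c a (a + csize c))" | "i \<in> set (compile d (a + csize c) e)"
    by auto
  then show ?case
    by cases (use Seq.IH in fastforce)+
next
  case (Pop r x y z)
  from Pop.prems consider "targets i \<subseteq> {a..a + csize (Pop r x y z)}" | "i \<in> set (compile x (a + 1) e)"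
    | "i \<in> set (compile y (a + 1 + csize x) e)" | "i \<in> set (compile z (a + 1 + csize x + csize y) e)"
    by auto
  then show ?case
    by cases (use Pop.IH in fastforce)+
next
  case (While r y z)
  from While.prems consider "targets i \<subseteq> insert e {a..a + csize (While r y z)}"
    | "i \<in> set (compile y (a + 1) a)" | "i \<in> set (compile z (a + 1 + csize y) a)"
    by auto
  then show ?case
    by cases (use While.IH in fastforce)+
qed auto

inductive istep :: "instr list \<Rightarrow> nat \<times> store \<Rightarrow> nat \<times> store \<Rightarrow> bool" for P where
  "pc < length P \<Longrightarrow> P ! pc = INop n \<Longrightarrow> istep P (pc, s) (n, s)"
| "pc < length P \<Longrightarrow> P ! pc = IPush r b n \<Longrightarrow> istep P (pc, s) (n, s(r := b # s r))"
| "pc < length P \<Longrightarrow> P ! pc = IPop r x y z \<Longrightarrow> s r = [] \<Longrightarrow> istep P (pc, s) (x, s)"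
| "pc < length P \<Longrightarrow> P ! pc = IPop r x y z \<Longrightarrow> s r = False # w \<Longrightarrow> istep P (pc, s) (y, s(r := w))"
| "pc < length P \<Longrightarrow> P ! pc = IPop r x y z \<Longrightarrow> s r = True # w \<Longrightarrow> istep P (pc, s) (z, s(r := w))"

definition code_at :: "instr list \<Rightarrow> nat \<Rightarrow> instr list \<Rightarrow> bool" where
  "code_at P a Q \<longleftrightarrow> (\<exists>xs ys. P = xs @ Q @ ys \<and> length xs = a)"

lemma code_at_Cons: "code_at P a (i # Q) \<Longrightarrow> a < length P \<and> P ! a = i \<and> code_at P (Suc a) Q"
  unfolding code_at_def
proof (elim exE conjE)
  fix xs ys assume *: "P = xs @ (i # Q) @ ys" "length xs = a"
  then show "a < length P \<and> P ! a = i \<and> (\<exists>xs ys. P = xs @ Q @ ys \<and> length xs = Suc a)"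
    by (intro conjI exI[of _ "xs @ [i]"] exI[of _ ys]) auto
qed

lemma code_at_append: "code_at P a (Q @ Q') \<Longrightarrow> code_at P a Q \<and> code_at P (a + length Q) Q'"
  unfolding code_at_def
proof (elim exE conjE)
  fix xs ys assume *: "P = xs @ (Q @ Q') @ ys" "length xs = a"
  then show "(\<exists>xs ys. P = xs @ Q @ ys \<and> length xs = a) \<and>
    (\<exists>xs ys. P = xs @ Q' @ ys \<and> length xs = a + length Q)"
    by (intro conjI exI[of _ "xs"] exI[of _ "Q' @ ys"] exI[of _ "xs @ Q"] exI[of _ "ys"]) auto
qed

text \<open>The body of a loop is compiled with the address of the test as its exit, so the rest of
  the loop is covered by the induction hypothesis for the same block of code.\<close>

lemma exec_compile:
  "exec c s t s' \<Longrightarrow> code_at P a (compile c a e) \<Longrightarrow> (istep P ^^ t) (a, s) (e, s')"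
proof (induction arbitrary: a e rule: exec.induct)
  case (Skip s)
  then show ?case by (auto dest!: code_at_Cons intro: istep.intros)
next
  case (Push r b s)
  then show ?case by (auto dest!: code_at_Cons intro: istep.intros simp del: fun_upd_apply)
next
  case (Seq c s t s' d u s'')
  from Seq.prems have "(istep P ^^ t) (a, s) (a + csize c, s')"
    "(istep P ^^ u) (a + csize c, s') (e, s'')"
    using Seq.IH by (auto dest!: code_at_append)
  then show ?case by (auto simp: relpowp_add)
next
  case (PopE s r c t s' d e')
  from PopE.prems have "istep P (a, s) (a + 1, s)" and "(istep P ^^ t) (a + 1, s) (e, s')"
    using PopE.hyps PopE.IH by (auto dest!: code_at_Cons code_at_append intro: istep.intros simp del: fun_upd_apply)
  then show ?case by (rule relpowp_Suc_I2)
next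
  case (PopF s r w d t s' c e')
  from PopF.prems have "istep P (a, s) (a + 1 + csize c, s(r := w))"
    and "(istep P ^^ t) (a + 1 + csize c, s(r := w)) (e, s')"
    using PopF.hyps PopF.IH by (auto dest!: code_at_Cons code_at_append intro: istep.intros simp del: fun_upd_apply)
  then show ?case by (rule relpowp_Suc_I2)
next
  case (PopT s r w e' t s' c d)
  from PopT.prems have "istep P (a, s) (a + 1 + csize c + csize d, s(r := w))"
    and "(istep P ^^ t) (a + 1 + csize c + csize d, s(r := w)) (e, s')"
    using PopT.hyps PopT.IH by (auto dest!: code_at_Cons code_at_append intro: istep.intros simp: add.assoc simp del: fun_upd_apply)
  then show ?case by (rule relpowp_Suc_I2)
next
  case (WhileE s r c d)
  then show ?case by (auto dest!: code_at_Cons intro: istep.intros)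
next
  case (WhileF s r w c t s' d u s'')
  from WhileF.prems have "istep P (a, s) (a + 1, s(r := w))"
    and "(istep P ^^ t) (a + 1, s(r := w)) (a, s')" and "(istep P ^^ u) (a, s') (e, s'')"
    using WhileF.hyps(1) WhileF.IH by (auto dest!: code_at_Cons code_at_append intro: istep.intros simp del: fun_upd_apply)
  then show ?case unfolding relpowp_add by (auto intro!: relpowp_Suc_I2 simp: relpowp_add simp del: relpowp.simps)
next
  case (WhileT s r w d t s' c u s'')
  from WhileT.prems have "istep P (a, s) (a + 1 + csize c, s(r := w))"
    and "(istep P ^^ t) (a + 1 + csize c, s(r := w)) (a, s')" and "(istep P ^^ u) (a, s') (e, s'')"
    using WhileT.hyps(1) WhileT.IH by (auto dest!: code_at_Cons code_at_append intro: istep.intros simp del: fun_upd_apply)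
  then show ?case unfolding relpowp_add by (auto intro!: relpowp_Suc_I2 simp: relpowp_add simp del: relpowp.simps)
qed

section \<open>Turing machines for stack programs\<close>

definition tape_of :: "nat \<Rightarrow> nat" where
  "tape_of r = (if r = 0 then 0 else Suc r)"

lemma tape_of_neq_1 [simp]: "tape_of r \<noteq> Suc 0" "Suc 0 \<noteq> tape_of r" "tape_of 0 = 0"
  by (auto simp: tape_of_def)

definition bit_sym :: "bool \<Rightarrow> nat" where
  "bit_sym b = (if b then 2 else 1)"

definition stay :: "nat list \<Rightarrow> (nat \<times> dir) list" where
  "stay ss = map (\<lambda>s. (s, Stay)) ss"

text \<open>States \<open>2 * pc\<close> and \<open>2 * pc + 1\<close> execute the instruction at \<open>pc\<close>; register \<open>r\<close> is a tape whose
  head is on the top of the stack. State \<open>2 * length P\<close> copies register 0 to the output tape.\<close>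

definition code_delta :: "instr list \<Rightarrow> nat \<Rightarrow> nat list \<Rightarrow> nat \<times> (nat \<times> dir) list" where
  "code_delta P q ss =
    (if q = 2 * length P then
       (if ss ! 0 = 0 then (Suc q, stay ss) else (q, (stay ss)[0 := (ss ! 0, ToRight), 1 := (ss ! 0, ToRight)]))
     else case P ! (q div 2) of
       INop n \<Rightarrow> (2 * n, stay ss)
     | IPush r b n \<Rightarrow>
         (if even q then (Suc q, (stay ss)[tape_of r := (ss ! tape_of r, ToLeft)])
          else (2 * n, (stay ss)[tape_of r := (bit_sym b, Stay)]))
     | IPop r x y z \<Rightarrow>
         (if ss ! tape_of r = 0 then (2 * x, stay ss)
          else (2 * (if ss ! tape_of r = 1 then y else z), (stay ss)[tape_of r := (ss ! tape_of r, ToRight)])))"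

text \<open>The tapes are those of the registers \<open>0\<close> to \<open>R\<close> and the output
  tape. There are two working states per instruction and one for copying; the next number is the
  halting state.\<close>

definition code_tm :: "nat \<Rightarrow> instr list \<Rightarrow> tm" where
  "code_tm R P = \<lparr>tapes = R + 2, symbols = 3, states = Suc (2 * length P), delta = code_delta P\<rparr>"

definition code_ok :: "nat \<Rightarrow> instr list \<Rightarrow> bool" where
  "code_ok R P \<longleftrightarrow> (\<forall>i \<in> set P. ireg i \<subseteq> {..R} \<and> targets i \<subseteq> {..length P})"

lemma tape_of_less: "r \<le> R \<Longrightarrow> tape_of r < R + 2"
  by (auto simp: tape_of_def)

lemma set_update_fst: "fst ` set xs \<subseteq> A \<Longrightarrow> fst y \<in> A \<Longrightarrow> fst ` set (xs[i := y]) \<subseteq> A"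
  using set_update_subset_insert[of xs i y] by fastforce

lemma length_stay [simp]: "length (stay ss) = length ss"
  by (simp add: stay_def)

lemma stay_nth [simp]: "i < length ss \<Longrightarrow> stay ss ! i = (ss ! i, Stay)"
  by (simp add: stay_def)

lemma wf_code_tm:
  assumes "code_ok R P"
  shows "wf_tm (code_tm R P)"
  unfolding wf_tm_def
proof (intro conjI allI impI; (elim conjE)?)
  fix q ss assume q: "q < states (code_tm R P)" and l: "length ss = tapes (code_tm R P)"
    and ss: "set ss \<subseteq> {..<symbols (code_tm R P)}"
  have st: "fst ` set (stay ss) \<subseteq> {..<3}" using ss by (auto simp: stay_def code_tm_def)
  have nth: "ss ! i < 3" if "i < R + 2" for i
    using ss l that by (auto simp: code_tm_def subset_iff)
  have "fst (code_delta P q ss) \<le> Suc (2 * length P) \<and>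
    length (snd (code_delta P q ss)) = R + 2 \<and> fst ` set (snd (code_delta P q ss)) \<subseteq> {..<3}"
  proof (cases "q = 2 * length P")
    case True
    then show ?thesis using l st nth
      by (auto simp: code_delta_def code_tm_def
            dest!: subsetD[OF set_update_subset_insert])
  next
    case False
    then have "q div 2 < length P" using q by (auto simp: code_tm_def)
    then have i: "P ! (q div 2) \<in> set P" by auto
    show ?thesis
    proof (cases "P ! (q div 2)")
      case (INop n)
      with i assms have "n \<le> length P" by (fastforce simp: code_ok_def)
      then show ?thesis using False INop l st by (auto simp: code_delta_def code_tm_def)
    next
      case (IPush r b n)
      with i assms have "n \<le> length P" "r \<le> R" by (fastforce simp: code_ok_def)+
      then show ?thesis using False IPush l st nth[OF tape_of_less] \<open>q div 2 < length P\<close>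
        by (auto simp: code_delta_def code_tm_def bit_sym_def intro!: set_update_fst[OF st] dest!: subsetD[OF set_update_subset_insert])
    next
      case (IPop r x y z)
      with i assms have "x \<le> length P" "y \<le> length P" "z \<le> length P" "r \<le> R"
        by (fastforce simp: code_ok_def)+
      then show ?thesis using False IPop l st nth[OF tape_of_less]
        by (auto simp: code_delta_def code_tm_def intro!: set_update_fst[OF st]  dest!: subsetD[OF set_update_subset_insert])
    qed
  qed
  then show "fst (delta (code_tm R P) q ss) \<le> states (code_tm R P)"
    "length (snd (delta (code_tm R P) q ss)) = tapes (code_tm R P)"
    "fst ` set (snd (delta (code_tm R P) q ss)) \<subseteq> {..<symbols (code_tm R P)}"
    by (simp_all add: code_tm_def)
qed (simp_all add: code_tm_def)

text \<open>Cells to the left of the head are unconstrained: popped bits stay there until a later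
  push overwrites them.\<close>

definition holds_stack :: "tape \<Rightarrow> bool list \<Rightarrow> bool" where
  "holds_stack tp w \<longleftrightarrow> (\<forall>i \<ge> 0. snd tp (fst tp + i) = word_cells w i)"

definition represents :: "nat \<Rightarrow> store \<Rightarrow> tape list \<Rightarrow> bool" where
  "represents R s ts \<longleftrightarrow> length ts = R + 2 \<and> ts ! 1 = (0, \<lambda>_. 0) \<and>
    (\<forall>r \<le> R. holds_stack (ts ! tape_of r) (s r))"

lemma word_cells_Cons: "0 \<le> i \<Longrightarrow> word_cells (b # w) i = (if i = 0 then bit_sym b else word_cells w (i - 1))"
  by (auto simp: word_cells_def bit_sym_def nth_Cons' nat_diff_distrib)

lemma read_holds_stack:
  assumes "holds_stack tp w"
  shows "read tp = (case w of [] \<Rightarrow> 0 | b # _ \<Rightarrow> bit_sym b)"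
proof -
  have "read tp = word_cells w 0"
    using assms unfolding holds_stack_def by (cases tp) (auto dest: spec[of _ 0])
  then show ?thesis by (auto split: list.split simp: word_cells_Cons) (simp add: word_cells_def)
qed

lemma holds_stack_push:
  "holds_stack tp w \<Longrightarrow> holds_stack (act (bit_sym b, Stay) (act (read tp, ToLeft) tp)) (b # w)"
proof (cases tp)
  fix p f assume h: "holds_stack tp w" and tp: "tp = (p, f)"
  have "f (p + i - 1) = word_cells w (i - 1)" if "0 \<le> i" "i \<noteq> 0" for i
    using h that unfolding holds_stack_def tp by (auto dest: spec[of _ "i - 1"] simp: algebra_simps)
  then show ?thesis by (auto simp: tp holds_stack_def word_cells_Cons algebra_simps)
qed

lemma holds_stack_pop:
  "holds_stack tp (b # w) \<Longrightarrow> holds_stack (act (read tp, ToRight) tp) w"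
proof (cases tp)
  fix p f assume h: "holds_stack tp (b # w)" and tp: "tp = (p, f)"
  have "f (p + 1 + i) = word_cells w i" if "0 \<le> i" for i
    using h that unfolding holds_stack_def tp
    by (auto simp: word_cells_Cons algebra_simps dest: spec[of _ "i + 1"])
  then show ?thesis by (auto simp: tp holds_stack_def)
qed

lemma act_stay: "act (read tp, Stay) tp = tp"
  by (cases tp) auto

lemma map2_act_stay: "map2 act (stay (map read ts)) ts = ts"
  by (induction ts) (auto simp: stay_def act_stay)

lemma map2_act_upd:
  "i < length ts \<Longrightarrow> map2 act ((stay (map read ts))[i := a]) ts = ts[i := act a (ts ! i)]"
proof (induction ts arbitrary: i)
  case (Cons tp ts)
  then show ?case
    using map2_act_stay[of ts] by (cases i) (auto simp: stay_def act_stay)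
qed simp

lemma map2_act_upd2:
  assumes "i < length ts" "j < length ts" "i \<noteq> j"
  shows "map2 act ((stay (map read ts))[i := a, j := b]) ts = ts[i := act a (ts ! i), j := act b (ts ! j)]"
  using assms
  by (intro nth_equalityI) (auto simp: nth_list_update act_stay)

lemma represents_upd:
  assumes "represents R s ts" "r \<le> R" "holds_stack tp w"
  shows "represents R (s(r := w)) (ts[tape_of r := tp])"
  using assms by (auto simp: represents_def nth_list_update tape_of_def)

lemma step_code_tm:
  assumes "q < 2 * length P"
  shows "step (code_tm R P) (q, ts) =
    (case code_delta P q (map read ts) of (q', as) \<Rightarrow> (q', map2 act as ts))"
  using assms by (simp add: code_tm_def)

text \<open>\<open>act\<close> writes before it moves, so a push takes two steps, one to move left
  and one to write. Every other instruction takes one step, hence the bound 2.\<close>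

lemma istep_simulation:
  assumes ok: "code_ok R P" and rep: "represents R s ts" and st: "istep P (pc, s) (pc', s')"
  shows "\<exists>n ts'. n \<le> 2 \<and> (step (code_tm R P) ^^ n) (2 * pc, ts) = (2 * pc', ts') \<and>
    represents R s' ts'"
  using st
proof cases
  case (1)
  then have "(step (code_tm R P) ^^ 1) (2 * pc, ts) = (2 * pc', ts)"
    by (simp add: step_code_tm code_delta_def map2_act_stay del: step.simps)
  with 1 rep show ?thesis by (intro exI[of _ 1] exI[of _ ts]) simp
next
  case (2 r b)
  then have r: "r \<le> R" using ok nth_mem unfolding code_ok_def by fastforce
  have l: "tape_of r < length ts" using rep r tape_of_less[OF r] by (simp add: represents_def)
  \<comment> \<open>The intermediate state of a push is odd and so differs from the copying
    state.\<close>
  have "\<not> 2 * length P = Suc (2 * pc)" by presburger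
  let ?tp = "ts ! tape_of r"
  let ?tp' = "act (bit_sym b, Stay) (act (read ?tp, ToLeft) ?tp)"
  have "step (code_tm R P) (2 * pc, ts) = (Suc (2 * pc), ts[tape_of r := act (read ?tp, ToLeft) ?tp])"
    using 2 l by (simp add: step_code_tm code_delta_def map2_act_upd del: step.simps)
  moreover have "step (code_tm R P) (Suc (2 * pc), ts') = (2 * pc', ts'[tape_of r := act (bit_sym b, Stay) (ts' ! tape_of r)])"
    if "length ts' = length ts" for ts'
    using 2 l that \<open>\<not> 2 * length P = Suc (2 * pc)\<close>
    by (simp add: step_code_tm code_delta_def map2_act_upd del: step.simps)
  ultimately have "(step (code_tm R P) ^^ 2) (2 * pc, ts) = (2 * pc', ts[tape_of r := ?tp'])"
    using l by (simp add: numeral_2_eq_2 del: step.simps)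
  moreover have "represents R s' (ts[tape_of r := ?tp'])"
    unfolding 2 using rep r
    by (intro represents_upd holds_stack_push) (auto simp: represents_def)
  ultimately show ?thesis by blast
next
  case (3 r y z)
  then have r: "r \<le> R" using ok nth_mem unfolding code_ok_def by fastforce
  have l: "tape_of r < length ts" using rep r tape_of_less[OF r] by (simp add: represents_def)
  have "read (ts ! tape_of r) = 0"
    using rep r 3 read_holds_stack[of "ts ! tape_of r" "s r"] by (auto simp: represents_def)
  then have "(step (code_tm R P) ^^ 1) (2 * pc, ts) = (2 * pc', ts)"
    using 3 l by (simp add: step_code_tm code_delta_def map2_act_stay del: step.simps)
  with 3 rep show ?thesis by (intro exI[of _ 1] exI[of _ ts]) simp
next
  case (4 r x z w)
  then have r: "r \<le> R" using ok nth_mem unfolding code_ok_def by fastforce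
  have l: "tape_of r < length ts" using rep r tape_of_less[OF r] by (simp add: represents_def)
  let ?tp = "ts ! tape_of r"
  have h: "holds_stack ?tp (False # w)" using rep r 4 by (auto simp: represents_def)
  have "(step (code_tm R P) ^^ 1) (2 * pc, ts) = (2 * pc', ts[tape_of r := act (read ?tp, ToRight) ?tp])"
    using 4 l read_holds_stack[OF h]
    by (simp add: step_code_tm code_delta_def map2_act_upd bit_sym_def del: step.simps)
  moreover have "represents R s' (ts[tape_of r := act (read ?tp, ToRight) ?tp])"
    unfolding 4 using rep r h by (auto intro!: represents_upd holds_stack_pop)
  ultimately show ?thesis by (metis one_le_numeral)
next
  case (5 r x y w)
  then have r: "r \<le> R" using ok nth_mem unfolding code_ok_def by fastforce
  have l: "tape_of r < length ts" using rep r tape_of_less[OF r] by (simp add: represents_def)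
  let ?tp = "ts ! tape_of r"
  have h: "holds_stack ?tp (True # w)" using rep r 5 by (auto simp: represents_def)
  have "(step (code_tm R P) ^^ 1) (2 * pc, ts) = (2 * pc', ts[tape_of r := act (read ?tp, ToRight) ?tp])"
    using 5 l read_holds_stack[OF h]
    by (simp add: step_code_tm code_delta_def map2_act_upd bit_sym_def del: step.simps)
  moreover have "represents R s' (ts[tape_of r := act (read ?tp, ToRight) ?tp])"
    unfolding 5 using rep r h by (auto intro!: represents_upd holds_stack_pop)
  ultimately show ?thesis by (metis one_le_numeral)
qed

lemma isteps_simulation:
  assumes ok: "code_ok R P" and rep: "represents R s ts" and st: "(istep P ^^ t) (pc, s) (pc', s')"
  shows "\<exists>n ts'. n \<le> 2 * t \<and> (step (code_tm R P) ^^ n) (2 * pc, ts) = (2 * pc', ts') \<and>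
    represents R s' ts'"
  using st
proof (induction t arbitrary: pc' s')
  case 0
  then show ?case using rep by auto
next
  case (Suc t)
  then obtain pc1 s1 where 1: "(istep P ^^ t) (pc, s) (pc1, s1)" and 2: "istep P (pc1, s1) (pc', s')"
    by auto
  from Suc.IH[OF 1] obtain n ts1 where n: "n \<le> 2 * t"
    "(step (code_tm R P) ^^ n) (2 * pc, ts) = (2 * pc1, ts1)" "represents R s1 ts1" by blast
  from istep_simulation[OF ok n(3) 2] obtain m ts2 where m: "m \<le> 2"
    "(step (code_tm R P) ^^ m) (2 * pc1, ts1) = (2 * pc', ts2)" "represents R s' ts2" by blast
  show ?case
    using n m by (intro exI[of _ "m + n"] exI[of _ ts2]) (simp add: funpow_add del: step.simps)
qed

text \<open>The induction is generalised by the part \<open>u\<close> of the output that is already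
  written. The additional step reads the blank after the word and halts.\<close>

lemma copy_output:
  assumes "length ts = R + 2" "holds_stack (ts ! 0) w"
    "ts ! 1 = (int (length u), word_cells u)"
  shows "halts_with (code_tm R P) ((step (code_tm R P) ^^ (Suc (length w))) (2 * length P, ts)) (u @ w)"
  using assms
proof (induction w arbitrary: u ts)
  case Nil
  have "read (ts ! 0) = 0" using read_holds_stack[OF Nil(2)] by simp
  then have "step (code_tm R P) (2 * length P, ts) = (Suc (2 * length P), ts)"
    using Nil(1) by (auto simp: code_tm_def code_delta_def map2_act_stay)
  then show ?case using Nil by (simp add: halts_with_def code_tm_def)
next
  case (Cons b w)
  have rd: "read (ts ! 0) = bit_sym b" using read_holds_stack[OF Cons.prems(2)] by simp
  let ?ts = "ts[0 := act (bit_sym b, ToRight) (ts ! 0), 1 := act (bit_sym b, ToRight) (ts ! 1)]"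
  have "step (code_tm R P) (2 * length P, ts) = (2 * length P, ?ts)"
    using Cons.prems(1) rd by (auto simp: code_tm_def code_delta_def bit_sym_def map2_act_upd2)
  moreover have "halts_with (code_tm R P) ((step (code_tm R P) ^^ (Suc (length w))) (2 * length P, ?ts)) ((u @ [b]) @ w)"
  proof (rule Cons.IH)
    show "length ?ts = R + 2" using Cons.prems by simp
    show "holds_stack (?ts ! 0) w" using holds_stack_pop[OF Cons.prems(2)] rd Cons.prems(1) by simp
    have "(word_cells u)(int (length u) := bit_sym b) = word_cells (u @ [b])"
      by (rule ext) (auto simp: word_cells_def bit_sym_def nth_append)
    then show "?ts ! 1 = (int (length (u @ [b])), word_cells (u @ [b]))"
      using Cons.prems by simp
  qed
  ultimately show ?case by (simp add: funpow_swap1 del: step.simps)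
qed

lemma regs_bound: "\<exists>R. regs c \<subseteq> {..R}"
  using finite_regs[of c] by (auto simp: finite_nat_set_iff_bounded_le)

theorem polytime_exec:
  assumes "\<And>w. \<exists>t s'. t \<le> a * length w ^ d + a \<and> exec c ((\<lambda>_. [])(0 := w)) t s' \<and> s' 0 = f w \<and>
    length (f w) \<le> a * length w ^ d + a"
  shows "polytime f"
proof -
  obtain R where R: "regs c \<subseteq> {..R}" using regs_bound by blast
  define P where "P = compile c 0 (csize c)"
  have lP: "length P = csize c" by (simp add: P_def)
  have ok: "code_ok R P"
    unfolding code_ok_def
  proof (intro ballI conjI)
    fix i assume i: "i \<in> set P"
    then show "ireg i \<subseteq> {..R}" using compile_ireg R unfolding P_def by blast
    show "targets i \<subseteq> {..length P}"
      using compile_targets[of i c 0 "csize c"] i by (force simp: P_def)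
  qed
  have code: "code_at P 0 (compile c 0 (csize c))"
    unfolding code_at_def P_def by (intro exI[of _ "[]"]) simp
  \<comment> \<open>The factor 3 stands for two machine steps per instruction and one step per
    output bit; the 1 is the halting step.\<close>
  have "\<exists>t \<le> (3 * a + 1) * length w ^ d + (3 * a + 1).
    halts_with (code_tm R P) ((step (code_tm R P) ^^ t) (init_config (code_tm R P) w)) (f w)" for w
  proof -
    obtain t s' where t: "t \<le> a * length w ^ d + a" and ex: "exec c ((\<lambda>_. [])(0 := w)) t s'"
      and s': "s' 0 = f w" and len: "length (f w) \<le> a * length w ^ d + a"
      using assms by blast
    let ?ts = "(0, word_cells w) # replicate (Suc R) (0, \<lambda>_. 0)"
    have rep: "represents R ((\<lambda>_. [])(0 := w)) ?ts"
      by (auto simp: represents_def holds_stack_def tape_of_def word_cells_def nth_Cons' fun_eq_iff)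
    from isteps_simulation[OF ok rep exec_compile[OF ex code]] obtain n ts where
      n: "n \<le> 2 * t" "(step (code_tm R P) ^^ n) (0, ?ts) = (2 * csize c, ts)" "represents R s' ts" by auto
    have "halts_with (code_tm R P) ((step (code_tm R P) ^^ (Suc (length (f w)))) (2 * length P, ts)) ([] @ f w)"
    proof (rule copy_output)
      show "holds_stack (ts ! 0) (f w)"
        using n(3) s' by (auto simp: represents_def dest: spec[of _ 0])
    qed (use n(3) in \<open>auto simp: represents_def word_cells_def fun_eq_iff\<close>)
    moreover have "init_config (code_tm R P) w = (0, ?ts)"
      by (simp add: init_config_def code_tm_def)
    ultimately have "halts_with (code_tm R P) ((step (code_tm R P) ^^ (Suc (length (f w)) + n)) (init_config (code_tm R P) w)) (f w)"
      using n(2) by (simp only: funpow_add lP o_apply append_Nil)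
    moreover have "Suc (length (f w)) + n \<le> (3 * a + 1) * length w ^ d + (3 * a + 1)"
      using n(1) t len by (simp add: algebra_simps)
    ultimately show ?thesis by blast
  qed
  then show ?thesis unfolding polytime_def using wf_code_tm[OF ok] by blast
qed

section \<open>Polynomial bounds\<close>

definition polyb :: "(nat \<Rightarrow> nat) \<Rightarrow> bool" where
  "polyb p \<longleftrightarrow> (\<exists>a d. \<forall>n. p n \<le> a * n ^ d + a)"

lemma polybI: "(\<And>n. p n \<le> a * n ^ d + a) \<Longrightarrow> polyb p"
  unfolding polyb_def by blast

text \<open>The summand 1 covers \<open>n = 0\<close>, where \<open>0 ^ 0 = 1\<close> but higher
  powers vanish.\<close>

lemma power_le_Suc_power: "(n::nat) ^ d \<le> n ^ (d + e) + 1"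
proof (cases "n = 0")
  case False
  then have "n ^ d \<le> n ^ (d + e)" by (intro power_increasing) auto
  then show ?thesis by simp
qed (simp add: power_0_left)

lemma polyb_const: "polyb (\<lambda>_. c)"
  by (rule polybI[of _ c 0]) simp

lemma polyb_id: "polyb (\<lambda>n. n)"
  by (rule polybI[of _ 1 1]) simp

lemma polyb_mono: "polyb q \<Longrightarrow> (\<And>n. p n \<le> q n) \<Longrightarrow> polyb p"
  unfolding polyb_def by (meson le_trans)

lemma polyb_add:
  assumes "polyb p" "polyb q"
  shows "polyb (\<lambda>n. p n + q n)"
proof -
  obtain a d b e where p: "\<And>n. p n \<le> a * n ^ d + a" and q: "\<And>n. q n \<le> b * n ^ e + b"
    using assms unfolding polyb_def by blast
  show ?thesis
  proof (rule polybI)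
    fix n
    have "p n + q n \<le> a * (n ^ (d + e) + 1) + a + (b * (n ^ (e + d) + 1) + b)"
      by (intro add_mono order_trans[OF p] order_trans[OF q] mult_le_mono power_le_Suc_power order_refl)
    also have "\<dots> \<le> (2 * a + 2 * b) * n ^ (d + e) + (2 * a + 2 * b)"
      by (simp add: algebra_simps)
    finally show "p n + q n \<le> (2 * a + 2 * b) * n ^ (d + e) + (2 * a + 2 * b)" .
  qed
qed

lemma polyb_mult:
  assumes "polyb p" "polyb q"
  shows "polyb (\<lambda>n. p n * q n)"
proof -
  obtain a d b e where p: "\<And>n. p n \<le> a * n ^ d + a" and q: "\<And>n. q n \<le> b * n ^ e + b"
    using assms unfolding polyb_def by blast
  show ?thesis
  proof (rule polybI)
    fix n
    have "p n * q n \<le> (a * n ^ d + a) * (b * n ^ e + b)"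
      by (intro mult_le_mono p q)
    also have "\<dots> = a * b * (n ^ (d + e) + n ^ d + n ^ e + 1)"
      by (simp add: algebra_simps power_add)
    also have "\<dots> \<le> a * b * (n ^ (d + e) + (n ^ (d + e) + 1) + (n ^ (e + d) + 1) + 1)"
      by (intro mult_le_mono add_mono power_le_Suc_power order_refl)
    also have "\<dots> \<le> (3 * (a * b)) * n ^ (d + e) + 3 * (a * b)"
      by (simp add: algebra_simps)
    finally show "p n * q n \<le> (3 * (a * b)) * n ^ (d + e) + 3 * (a * b)" .
  qed
qed

lemma polyb_power: "polyb p \<Longrightarrow> polyb (\<lambda>n. p n ^ d)"
  by (induction d) (auto intro: polyb_const polyb_mult)

lemma polyb_comp:
  assumes "polyb p" "polyb q"
  shows "polyb (\<lambda>n. p (q n))"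
proof -
  obtain a d where p: "\<And>n. p n \<le> a * n ^ d + a" using assms unfolding polyb_def by blast
  have "polyb (\<lambda>n. a * q n ^ d + a)" by (intro polyb_add polyb_mult polyb_const polyb_power assms)
  then show ?thesis using p by (rule polyb_mono)
qed

text \<open>Monotonicity allows the size of an intermediate result to be replaced by its bound
  inside a running time.\<close>

lemma polyb_mono_majorant:
  assumes "polyb p"
  obtains q where "polyb q" "mono q" "\<And>n. p n \<le> q n"
proof -
  obtain a d where p: "\<And>n. p n \<le> a * n ^ d + a" using assms unfolding polyb_def by blast
  have "mono (\<lambda>n. a * n ^ d + a)" by (intro monoI add_mono mult_le_mono power_mono) auto
  with p show thesis by (intro that[of "\<lambda>n. a * n ^ d + a"] polybI) auto
qed

lemmas polyb_intros = polyb_const polyb_id polyb_add polyb_mult polyb_power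

section \<open>Stack routines with time bounds\<close>

definition runs :: "com \<Rightarrow> store \<Rightarrow> store \<Rightarrow> nat \<Rightarrow> bool" where
  "runs c s s' n \<longleftrightarrow> (\<exists>t \<le> n. exec c s t s')"

lemma runs_mono: "runs c s s' m \<Longrightarrow> m \<le> n \<Longrightarrow> runs c s s' n"
  unfolding runs_def by (meson le_trans)

lemma runs_eq: "runs c s s' m \<Longrightarrow> s' = s'' \<Longrightarrow> m \<le> n \<Longrightarrow> runs c s s'' n"
  using runs_mono by blast

lemma runs_Seq: "runs c s s' m \<Longrightarrow> runs d s' s'' n \<Longrightarrow> runs (Seq c d) s s'' (m + n)"
  unfolding runs_def by (meson add_mono exec.Seq)

lemma runs_Skip: "runs Skip s s (Suc n)"
  unfolding runs_def using exec.Skip by (metis One_nat_def Suc_le_mono le0)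

lemma runs_Push: "runs (Push r b) s (s(r := b # s r)) 1"
  unfolding runs_def using exec.Push by blast

lemma runs_Pop:
  assumes "s r = [] \<Longrightarrow> runs c s s' n"
    and "\<And>w. s r = False # w \<Longrightarrow> runs d (s(r := w)) s' n"
    and "\<And>w. s r = True # w \<Longrightarrow> runs e (s(r := w)) s' n"
  shows "runs (Pop r c d e) s s' (Suc n)"
proof (cases "s r")
  case Nil
  with assms(1) show ?thesis unfolding runs_def by (meson Suc_le_mono exec.PopE)
next
  case (Cons b w)
  then have "\<exists>t \<le> n. exec (if b then e else d) (s(r := w)) t s'"
    using assms(2,3) unfolding runs_def by (cases b) auto
  with Cons show ?thesis unfolding runs_def
    by (cases b) (auto intro: exec.PopF exec.PopT Suc_le_mono[THEN iffD2])
qed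

lemma runs_WhileE: "s r = [] \<Longrightarrow> runs (While r c d) s s 1"
  unfolding runs_def using exec.WhileE by blast

lemma runs_While:
  assumes "s r = b # w" "runs (if b then d else c) (s(r := w)) s' m" "runs (While r c d) s' s'' n"
  shows "runs (While r c d) s s'' (Suc (m + n))"
proof -
  obtain t u where "t \<le> m" "u \<le> n" "exec (if b then d else c) (s(r := w)) t s'" "exec (While r c d) s' u s''"
    using assms unfolding runs_def by blast
  then have "exec (While r c d) s (Suc (t + u)) s''" "Suc (t + u) \<le> Suc (m + n)"
    using assms(1) by (cases b; auto intro: exec.WhileF exec.WhileT)+
  then show ?thesis unfolding runs_def by blast
qed

fun pushes :: "nat \<Rightarrow> bool list \<Rightarrow> com" where
  "pushes r [] = Skip"
| "pushes r (b # w) = Seq (Push r b) (pushes r w)"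

lemma runs_pushes: "runs (pushes r w) s (s(r := rev w @ s r)) (Suc (length w))"
proof (induction w arbitrary: s)
  case Nil
  then show ?case using runs_Skip by simp
next
  case (Cons b w)
  show ?case
    unfolding pushes.simps
    by (rule runs_eq, rule runs_Seq, rule runs_Push, rule Cons.IH) auto
qed

text \<open>Moving a word from one stack to another reverses it, so a transfer that preserves the
  order uses two translations through a scratch register.\<close>

definition translate :: "nat \<Rightarrow> nat \<Rightarrow> (bool \<Rightarrow> bool list) \<Rightarrow> com" where
  "translate r a g = While r (pushes a (g False)) (pushes a (g True))"

lemma runs_translate:
  assumes "r \<noteq> a"
  shows "runs (translate r a g) s (s(r := [], a := rev (concat (map g (s r))) @ s a))
    ((length (g False) + length (g True) + 2) * length (s r) + 1)"
  unfolding translate_def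
proof (induction "s r" arbitrary: s)
  case Nil
  show ?case by (rule runs_eq, rule runs_WhileE) (use Nil in auto)
next
  case (Cons b w)
  let ?s = "s(r := w, a := rev (g b) @ s a)"
  have 1: "runs (if b then pushes a (g True) else pushes a (g False)) (s(r := w)) ?s
      (Suc (length (g False) + length (g True)))"
    by (cases b; simp; rule runs_eq, rule runs_pushes) (use assms in auto)
  have 2: "runs (While r (pushes a (g False)) (pushes a (g True))) ?s
    (s(r := [], a := rev (concat (map g (s r))) @ s a))
    ((length (g False) + length (g True) + 2) * length w + 1)"
    by (rule runs_eq[OF Cons.hyps(1)[of ?s]]) (use assms Cons.hyps(2)[symmetric] in \<open>auto simp: fun_eq_iff\<close>)
  show ?case
    by (rule runs_eq[OF runs_While[OF Cons.hyps(2)[symmetric] 1 2]])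
      (use Cons.hyps(2)[symmetric] in \<open>auto simp: algebra_simps\<close>)
qed

definition clear :: "nat \<Rightarrow> com" where
  "clear r = translate r (Suc r) (\<lambda>_. [])"

lemma runs_clear: "runs (clear r) s (s(r := [])) (2 * length (s r) + 1)"
  unfolding clear_def by (rule runs_eq[OF runs_translate]) (auto simp: fun_eq_iff)

definition move :: "nat \<Rightarrow> nat \<Rightarrow> nat \<Rightarrow> com" where
  "move r a k = Seq (translate r k (\<lambda>b. [b])) (translate k a (\<lambda>b. [b]))"

lemma runs_move:
  assumes "r \<noteq> k" "a \<noteq> k" "r \<noteq> a" "s k = []"
  shows "runs (move r a k) s (s(r := [], a := s r @ s a)) (8 * length (s r) + 2)"
  unfolding move_def
  by (rule runs_eq, rule runs_Seq, rule runs_translate, fact, rule runs_translate)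
    (use assms in \<open>auto simp: fun_eq_iff concat_map_singleton\<close>)

definition copy :: "nat \<Rightarrow> nat \<Rightarrow> nat \<Rightarrow> com" where
  "copy r a k = Seq (translate r k (\<lambda>b. [b]))
    (While k (Seq (Push r False) (Push a False)) (Seq (Push r True) (Push a True)))"

lemma runs_copy_loop:
  assumes "r \<noteq> k" "a \<noteq> k" "r \<noteq> a"
  shows "runs (While k (Seq (Push r False) (Push a False)) (Seq (Push r True) (Push a True))) s
    (s(k := [], r := rev (s k) @ s r, a := rev (s k) @ s a)) (3 * length (s k) + 1)"
proof (induction "s k" arbitrary: s)
  case Nil
  show ?case by (rule runs_eq, rule runs_WhileE) (use Nil in auto)
next
  case (Cons b w)
  let ?s = "s(k := w, r := b # s r, a := b # s a)"
  have 1: "runs (if b then Seq (Push r True) (Push a True) else Seq (Push r False) (Push a False))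
    (s(k := w)) ?s 2"
    by (cases b; simp; rule runs_eq, rule runs_Seq, rule runs_Push, rule runs_Push)
      (use assms in \<open>auto simp: fun_eq_iff\<close>)
  show ?case
    by (rule runs_eq[OF runs_While[OF Cons.hyps(2)[symmetric] 1 Cons.hyps(1)[of ?s]]])
      (use assms Cons.hyps(2)[symmetric] in \<open>auto simp: fun_eq_iff\<close>)
qed

lemma runs_copy:
  assumes "r \<noteq> k" "a \<noteq> k" "r \<noteq> a" "s k = []"
  shows "runs (copy r a k) s (s(a := s r @ s a)) (8 * length (s r) + 2)"
  unfolding copy_def
  by (rule runs_eq, rule runs_Seq, rule runs_translate, fact, rule runs_copy_loop)
    (use assms in \<open>auto simp: fun_eq_iff concat_map_singleton\<close>)

text \<open>The word is built from its end on top of the second component. The tag of a bit is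
  therefore pushed after the bit, which explains \<open>[b, True]\<close>.\<close>

definition pair_regs :: "nat \<Rightarrow> nat \<Rightarrow> nat \<Rightarrow> com" where
  "pair_regs r a k = Seq (translate r k (\<lambda>b. [b])) (Seq (Push a False) (translate k a (\<lambda>b. [b, True])))"

lemma rev_concat_pairs: "rev (concat (map (\<lambda>b. [b, True]) (rev w))) = concat (map (\<lambda>b. [True, b]) w)"
  by (induction w) auto

lemma runs_pair_regs:
  assumes "r \<noteq> k" "a \<noteq> k" "r \<noteq> a" "s k = []"
  shows "runs (pair_regs r a k) s (s(r := [], a := pair_word (s r) (s a))) (10 * length (s r) + 3)"
  unfolding pair_regs_def
  by (rule runs_eq, rule runs_Seq, rule runs_translate, fact, rule runs_Seq, rule runs_Push, rule runs_translate)
    (use assms in \<open>auto simp: fun_eq_iff concat_map_singleton rev_concat_pairs pair_word_def self_delim_def\<close>)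

text \<open>Register \<open>k\<close> is the loop flag.\<close>

definition unpair_regs :: "nat \<Rightarrow> nat \<Rightarrow> nat \<Rightarrow> com" where
  "unpair_regs r a k = Seq (Push k True) (Seq
    (While k Skip (Pop r Skip Skip
      (Pop r Skip (Seq (Push (Suc k) False) (Push k True)) (Seq (Push (Suc k) True) (Push k True)))))
    (translate (Suc k) a (\<lambda>b. [b])))"

text \<open>A loop tests a register, while the decoding has to stop at a tag inside the word. Each
  round consumes the flag, and the flag is set again exactly if the tag just read was
  \<open>True\<close>.\<close>

lemma runs_unpair_loop:
  assumes "r < k" "s k = [True]" "s r = self_delim u @ v"
  shows "runs (While k Skip (Pop r Skip Skip
      (Pop r Skip (Seq (Push (Suc k) False) (Push k True)) (Seq (Push (Suc k) True) (Push k True))))) s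
    (s(k := [], r := v, Suc k := rev u @ s (Suc k))) (6 * length u + 5)"
  using assms(2,3)
proof (induction u arbitrary: s)
  case Nil
  have 1: "runs (Pop r Skip Skip (Pop r Skip (Seq (Push (Suc k) False) (Push k True)) (Seq (Push (Suc k) True) (Push k True))))
    (s(k := [])) (s(k := [], r := v)) 2"
    by (rule runs_eq, rule runs_Pop[where n = 1 and s' = "s(k := [], r := v)"])
      (use Nil assms(1) in \<open>auto simp: self_delim_def intro: runs_Skip\<close>)
  show ?case
    by (rule runs_eq, rule runs_While[where b = True and w = "[]" and r = k], rule Nil, simp, rule 1, rule runs_WhileE)
      (use assms(1) in \<open>auto simp: fun_eq_iff\<close>)
next
  case (Cons b u)
  let ?s = "s(r := self_delim u @ v, Suc k := b # s (Suc k))"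
  have sr: "s r = True # b # self_delim u @ v" using Cons.prems by (simp add: self_delim_def)
  have 0: "runs (Seq (Push (Suc k) b) (Push k True)) (s(k := [], r := self_delim u @ v)) ?s 2"
    by (rule runs_eq[OF runs_Seq[OF runs_Push runs_Push]]) (use assms(1) Cons.prems in \<open>auto simp: fun_eq_iff\<close>)
  have 2: "runs (Pop r Skip (Seq (Push (Suc k) False) (Push k True)) (Seq (Push (Suc k) True) (Push k True)))
    (s(k := [], r := b # self_delim u @ v)) ?s 3"
    by (rule runs_eq, rule runs_Pop[where n = 2 and s' = ?s])
      (use 0 in \<open>auto simp: fun_upd_twist\<close>)
  have 1: "runs (Pop r Skip Skip (Pop r Skip (Seq (Push (Suc k) False) (Push k True)) (Seq (Push (Suc k) True) (Push k True))))
    (s(k := [])) ?s 4"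
    by (rule runs_eq, rule runs_Pop[where n = 3 and s' = ?s])
      (use 2 assms(1) sr in auto)
  have 3: "?s k = [True]" "?s r = self_delim u @ v" using assms(1) Cons.prems by auto
  show ?case
    by (rule runs_eq, rule runs_While[where b = True and w = "[]" and r = k], rule Cons.prems, simp, rule 1,
        rule Cons.IH[OF 3])
      (use assms(1) in \<open>auto simp: fun_eq_iff\<close>)
qed

lemma runs_unpair_regs:
  assumes "r < k" "a < k" "r \<noteq> a" "s k = []" "s (Suc k) = []" "s r = pair_word u v"
  shows "runs (unpair_regs r a k) s (s(r := v, a := u @ s a)) (10 * length u + 8)"
  unfolding unpair_regs_def
  by (rule runs_eq, rule runs_Seq, rule runs_Push, rule runs_Seq,
      rule runs_unpair_loop[where u = u and v = v], fact, insert assms, simp, simp add: pair_word_def,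
      rule runs_translate)
    (auto simp: fun_eq_iff concat_map_singleton)

text \<open>This is the code of a bit as an element of a list, \<open>self_delim [b]\<close>. The
  routines below convert between raw words, which machines read and write, and the encoding of words
  as lists of bits.\<close>

definition wrap_bit :: "bool \<Rightarrow> bool list" where
  "wrap_bit b = [True, b, False]"

definition wrap_regs :: "nat \<Rightarrow> com" where
  "wrap_regs k = Seq (translate 0 k (\<lambda>b. [b])) (translate k 0 (\<lambda>b. rev (wrap_bit b)))"

lemma rev_concat_wrap: "rev (concat (map (\<lambda>b. rev (wrap_bit b)) (rev w))) = concat (map wrap_bit w)"
  by (induction w) auto

lemma runs_wrap_regs:
  assumes "0 < k" "s k = []" "s 0 = w"
  shows "runs (wrap_regs k) s (s(0 := concat (map wrap_bit w))) (12 * length w + 2)"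
  unfolding wrap_regs_def
  by (rule runs_eq, rule runs_Seq, rule runs_translate, insert assms, simp, rule runs_translate)
    (auto simp: fun_eq_iff concat_map_singleton rev_concat_wrap, simp add: wrap_bit_def)

definition unwrap_regs :: "nat \<Rightarrow> com" where
  "unwrap_regs k = Seq (While 0 Skip (Pop 0 Skip
      (Seq (Push k False) (Pop 0 Skip Skip Skip)) (Seq (Push k True) (Pop 0 Skip Skip Skip))))
    (translate k 0 (\<lambda>b. [b]))"

lemma runs_unwrap_loop:
  assumes "0 < k" "s 0 = concat (map wrap_bit w)"
  shows "runs (While 0 Skip (Pop 0 Skip
      (Seq (Push k False) (Pop 0 Skip Skip Skip)) (Seq (Push k True) (Pop 0 Skip Skip Skip)))) s
    (s(0 := [], k := rev w @ s k)) (5 * length w + 1)"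
  using assms(2)
proof (induction w arbitrary: s)
  case Nil
  show ?case by (rule runs_eq, rule runs_WhileE) (use Nil in auto)
next
  case (Cons b w)
  let ?r = "concat (map wrap_bit w)"
  let ?s = "s(0 := ?r, k := b # s k)"
  have s0: "s 0 = True # b # False # ?r" using Cons.prems wrap_bit_def[of b] by simp
  have 0: "runs (Pop 0 Skip Skip Skip) (s(0 := False # ?r, k := b # s k)) ?s 2"
    by (rule runs_eq, rule runs_Pop[where n = 1 and s' = ?s])
      (use assms(1) in \<open>auto simp: fun_upd_twist intro: runs_Skip\<close>)
  have 2: "runs (Seq (Push k b) (Pop 0 Skip Skip Skip)) (s(0 := False # ?r)) ?s 3"
    by (rule runs_eq, rule runs_Seq, rule runs_Push) (use 0 assms(1) in auto)
  have 1: "runs (Pop 0 Skip (Seq (Push k False) (Pop 0 Skip Skip Skip)) (Seq (Push k True) (Pop 0 Skip Skip Skip)))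
    (s(0 := b # False # ?r)) ?s 4"
    by (rule runs_eq, rule runs_Pop[where n = 3 and s' = ?s]) (use 2 in auto)
  have 3: "?s 0 = ?r" using assms(1) by simp
  show ?case
    by (rule runs_eq, rule runs_While[where r = 0 and s = s, OF s0], simp, rule 1, rule Cons.IH[of ?s, OF 3])
      (use assms(1) in \<open>auto simp: fun_eq_iff\<close>)
qed

lemma runs_unwrap_regs:
  assumes "0 < k" "s k = []" "s 0 = concat (map wrap_bit w)"
  shows "runs (unwrap_regs k) s (s(0 := w)) (9 * length w + 2)"
  unfolding unwrap_regs_def
  by (rule runs_eq, rule runs_Seq, rule runs_unwrap_loop, fact, fact, rule runs_translate)
    (use assms in \<open>auto simp: fun_eq_iff concat_map_singleton\<close>)

section \<open>Polynomial-time functions\<close>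

class enc =
  fixes enc :: "'a \<Rightarrow> bool list"
  assumes enc_inject: "enc x = enc y \<Longrightarrow> x = y"

lemma pair_word_eq_iff [simp]: "pair_word u v = pair_word u' v' \<longleftrightarrow> u = u' \<and> v = v'"
  by (simp add: pair_word_def prefix_freeD[OF prefix_free_self_delim])

lemma length_self_delim [simp]: "length (self_delim w) = 2 * length w + 1"
  by (induction w) (auto simp: self_delim_def)

instantiation bool :: enc
begin
definition "enc b = [b]"
instance by standard (simp add: enc_bool_def)
end

instantiation prod :: (enc, enc) enc
begin
definition "enc p = pair_word (enc (fst p)) (enc (snd p))"
instance by standard (auto simp: enc_prod_def intro: prod_eqI enc_inject)
end

instantiation list :: (enc) enc
begin
definition "enc xs = concat (map (\<lambda>x. self_delim (enc x)) xs)"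
instance
proof
  show "enc xs = enc ys \<Longrightarrow> xs = ys" for xs ys :: "'a list"
  proof (induction xs arbitrary: ys)
    case Nil
    then show ?case by (cases ys) (auto simp: enc_list_def self_delim_def)
  next
    case (Cons x xs)
    then have "ys \<noteq> []" by (auto simp: enc_list_def self_delim_def)
    then obtain y ys' where ys: "ys = y # ys'" by (cases ys) auto
    with Cons.prems have "enc x = enc y" "enc xs = enc ys'"
      by (simp_all add: enc_list_def prefix_freeD[OF prefix_free_self_delim])
    with Cons.IH ys show ?case by (auto intro: enc_inject)
  qed
qed
end

hide_fact (open) Defs.enc_list_def

lemma enc_Nil [simp]: "enc [] = []"
  by (simp add: enc_list_def)

text \<open>Lists are encoded without a terminator, so that a nonempty list has the same code as the
  pair of its head and tail. Constructing and destructing lists then reduces to pairing and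
  unpairing.\<close>

lemma enc_Cons: "enc (x # xs) = pair_word (enc x) (enc xs)"
  by (simp add: enc_list_def pair_word_def)

lemma enc_Pair: "enc (x, y) = pair_word (enc x) (enc y)"
  by (simp add: enc_prod_def)

lemma enc_word: "enc (w :: bool list) = concat (map wrap_bit w)"
  by (induction w) (auto simp: enc_list_def enc_bool_def self_delim_def wrap_bit_def)

abbreviation esize :: "'a::enc \<Rightarrow> nat" where
  "esize x \<equiv> length (enc x)"

lemma esize_Pair [simp]: "esize (x, y) = 2 * esize x + 1 + esize y"
  by (simp add: enc_Pair pair_word_def)

lemma esize_Cons [simp]: "esize (x # xs) = 2 * esize x + 1 + esize xs"
  by (simp add: enc_Cons pair_word_def)

lemma esize_word [simp]: "esize (w :: bool list) = 3 * length w"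
  by (induction w) (auto simp: enc_bool_def)

lemma esize_bool [simp]: "esize (b :: bool) = 1"
  by (simp add: enc_bool_def)

lemma esize_append [simp]: "esize (xs @ ys) = esize xs + esize ys"
  by (simp add: enc_list_def)

lemma esize_rev [simp]: "esize (rev xs) = esize xs"
  by (induction xs) auto

lemma length_le_esize: "length xs \<le> esize xs"
  by (induction xs) auto

text \<open>Polynomial-time functions between encoded types: a stack program transforms register 0 in
  place, using registers from \<open>k\<close> on, initially empty, as workspace that it leaves empty.\<close>

definition computes :: "nat \<Rightarrow> com \<Rightarrow> ('a::enc \<Rightarrow> 'b::enc) \<Rightarrow> (nat \<Rightarrow> nat) \<Rightarrow> bool" where
  "computes k c f p \<longleftrightarrow> (\<forall>s x. s 0 = enc x \<longrightarrow> (\<forall>i \<ge> k. s i = []) \<longrightarrow>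
    runs c s (s(0 := enc (f x))) (p (esize x)))"

definition pt :: "('a::enc \<Rightarrow> 'b::enc) \<Rightarrow> bool" where
  "pt f \<longleftrightarrow> (\<exists>p. polyb p \<and> (\<forall>k \<ge> 1. \<exists>c. computes k c f p))"

lemma computesI:
  assumes "\<And>s x. s 0 = enc x \<Longrightarrow> \<forall>i \<ge> k. s i = [] \<Longrightarrow> runs c s (s(0 := enc (f x))) (p (esize x))"
  shows "computes k c f p"
  using assms unfolding computes_def by blast

lemma computesD:
  assumes "computes k c f p" "s 0 = enc x" "\<And>i. i \<ge> k \<Longrightarrow> s i = []"
  shows "runs c s (s(0 := enc (f x))) (p (esize x))"
  using assms unfolding computes_def by blast

lemma computes_mono: "computes k c f p \<Longrightarrow> (\<And>n. p n \<le> q n) \<Longrightarrow> computes k c f q"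
  unfolding computes_def by (meson runs_mono)

lemma ptI:
  assumes "polyb p"
    and "\<And>k. k \<ge> 1 \<Longrightarrow> \<exists>c. computes k c f p"
  shows "pt f"
  using assms unfolding pt_def by blast

lemma exec_length: "exec c s t s' \<Longrightarrow> length (s' r) \<le> length (s r) + t"
  by (induction rule: exec.induct) (auto split: if_splits)

text \<open>A step pushes at most one bit, so a time bound is also a bound on the growth of the
  output. One monotone majorant serves for both.\<close>

lemma ptE:
  assumes "pt (f :: 'a::enc \<Rightarrow> _)"
  obtains p where "polyb p" "mono p" "\<And>x. esize (f x) \<le> p (esize x)"
    "\<And>k. k \<ge> 1 \<Longrightarrow> \<exists>c. computes k c f p"
proof -
  obtain p0 where p0: "polyb p0" "\<And>k. k \<ge> 1 \<Longrightarrow> \<exists>c. computes k c f p0"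
    using assms unfolding pt_def by blast
  have "polyb (\<lambda>n. n + p0 n)" by (intro polyb_intros p0)
  then obtain p where p: "polyb p" "mono p" "\<And>n. n + p0 n \<le> p n"
    by (rule polyb_mono_majorant) blast
  have le: "p0 n \<le> p n" for n using p(3)[of n] by simp
  show thesis
  proof (rule that[OF p(1,2)])
    fix x :: 'a
    let ?s = "(\<lambda>_. [])(0 := enc x)"
    obtain c where "computes 1 c f p0"
      using p0(2)[of 1] by blast
    from computesD[OF this, of ?s x] have "runs c ?s ((\<lambda>_. [])(0 := enc (f x))) (p0 (esize x))"
      by simp
    then obtain t where t: "t \<le> p0 (esize x)" "exec c ((\<lambda>_. [])(0 := enc x)) t ((\<lambda>_. [])(0 := enc (f x)))"
      unfolding runs_def by blast
    show "esize (f x) \<le> p (esize x)"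
      using exec_length[OF t(2), of 0] t(1) p(3)[of "esize x"] by simp
  next
    fix k :: nat assume "k \<ge> 1"
    from p0(2)[OF this] show "\<exists>c. computes k c f p"
      using computes_mono le by blast
  qed
qed

lemma pt_id: "pt (\<lambda>x. x)"
  by (rule ptI[of "\<lambda>_. 1"])
    (auto intro!: polyb_const exI[of _ Skip] runs_Skip computesI simp: fun_upd_idem)

lemma pt_const: "pt (\<lambda>_. y)"
proof (rule ptI[of "\<lambda>n. 2 * n + 1 + Suc (esize y)"])
  fix k :: nat assume k: "k \<ge> 1"
  show "\<exists>c. computes k c (\<lambda>_. y) (\<lambda>n. 2 * n + 1 + Suc (esize y))"
    by (intro exI[of _ "Seq (clear 0) (pushes 0 (rev (enc y)))"] computesI)
      (rule runs_eq, rule runs_Seq, rule runs_clear, rule runs_pushes, auto)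
qed (intro polyb_intros)

lemma pt_comp:
  assumes "pt f" "pt (g :: 'a::enc \<Rightarrow> _)"
  shows "pt (\<lambda>x. f (g x))"
proof -
  from assms(1) obtain p where p: "polyb p" "mono p" "\<And>k. k \<ge> 1 \<Longrightarrow> \<exists>c. computes k c f p" by (rule ptE) blast
  from assms(2) obtain q where q: "polyb q" "mono q" "\<And>x. esize (g x) \<le> q (esize x)"
    "\<And>k. k \<ge> 1 \<Longrightarrow> \<exists>c. computes k c g q" by (rule ptE) blast
  show ?thesis
  proof (rule ptI[of "\<lambda>n. q n + p (q n)"])
    show "polyb (\<lambda>n. q n + p (q n))" by (intro polyb_add q polyb_comp[OF p(1) q(1)])
    fix k :: nat assume k: "k \<ge> 1"
    obtain c where c: "computes k c f p" using p(3)[OF k] by blast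
    obtain d where d: "computes k d g q" using q(4)[OF k] by blast
    show "\<exists>c. computes k c (\<lambda>x. f (g x)) (\<lambda>n. q n + p (q n))"
    proof (intro exI[of _ "Seq d c"] computesI)
      fix s and x :: 'a assume s: "s 0 = enc x" "\<forall>i \<ge> k. s i = []"
      have 1: "runs d s (s(0 := enc (g x))) (q (esize x))"
        by (rule computesD[OF d]) (use s in auto)
      have "runs c (s(0 := enc (g x))) (s(0 := enc (g x), 0 := enc (f (g x)))) (p (esize (g x)))"
        by (rule computesD[OF c]) (use s k in auto)
      then have 2: "runs c (s(0 := enc (g x))) (s(0 := enc (f (g x)))) (p (q (esize x)))"
        by (rule runs_eq) (use p(2) q(3) in \<open>auto simp: mono_def\<close>)
      show "runs (Seq d c) s (s(0 := enc (f (g x)))) (q (esize x) + p (q (esize x)))"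
        using runs_Seq[OF 1 2] .
    qed
  qed
qed

lemma pt_fst0: "pt (fst :: 'a::enc \<times> 'b::enc \<Rightarrow> 'a)"
proof (rule ptI[of "\<lambda>n. 10 * n + 8 + ((2 * n + 1) + (8 * n + 2))"])
  fix k :: nat assume k: "k \<ge> 1"
  show "\<exists>c. computes k c (fst :: 'a \<times> 'b \<Rightarrow> 'a) (\<lambda>n. 10 * n + 8 + ((2 * n + 1) + (8 * n + 2)))"
  proof (intro exI[of _ "Seq (unpair_regs 0 k (Suc k)) (Seq (clear 0) (move k 0 (Suc k)))"] computesI)
    fix s and x :: "'a \<times> 'b" assume s: "s 0 = enc x" "\<forall>i \<ge> k. s i = []"
    show "runs (Seq (unpair_regs 0 k (Suc k)) (Seq (clear 0) (move k 0 (Suc k)))) s (s(0 := enc (fst x)))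
      (10 * esize x + 8 + ((2 * esize x + 1) + (8 * esize x + 2)))"
      by (rule runs_eq, rule runs_Seq, rule runs_unpair_regs[where u = "enc (fst x)" and v = "enc (snd x)"],
          insert k s, simp, simp, simp, simp, simp, simp add: enc_prod_def, rule runs_Seq, rule runs_clear,
          rule runs_move)
        (auto simp: fun_eq_iff enc_prod_def pair_word_def)
  qed
qed (intro polyb_intros)

lemma pt_snd0: "pt (snd :: 'a::enc \<times> 'b::enc \<Rightarrow> 'b)"
proof (rule ptI[of "\<lambda>n. 10 * n + 8 + (2 * n + 1)"])
  fix k :: nat assume k: "k \<ge> 1"
  show "\<exists>c. computes k c (snd :: 'a \<times> 'b \<Rightarrow> 'b) (\<lambda>n. 10 * n + 8 + (2 * n + 1))"
  proof (intro exI[of _ "Seq (unpair_regs 0 k (Suc k)) (clear k)"] computesI)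
    fix s and x :: "'a \<times> 'b" assume s: "s 0 = enc x" "\<forall>i \<ge> k. s i = []"
    show "runs (Seq (unpair_regs 0 k (Suc k)) (clear k)) s (s(0 := enc (snd x)))
      (10 * esize x + 8 + (2 * esize x + 1))"
      by (rule runs_eq, rule runs_Seq, rule runs_unpair_regs[where u = "enc (fst x)" and v = "enc (snd x)"],
          insert k s, simp, simp, simp, simp, simp, simp add: enc_prod_def, rule runs_clear)
        (auto simp: fun_eq_iff enc_prod_def pair_word_def)
  qed
qed (intro polyb_intros)

lemmas pt_fst = pt_comp[OF pt_fst0]
lemmas pt_snd = pt_comp[OF pt_snd0]

text \<open>Register \<open>k\<close> keeps the argument during the first computation and
  \<open>Suc k\<close> keeps its result during the second, hence the workspaces from
  \<open>Suc k\<close> and from \<open>k + 2\<close>.\<close>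

lemma pt_Pair:
  assumes "pt (f :: 'a::enc \<Rightarrow> _)" "pt g"
  shows "pt (\<lambda>x. (f x, g x))"
proof -
  from assms(1) obtain p where p: "polyb p" "mono p" "\<And>x. esize (f x) \<le> p (esize x)"
    "\<And>k. k \<ge> 1 \<Longrightarrow> \<exists>c. computes k c f p" by (rule ptE) blast
  from assms(2) obtain q where q: "polyb q" "mono q" "\<And>x. esize (g x) \<le> q (esize x)"
    "\<And>k. k \<ge> 1 \<Longrightarrow> \<exists>c. computes k c g q" by (rule ptE) blast
  let ?p = "\<lambda>n. (8 * n + 2) + (p n + ((8 * p n + 2) + ((8 * n + 2) + (q n + (10 * p n + 3)))))"
  show ?thesis
  proof (rule ptI[of ?p])
    show "polyb ?p" by (intro polyb_intros p q)
    fix k :: nat assume k: "k \<ge> 1"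
    obtain c where c: "computes (Suc k) c f p" using p(4)[of "Suc k"] by auto
    obtain d where d: "computes (k + 2) d g q" using q(4)[of "k + 2"] by auto
    let ?c = "Seq (copy 0 k (Suc k)) (Seq c (Seq (move 0 (Suc k) (k + 2)) (Seq (move k 0 (k + 2))
      (Seq d (pair_regs (Suc k) 0 (k + 2))))))"
    show "\<exists>c. computes k c (\<lambda>x. (f x, g x)) ?p"
    proof (intro exI[of _ ?c] computesI)
      fix s and x :: 'a assume s: "s 0 = enc x" "\<forall>i \<ge> k. s i = []"
      let ?s1 = "s(k := enc x)"
      let ?s2 = "s(0 := enc (f x), k := enc x)"
      let ?s3 = "s(0 := [], k := enc x, Suc k := enc (f x))"
      let ?s4 = "s(0 := enc x, Suc k := enc (f x))"
      let ?s5 = "s(0 := enc (g x), Suc k := enc (f x))"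
      have "runs (copy 0 k (Suc k)) s ?s1 (8 * esize x + 2)"
        by (rule runs_eq, rule runs_copy) (use k s in \<open>auto simp: fun_eq_iff\<close>)
      moreover have "runs c ?s1 ?s2 (p (esize x))"
        by (rule runs_eq, rule computesD[OF c, where x = x]) (use k s in \<open>auto simp: fun_eq_iff\<close>)
      moreover have "runs (move 0 (Suc k) (k + 2)) ?s2 ?s3 (8 * p (esize x) + 2)"
        by (rule runs_eq, rule runs_move) (use k s p(3) in \<open>auto simp: fun_eq_iff\<close>)
      moreover have "runs (move k 0 (k + 2)) ?s3 ?s4 (8 * esize x + 2)"
        by (rule runs_eq, rule runs_move) (use k s in \<open>auto simp: fun_eq_iff\<close>)
      moreover have "runs d ?s4 ?s5 (q (esize x))"
        by (rule runs_eq, rule computesD[OF d, where x = x]) (use k s in \<open>auto simp: fun_eq_iff\<close>)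
      moreover have "runs (pair_regs (Suc k) 0 (k + 2)) ?s5 (s(0 := enc (f x, g x))) (10 * p (esize x) + 3)"
        by (rule runs_eq, rule runs_pair_regs) (use k s p(3) in \<open>auto simp: fun_eq_iff enc_Pair\<close>)
      ultimately show "runs ?c s (s(0 := enc (f x, g x))) (?p (esize x))"
        by (intro runs_Seq)
    qed
  qed
qed

lemma pt_If:
  assumes "pt (b :: 'a::enc \<Rightarrow> _)" "pt f" "pt g"
  shows "pt (\<lambda>x. if b x then f x else g x)"
proof -
  from assms(1) obtain r where r: "polyb r"
    "\<And>k. k \<ge> 1 \<Longrightarrow> \<exists>c. computes k c b r" by (rule ptE) blast
  from assms(2) obtain p where p: "polyb p"
    "\<And>k. k \<ge> 1 \<Longrightarrow> \<exists>c. computes k c f p" by (rule ptE) blast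
  from assms(3) obtain q where q: "polyb q"
    "\<And>k. k \<ge> 1 \<Longrightarrow> \<exists>c. computes k c g q" by (rule ptE) blast
  let ?p = "\<lambda>n. (8 * n + 2) + (r n + (1 + ((8 * n + 2) + (p n + q n))))"
  show ?thesis
  proof (rule ptI[of ?p])
    show "polyb ?p" by (intro polyb_intros p q r)
    fix k :: nat assume k: "k \<ge> 1"
    obtain a where a: "computes (Suc k) a b r" using r(2)[of "Suc k"] by auto
    obtain c where c: "computes k c f p" using p(2)[OF k] by auto
    obtain d where d: "computes k d g q" using q(2)[OF k] by auto
    let ?c = "Seq (copy 0 k (Suc k)) (Seq a (Pop 0 Skip (Seq (move k 0 (Suc k)) d) (Seq (move k 0 (Suc k)) c)))"
    show "\<exists>c. computes k c (\<lambda>x. if b x then f x else g x) ?p"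
    proof (intro exI[of _ ?c] computesI)
      fix s and x :: 'a assume s: "s 0 = enc x" "\<forall>i \<ge> k. s i = []"
      let ?s1 = "s(k := enc x)"
      let ?s2 = "s(0 := [b x], k := enc x)"
      let ?y = "enc (if b x then f x else g x)"
      have "runs (copy 0 k (Suc k)) s ?s1 (8 * esize x + 2)"
        by (rule runs_eq, rule runs_copy) (use k s in \<open>auto simp: fun_eq_iff\<close>)
      moreover have "runs a ?s1 ?s2 (r (esize x))"
        by (rule runs_eq, rule computesD[OF a, where x = x]) (use k s in \<open>auto simp: fun_eq_iff enc_bool_def\<close>)
      moreover have "runs (Pop 0 Skip (Seq (move k 0 (Suc k)) d) (Seq (move k 0 (Suc k)) c)) ?s2 (s(0 := ?y))
        (1 + ((8 * esize x + 2) + (p (esize x) + q (esize x))))"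
      proof -
        have 1: "runs (move k 0 (Suc k)) (s(0 := [], k := enc x)) s (8 * esize x + 2)"
          by (rule runs_eq, rule runs_move) (use k s in \<open>auto simp: fun_eq_iff\<close>)
        have 2: "runs (if b x then c else d) s (s(0 := ?y)) (p (esize x) + q (esize x))"
          using computesD[OF c, of s x] computesD[OF d, of s x] s by (auto intro: runs_mono)
        have 3: "s(k := enc x, 0 := []) = s(0 := [], k := enc x)"
          using k by (auto simp: fun_eq_iff)
        show ?thesis
          unfolding plus_1_eq_Suc
          by (rule runs_Pop) (use k runs_Seq[OF 1 2] in \<open>auto simp: 3 split: if_splits\<close>)
      qed
      ultimately show "runs ?c s (s(0 := ?y)) (?p (esize x))"
        by (intro runs_Seq)
    qed
  qed
qed


text \<open>Popping one bit tells an empty list from a nonempty one. In the second case the bit is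
  pushed back, and the register already holds the code of the pair of head and tail.\<close>

lemma pt_case_list:
  assumes "pt (l :: 'a::enc \<Rightarrow> 'b::enc list)" "pt f" "pt (\<lambda>z. g (fst z) (fst (snd z)) (snd (snd z)))"
  shows "pt (\<lambda>x. case l x of [] \<Rightarrow> f x | y # ys \<Rightarrow> g x y ys)"
proof -
  let ?g = "\<lambda>z. g (fst z) (fst (snd z)) (snd (snd z))"
  from assms(1) obtain r where r: "polyb r" "\<And>x. esize (l x) \<le> r (esize x)"
    "\<And>k. k \<ge> 1 \<Longrightarrow> \<exists>c. computes k c l r" by (rule ptE) blast
  from assms(2) obtain p where p: "polyb p"
    "\<And>k. k \<ge> 1 \<Longrightarrow> \<exists>c. computes k c f p" by (rule ptE) blast
  from assms(3) obtain q where q: "polyb q" "mono q"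
    "\<And>k. k \<ge> 1 \<Longrightarrow> \<exists>c. computes k c ?g q" by (rule ptE) blast
  let ?m = "\<lambda>n. 2 * n + 1 + r n"
  let ?p = "\<lambda>n. (8 * n + 2) + (r n + (1 + ((8 * n + 2) + (p n + (1 + (10 * n + 3 + q (?m n)))))))"
  show ?thesis
  proof (rule ptI[of ?p])
    show "polyb ?p" by (intro polyb_add polyb_mult polyb_const polyb_id p r polyb_comp[OF q(1)])
    fix k :: nat assume k: "k \<ge> 1"
    obtain a where a: "computes (Suc k) a l r" using r(3)[of "Suc k"] by auto
    obtain c where c: "computes k c f p" using p(2)[OF k] by auto
    obtain d where d: "computes k d ?g q" using q(3)[OF k] by auto
    let ?d = "Seq (pair_regs k 0 (Suc k)) d"
    let ?c = "Seq (copy 0 k (Suc k)) (Seq a (Pop 0 (Seq (move k 0 (Suc k)) c)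
      (Seq (Push 0 False) ?d) (Seq (Push 0 True) ?d)))"
    show "\<exists>c. computes k c (\<lambda>x. case l x of [] \<Rightarrow> f x | y # ys \<Rightarrow> g x y ys) ?p"
    proof (intro exI[of _ ?c] computesI)
      fix s and x :: 'a assume s: "s 0 = enc x" "\<forall>i \<ge> k. s i = []"
      let ?s1 = "s(k := enc x)"
      let ?s2 = "s(0 := enc (l x), k := enc x)"
      let ?y = "enc (case l x of [] \<Rightarrow> f x | y # ys \<Rightarrow> g x y ys)"
      let ?n = "esize x"
      have "runs (copy 0 k (Suc k)) s ?s1 (8 * ?n + 2)"
        by (rule runs_eq, rule runs_copy) (use k s in \<open>auto simp: fun_eq_iff\<close>)
      moreover have "runs a ?s1 ?s2 (r ?n)"
        by (rule runs_eq, rule computesD[OF a, where x = x]) (use k s in \<open>auto simp: fun_eq_iff\<close>)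
      moreover have "runs (Pop 0 (Seq (move k 0 (Suc k)) c) (Seq (Push 0 False) ?d) (Seq (Push 0 True) ?d)) ?s2 (s(0 := ?y))
        (1 + ((8 * ?n + 2) + (p ?n + (1 + (10 * ?n + 3 + q (?m ?n))))))"
      proof (cases "l x")
        case Nil
        have 1: "runs (move k 0 (Suc k)) ?s2 s (8 * ?n + 2)"
          by (rule runs_eq, rule runs_move) (use k s Nil in \<open>auto simp: fun_eq_iff\<close>)
        have 2: "runs c s (s(0 := ?y)) (p ?n + (1 + (10 * ?n + 3 + q (?m ?n))))"
          by (rule runs_eq, rule computesD[OF c, of s x]) (use s Nil in auto)
        show ?thesis
          unfolding plus_1_eq_Suc
          by (rule runs_Pop) (use k Nil runs_Seq[OF 1 2] in auto)
      next
        case (Cons y ys)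
        have e: "enc (l x) = enc (y, ys)" by (simp add: Cons enc_Cons enc_Pair)
        have 1: "runs (pair_regs k 0 (Suc k)) ?s2 (s(0 := enc (x, y, ys))) (10 * ?n + 3)"
          by (rule runs_eq, rule runs_pair_regs) (use k s in \<open>auto simp: fun_eq_iff e enc_Pair[of x]\<close>)
        have n: "esize (x, y, ys) \<le> ?m ?n" using r(2)[of x] Cons by simp
        have 2: "runs d (s(0 := enc (x, y, ys))) (s(0 := ?y)) (q (?m ?n))"
          by (rule runs_eq, rule computesD[OF d, where x = "(x, y, ys)"])
            (use k s Cons monoD[OF q(2) n] in auto)
        have 3: "runs (Seq (Push 0 b) ?d) (?s2(0 := w)) (s(0 := ?y)) (1 + (10 * ?n + 3 + q (?m ?n)))"
          if "?s2 0 = b # w" for b w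
          by (rule runs_Seq[OF runs_Push])
            (use that k runs_Seq[OF 1 2] in \<open>auto simp: fun_upd_idem fun_upd_twist\<close>)
        have 4: "runs (Seq (Push 0 b) ?d) (?s2(0 := w)) (s(0 := ?y)) ((8 * ?n + 2) + (p ?n + (1 + (10 * ?n + 3 + q (?m ?n)))))"
          if "?s2 0 = b # w" for b w
          by (rule runs_mono[OF 3[OF that]]) simp
        have 5: "?s2 0 \<noteq> []" using k by (auto simp: e enc_Pair pair_word_def self_delim_def)
        show ?thesis
          by (rule runs_eq, rule runs_Pop[where s' = "s(0 := ?y)" and
                n = "(8 * ?n + 2) + (p ?n + (1 + (10 * ?n + 3 + q (?m ?n))))"])
            (use 5 4 in \<open>blast | simp\<close>)+
      qed
      ultimately show "runs ?c s (s(0 := ?y)) (?p ?n)"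
        by (intro runs_Seq)
    qed
  qed
qed


text \<open>Iterating a polynomial-time step can produce results of exponential size. The assumed
  bound on the accumulators after every prefix of the list excludes this, so that each round takes
  polynomial time.\<close>

lemma pt_foldl_bounded:
  assumes f: "pt (f :: 'a::enc \<Rightarrow> 'c::enc)" and l: "pt (l :: 'a \<Rightarrow> 'b::enc list)"
    and g: "pt (\<lambda>z. g (fst z) (fst (snd z)) (snd (snd z)))"
    and b: "polyb b" and bound: "\<And>x xs ys. l x = xs @ ys \<Longrightarrow> esize (foldl (g x) (f x) xs) \<le> b (esize x)"
  shows "pt (\<lambda>x. foldl (g x) (f x) (l x))"
proof -
  let ?g = "\<lambda>z. g (fst z) (fst (snd z)) (snd (snd z))"
  from f obtain p where p: "polyb p" "\<And>k. k \<ge> 1 \<Longrightarrow> \<exists>c. computes k c f p" by (rule ptE) blast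
  from l obtain r where r: "polyb r" "\<And>x. esize (l x) \<le> r (esize x)"
    "\<And>k. k \<ge> 1 \<Longrightarrow> \<exists>c. computes k c l r" by (rule ptE) blast
  from g obtain q where q: "polyb q" "mono q"
    "\<And>k. k \<ge> 1 \<Longrightarrow> \<exists>c. computes k c ?g q" by (rule ptE) blast
  let ?m = "\<lambda>n. 2 * n + 1 + (2 * b n + 1 + r n)"
  let ?i = "\<lambda>n. 1 + ((10 * r n + 8) + ((10 * b n + 3) + ((8 * n + 2) + ((10 * n + 3) + ((8 * ?m n + 2) + q (?m n))))))"
  let ?p = "\<lambda>n. (8 * n + 2) + (r n + ((8 * r n + 2) + ((8 * n + 2) + (p n + ((?i n + 1) * r n + 1 + (2 * n + 1))))))"
  show ?thesis
  proof (rule ptI[of ?p])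
    show "polyb ?p"
      by (intro polyb_add polyb_mult polyb_const polyb_id p r b polyb_comp[OF q(1)])
    fix k :: nat assume k: "k \<ge> 1"
    obtain cl where cl: "computes (Suc k) cl l r" using r(3)[of "Suc k"] by auto
    obtain cf where cf: "computes (k + 2) cf f p" using p(2)[of "k + 2"] by auto
    obtain cg where cg: "computes (k + 2) cg ?g q" using q(3)[of "k + 2"] by auto
    let ?b = "Seq (unpair_regs (k + 1) (k + 2) (k + 3)) (Seq (pair_regs 0 (k + 2) (k + 3))
      (Seq (copy k 0 (k + 3)) (Seq (pair_regs 0 (k + 2) (k + 3)) (Seq (move (k + 2) 0 (k + 3)) cg))))"
    let ?w = "While (k + 1) (Seq (Push (k + 1) False) ?b) (Seq (Push (k + 1) True) ?b)"
    let ?c = "Seq (copy 0 k (k + 1)) (Seq cl (Seq (move 0 (k + 1) (k + 2)) (Seq (copy k 0 (k + 2))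
      (Seq cf (Seq ?w (clear k))))))"
    show "\<exists>c. computes k c (\<lambda>x. foldl (g x) (f x) (l x)) ?p"
    proof (intro exI[of _ ?c] computesI)
      fix s and x :: 'a assume s: "s 0 = enc x" "\<forall>i \<ge> k. s i = []"
      let ?n = "esize x"
      \<comment> \<open>The loop keeps the accumulator in register 0, the argument \<open>x\<close>
        in \<open>k\<close> and the remaining list in \<open>k + 1\<close>.\<close>
      let ?st = "\<lambda>a ys. s(0 := enc a, k := enc x, k + 1 := enc ys)"
      have body: "runs (Seq (Push (k + 1) bt) ?b) ((?st a (y # ys))(k + 1 := w)) (?st (g x a y) ys) (?i ?n)"
        if w: "enc (y # ys) = bt # w" and a: "esize a \<le> b ?n" and ys: "esize (y # ys) \<le> r ?n" for bt w a y ys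
      proof -
        let ?s2 = "s(0 := enc a, k := enc x, k + 1 := enc ys, k + 2 := enc y)"
        let ?s3 = "s(0 := [], k := enc x, k + 1 := enc ys, k + 2 := enc (a, y))"
        let ?s4 = "s(0 := enc x, k := enc x, k + 1 := enc ys, k + 2 := enc (a, y))"
        let ?s5 = "s(0 := [], k := enc x, k + 1 := enc ys, k + 2 := enc (x, a, y))"
        let ?s6 = "s(0 := enc (x, a, y), k := enc x, k + 1 := enc ys)"
        have m: "esize (x, a, y) \<le> ?m ?n" using a ys by simp
        have y: "esize y \<le> r ?n" using ys by simp
        have "runs (Push (k + 1) bt) ((?st a (y # ys))(k + 1 := w)) (?st a (y # ys)) 1"
          by (rule runs_eq, rule runs_Push) (use k w in \<open>auto simp: fun_eq_iff\<close>)
        moreover have "runs (unpair_regs (k + 1) (k + 2) (k + 3)) (?st a (y # ys)) ?s2 (10 * r ?n + 8)"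
          by (rule runs_eq, rule runs_unpair_regs[where u = "enc y" and v = "enc ys"])
            (use k s y in \<open>auto simp: fun_eq_iff enc_Cons\<close>)
        moreover have "runs (pair_regs 0 (k + 2) (k + 3)) ?s2 ?s3 (10 * b ?n + 3)"
          by (rule runs_eq, rule runs_pair_regs) (use k s a in \<open>auto simp: fun_eq_iff enc_Pair\<close>)
        moreover have "runs (copy k 0 (k + 3)) ?s3 ?s4 (8 * ?n + 2)"
          by (rule runs_eq, rule runs_copy) (use k s in \<open>auto simp: fun_eq_iff\<close>)
        moreover have "runs (pair_regs 0 (k + 2) (k + 3)) ?s4 ?s5 (10 * ?n + 3)"
          by (rule runs_eq, rule runs_pair_regs) (use k s in \<open>auto simp: fun_eq_iff enc_Pair[of x]\<close>)
        moreover have "runs (move (k + 2) 0 (k + 3)) ?s5 ?s6 (8 * ?m ?n + 2)"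
          by (rule runs_eq, rule runs_move) (use k s m in \<open>auto simp: fun_eq_iff\<close>)
        moreover have "runs cg ?s6 (?st (g x a y) ys) (q (?m ?n))"
          by (rule runs_eq, rule computesD[OF cg, where x = "(x, a, y)"])
            (use k s monoD[OF q(2) m] in \<open>auto simp: fun_eq_iff\<close>)
        ultimately show ?thesis by (intro runs_Seq)
      qed
      have loop: "runs ?w (?st (foldl (g x) (f x) xs) ys) (?st (foldl (g x) (f x) (xs @ ys)) ([] :: 'b list)) ((?i ?n + 1) * length ys + 1)"
        if "l x = xs @ ys" for xs ys
        using that
      proof (induction ys arbitrary: xs)
        case Nil
        show ?case by (rule runs_eq, rule runs_WhileE) auto
      next
        case (Cons y ys)
        obtain bt w where w: "enc (y # ys) = bt # w"
          by (cases "enc (y # ys)") (auto simp: enc_Cons pair_word_def self_delim_def)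
        let ?a = "foldl (g x) (f x) xs"
        have a: "esize ?a \<le> b ?n" using bound Cons.prems by blast
        have y: "esize (y # ys) \<le> r ?n" using r(2)[of x] Cons.prems by simp
        have 1: "?st ?a (y # ys) (k + 1) = bt # w" using w by simp
        have 2: "runs (if bt then Seq (Push (k + 1) True) ?b else Seq (Push (k + 1) False) ?b)
          ((?st ?a (y # ys))(k + 1 := w)) (?st (g x ?a y) ys) (?i ?n)"
          using body[OF w a y] by (cases bt) auto
        have lx: "l x = (xs @ [y]) @ ys" using Cons.prems by simp
        have 3: "runs ?w (?st (g x ?a y) ys) (?st (foldl (g x) (f x) (xs @ y # ys)) ([] :: 'b list)) ((?i ?n + 1) * length ys + 1)"
          using Cons.IH[OF lx] by (simp only: foldl_append foldl_Cons foldl_Nil append_assoc append_Cons append_Nil)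
        show ?case by (rule runs_eq[OF runs_While[OF 1 2 3]]) (auto simp: algebra_simps)
      qed
      have len: "length (l x) \<le> r ?n" using length_le_esize[of "l x"] r(2)[of x] by simp
      have "runs (copy 0 k (k + 1)) s (s(k := enc x)) (8 * ?n + 2)"
        by (rule runs_eq, rule runs_copy) (use k s in \<open>auto simp: fun_eq_iff\<close>)
      moreover have "runs cl (s(k := enc x)) (s(0 := enc (l x), k := enc x)) (r ?n)"
        by (rule runs_eq, rule computesD[OF cl, where x = x]) (use k s in \<open>auto simp: fun_eq_iff\<close>)
      moreover have "runs (move 0 (k + 1) (k + 2)) (s(0 := enc (l x), k := enc x))
          (s(0 := [], k := enc x, k + 1 := enc (l x))) (8 * r ?n + 2)"
        by (rule runs_eq, rule runs_move) (use k s r(2)[of x] in \<open>auto simp: fun_eq_iff\<close>)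
      moreover have "runs (copy k 0 (k + 2)) (s(0 := [], k := enc x, k + 1 := enc (l x)))
          (s(0 := enc x, k := enc x, k + 1 := enc (l x))) (8 * ?n + 2)"
        by (rule runs_eq, rule runs_copy) (use k s in \<open>auto simp: fun_eq_iff\<close>)
      moreover have "runs cf (s(0 := enc x, k := enc x, k + 1 := enc (l x))) (?st (f x) (l x)) (p ?n)"
        by (rule runs_eq, rule computesD[OF cf, where x = x]) (use k s in \<open>auto simp: fun_eq_iff\<close>)
      moreover have "runs ?w (?st (f x) (l x)) (?st (foldl (g x) (f x) (l x)) ([] :: 'b list)) ((?i ?n + 1) * r ?n + 1)"
        by (rule runs_eq) (use loop[of "[]" "l x"] len in \<open>auto intro: mult_le_mono2\<close>)
      moreover have "runs (clear k) (?st (foldl (g x) (f x) (l x)) ([] :: 'b list)) (s(0 := enc (foldl (g x) (f x) (l x)))) (2 * ?n + 1)"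
        by (rule runs_eq, rule runs_clear) (use k s in \<open>auto simp: fun_eq_iff\<close>)
      ultimately show "runs ?c s (s(0 := enc (foldl (g x) (f x) (l x)))) (?p ?n)"
        by (intro runs_Seq)
    qed
  qed
qed

lemma pt_enc: "pt (enc :: 'a::enc \<Rightarrow> bool list)"
proof (rule ptI[of "\<lambda>n. 12 * n + 2"])
  fix k :: nat assume k: "k \<ge> 1"
  show "\<exists>c. computes k c (enc :: 'a \<Rightarrow> bool list) (\<lambda>n. 12 * n + 2)"
    by (intro exI[of _ "wrap_regs k"] computesI; rule runs_eq, rule runs_wrap_regs)
      (use k in \<open>auto simp: enc_word\<close>)
qed (intro polyb_intros)

theorem polytime_pt:
  assumes "pt (f :: bool list \<Rightarrow> bool list)"
  shows "polytime f"
proof -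
  obtain p where p: "polyb p" "mono p" "\<And>x. esize (f x) \<le> p (esize x)"
    "\<And>k. k \<ge> 1 \<Longrightarrow> \<exists>c. computes k c f p" using assms by (rule ptE) blast
  obtain c where c: "computes 1 c f p" using p(4)[of 1] by auto
  let ?t = "\<lambda>n. (12 * n + 2) + (p (3 * n) + (9 * p (3 * n) + 2))"
  have "polyb ?t" by (intro polyb_add polyb_mult polyb_const polyb_id polyb_comp[OF p(1)])
  then obtain a d where ad: "\<And>n. ?t n \<le> a * n ^ d + a" unfolding polyb_def by blast
  let ?c = "Seq (wrap_regs 1) (Seq c (unwrap_regs 1))"
  show ?thesis
  proof (rule polytime_exec[of a d ?c])
    fix w :: "bool list"
    let ?s = "(\<lambda>_. [])(0 := w)"
    have e: "length (f w) \<le> p (3 * length w)" using p(3)[of w] by simp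
    have "runs (wrap_regs 1) ?s ((\<lambda>_. [])(0 := enc w)) (12 * length w + 2)"
      by (rule runs_eq, rule runs_wrap_regs) (auto simp: enc_word)
    moreover have "runs c ((\<lambda>_. [])(0 := enc w)) ((\<lambda>_. [])(0 := enc (f w))) (p (3 * length w))"
      by (rule runs_eq, rule computesD[OF c, where x = w]) auto
    moreover have "runs (unwrap_regs 1) ((\<lambda>_. [])(0 := enc (f w))) ((\<lambda>_. [])(0 := f w)) (9 * p (3 * length w) + 2)"
      by (rule runs_eq, rule runs_unwrap_regs[where w = "f w"]) (use e in \<open>auto simp: enc_word\<close>)
    ultimately have "runs ?c ?s ((\<lambda>_. [])(0 := f w)) (?t (length w))"
      by (intro runs_Seq)
    moreover have "length (f w) \<le> ?t (length w)" using e by simp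
    ultimately show "\<exists>t s'. t \<le> a * length w ^ d + a \<and> exec ?c ?s t s' \<and> s' 0 = f w \<and>
      length (f w) \<le> a * length w ^ d + a"
      using ad[of "length w"] unfolding runs_def by (meson fun_upd_same le_trans)
  qed
qed

section \<open>Closure under Boolean and list operations\<close>

lemma pt_not: "pt P \<Longrightarrow> pt (\<lambda>x. \<not> P x)"
  by (rule back_subst[of pt "\<lambda>x. if P x then False else True"], intro pt_If pt_const) auto

lemma pt_conj: "pt P \<Longrightarrow> pt Q \<Longrightarrow> pt (\<lambda>x. P x \<and> Q x)"
  by (rule back_subst[of pt "\<lambda>x. if P x then Q x else False"], intro pt_If pt_const) auto

lemma pt_disj: "pt P \<Longrightarrow> pt Q \<Longrightarrow> pt (\<lambda>x. P x \<or> Q x)"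
  by (rule back_subst[of pt "\<lambda>x. if P x then True else Q x"], intro pt_If pt_const) auto

lemma pt_imp: "pt P \<Longrightarrow> pt Q \<Longrightarrow> pt (\<lambda>x. P x \<longrightarrow> Q x)"
  by (rule back_subst[of pt "\<lambda>x. if P x then Q x else True"], intro pt_If pt_const) auto

lemma pt_Cons: "pt f \<Longrightarrow> pt g \<Longrightarrow> pt (\<lambda>x. f x # g x)"
proof -
  assume "pt f" "pt g"
  then have "pt (\<lambda>x. (f x, g x))" by (rule pt_Pair)
  moreover have "enc (f x, g x) = enc (f x # g x)" for x
    by (simp add: enc_Cons enc_Pair)
  ultimately show ?thesis unfolding pt_def computes_def by simp
qed

fun hd0 :: "'a list list \<Rightarrow> 'a list" where
  "hd0 [] = []"
| "hd0 (x # xs) = x"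

lemma hd0_case: "hd0 l = (case l of [] \<Rightarrow> [] | y # ys \<Rightarrow> y)"
  by (cases l) auto

lemma tl_case: "tl l = (case l of [] \<Rightarrow> [] | y # ys \<Rightarrow> ys)"
  by (cases l) auto

lemma pt_hd0: "pt l \<Longrightarrow> pt (\<lambda>x. hd0 (l x))"
  unfolding hd0_case by (intro pt_case_list pt_const pt_fst pt_snd pt_id)

lemma pt_tl: "pt l \<Longrightarrow> pt (\<lambda>x. tl (l x))"
  unfolding tl_case by (intro pt_case_list pt_const pt_fst pt_snd pt_id)

lemma pt_null: "pt l \<Longrightarrow> pt (\<lambda>x. l x = [])"
proof -
  assume l: "pt l"
  have "pt (\<lambda>x. case l x of [] \<Rightarrow> True | y # ys \<Rightarrow> False)" by (intro pt_case_list pt_const l)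
  moreover have "(case l x of [] \<Rightarrow> True | y # ys \<Rightarrow> False) = (l x = [])" for x by (cases "l x") auto
  ultimately show ?thesis by simp
qed

lemma esize_le_mem: "y \<in> set ys \<Longrightarrow> esize y \<le> esize ys"
  by (induction ys) auto

text \<open>If a step enlarges the accumulator by an amount that does not depend on the accumulator,
  the amounts just add up over the list. Most folds below have this form.\<close>

lemma pt_foldl_additive:
  assumes f: "pt (f :: 'a::enc \<Rightarrow> 'c::enc)" and l: "pt (l :: 'a \<Rightarrow> 'b::enc list)"
    and g: "pt (\<lambda>z. g (fst z) (fst (snd z)) (snd (snd z)))"
    and p: "polyb p" "\<And>x a y. esize (g x a y) \<le> esize a + p (esize x + esize y)"
  shows "pt (\<lambda>x. foldl (g x) (f x) (l x))"
proof -
  from f obtain q where q: "polyb q" "\<And>x. esize (f x) \<le> q (esize x)" by (rule ptE) blast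
  from l obtain r where r: "polyb r" "\<And>x. esize (l x) \<le> r (esize x)" by (rule ptE) blast
  from p(1) obtain p' where p': "polyb p'" "mono p'" "\<And>n. p n \<le> p' n" by (rule polyb_mono_majorant) blast
  let ?b = "\<lambda>n. q n + r n * p' (n + r n)"
  show ?thesis
  proof (rule pt_foldl_bounded[where b = ?b])
    show "polyb ?b" by (intro polyb_add polyb_mult q r polyb_comp[OF p'(1)] polyb_id)
    fix x xs ys assume lx: "l x = xs @ ys"
    have sub: "esize y \<le> r (esize x)" if "y \<in> set xs" for y
      using esize_le_mem[of y "l x"] that r(2)[of x] lx by simp
    have "esize (foldl (g x) a xs) \<le> esize a + length xs * p' (esize x + r (esize x))" for a
      using sub
    proof (induction xs arbitrary: a)
      case (Cons y xs)
      have "esize (foldl (g x) (g x a y) xs) \<le> esize (g x a y) + length xs * p' (esize x + r (esize x))"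
        using Cons by simp
      also have "esize (g x a y) \<le> esize a + p' (esize x + esize y)"
        using p(2)[of x a y] p'(3) le_trans by (metis add_left_mono)
      also have "p' (esize x + esize y) \<le> p' (esize x + r (esize x))"
        using Cons.prems by (intro monoD[OF p'(2)]) simp
      finally show ?case by simp
    qed simp
    from this[of "f x"] have "esize (foldl (g x) (f x) xs) \<le> q (esize x) + length xs * p' (esize x + r (esize x))"
      using q(2)[of x] by linarith
    also have "\<dots> \<le> ?b (esize x)"
      using length_le_esize[of "l x"] r(2)[of x] lx by simp
    finally show "esize (foldl (g x) (f x) xs) \<le> ?b (esize x)" .
  qed (fact f l g)+
qed

lemma polyb_Suc: "polyb p \<Longrightarrow> polyb (\<lambda>n. Suc (p n))"
  using polyb_add[OF polyb_const[of 1], of p] by simp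

lemma pt_rev: "pt l \<Longrightarrow> pt (\<lambda>x. rev (l x))"
proof -
  assume l: "pt l"
  have "pt (\<lambda>x. foldl (\<lambda>a y. y # a) [] (l x))"
    by (rule pt_foldl_additive[where p = "\<lambda>n. 2 * n + 1"])
      (auto intro!: l pt_const pt_Cons pt_fst pt_snd pt_id polyb_intros polyb_Suc)
  moreover have "foldl (\<lambda>a y. y # a) ys xs = rev xs @ ys" for ys xs :: "'b list"
    by (induction xs arbitrary: ys) auto
  ultimately show ?thesis by simp
qed

lemma pt_append: "pt l \<Longrightarrow> pt m \<Longrightarrow> pt (\<lambda>x. l x @ m x)"
proof -
  assume l: "pt l" and m: "pt m"
  have "pt (\<lambda>x. foldl (\<lambda>a y. y # a) (m x) (rev (l x)))"
    by (rule pt_foldl_additive[where p = "\<lambda>n. 2 * n + 1"])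
      (auto intro!: l m pt_rev pt_const pt_Cons pt_fst pt_snd pt_id polyb_intros polyb_Suc)
  moreover have "foldl (\<lambda>a y. y # a) ys (rev xs) = xs @ ys" for ys xs :: "'b list"
    by (induction xs arbitrary: ys) auto
  ultimately show ?thesis by simp
qed

lemma pt_map:
  assumes f: "pt (\<lambda>z. f (fst z) (snd z))" and l: "pt (l :: 'a::enc \<Rightarrow> 'b::enc list)"
  shows "pt (\<lambda>x. map (f x) (l x))"
proof -
  from f obtain q where q: "polyb q" "mono q" "\<And>z. esize (f (fst z) (snd z)) \<le> q (esize z)" by (rule ptE) blast
  have "pt (\<lambda>x. foldl (\<lambda>a y. f x y # a) [] (rev (l x)))"
  proof (rule pt_foldl_additive[where p = "\<lambda>n. 2 * q (2 * n + 1) + 1"])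
    show "polyb (\<lambda>n. 2 * q (2 * n + 1) + 1)"
      by (intro polyb_add polyb_mult polyb_const polyb_id polyb_comp[OF q(1)])
    show "pt (\<lambda>z. f (fst z) (snd (snd z)) # fst (snd z))"
      by (intro pt_Cons pt_comp[OF f, of "\<lambda>z. (fst z, snd (snd z))", simplified] pt_Pair pt_fst pt_snd pt_id)
    fix x a y
    have "esize (f x y) \<le> q (2 * esize x + 1 + esize y)" using q(3)[of "(x, y)"] by simp
    also have "\<dots> \<le> q (2 * (esize x + esize y) + 1)" by (intro monoD[OF q(2)]) simp
    finally show "esize (f x y # a) \<le> esize a + (2 * q (2 * (esize x + esize y) + 1) + 1)" by simp
  qed (intro l pt_rev pt_const)+
  moreover have "foldl (\<lambda>a y. f x y # a) zs (rev ys) = map (f x) ys @ zs" for x ys zs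
    by (induction ys arbitrary: zs) auto
  ultimately show ?thesis by simp
qed

lemma pt_concat: "pt l \<Longrightarrow> pt (\<lambda>x. concat (l x))"
proof -
  assume l: "pt l"
  have "pt (\<lambda>x. foldl (\<lambda>a y. a @ y) [] (l x))"
    by (rule pt_foldl_additive[where p = "\<lambda>n. n"])
      (auto intro!: l pt_const pt_append pt_fst pt_snd pt_id polyb_intros polyb_Suc)
  moreover have "foldl (\<lambda>a y. a @ y) zs yss = zs @ concat yss" for zs :: "'b list" and yss
    by (induction yss arbitrary: zs) auto
  ultimately show ?thesis by simp
qed

lemma pt_Bex:
  assumes P: "pt (\<lambda>z. P (fst z) (snd z))" and l: "pt (l :: 'a::enc \<Rightarrow> 'b::enc list)"
  shows "pt (\<lambda>x. \<exists>y \<in> set (l x). P x y)"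
proof -
  have "pt (\<lambda>x. foldl (\<lambda>a y. a \<or> P x y) False (l x))"
  proof (rule pt_foldl_bounded[where b = "\<lambda>_. 1"])
    show "pt (\<lambda>z. fst (snd z) \<or> P (fst z) (snd (snd z)))"
      by (intro pt_disj pt_comp[OF P, of "\<lambda>z. (fst z, snd (snd z))", simplified] pt_Pair pt_fst pt_snd pt_id)
  qed (intro l pt_const polyb_const | simp)+
  moreover have "foldl (\<lambda>a y. a \<or> P x y) b ys \<longleftrightarrow> b \<or> (\<exists>y \<in> set ys. P x y)" for x b ys
    by (induction ys arbitrary: b) auto
  ultimately show ?thesis by simp
qed

lemma pt_Ball:
  assumes P: "pt (\<lambda>z. P (fst z) (snd z))" and l: "pt (l :: 'a::enc \<Rightarrow> 'b::enc list)"
  shows "pt (\<lambda>x. \<forall>y \<in> set (l x). P x y)"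
  using pt_not[OF pt_Bex[OF pt_not[OF P] l]] by simp

text \<open>The fold runs along one word and consumes the other, which is kept in the accumulator,
  so the accumulator never grows. The flag becomes false at the first difference.\<close>

lemma pt_word_eq:
  fixes f g :: "'a::enc \<Rightarrow> bool list"
  assumes f: "pt f" and g: "pt g"
  shows "pt (\<lambda>x. f x = g x)"
proof -
  define h :: "bool \<times> bool list \<Rightarrow> bool \<Rightarrow> bool \<times> bool list" where
    "h = (\<lambda>a b. case snd a of [] \<Rightarrow> (False, []) | y # ys \<Rightarrow> (fst a \<and> (if b then y else \<not> y), ys))"
  have "pt (\<lambda>x. foldl h (True, g x) (f x))"
  proof (rule pt_foldl_additive[where p = "\<lambda>_. 0"])
    show "pt (\<lambda>z :: 'a \<times> (bool \<times> bool list) \<times> bool. h (fst (snd z)) (snd (snd z)))"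
      unfolding h_def
      by (intro pt_case_list pt_const pt_Pair pt_conj pt_If pt_not pt_fst pt_snd pt_id)
    show "esize (h a y) \<le> esize a + 0" for x :: 'a and a y
      by (cases a; cases "snd a") (auto simp: h_def)
  qed (intro f g pt_Pair pt_const polyb_const)+
  then have "pt (\<lambda>x. fst (foldl h (True, g x) (f x)) \<and> snd (foldl h (True, g x) (f x)) = [])"
    by (intro pt_conj pt_fst pt_null pt_snd)
  moreover have F: "\<not> fst (foldl h (False, v) w)" for v w
    by (induction w arbitrary: v) (auto simp: h_def split: list.split)
  have "(fst (foldl h (True, v) w) \<and> snd (foldl h (True, v) w) = []) = (w = v)" for v w
  proof (induction w arbitrary: v)
    case (Cons b w)
    show ?case
    proof (cases v)
      case Nil
      then show ?thesis using F by (auto simp: h_def)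
    next
      case (Cons c v')
      then show ?thesis using F Cons.IH by (cases "b = c") (auto simp: h_def)
    qed
  qed auto
  ultimately show ?thesis by simp
qed

lemma enc_eq_iff: "enc x = enc y \<longleftrightarrow> x = y"
  by (auto dest: enc_inject)

text \<open>Since \<open>enc\<close> is injective and itself in \<open>pt\<close>, equality in any
  encoded type reduces to equality of words.\<close>

lemma pt_eq: "pt f \<Longrightarrow> pt g \<Longrightarrow> pt (\<lambda>x. f x = g x)"
  using pt_word_eq[OF pt_comp[OF pt_enc, of f] pt_comp[OF pt_enc, of g]]
  by (simp add: enc_eq_iff)

lemma pt_mem: "pt f \<Longrightarrow> pt l \<Longrightarrow> pt (\<lambda>x. f x \<in> set (l x))"
proof -
  assume f: "pt f" and l: "pt l"
  have "pt (\<lambda>z. f (fst z) = snd z)" by (intro pt_eq pt_comp[OF f] pt_fst pt_snd pt_id)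
  from pt_Bex[OF this l] show ?thesis by simp
qed

text \<open>\<open>justified P xs\<close>: every element of \<open>xs\<close> is related by \<open>P\<close> to the list of its predecessors.\<close>

definition justified :: "('a list \<Rightarrow> 'a \<Rightarrow> bool) \<Rightarrow> 'a list \<Rightarrow> bool" where
  "justified P xs = fst (foldl (\<lambda>a x. (fst a \<and> P (snd a) x, x # snd a)) (True, []) xs)"

lemma snd_foldl_justified:
  "snd (foldl (\<lambda>a x. (fst a \<and> P (snd a) x, x # snd a)) (b, ys) xs) = rev xs @ ys"
  by (induction xs arbitrary: b ys) auto

lemma justified_Nil [simp]: "justified P []"
  by (simp add: justified_def)

lemma justified_snoc [simp]: "justified P (xs @ [x]) \<longleftrightarrow> justified P xs \<and> P (rev xs) x"
  by (simp add: justified_def snd_foldl_justified)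

lemma pt_justified:
  assumes P: "pt (\<lambda>z. P (fst z) (fst (snd z)) (snd (snd z)))" and l: "pt (l :: 'a::enc \<Rightarrow> 'b::enc list)"
  shows "pt (\<lambda>x. justified (P x) (l x))"
  unfolding justified_def
proof (rule pt_fst, rule pt_foldl_additive[where p = "\<lambda>n. 2 * n + 1"])
  show "pt (\<lambda>z. (fst (fst (snd z)) \<and> P (fst z) (snd (fst (snd z))) (snd (snd z)), snd (snd z) # snd (fst (snd z))))"
    by (intro pt_Pair pt_conj pt_Cons pt_comp[OF P, of "\<lambda>z. (fst z, snd (fst (snd z)), snd (snd z))", simplified]
        pt_fst pt_snd pt_id)
qed (auto intro!: l pt_Pair pt_const polyb_intros polyb_Suc)

text \<open>A total inverse of \<open>concat \<circ> map self_delim\<close>; the flag records that a bit of the current word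
  comes next.\<close>

definition split_step :: "(bool \<times> bool list \<times> bool list list) \<Rightarrow> bool \<Rightarrow> bool \<times> bool list \<times> bool list list" where
  "split_step a b = (if fst a then (False, b # fst (snd a), snd (snd a))
    else if b then (True, snd a) else (False, [], rev (fst (snd a)) # snd (snd a)))"

definition split_words :: "bool list \<Rightarrow> bool list list" where
  "split_words w = rev (snd (snd (foldl split_step (False, [], []) w)))"

definition join_words :: "bool list list \<Rightarrow> bool list" where
  "join_words ws = concat (map self_delim ws)"

lemma split_join [simp]: "split_words (join_words ws) = ws"
proof -
  have 1: "foldl split_step (False, u, vs) (self_delim w) = (False, [], rev (rev w @ u) # vs)" for u vs w
    by (induction w arbitrary: u) (auto simp: self_delim_def split_step_def)
  have "foldl split_step (False, [], vs) (join_words ws) = (False, [], rev ws @ vs)" for vs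
    by (induction ws arbitrary: vs) (auto simp: join_words_def 1)
  then show ?thesis by (simp add: split_words_def)
qed

lemma pt_split_words: "pt f \<Longrightarrow> pt (\<lambda>x. split_words (f x))"
  unfolding split_words_def
proof (rule pt_rev, rule pt_snd, rule pt_snd, rule pt_foldl_additive[where p = "\<lambda>_. 10"])
  show "pt (\<lambda>z. split_step (fst (snd z)) (snd (snd z)))"
    unfolding split_step_def by (intro pt_If pt_Pair pt_Cons pt_rev pt_const pt_fst pt_snd pt_id)
  show "esize (split_step a y) \<le> esize a + 10" for x :: 'a and a y
    by (cases a) (auto simp: split_step_def)
qed (auto intro!: pt_Pair pt_const polyb_intros)

lemma pt_self_delim: "pt f \<Longrightarrow> pt (\<lambda>x. self_delim (f x))"
  unfolding self_delim_def
  by (intro pt_append pt_concat pt_map pt_Cons pt_const pt_snd pt_id)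

lemmas pt_intros = pt_id pt_const pt_fst pt_snd pt_Pair pt_If pt_not pt_conj pt_disj pt_imp pt_Cons
  pt_hd0 pt_tl pt_null pt_rev pt_append pt_map pt_concat pt_Bex pt_Ball pt_mem pt_eq
  pt_justified pt_split_words pt_self_delim

section \<open>Universal models\<close>

datatype subj = SC nat | SN concept

text \<open>\<open>FA (SC c) C\<close>: the constant \<open>c\<close> is in \<open>C\<close>; \<open>FA (SN B) C\<close>: \<open>B\<close> is subsumed by \<open>C\<close>;
  \<open>FN C\<close>: \<open>C\<close> is nonempty; \<open>FR r s\<close>: \<open>r\<close> is a subrole of \<open>s\<close>.\<close>

datatype fact = FA subj concept | FN concept | FR nat nat

fun subj_ok :: "database \<Rightarrow> subj \<Rightarrow> bool" where
  "subj_ok D (SC c) \<longleftrightarrow> c \<in> adom D"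
| "subj_ok D (SN C) \<longleftrightarrow> True"

text \<open>One step of a consequence calculus. The last rule for \<open>FA\<close> passes through
  an anonymous successor known only to be in \<open>B\<close>, which is why subsumptions are derived
  along with facts about constants. The guard \<open>subj_ok\<close> reflects that only constants of
  the database are certain to lie in the domain.\<close>

fun derives :: "ontology \<Rightarrow> database \<Rightarrow> fact set \<Rightarrow> fact \<Rightarrow> bool" where
  "derives Ont D F (FR r s) \<longleftrightarrow> r = s \<or> (\<exists>t. FR r t \<in> F \<and> RI t s \<in> set Ont)"
| "derives Ont D F (FN C) \<longleftrightarrow> C = Top \<or> (\<exists>c. FA (SC c) C \<in> F) \<or>
    (\<exists>B. FN B \<in> F \<and> FA (SN B) C \<in> F) \<or> (\<exists>r. FN (Ex r C) \<in> F)"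
| "derives Ont D F (FA X E) \<longleftrightarrow> X = SN E \<or> (E = Top \<and> subj_ok D X) \<or>
    (\<exists>A c. X = SC c \<and> E = Name A \<and> CAtom A c \<in> set D) \<or>
    (\<exists>B C. E = And B C \<and> FA X B \<in> F \<and> FA X C \<in> F) \<or>
    (\<exists>C. FA X (And E C) \<in> F \<or> FA X (And C E) \<in> F) \<or>
    (\<exists>C. FA X C \<in> F \<and> CI C E \<in> set Ont) \<or>
    (\<exists>c r c' s C. X = SC c \<and> E = Ex s C \<and> RAtom r c c' \<in> set D \<and> FR r s \<in> F \<and> FA (SC c') C \<in> F) \<or>
    (\<exists>r B s C. E = Ex s C \<and> FA X (Ex r B) \<in> F \<and> FA (SN B) C \<in> F \<and> FR r s \<in> F)"

fun holds :: "'d elem interp \<Rightarrow> fact \<Rightarrow> bool" where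
  "holds I (FR r s) \<longleftrightarrow> rext I r \<subseteq> rext I s"
| "holds I (FN C) \<longleftrightarrow> ext I C \<noteq> {}"
| "holds I (FA (SC c) C) \<longleftrightarrow> Const c \<in> ext I C"
| "holds I (FA (SN B) C) \<longleftrightarrow> ext I B \<subseteq> ext I C"

lemma ext_subset_domain: "wf_interp I \<Longrightarrow> ext I C \<subseteq> domain I"
  by (induction C) (auto simp: wf_interp_def)

lemma model_CAtom: "model Ont D I \<Longrightarrow> CAtom A c \<in> set D \<Longrightarrow> Const c \<in> cext I A"
  unfolding model_def by (metis atom.map(1) sat_atom.simps(1))

lemma model_RAtom: "model Ont D I \<Longrightarrow> RAtom r c c' \<in> set D \<Longrightarrow> (Const c, Const c') \<in> rext I r"
  unfolding model_def by (metis atom.map(2) sat_atom.simps(2))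

lemma model_adom: "model Ont D I \<Longrightarrow> c \<in> adom D \<Longrightarrow> Const c \<in> domain I"
proof -
  assume m: "model Ont D I" and "c \<in> adom D"
  then obtain a where a: "a \<in> set D" "c \<in> set_atom a" by (auto simp: adom_def)
  from m have wf: "cext I A \<subseteq> domain I" "rext I r \<subseteq> domain I \<times> domain I" for A r
    by (auto simp: model_def wf_interp_def)
  show ?thesis
  proof (cases a)
    case (CAtom A x)
    with a model_CAtom[OF m, of A x] wf(1)[of A] show ?thesis by auto
  next
    case (RAtom r x y)
    with a model_RAtom[OF m, of r x y] wf(2)[of r] show ?thesis by auto
  qed
qed

lemma derives_sound:
  assumes m: "model Ont D I" and F: "\<And>f. f \<in> F \<Longrightarrow> holds I f" and f: "derives Ont D F f"
  shows "holds I f"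
proof -
  from m have wf: "wf_interp I" by (simp add: model_def)
  have CI: "ext I C \<subseteq> ext I E" if "CI C E \<in> set Ont" for C E
    using m that unfolding model_def by (metis sat_inclusion.simps(1))
  have RI: "rext I r \<subseteq> rext I s" if "RI r s \<in> set Ont" for r s
    using m that unfolding model_def by (metis sat_inclusion.simps(2))
  show ?thesis
  proof (cases f)
    case (FR r s)
    with f F RI show ?thesis by (fastforce dest: F)
  next
    case (FN C)
    with f consider "C = Top" | c where "FA (SC c) C \<in> F" | B where "FN B \<in> F" "FA (SN B) C \<in> F"
      | r where "FN (Ex r C) \<in> F" by auto
    then show ?thesis using FN wf
      by cases (auto dest!: F simp: wf_interp_def)
  next
    case (FA X E)
    \<comment> \<open>With \<open>xs\<close> both kinds of subjects are treated alike:
      \<open>FA X C\<close> holds iff \<open>xs \<subseteq> ext I C\<close>.\<close>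
    define xs where "xs = (case X of SC c \<Rightarrow> {Const c} | SN C \<Rightarrow> ext I C)"
    have holds_FA: "holds I (FA X C) \<longleftrightarrow> xs \<subseteq> ext I C" for C
      by (cases X) (auto simp: xs_def)
    have dom: "xs \<subseteq> domain I" if "subj_ok D X"
      using that model_adom[OF m] ext_subset_domain[OF wf] by (cases X) (auto simp: xs_def)
    have pairs: "x \<in> domain I" if "(x, y) \<in> rext I r" for x y r
      using that wf by (auto simp: wf_interp_def)
    from f FA consider "X = SN E" | "E = Top" "subj_ok D X"
      | A c where "X = SC c" "E = Name A" "CAtom A c \<in> set D"
      | B C where "E = And B C" "FA X B \<in> F" "FA X C \<in> F"
      | C where "FA X (And E C) \<in> F" | C where "FA X (And C E) \<in> F"
      | C where "FA X C \<in> F" "CI C E \<in> set Ont"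
      | c r c' s C where "X = SC c" "E = Ex s C" "RAtom r c c' \<in> set D" "FR r s \<in> F" "FA (SC c') C \<in> F"
      | r B s C where "E = Ex s C" "FA X (Ex r B) \<in> F" "FA (SN B) C \<in> F" "FR r s \<in> F"
      by auto
    then have "xs \<subseteq> ext I E"
    proof cases
      case 1
      then show ?thesis by (simp add: xs_def)
    next
      case 3
      then show ?thesis using model_CAtom[OF m] by (simp add: xs_def)
    next
      case (7 C)
      then show ?thesis using CI F holds_FA by blast
    next
      case (8 c r c' s C)
      from F[OF 8(4)] F[OF 8(5)] model_RAtom[OF m 8(3)] show ?thesis
        using 8 pairs by (auto simp: xs_def)
    next
      case (9 r B s C)
      from F[OF 9(2)] F[OF 9(3)] F[OF 9(4)] have
        "xs \<subseteq> ext I (Ex r B)" "ext I B \<subseteq> ext I C" "rext I r \<subseteq> rext I s"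
        by (simp_all add: holds_FA)
      then show ?thesis unfolding 9(1) by fastforce
    qed (use dom F[unfolded holds_FA] holds_FA F in \<open>auto dest!: F simp: holds_FA\<close>)
    then show ?thesis using FA holds_FA by simp
  qed
qed

lemma justified_derives_sound:
  assumes "model Ont D I" "justified (\<lambda>F. derives Ont D (set F)) fs"
  shows "f \<in> set fs \<Longrightarrow> holds I f"
  using assms(2)
proof (induction fs arbitrary: f rule: rev_induct)
  case (snoc g fs)
  then have "\<And>h. h \<in> set (rev fs) \<Longrightarrow> holds I h" by auto
  with snoc.prems derives_sound[OF assms(1), of "set (rev fs)"] show ?case by auto
qed simp

text \<open>A longest duplicate-free justified list within \<open>U\<close> is saturated, as
  otherwise it could be extended. Its order is a derivation of its facts, as needed for a
  certificate.\<close>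

lemma justified_saturated:
  assumes "finite U"
  obtains fs where "justified (\<lambda>F. P (set F)) fs" "distinct fs" "set fs \<subseteq> U"
    "\<And>f. f \<in> U \<Longrightarrow> P (set fs) f \<Longrightarrow> f \<in> set fs"
proof -
  let ?Q = "\<lambda>fs. justified (\<lambda>F. P (set F)) fs \<and> distinct fs \<and> set fs \<subseteq> U"
  have "length fs < Suc (card U)" if "?Q fs" for fs
    using that assms by (metis card_mono distinct_card le_imp_less_Suc)
  then obtain fs where fs: "?Q fs" "\<And>gs. ?Q gs \<Longrightarrow> length gs \<le> length fs"
    using ex_has_greatest_nat[of ?Q "[]" length "Suc (card U)"] by auto
  show thesis
  proof (rule that)
    fix f assume f: "f \<in> U" "P (set fs) f"
    show "f \<in> set fs"
    proof (rule ccontr)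
      assume "f \<notin> set fs"
      with f fs(1) have "?Q (fs @ [f])" by auto
      from fs(2)[OF this] show False by simp
    qed
  qed (use fs in auto)
qed

text \<open>The universal model of a saturated set of facts: nodes are paths (most recent edge first) that
  start from a constant or from a nonempty concept.\<close>

type_synonym node = "subj \<times> (nat \<times> concept) list"

fun node_subj :: "node \<Rightarrow> subj" where
  "node_subj (X, []) = X"
| "node_subj (X, (r, C) # p) = SN C"

inductive_set nodes :: "database \<Rightarrow> fact set \<Rightarrow> node set" for D F where
  const: "c \<in> adom D \<Longrightarrow> (SC c, []) \<in> nodes D F"
| root: "FN C \<in> F \<Longrightarrow> (SN C, []) \<in> nodes D F"
| child: "n = (X, p) \<Longrightarrow> n \<in> nodes D F \<Longrightarrow> FA (node_subj n) (Ex r C) \<in> F \<Longrightarrow> (X, (r, C) # p) \<in> nodes D F"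

definition edge :: "database \<Rightarrow> fact set \<Rightarrow> nat \<Rightarrow> node \<Rightarrow> node \<Rightarrow> bool" where
  "edge D F s n n' \<longleftrightarrow>
    (\<exists>r c c'. n = (SC c, []) \<and> n' = (SC c', []) \<and> RAtom r c c' \<in> set D \<and> FR r s \<in> F) \<or>
    (\<exists>r C. n' = (fst n, (r, C) # snd n) \<and> FR r s \<in> F)"

definition canonical :: "database \<Rightarrow> fact set \<Rightarrow> node interp" where
  "canonical D F = \<lparr>domain = nodes D F,
    cext = \<lambda>A. {n \<in> nodes D F. FA (node_subj n) (Name A) \<in> F},
    rext = \<lambda>s. {(n, n'). n \<in> nodes D F \<and> n' \<in> nodes D F \<and> edge D F s n n'}\<rparr>"

text \<open>\<open>S\<close> and \<open>Rs\<close> are the concepts and roles under consideration.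
  Closure is demanded only for facts over them, so that \<open>F\<close> can be finite although the
  rules alone would yield infinitely many facts.\<close>

locale saturated =
  fixes Ont :: ontology and D :: database and S :: "concept set" and Rs :: "nat set" and F :: "fact set"
  assumes S_Top: "Top \<in> S"
    and S_And: "And B C \<in> S \<Longrightarrow> B \<in> S \<and> C \<in> S"
    and S_Ex: "Ex r C \<in> S \<Longrightarrow> r \<in> Rs \<and> C \<in> S"
    and S_CI: "CI B C \<in> set Ont \<Longrightarrow> B \<in> S \<and> C \<in> S"
    and S_RI: "RI r s \<in> set Ont \<Longrightarrow> r \<in> Rs \<and> s \<in> Rs"
    and S_CAtom: "CAtom A c \<in> set D \<Longrightarrow> Name A \<in> S"
    and S_RAtom: "RAtom r c c' \<in> set D \<Longrightarrow> r \<in> Rs"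
    and F_FA: "FA X C \<in> F \<Longrightarrow> X \<in> SC ` adom D \<union> SN ` S \<and> C \<in> S"
    and F_FN: "FN C \<in> F \<Longrightarrow> C \<in> S"
    and F_FR: "FR r s \<in> F \<Longrightarrow> r \<in> Rs \<and> s \<in> Rs"
    and closed_FA: "X \<in> SC ` adom D \<union> SN ` S \<Longrightarrow> C \<in> S \<Longrightarrow> derives Ont D F (FA X C) \<Longrightarrow> FA X C \<in> F"
    and closed_FN: "C \<in> S \<Longrightarrow> derives Ont D F (FN C) \<Longrightarrow> FN C \<in> F"
    and closed_FR: "r \<in> Rs \<Longrightarrow> s \<in> Rs \<Longrightarrow> derives Ont D F (FR r s) \<Longrightarrow> FR r s \<in> F"
begin

lemma node_subj: "n \<in> nodes D F \<Longrightarrow> node_subj n \<in> SC ` adom D \<union> SN ` S"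
  by (induction rule: nodes.induct) (auto dest!: F_FN F_FA S_Ex)

lemma node_childD: "(X, (r, C) # p) \<in> nodes D F \<Longrightarrow> FA (node_subj (X, p)) (Ex r C) \<in> F"
  by (erule nodes.cases) auto

text \<open>A child witnesses an existential concept of its parent, so its own concept is nonempty
  by the rules for \<open>FN\<close>. This allows a certificate to introduce any anonymous node as a
  root.\<close>

lemma FN_node: "n \<in> nodes D F \<Longrightarrow> node_subj n = SN C \<Longrightarrow> FN C \<in> F"
proof (induction arbitrary: C rule: nodes.induct)
  case (child n X p r B)
  from child.prems have C: "C = B" by simp
  have S: "Ex r B \<in> S" "B \<in> S" using S_Ex[of r B] F_FA[OF child.hyps(3)] by auto
  have "FN (Ex r B) \<in> F"
  proof (cases "node_subj n")
    case (SC c)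
    with child.hyps(3) show ?thesis by (intro closed_FN S) auto
  next
    case (SN B')
    with child.hyps(3) child.IH[OF SN] show ?thesis by (intro closed_FN S) auto
  qed
  then show ?case unfolding C by (intro closed_FN S) auto
qed auto

lemma FR_refl: "r \<in> Rs \<Longrightarrow> FR r r \<in> F"
  by (rule closed_FR) auto

text \<open>The two kinds of edges correspond to the last two rules for \<open>FA\<close>. The
  conclusion is restricted to \<open>S\<close> because \<open>F\<close> contains no facts about
  other concepts.\<close>

lemma ext_canonicalD: "n \<in> ext (canonical D F) E \<Longrightarrow> E \<in> S \<Longrightarrow> FA (node_subj n) E \<in> F"
proof (induction E arbitrary: n)
  case Top
  then have "n \<in> nodes D F" by (simp add: canonical_def)
  from node_subj[OF this] show ?case by (intro closed_FA S_Top) auto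
next
  case (Name A)
  then show ?case by (simp add: canonical_def)
next
  case (And B C)
  then have "FA (node_subj n) B \<in> F" "FA (node_subj n) C \<in> F"
    using And.IH And.prems(1) S_And[OF And.prems(2)] by simp_all
  moreover from F_FA[OF this(1)] have "node_subj n \<in> SC ` adom D \<union> SN ` S" ..
  ultimately show ?case using And.prems(2) by (intro closed_FA) auto
next
  case (Ex s C)
  then obtain n' where n: "n \<in> nodes D F" "n' \<in> nodes D F" "edge D F s n n'" "n' \<in> ext (canonical D F) C"
    by (auto simp: canonical_def)
  have C: "FA (node_subj n') C \<in> F" using Ex n(4) S_Ex by blast
  from n(3) show ?case unfolding edge_def
  proof (elim disjE exE conjE)
    fix r c c' assume "n = (SC c, [])" "n' = (SC c', [])" "RAtom r c c' \<in> set D" "FR r s \<in> F"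
    with C Ex.prems(2) node_subj[OF n(1)] show ?thesis by (intro closed_FA) auto
  next
    fix r B assume *: "n' = (fst n, (r, B) # snd n)" "FR r s \<in> F"
    with node_childD[of "fst n" r B "snd n"] n(2) have "FA (node_subj n) (Ex r B) \<in> F" by simp
    with * C Ex.prems(2) node_subj[OF n(1)] show ?thesis by (intro closed_FA) auto
  qed
qed

lemma ext_canonicalI: "FA (node_subj n) E \<in> F \<Longrightarrow> n \<in> nodes D F \<Longrightarrow> n \<in> ext (canonical D F) E"
proof (induction E arbitrary: n)
  case (And B C)
  have S: "B \<in> S" "C \<in> S" using S_And[of B C] F_FA[OF And.prems(1)] by auto
  have "FA (node_subj n) B \<in> F" "FA (node_subj n) C \<in> F"
    using And.prems(1) unfolding atomize_conj
    by (intro conjI closed_FA[OF node_subj[OF And.prems(2)]] S; unfold derives.simps; blast)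
  then show ?case using And.IH And.prems(2) by simp
next
  case (Ex r C)
  have S: "r \<in> Rs" "C \<in> S" using S_Ex[of r C] F_FA[OF Ex.prems(1)] by auto
  obtain X p where n: "n = (X, p)" by (cases n)
  let ?n = "(X, (r, C) # p)"
  have n': "?n \<in> nodes D F" using Ex.prems by (auto intro: nodes.child[OF n])
  have "FA (node_subj ?n) C \<in> F" using S by (intro closed_FA) auto
  from Ex.IH[OF this n'] have "?n \<in> ext (canonical D F) C" .
  moreover have "edge D F r n ?n" unfolding edge_def n using FR_refl[OF S(1)] by auto
  ultimately show ?case using Ex.prems(2) n' by (auto simp: canonical_def)
qed (auto simp: canonical_def)

lemma wf_canonical: "wf_interp (canonical D F)"
proof -
  have "FN Top \<in> F" by (rule closed_FN) (auto intro: S_Top)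
  then show ?thesis by (auto simp: wf_interp_def canonical_def dest: nodes.root)
qed

lemma canonical_inclusion: "a \<in> set Ont \<Longrightarrow> sat_inclusion (canonical D F) a"
proof (cases a)
  case (CI B C)
  assume a: "a \<in> set Ont"
  with CI have S: "B \<in> S" "C \<in> S" using S_CI[of B C] by auto
  show ?thesis
  proof (simp add: CI, rule)
    fix n assume n: "n \<in> ext (canonical D F) B"
    then have dom: "n \<in> nodes D F" using ext_subset_domain[OF wf_canonical] by (auto simp: canonical_def)
    have "FA (node_subj n) C \<in> F"
      using ext_canonicalD[OF n S(1)] a CI node_subj[OF dom] by (intro closed_FA S) auto
    then show "n \<in> ext (canonical D F) C" using dom by (rule ext_canonicalI)
  qed
next
  case (RI r s)
  assume a: "a \<in> set Ont"
  have "FR t s \<in> F" if "FR t r \<in> F" for t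
    using that F_FR[OF that] a RI S_RI[of r s] by (intro closed_FR) auto
  then show ?thesis by (auto simp: RI canonical_def edge_def)
qed

lemma canonical_CAtom: "CAtom A c \<in> set D \<Longrightarrow> (SC c, []) \<in> cext (canonical D F) A"
proof -
  assume a: "CAtom A c \<in> set D"
  then have c: "c \<in> adom D" by (force simp: adom_def)
  then have "FA (SC c) (Name A) \<in> F" using a S_CAtom by (intro closed_FA) auto
  with c show ?thesis by (simp add: canonical_def nodes.const)
qed

lemma canonical_RAtom: "RAtom r c c' \<in> set D \<Longrightarrow> ((SC c, []), (SC c', [])) \<in> rext (canonical D F) r"
proof -
  assume a: "RAtom r c c' \<in> set D"
  then have c: "c \<in> adom D" "c' \<in> adom D" by (force simp: adom_def)+
  from a FR_refl S_RAtom have "FR r r \<in> F" by blast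
  with a c show ?thesis by (auto simp: canonical_def nodes.const edge_def)
qed

end

section \<open>Transfer of the universal model to the given element type\<close>

instance concept :: countable by countable_datatype
instance subj :: countable by countable_datatype

definition map_interp :: "('a \<Rightarrow> 'b) \<Rightarrow> 'a interp \<Rightarrow> 'b interp" where
  "map_interp f I = \<lparr>domain = f ` domain I, cext = \<lambda>A. f ` cext I A, rext = \<lambda>r. map_prod f f ` rext I r\<rparr>"

lemma wf_map_interp: "wf_interp I \<Longrightarrow> wf_interp (map_interp f I)"
  by (fastforce simp: wf_interp_def map_interp_def)

lemma ext_map_interp:
  assumes "wf_interp I" "inj f"
  shows "ext (map_interp f I) C = f ` ext I C"
proof (induction C)
  case (And B C)
  then show ?case by (simp add: image_Int[OF assms(2)])
next
  case (Ex r C)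
  have mp: "(f x, f y) \<in> map_prod f f ` rext I r \<longleftrightarrow> (x, y) \<in> rext I r" for x y
    using assms(2) by (auto simp: inj_def)
  have "ext (map_interp f I) (Ex r C) =
    {d \<in> f ` domain I. \<exists>e \<in> f ` ext I C. (d, e) \<in> map_prod f f ` rext I r}"
    unfolding ext.simps Ex.IH by (simp add: map_interp_def)
  also have "\<dots> = f ` ext I (Ex r C)" by (auto simp: inj_eq[OF assms(2)] mp intro!: imageI)
  finally show ?case .
qed (simp_all add: map_interp_def)

lemma sat_inclusion_map_interp:
  assumes "wf_interp I" "inj f" "sat_inclusion I a"
  shows "sat_inclusion (map_interp f I) a"
proof (cases a)
  case (CI B C)
  with assms show ?thesis by (simp add: ext_map_interp image_mono)
next
  case (RI r s)
  with assms show ?thesis by (auto simp: map_interp_def)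
qed

lemma query_hom_map_interp:
  assumes "inj f" "query_hom h q (map_interp f I)"
  obtains h' where "query_hom h' q I" "\<And>x. x \<in> qvars q \<Longrightarrow> h x = f (h' x)"
proof -
  let ?h = "\<lambda>x. inv f (h x)"
  have h: "h x = f (?h x)" "?h x \<in> domain I" if "x \<in> qvars q" for x
    using assms that by (auto simp: query_hom_def map_interp_def image_subset_iff image_iff)
  have "sat_atom I (map_atom ?h a)" if a: "a \<in> set (body q)" for a
  proof -
    have "sat_atom (map_interp f I) (map_atom h a)" using assms(2) a by (simp add: query_hom_def)
    then show ?thesis using assms(1) by (cases a) (auto simp: map_interp_def)
  qed
  with h that[of ?h] show thesis by (auto simp: query_hom_def)
qed

text \<open>The type \<open>'d\<close> may be finite, so nodes other than constants of the database
  are placed on constants above all those that occur. Standard names permit this, since such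
  constants are not mentioned by the database. Treating constants outside \<open>adom D\<close> in
  the same way makes the map injective on the whole type of nodes.\<close>

definition node_elem :: "database \<Rightarrow> node \<Rightarrow> 'd elem" where
  "node_elem D n = (case n of (SC c, []) \<Rightarrow> (if c \<in> adom D then Const c else Const (Suc (Max (insert 0 (adom D))) + to_nat n))
    | _ \<Rightarrow> Const (Suc (Max (insert 0 (adom D))) + to_nat n))"

lemma finite_adom: "finite (adom D)"
proof -
  have "finite (set_atom a)" for a :: "nat atom" by (cases a) auto
  then show ?thesis by (simp add: adom_def)
qed

lemma node_elem_const: "c \<in> adom D \<Longrightarrow> node_elem D (SC c, []) = Const c"
  by (simp add: node_elem_def)

lemma node_elem_cases:
  "(\<exists>c \<in> adom D. n = (SC c, []) \<and> (node_elem D n :: 'a elem) = Const c) \<or>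
   (node_elem D n :: 'a elem) = Const (Suc (Max (insert 0 (adom D))) + to_nat n)"
  by (cases n; cases "fst n"; cases "snd n") (auto simp: node_elem_def)

lemma inj_node_elem: "inj (node_elem D :: node \<Rightarrow> 'a elem)"
proof (rule injI)
  have le: "c \<noteq> Suc (Max (insert 0 (adom D)) + k)" "Suc (Max (insert 0 (adom D)) + k) \<noteq> c"
    if "c \<in> adom D" for c k
  proof -
    have "c \<le> Max (insert 0 (adom D))" using that finite_adom[of D] by (intro Max_ge) auto
    then show "c \<noteq> Suc (Max (insert 0 (adom D)) + k)" "Suc (Max (insert 0 (adom D)) + k) \<noteq> c" by simp_all
  qed
  fix m n assume "(node_elem D m :: 'a elem) = node_elem D n"
  then show "m = n"
    using node_elem_cases[of D m, where ?'a = 'a] node_elem_cases[of D n, where ?'a = 'a]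
    by (elim disjE bexE conjE) (auto simp: le)
qed

lemma (in saturated) model_canonical: "model Ont D (map_interp (node_elem D :: node \<Rightarrow> 'd elem) (canonical D F))"
proof -
  let ?g = "node_elem D :: node \<Rightarrow> 'd elem"
  have "sat_atom (map_interp ?g (canonical D F)) (map_atom Const a)" if a: "a \<in> set D" for a
  proof (cases a)
    case (CAtom A c)
    with a have "c \<in> adom D" by (force simp: adom_def)
    then have "?g (SC c, []) = Const c" by (rule node_elem_const)
    with imageI[OF canonical_CAtom[of A c], of "?g"] a CAtom show ?thesis
      by (simp add: map_interp_def)
  next
    case (RAtom r c c')
    with a have "c \<in> adom D" "c' \<in> adom D" by (force simp: adom_def)+
    then have "?g (SC c, []) = Const c" "?g (SC c', []) = Const c'"
      by (auto intro: node_elem_const)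
    with imageI[OF canonical_RAtom[of r c c'], of "map_prod ?g ?g"] a RAtom
    show ?thesis by (simp add: map_interp_def)
  qed
  then show ?thesis
    using wf_canonical canonical_inclusion
    by (auto simp: model_def intro!: wf_map_interp sat_inclusion_map_interp inj_node_elem)
qed

section \<open>Query matches and their certificates\<close>

lemma justified_iff: "justified P xs \<longleftrightarrow> (\<forall>i < length xs. P (rev (take i xs)) (xs ! i))"
proof (induction xs rule: rev_induct)
  case (snoc x xs)
  have "(\<forall>i < length (xs @ [x]). P (rev (take i (xs @ [x]))) ((xs @ [x]) ! i)) \<longleftrightarrow>
    (\<forall>i < length xs. P (rev (take i xs)) (xs ! i)) \<and> P (rev xs) x"
    by (auto simp: less_Suc_eq nth_append)
  with snoc show ?case by simp
qed simp

text \<open>Certificates for matches of a query in the universal model: a list of nodes, named by numbers,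
  and an assignment of node names to the variables.  A child node refers to its parent.\<close>

datatype entry = EConst nat | ERoot concept | EChild nat nat concept

fun entry_subj :: "entry \<Rightarrow> subj" where
  "entry_subj (EConst c) = SC c"
| "entry_subj (ERoot C) = SN C"
| "entry_subj (EChild p r C) = SN C"

fun entry_ok :: "database \<Rightarrow> fact set \<Rightarrow> (nat \<times> entry) set \<Rightarrow> entry \<Rightarrow> bool" where
  "entry_ok D F N (EConst c) \<longleftrightarrow> c \<in> adom D"
| "entry_ok D F N (ERoot C) \<longleftrightarrow> FN C \<in> F"
| "entry_ok D F N (EChild p r C) \<longleftrightarrow> (\<exists>e. (p, e) \<in> N \<and> FA (entry_subj e) (Ex r C) \<in> F)"

definition entry_derives :: "database \<Rightarrow> fact set \<Rightarrow> (nat \<times> entry) list \<Rightarrow> nat \<times> entry \<Rightarrow> bool" where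
  "entry_derives D F N ne \<longleftrightarrow> fst ne \<notin> fst ` set N \<and> entry_ok D F (set N) (snd ne)"

fun atom_match :: "database \<Rightarrow> fact set \<Rightarrow> (nat \<times> entry) set \<Rightarrow> (nat \<times> nat) set \<Rightarrow> nat atom \<Rightarrow> bool" where
  "atom_match D F N M (CAtom A x) \<longleftrightarrow> (\<exists>n e. (x, n) \<in> M \<and> (n, e) \<in> N \<and> FA (entry_subj e) (Name A) \<in> F)"
| "atom_match D F N M (RAtom s x y) \<longleftrightarrow> (\<exists>n e m e'. (x, n) \<in> M \<and> (y, m) \<in> M \<and> (n, e) \<in> N \<and> (m, e') \<in> N \<and>
    ((\<exists>c c' r. e = EConst c \<and> e' = EConst c' \<and> RAtom r c c' \<in> set D \<and> FR r s \<in> F) \<or>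
     (\<exists>r C. e' = EChild n r C \<and> FR r s \<in> F)))"

definition query_match :: "database \<Rightarrow> fact set \<Rightarrow> (nat \<times> entry) set \<Rightarrow> (nat \<times> nat) set \<Rightarrow> cq \<Rightarrow> bool" where
  "query_match D F N M q \<longleftrightarrow>
    (\<forall>x n. (x, n) \<in> M \<longrightarrow> n \<in> fst ` N \<and> (\<forall>m. (x, m) \<in> M \<longrightarrow> n = m)) \<and>
    set (ans q) \<subseteq> fst ` M \<and> (\<forall>a \<in> set (body q). atom_match D F N M a)"

text \<open>Both kinds of candidate tuples: \<open>cv\<close> extracts the constant from a tuple entry, and \<open>mu\<close> tells
  whether equal wildcards must be filled equally.\<close>

definition tuple_match :: "('w \<Rightarrow> nat option) \<Rightarrow> bool \<Rightarrow> (nat \<times> 'w) set \<Rightarrow> (nat \<times> entry) set \<Rightarrow> (nat \<times> nat) set \<Rightarrow> bool" where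
  "tuple_match cv mu Z N M \<longleftrightarrow>
    (\<forall>(x, v) \<in> Z. \<forall>k. cv v = Some k \<longrightarrow> (\<exists>n. (x, n) \<in> M \<and> (n, EConst k) \<in> N)) \<and>
    (mu \<longrightarrow> (\<forall>(x, v) \<in> Z. \<forall>(x', v') \<in> Z. v = v' \<longrightarrow> (\<exists>n. (x, n) \<in> M \<and> (x', n) \<in> M)))"

definition tuple_fits :: "('w \<Rightarrow> nat option) \<Rightarrow> bool \<Rightarrow> (nat \<times> 'w) set \<Rightarrow> (nat \<Rightarrow> 'd elem) \<Rightarrow> bool" where
  "tuple_fits cv mu Z h \<longleftrightarrow>
    (\<forall>(x, v) \<in> Z. \<forall>k. cv v = Some k \<longrightarrow> h x = Const k) \<and>
    (mu \<longrightarrow> (\<forall>(x, v) \<in> Z. \<forall>(x', v') \<in> Z. v = v' \<longrightarrow> h x = h x'))"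

definition entry_holds :: "'d elem interp \<Rightarrow> (nat \<Rightarrow> 'd elem) \<Rightarrow> nat \<times> entry \<Rightarrow> bool" where
  "entry_holds I g ne \<longleftrightarrow> g (fst ne) \<in> domain I \<and> (case snd ne of
     EConst c \<Rightarrow> g (fst ne) = Const c
   | ERoot C \<Rightarrow> g (fst ne) \<in> ext I C
   | EChild p r C \<Rightarrow> g (fst ne) \<in> ext I C \<and> (g p, g (fst ne)) \<in> rext I r)"

lemma entry_holds_FA:
  assumes "entry_holds I g (n, e)" "holds I (FA (entry_subj e) C)"
  shows "g n \<in> ext I C"
  using assms by (cases e) (auto simp: entry_holds_def)

text \<open>Derived facts hold in every model, so elements can be chosen entry by entry: the witness
  comes from a nonempty concept or from an existential concept of the parent. This takes the place
  of a homomorphism from the whole universal model.\<close>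

lemma entries_sound:
  assumes m: "model Ont D I" and F: "\<And>f. f \<in> F \<Longrightarrow> holds I f"
    and j: "justified (entry_derives D F) ns"
  shows "\<exists>g. \<forall>ne \<in> set ns. entry_holds I g ne"
  using j
proof (induction ns rule: rev_induct)
  case (snoc ne ns)
  then obtain g where g: "\<forall>ne \<in> set ns. entry_holds I g ne" by auto
  obtain n e where ne: "ne = (n, e)" by (cases ne)
  from m have wf: "wf_interp I" by (simp add: model_def)
  from snoc.prems have new: "n \<notin> fst ` set ns" and ok: "entry_ok D F (set ns) e"
    by (auto simp: entry_derives_def ne)
  have "\<exists>d. entry_holds I (g(n := d)) (n, e)"
  proof (cases e)
    case (EConst c)
    with ok model_adom[OF m] show ?thesis by (auto simp: entry_holds_def)
  next
    case (ERoot C)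
    with ok F[of "FN C"] obtain d where d: "d \<in> ext I C" by auto
    with ext_subset_domain[OF wf] have "d \<in> domain I" by blast
    with d ERoot show ?thesis by (auto simp: entry_holds_def)
  next
    case (EChild p r C)
    with ok obtain e' where e': "(p, e') \<in> set ns" "FA (entry_subj e') (Ex r C) \<in> F" by auto
    then have "g p \<in> ext I (Ex r C)" using g F by (intro entry_holds_FA[of I g p e']) auto
    then obtain d where d: "d \<in> ext I C" "(g p, d) \<in> rext I r" by auto
    with ext_subset_domain[OF wf] have "d \<in> domain I" by blast
    moreover have "p \<noteq> n" using e'(1) new by force
    ultimately show ?thesis using d EChild by (auto simp: entry_holds_def)
  qed
  then obtain d where d: "entry_holds I (g(n := d)) (n, e)" by blast
  \<comment> \<open>No earlier entry refers to the new name as its parent, because a parent must be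
    listed before its child. Changing \<open>g\<close> at \<open>n\<close> thus leaves the earlier
    entries valid.\<close>
  have par: "p \<noteq> n" if "(m, EChild p r C) \<in> set ns" for m p r C
  proof -
    from that obtain i where i: "i < length ns" "ns ! i = (m, EChild p r C)" by (auto simp: in_set_conv_nth)
    have "justified (entry_derives D F) ns" using snoc.prems by simp
    with i have "entry_derives D F (rev (take i ns)) (m, EChild p r C)"
      unfolding justified_iff by metis
    then obtain e' where "(p, e') \<in> set ns" by (auto simp: entry_derives_def dest: in_set_takeD)
    with new show ?thesis by force
  qed
  have "entry_holds I (g(n := d)) ne'" if "ne' \<in> set ns" for ne'
  proof -
    have "fst ne' \<noteq> n" using that new by force
    with g[rule_format, OF that] par[of "fst ne'"] that show ?thesis
      by (cases ne') (auto simp: entry_holds_def split: entry.splits)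
  qed
  with d ne show ?case by (intro exI[of _ "g(n := d)"]) (auto simp del: fun_upd_apply)
qed simp

lemma match_sound:
  assumes m: "model Ont D (I :: 'd elem interp)"
    and fs: "justified (\<lambda>F. derives Ont D (set F)) fs"
    and ns: "justified (entry_derives D (set fs)) ns"
    and q: "query_match D (set fs) (set ns) M q" and t: "tuple_match cv mu Z (set ns) M"
  shows "\<exists>h. query_hom h q I \<and> tuple_fits cv mu Z h"
proof -
  have F: "holds I f" if "f \<in> set fs" for f using justified_derives_sound[OF m fs that] .
  from entries_sound[OF m F ns] obtain g where g: "\<And>ne. ne \<in> set ns \<Longrightarrow> entry_holds I g ne" by blast
  \<comment> \<open>\<open>query_match\<close> makes \<open>M\<close> functional, so the choice is
    unique where it is used.\<close>
  define h where "h = (\<lambda>x. g (SOME n. (x, n) \<in> M))"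
  have hM: "h x = g n" if "(x, n) \<in> M" for x n
  proof -
    have "(x, SOME n. (x, n) \<in> M) \<in> M" using that by (rule someI)
    with that q have "(SOME n. (x, n) \<in> M) = n" unfolding query_match_def by blast
    then show ?thesis by (simp add: h_def)
  qed
  have dom: "h x \<in> domain I" if "(x, n) \<in> M" for x n
  proof -
    have "n \<in> fst ` set ns" using that q unfolding query_match_def by blast
    then obtain e where "(n, e) \<in> set ns" by auto
    from g[OF this] hM[OF that] show ?thesis by (simp add: entry_holds_def)
  qed
  have at: "sat_atom I (map_atom h a)" "\<forall>x \<in> set_atom a. x \<in> fst ` M" if "a \<in> set (body q)" for a
  proof -
    from that q have a: "atom_match D (set fs) (set ns) M a" by (simp add: query_match_def)
    have "sat_atom I (map_atom h a) \<and> (\<forall>x \<in> set_atom a. x \<in> fst ` M)"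
    proof (cases a)
      case (CAtom A x)
      with a obtain n e where n: "(x, n) \<in> M" "(n, e) \<in> set ns" "FA (entry_subj e) (Name A) \<in> set fs" by auto
      have "g n \<in> ext I (Name A)" by (rule entry_holds_FA[OF g[OF n(2)] F[OF n(3)]])
      with CAtom n hM show ?thesis by force
    next
      case (RAtom s x y)
      with a obtain n e m e' where n: "(x, n) \<in> M" "(y, m) \<in> M" "(n, e) \<in> set ns" "(m, e') \<in> set ns"
        and or: "(\<exists>c c' r. e = EConst c \<and> e' = EConst c' \<and> RAtom r c c' \<in> set D \<and> FR r s \<in> set fs) \<or>
          (\<exists>r C. e' = EChild n r C \<and> FR r s \<in> set fs)" unfolding RAtom atom_match.simps by blast
      from or have "(g n, g m) \<in> rext I s"
      proof (elim disjE exE conjE)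
        fix c c' r assume *: "e = EConst c" "e' = EConst c'" "RAtom r c c' \<in> set D" "FR r s \<in> set fs"
        with g[OF n(3)] g[OF n(4)] have "g n = Const c" "g m = Const c'" by (auto simp: entry_holds_def)
        with F[OF *(4)] model_RAtom[OF m *(3)] show ?thesis by auto
      next
        fix r C assume *: "e' = EChild n r C" "FR r s \<in> set fs"
        with g[OF n(4)] F[OF *(2)] show ?thesis by (auto simp: entry_holds_def)
      qed
      with RAtom n hM[OF n(1)] hM[OF n(2)] show ?thesis by force
    qed
    then show "sat_atom I (map_atom h a)" "\<forall>x \<in> set_atom a. x \<in> fst ` M" by auto
  qed
  have "qvars q \<subseteq> fst ` M" using at(2) q by (auto simp: qvars_def query_match_def)
  then have "h ` qvars q \<subseteq> domain I" using dom by auto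
  then have "query_hom h q I" using at(1) by (simp add: query_hom_def)
  moreover have "tuple_fits cv mu Z h"
    unfolding tuple_fits_def
  proof (intro conjI impI ballI allI; clarify)
    fix x v k assume "(x, v) \<in> Z" "cv v = Some k"
    with t obtain n where n: "(x, n) \<in> M" "(n, EConst k) \<in> set ns" unfolding tuple_match_def by blast
    with hM[OF n(1)] g[OF n(2)] show "h x = Const k" by (simp add: entry_holds_def)
  next
    fix x v x' v' assume "mu" "(x, v) \<in> Z" "(x', v) \<in> Z"
    with t obtain n where "(x, n) \<in> M" "(x', n) \<in> M" unfolding tuple_match_def by blast
    with hM show "h x = h x'" by metis
  qed
  ultimately show ?thesis by blast
qed

lemma finite_qvars: "finite (qvars q)"
proof -
  have "finite (set_atom a)" for a :: "nat atom" by (cases a) auto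
  then show ?thesis by (simp add: qvars_def)
qed

text \<open>A node in the image of a match is named by one of the variables mapped to it. Names are
  thereby as short as the variables and never more numerous.\<close>

definition var_of :: "(nat \<Rightarrow> node) \<Rightarrow> cq \<Rightarrow> node \<Rightarrow> nat" where
  "var_of h q n = (SOME x. x \<in> qvars q \<and> h x = n)"

lemma var_of: "n \<in> h ` qvars q \<Longrightarrow> var_of h q n \<in> qvars q \<and> h (var_of h q n) = n"
  unfolding var_of_def by (rule someI_ex) auto

text \<open>If the parent lies outside the image of the match, the path is cut and the node becomes
  a root. The lost edge is used by no atom of the query, since both ends of a used edge are in the
  image.\<close>

definition entry_of :: "(nat \<Rightarrow> node) \<Rightarrow> cq \<Rightarrow> node \<Rightarrow> entry" where
  "entry_of h q n = (case n of
     (SC c, []) \<Rightarrow> EConst c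
   | (SN C, []) \<Rightarrow> ERoot C
   | (X, (r, C) # p) \<Rightarrow> if (X, p) \<in> h ` qvars q then EChild (var_of h q (X, p)) r C else ERoot C)"

lemma entry_of_child: "entry_of h q (X, (r, C) # p) =
    (if (X, p) \<in> h ` qvars q then EChild (var_of h q (X, p)) r C else ERoot C)"
  by (cases X) (auto simp: entry_of_def)

lemma entry_subj_entry_of [simp]: "entry_subj (entry_of h q n) = node_subj n"
  by (cases n; cases "snd n"; cases "fst n") (auto simp: entry_of_def)

lemma (in saturated) match_complete:
  assumes hom: "query_hom h q (canonical D F)"
    and fits: "tuple_fits cv mu Z (\<lambda>x. node_elem D (h x) :: 'd elem)" and Z: "fst ` Z \<subseteq> qvars q"
    and cvD: "\<And>x v k. (x, v) \<in> Z \<Longrightarrow> cv v = Some k \<Longrightarrow> k \<in> adom D"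
  obtains ns M where "justified (entry_derives D F) ns" "finite M" "M \<subseteq> qvars q \<times> qvars q"
    "distinct ns" "set ns \<subseteq> qvars q \<times> (EConst ` adom D \<union> ERoot ` S \<union> (\<lambda>(p, r, C). EChild p r C) ` (qvars q \<times> Rs \<times> S))"
    "query_match D F (set ns) M q" "tuple_match cv mu Z (set ns) M"
proof -
  let ?P = "h ` qvars q"
  have dom: "?P \<subseteq> nodes D F" using hom by (simp add: query_hom_def canonical_def)
  have "finite ?P" by (simp add: finite_qvars)
  from finite_distinct_list[OF this] obtain ps0 where ps0: "set ps0 = ?P" "distinct ps0"
    by (elim exE conjE)
  \<comment> \<open>Sorting by depth places every parent before its children, as a justified list of
    entries requires.\<close>
  define ps where "ps = sort_key (\<lambda>n. length (snd n)) ps0"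
  have ps: "set ps = ?P" "distinct ps" "sorted (map (\<lambda>n. length (snd n)) ps)"
    using ps0 by (auto simp: ps_def)
  define ns where "ns = map (\<lambda>n. (var_of h q n, entry_of h q n)) ps"
  define M where "M = (\<lambda>x. (x, var_of h q (h x))) ` qvars q"
  have inj: "var_of h q n = var_of h q m \<Longrightarrow> n = m" if "n \<in> ?P" "m \<in> ?P" for n m
    using var_of[OF that(1)] var_of[OF that(2)] by metis
  have in_ns: "(var_of h q n, entry_of h q n) \<in> set ns" if "n \<in> ?P" for n
    using that ps by (auto simp: ns_def)
  have in_M: "(x, var_of h q (h x)) \<in> M" if "x \<in> qvars q" for x using that by (auto simp: M_def)
  have j: "justified (entry_derives D F) ns"
    unfolding justified_iff
  proof (intro allI impI)
    fix i assume "i < length ns"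
    then have i: "i < length ps" by (simp add: ns_def)
    let ?n = "ps ! i"
    have n: "?n \<in> ?P" using i ps by auto
    then have node: "?n \<in> nodes D F" using dom by blast
    have new: "var_of h q ?n \<notin> fst ` set (take i ns)"
    proof
      assume "var_of h q ?n \<in> fst ` set (take i ns)"
      then obtain m where m: "m \<in> set (take i ps)" "var_of h q ?n = var_of h q m"
        by (auto simp: ns_def take_map)
      with inj[OF n] ps have "?n = m" by (metis in_set_takeD)
      with m(1) obtain k where "k < i" "ps ! k = ps ! i" using i by (auto simp: in_set_conv_nth)
      with ps(2) i show False by (simp add: nth_eq_iff_index_eq)
    qed
    have "entry_ok D F (set (take i ns)) (entry_of h q ?n)"
    proof (cases "entry_of h q ?n")
      case (EConst c)
      then have "?n = (SC c, [])" by (auto simp: entry_of_def split: prod.splits subj.splits list.splits if_splits)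
      with node EConst show ?thesis by (auto elim: nodes.cases)
    next
      case (ERoot C)
      then have "node_subj ?n = SN C" by (metis entry_subj.simps(2) entry_subj_entry_of)
      with ERoot FN_node[OF node] show ?thesis by simp
    next
      case (EChild p r C)
      then obtain X u where X: "?n = (X, (r, C) # u)" "(X, u) \<in> ?P" "p = var_of h q (X, u)"
        by (auto simp: entry_of_def split: prod.splits subj.splits list.splits if_splits)
      from X(2) ps obtain k where k: "k < length ps" "ps ! k = (X, u)" by (metis in_set_conv_nth)
      have "k < i"
      proof (rule ccontr)
        assume "\<not> k < i"
        with ps(3) k(1) have "length (snd (ps ! i)) \<le> length (snd (ps ! k))"
          using sorted_nth_mono[OF ps(3), of i k] i by simp
        with X k show False by simp
      qed
      then have "(X, u) \<in> set (take i ps)" using k i by (metis in_set_conv_nth length_take min_less_iff_conj nth_take)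
      then have "(p, entry_of h q (X, u)) \<in> set (take i ns)" by (auto simp: ns_def take_map X(3))
      moreover have "FA (node_subj (X, u)) (Ex r C) \<in> F" using node X node_childD by simp
      ultimately show ?thesis unfolding EChild by (auto intro!: exI[of _ "entry_of h q (X, u)"])
    qed
    with new show "entry_derives D F (rev (take i ns)) (ns ! i)"
      using i by (simp add: entry_derives_def ns_def)
  qed
  have M_sub: "M \<subseteq> qvars q \<times> qvars q" using var_of[of "h _" h q] by (auto simp: M_def)
  have "distinct (map fst ns)"
    using ps inj by (auto simp: ns_def o_def distinct_map inj_on_def)
  then have dist: "distinct ns" by (simp add: distinct_map)
  have ns_sub: "set ns \<subseteq> qvars q \<times> (EConst ` adom D \<union> ERoot ` S \<union> (\<lambda>(p, r, C). EChild p r C) ` (qvars q \<times> Rs \<times> S))"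
  proof
    fix ne assume "ne \<in> set ns"
    then obtain n where n: "n \<in> ?P" "ne = (var_of h q n, entry_of h q n)" using ps by (auto simp: ns_def)
    from n dom have node: "n \<in> nodes D F" by blast
    have subj: "node_subj n \<in> SC ` adom D \<union> SN ` S" by (rule node_subj[OF node])
    have "entry_of h q n \<in> EConst ` adom D \<union> ERoot ` S \<union> (\<lambda>(p, r, C). EChild p r C) ` (qvars q \<times> Rs \<times> S)"
    proof (cases "entry_of h q n")
      case (EChild p r C)
      then obtain X u where X: "n = (X, (r, C) # u)" "(X, u) \<in> ?P" "p = var_of h q (X, u)"
        by (auto simp: entry_of_def split: prod.splits subj.splits list.splits if_splits)
      with node node_childD have "FA (node_subj (X, u)) (Ex r C) \<in> F" by blast
      then have "r \<in> Rs" "C \<in> S" using S_Ex[of r C] F_FA[of _ "Ex r C"] by auto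
      with X var_of[OF X(2)] have "(p, r, C) \<in> qvars q \<times> Rs \<times> S" by simp
      then show ?thesis unfolding EChild by (intro UnI2 image_eqI[of _ _ "(p, r, C)"]) auto
    qed (use subj entry_subj_entry_of[of h q n] in auto)
    with n var_of[OF n(1)] show "ne \<in> qvars q \<times> (EConst ` adom D \<union> ERoot ` S \<union> (\<lambda>(p, r, C). EChild p r C) ` (qvars q \<times> Rs \<times> S))"
      by simp
  qed
  have fn: "n \<in> fst ` set ns \<and> (\<forall>m. (x, m) \<in> M \<longrightarrow> n = m)" if "(x, n) \<in> M" for x n
  proof -
    from that have x: "x \<in> qvars q" "n = var_of h q (h x)" by (auto simp: M_def)
    with imageI[OF in_ns[of "h x"], of fst] show ?thesis by (auto simp: M_def)
  qed
  have am: "atom_match D F (set ns) M a" if a: "a \<in> set (body q)" for a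
  proof -
    from hom a have sat: "sat_atom (canonical D F) (map_atom h a)" by (simp add: query_hom_def)
    have vars: "set_atom a \<subseteq> qvars q" using a by (auto simp: qvars_def)
    show ?thesis
    proof (cases a)
      case (CAtom A x)
      with sat vars in_M[of x] in_ns[of "h x"] show ?thesis
        by (auto simp: canonical_def intro!: exI[of _ "var_of h q (h x)"] exI[of _ "entry_of h q (h x)"])
    next
      case (RAtom s x y)
      with vars have xy: "x \<in> qvars q" "y \<in> qvars q" by auto
      from sat RAtom have "edge D F s (h x) (h y)" by (simp add: canonical_def)
      then have "(\<exists>c c' r. entry_of h q (h x) = EConst c \<and> entry_of h q (h y) = EConst c' \<and> RAtom r c c' \<in> set D \<and> FR r s \<in> F) \<or>
        (\<exists>r C. entry_of h q (h y) = EChild (var_of h q (h x)) r C \<and> FR r s \<in> F)"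
        unfolding edge_def
      proof (elim disjE exE conjE)
        fix r C assume *: "h y = (fst (h x), (r, C) # snd (h x))" "FR r s \<in> F"
        have "entry_of h q (h y) = EChild (var_of h q (h x)) r C"
          using xy by (simp add: *(1) entry_of_child)
        with * show ?thesis by blast
      qed (auto simp: entry_of_def)
      then show ?thesis unfolding RAtom atom_match.simps
        using in_M[OF xy(1)] in_M[OF xy(2)] in_ns[of "h x"] in_ns[of "h y"] xy by blast
    qed
  qed
  have "set (ans q) \<subseteq> fst ` M" by (force simp: M_def qvars_def)
  with fn am have qm: "query_match D F (set ns) M q" unfolding query_match_def by blast
  have tm: "tuple_match cv mu Z (set ns) M"
    unfolding tuple_match_def
  proof (intro conjI impI ballI allI; clarify)
    fix x v k assume xv: "(x, v) \<in> Z" "cv v = Some k"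
    with fits have "node_elem D (h x) = (Const k :: 'd elem)" unfolding tuple_fits_def by blast
    moreover have "k \<in> adom D" using cvD xv by blast
    then have "node_elem D (SC k, []) = (Const k :: 'd elem)" by (rule node_elem_const)
    ultimately have hx: "h x = (SC k, [])" using inj_node_elem[THEN injD] by metis
    from xv Z have x: "x \<in> qvars q" by force
    have "entry_of h q (h x) = EConst k" by (simp add: hx entry_of_def)
    with in_M[OF x] in_ns[of "h x"] x show "\<exists>n. (x, n) \<in> M \<and> (n, EConst k) \<in> set ns" by auto
  next
    fix x v x' v' assume *: "mu" "(x, v) \<in> Z" "(x', v) \<in> Z"
    with fits have "node_elem D (h x) = (node_elem D (h x') :: 'd elem)" unfolding tuple_fits_def by blast
    then have "h x = h x'" using inj_node_elem[THEN injD] by metis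
    moreover from * Z have "x \<in> qvars q" "x' \<in> qvars q" by force+
    ultimately show "\<exists>n. (x, n) \<in> M \<and> (x', n) \<in> M" using in_M by metis
  qed
  show thesis
    by (rule that[OF j _ M_sub dist ns_sub qm tm]) (simp add: M_def finite_qvars)
qed

section \<open>Concepts, roles and facts over a given input\<close>

fun subs :: "concept \<Rightarrow> concept set" where
  "subs Top = {Top}"
| "subs (Name A) = {Name A}"
| "subs (And C E) = insert (And C E) (subs C \<union> subs E)"
| "subs (Ex r C) = insert (Ex r C) (subs C)"

lemma subs_refl: "C \<in> subs C" by (cases C) auto

lemma subs_closed: "And B E \<in> subs C \<Longrightarrow> B \<in> subs C \<and> E \<in> subs C" "Ex r B \<in> subs C \<Longrightarrow> B \<in> subs C"
  by (induction C) (auto simp: subs_refl)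

lemma finite_subs: "finite (subs C)" by (induction C) auto

lemma card_subs: "card (subs C) \<le> length (enc_concept C)"
proof (induction C)
  case (And C E)
  have "card (subs (And C E)) \<le> Suc (card (subs C \<union> subs E))"
    by (simp add: card_insert_le_m1 finite_subs card_insert_if)
  also have "\<dots> \<le> Suc (card (subs C) + card (subs E))" by (simp add: card_Un_le)
  finally show ?case using And by simp
next
  case (Ex r C)
  have "card (subs (Ex r C)) \<le> Suc (card (subs C))"
    by (simp add: finite_subs card_insert_if)
  with Ex show ?case by simp
qed auto

lemma length_subs: "B \<in> subs C \<Longrightarrow> length (enc_concept B) \<le> length (enc_concept C)"
  by (induction C) auto

fun inclusion_subs :: "inclusion \<Rightarrow> concept set" where
  "inclusion_subs (CI B C) = subs B \<union> subs C"
| "inclusion_subs (RI r s) = {}"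

fun inclusion_roles :: "inclusion \<Rightarrow> nat set" where
  "inclusion_roles (CI B C) = {}"
| "inclusion_roles (RI r s) = {r, s}"

fun atom_concepts :: "nat atom \<Rightarrow> concept set" where
  "atom_concepts (CAtom A c) = {Name A}"
| "atom_concepts (RAtom r c c') = {}"

fun atom_roles :: "nat atom \<Rightarrow> nat set" where
  "atom_roles (CAtom A c) = {}"
| "atom_roles (RAtom r c c') = {r}"

fun top_role :: "concept \<Rightarrow> nat set" where
  "top_role (Ex r C) = {r}"
| "top_role _ = {}"

definition concepts_of :: "ontology \<Rightarrow> database \<Rightarrow> concept set" where
  "concepts_of Ont D = insert Top ((\<Union>a \<in> set Ont. inclusion_subs a) \<union> (\<Union>a \<in> set D. atom_concepts a))"

definition roles_of :: "ontology \<Rightarrow> database \<Rightarrow> nat set" where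
  "roles_of Ont D = (\<Union>C \<in> concepts_of Ont D. top_role C) \<union> (\<Union>a \<in> set Ont. inclusion_roles a) \<union>
    (\<Union>a \<in> set D. atom_roles a)"

definition facts_of :: "ontology \<Rightarrow> database \<Rightarrow> fact set" where
  "facts_of Ont D = (\<lambda>(X, C). FA X C) ` ((SC ` adom D \<union> SN ` concepts_of Ont D) \<times> concepts_of Ont D) \<union>
    FN ` concepts_of Ont D \<union> (\<lambda>(r, s). FR r s) ` (roles_of Ont D \<times> roles_of Ont D)"

lemma FA_in_facts_of: "FA X C \<in> facts_of Ont D \<longleftrightarrow> X \<in> SC ` adom D \<union> SN ` concepts_of Ont D \<and> C \<in> concepts_of Ont D"
  unfolding facts_of_def by (auto simp del: Un_iff intro!: image_eqI[of _ _ "(X, C)"] simp: Un_iff[of "FA X C"])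

lemma FN_in_facts_of: "FN C \<in> facts_of Ont D \<longleftrightarrow> C \<in> concepts_of Ont D"
  unfolding facts_of_def by auto

lemma FR_in_facts_of: "FR r s \<in> facts_of Ont D \<longleftrightarrow> r \<in> roles_of Ont D \<and> s \<in> roles_of Ont D"
  unfolding facts_of_def by auto

lemma finite_concepts_of: "finite (concepts_of Ont D)"
proof -
  have "finite (inclusion_subs a)" for a by (cases a) (auto simp: finite_subs)
  moreover have "finite (atom_concepts a)" for a by (cases a) auto
  ultimately show ?thesis by (simp add: concepts_of_def)
qed

lemma finite_roles_of: "finite (roles_of Ont D)"
proof -
  have "finite (top_role a)" for a by (cases a) auto
  moreover have "finite (inclusion_roles a)" for a by (cases a) auto
  moreover have "finite (atom_roles a)" for a by (cases a) auto
  ultimately show ?thesis by (simp add: roles_of_def finite_concepts_of)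
qed

lemma finite_facts_of: "finite (facts_of Ont D)"
  by (simp add: facts_of_def finite_concepts_of finite_roles_of finite_adom)

lemma inclusion_subs_closed:
  "And B E \<in> inclusion_subs a \<Longrightarrow> B \<in> inclusion_subs a \<and> E \<in> inclusion_subs a"
  "Ex r B \<in> inclusion_subs a \<Longrightarrow> B \<in> inclusion_subs a"
  by (cases a; auto dest: subs_closed)+

lemma concepts_of_closed:
  "And B E \<in> concepts_of Ont D \<Longrightarrow> B \<in> concepts_of Ont D \<and> E \<in> concepts_of Ont D"
  "Ex r B \<in> concepts_of Ont D \<Longrightarrow> B \<in> concepts_of Ont D"
proof -
  have at: "C \<notin> atom_concepts a" if "C = And B E \<or> C = Ex r B" for C a using that by (cases a) auto
  have ob: "\<exists>a \<in> set Ont. C \<in> inclusion_subs a" if "C = And B E \<or> C = Ex r B" "C \<in> concepts_of Ont D" for C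
    using that at[OF that(1)] by (auto simp: concepts_of_def)
  have sub: "C \<in> concepts_of Ont D" if "a \<in> set Ont" "C \<in> inclusion_subs a" for a C
    using that by (auto simp: concepts_of_def)
  show "And B E \<in> concepts_of Ont D \<Longrightarrow> B \<in> concepts_of Ont D \<and> E \<in> concepts_of Ont D"
    using ob[of "And B E"] inclusion_subs_closed(1) sub by meson
  show "Ex r B \<in> concepts_of Ont D \<Longrightarrow> B \<in> concepts_of Ont D"
    using ob[of "Ex r B"] inclusion_subs_closed(2) sub by meson
qed

lemma saturated_facts_of:
  assumes sub: "F \<subseteq> facts_of Ont D" and cl: "\<And>f. f \<in> facts_of Ont D \<Longrightarrow> derives Ont D F f \<Longrightarrow> f \<in> F"
  shows "saturated Ont D (concepts_of Ont D) (roles_of Ont D) F"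
proof
  fix B C assume "CI B C \<in> set Ont"
  then have "inclusion_subs (CI B C) \<subseteq> concepts_of Ont D" unfolding concepts_of_def by blast
  then show "B \<in> concepts_of Ont D \<and> C \<in> concepts_of Ont D" by (auto simp: subs_refl)
next
  fix r s assume "RI r s \<in> set Ont"
  then have "inclusion_roles (RI r s) \<subseteq> roles_of Ont D" unfolding roles_of_def by blast
  then show "r \<in> roles_of Ont D \<and> s \<in> roles_of Ont D" by auto
next
  fix A c assume "CAtom A c \<in> set D"
  then have "atom_concepts (CAtom A c) \<subseteq> concepts_of Ont D" unfolding concepts_of_def by blast
  then show "Name A \<in> concepts_of Ont D" by auto
next
  fix r c c' assume "RAtom r c c' \<in> set D"
  then have "atom_roles (RAtom r c c') \<subseteq> roles_of Ont D" unfolding roles_of_def by blast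
  then show "r \<in> roles_of Ont D" by auto
next
  fix r C assume C: "Ex r C \<in> concepts_of Ont D"
  then have "top_role (Ex r C) \<subseteq> roles_of Ont D" unfolding roles_of_def by blast
  with concepts_of_closed(2)[OF C] show "r \<in> roles_of Ont D \<and> C \<in> concepts_of Ont D" by auto
next
  show "Top \<in> concepts_of Ont D" by (simp add: concepts_of_def)
next
  show "And B C \<in> concepts_of Ont D \<Longrightarrow> B \<in> concepts_of Ont D \<and> C \<in> concepts_of Ont D" for B C
    by (rule concepts_of_closed(1))
next
  fix X C assume "FA X C \<in> F"
  with sub show "X \<in> SC ` adom D \<union> SN ` concepts_of Ont D \<and> C \<in> concepts_of Ont D"
    unfolding FA_in_facts_of[symmetric] by blast
next
  fix C assume "FN C \<in> F"
  with sub show "C \<in> concepts_of Ont D" unfolding FN_in_facts_of[symmetric] by blast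
next
  fix r s assume "FR r s \<in> F"
  with sub show "r \<in> roles_of Ont D \<and> s \<in> roles_of Ont D" unfolding FR_in_facts_of[symmetric] by blast
qed (simp_all add: cl FA_in_facts_of FN_in_facts_of FR_in_facts_of)

text \<open>Entries of candidate tuples of both kinds: \<open>(False, c)\<close> is the constant \<open>c\<close>, \<open>(True, j)\<close> is
  the wildcard with index \<open>j + 1\<close>, and \<open>(True, 0)\<close> is the single wildcard.\<close>

type_synonym slot = "bool \<times> nat"

definition slot_const :: "slot \<Rightarrow> nat option" where
  "slot_const v = (if fst v then None else Some (snd v))"

definition slots_ok :: "bool \<Rightarrow> database \<Rightarrow> slot list \<Rightarrow> bool" where
  "slots_ok mu D z \<longleftrightarrow> (\<forall>v \<in> set z. fst v \<or> snd v \<in> adom D) \<and>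
    (if mu then justified (\<lambda>P v. fst v \<and> snd v \<noteq> 0 \<longrightarrow> (\<exists>u \<in> set P. fst u \<and> snd v = Suc (snd u))) z
     else \<forall>v \<in> set z. fst v \<longrightarrow> snd v = 0)"

definition slots_le :: "bool \<Rightarrow> slot list \<Rightarrow> slot list \<Rightarrow> bool" where
  "slots_le mu z' z \<longleftrightarrow> length z' = length z \<and> (\<forall>(v', v) \<in> set (zip z' z). v' = v \<or> fst v) \<and>
    (mu \<longrightarrow> (\<forall>(v', v) \<in> set (zip z' z). \<forall>(u', u) \<in> set (zip z' z). v = u \<longrightarrow> v' = u'))"

text \<open>The comparison of an answer with the tuple is restated as a condition on the match
  itself. With \<open>mu\<close> as a switch, one kind of certificate then covers both wildcard
  semantics.\<close>

definition gpartial :: "'d itself \<Rightarrow> bool \<Rightarrow> omq \<Rightarrow> database \<Rightarrow> slot list \<Rightarrow> bool" where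
  "gpartial T mu Q D z \<longleftrightarrow> length z = length (ans (query Q)) \<and> slots_ok mu D z \<and>
    (\<forall>I :: 'd elem interp. model (onto Q) D I \<longrightarrow>
      (\<exists>h. query_hom h (query Q) I \<and> tuple_fits slot_const mu (set (zip (ans (query Q)) z)) h))"

fun slot_s :: "nat swild \<Rightarrow> slot" where
  "slot_s (SVal c) = (False, c)"
| "slot_s Star = (True, 0)"

fun slot_m :: "nat mwild \<Rightarrow> slot" where
  "slot_m (MVal c) = (False, c)"
| "slot_m (Wild j) = (True, j)"

lemma slot_s_inject [simp]: "slot_s u = slot_s v \<longleftrightarrow> u = v"
  by (cases u; cases v) auto

lemma slot_m_inject [simp]: "slot_m u = slot_m v \<longleftrightarrow> u = v"
  by (cases u; cases v) auto

lemma slots_ok_s: "slots_ok False D (map slot_s c) \<longleftrightarrow> stuple D c"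
proof -
  have "(fst (slot_s v) \<or> snd (slot_s v) \<in> adom D) \<and> (fst (slot_s v) \<longrightarrow> snd (slot_s v) = 0)
    \<longleftrightarrow> v = Star \<or> v \<in> SVal ` adom D" for v by (cases v) auto
  then show ?thesis unfolding slots_ok_def stuple_def by (auto simp: all_set_conv_all_nth)
qed

lemma slots_ok_m: "slots_ok True D (map slot_m c) \<longleftrightarrow> mtuple D c"
proof -
  have 1: "fst (slot_m v) \<or> snd (slot_m v) \<in> adom D \<longleftrightarrow> (\<exists>j. v = Wild j) \<or> v \<in> MVal ` adom D" for v
    by (cases v) auto
  have 2: "(fst (slot_m v) \<and> snd (slot_m v) \<noteq> 0 \<longrightarrow> (\<exists>u \<in> slot_m ` P. fst u \<and> snd (slot_m v) = Suc (snd u))) \<longleftrightarrow>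
    (\<forall>j. v = Wild (Suc j) \<longrightarrow> (\<exists>u \<in> P. fst (slot_m u) \<and> Suc j = Suc (snd (slot_m u))))" for v P
    by (cases v) (auto simp: gr0_conv_Suc)
  have 3: "fst (slot_m u) \<and> Suc j = Suc (snd (slot_m u)) \<longleftrightarrow> u = Wild j" for u j
    by (cases u) auto
  have "justified (\<lambda>P v. fst v \<and> snd v \<noteq> 0 \<longrightarrow> (\<exists>u \<in> set P. fst u \<and> snd v = Suc (snd u))) (map slot_m c) \<longleftrightarrow>
    (\<forall>i < length c. \<forall>j. c ! i = Wild (Suc j) \<longrightarrow> (\<exists>u \<in> set (take i c). fst (slot_m u) \<and> Suc j = Suc (snd (slot_m u))))"
    unfolding justified_iff by (simp add: take_map rev_map[symmetric] 2[unfolded neq0_conv nat.inject] del: bex_simps)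
  also have "\<dots> \<longleftrightarrow> (\<forall>i < length c. \<forall>j. c ! i = Wild (Suc j) \<longrightarrow> (\<exists>k < i. c ! k = Wild j))"
  proof -
    have "(\<exists>u \<in> set (take i c). u = w) \<longleftrightarrow> (\<exists>k < i. c ! k = w)" if "i < length c" for i w
      using that by (auto simp: in_set_conv_nth)
    then show ?thesis unfolding 3 by blast
  qed
  finally show ?thesis unfolding slots_ok_def mtuple_def by (auto simp: 1 all_set_conv_all_nth)
qed

lemma Ball_zip: "length xs = length ys \<Longrightarrow> (\<forall>p \<in> set (zip xs ys). P p) \<longleftrightarrow> (\<forall>i < length xs. P (xs ! i, ys ! i))"
  by (auto simp: set_zip)

lemma slots_le_s: "slots_le False (map slot_s c') (map slot_s c) \<longleftrightarrow> sle c' c"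
proof (cases "length c' = length c")
  case True
  have *: "u = v \<or> fst (slot_s v) \<longleftrightarrow> v \<in> {u, Star}" for u v by (cases v) auto
  show ?thesis unfolding slots_le_def sle_def using True
    by (auto simp: Ball_zip * split_beta)
qed (simp add: slots_le_def sle_def)

lemma slots_le_m: "slots_le True (map slot_m c') (map slot_m c) \<longleftrightarrow> mle c' c"
proof (cases "length c' = length c")
  case True
  have *: "u = v \<or> fst (slot_m v) \<longleftrightarrow> u = v \<or> (\<exists>j. v = Wild j)" for u v by (cases v) auto
  show ?thesis unfolding slots_le_def mle_def using True
    by (auto simp: Ball_zip * split_beta)
qed (simp add: slots_le_def mle_def)

lemma Bex_answers: "(\<exists>a \<in> answers q I. P a) \<longleftrightarrow> (\<exists>h. query_hom h q I \<and> P (map h (ans q)))"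
  by (auto simp: answers_def)

lemma gpartial_s: "gpartial T False Q D (map slot_s c) \<longleftrightarrow> partial_answer_s T Q D c"
proof (cases "length c = length (ans (query Q))")
  case True
  have "tuple_fits slot_const False (set (zip (ans (query Q)) (map slot_s c))) h \<longleftrightarrow>
    sle (map SVal (map h (ans (query Q)))) (map (map_swild Const) c)" for h :: "nat \<Rightarrow> 'a elem"
  proof -
    have *: "(\<forall>k. slot_const (slot_s v) = Some k \<longrightarrow> d = Const k) \<longleftrightarrow> map_swild Const v = SVal d \<or> map_swild (Const :: nat \<Rightarrow> 'a elem) v = Star"
      for v and d :: "'a elem" by (cases v) (auto simp: slot_const_def)
    show ?thesis unfolding tuple_fits_def sle_def using True
      by (simp add: Ball_zip * split_beta)
  qed
  then show ?thesis unfolding gpartial_def partial_answer_s_def Bex_answers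
    by (simp add: slots_ok_s)
qed (simp add: gpartial_def partial_answer_s_def)

lemma gpartial_m: "gpartial T True Q D (map slot_m c) \<longleftrightarrow> partial_answer_m T Q D c"
proof (cases "length c = length (ans (query Q))")
  case True
  have "tuple_fits slot_const True (set (zip (ans (query Q)) (map slot_m c))) h \<longleftrightarrow>
    mle (map MVal (map h (ans (query Q)))) (map (map_mwild Const) c)" for h :: "nat \<Rightarrow> 'a elem"
  proof -
    have *: "(\<forall>k. slot_const (slot_m v) = Some k \<longrightarrow> d = Const k) \<longleftrightarrow> MVal d = map_mwild Const v \<or> (\<exists>j. map_mwild (Const :: nat \<Rightarrow> 'a elem) v = Wild j)"
      for v and d :: "'a elem" by (cases v) (auto simp: slot_const_def)
    have **: "map_mwild (Const :: nat \<Rightarrow> 'a elem) u = map_mwild Const v \<longleftrightarrow> u = v" for u v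
      by (cases u; cases v) auto
    show ?thesis unfolding tuple_fits_def mle_def using True
      by (simp add: Ball_zip * ** split_beta)
  qed
  then show ?thesis unfolding gpartial_def partial_answer_m_def Bex_answers
    by (simp add: slots_ok_m)
qed (simp add: gpartial_def partial_answer_m_def)

text \<open>It suffices to use the answer condition in a single model, the universal model of a
  saturated justified list. That list also serves as the derivation in the certificate.\<close>

lemma gpartial_certificate:
  assumes "gpartial TYPE('d) mu Q D z"
  obtains fs ns M where
    "justified (\<lambda>F. derives (onto Q) D (set F)) fs" "distinct fs" "set fs \<subseteq> facts_of (onto Q) D"
    "justified (entry_derives D (set fs)) ns" "distinct ns"
    "set ns \<subseteq> qvars (query Q) \<times> (EConst ` adom D \<union> ERoot ` concepts_of (onto Q) D \<union>
      (\<lambda>(p, r, C). EChild p r C) ` (qvars (query Q) \<times> roles_of (onto Q) D \<times> concepts_of (onto Q) D))"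
    "finite M" "M \<subseteq> qvars (query Q) \<times> qvars (query Q)"
    "query_match D (set fs) (set ns) M (query Q)"
    "tuple_match slot_const mu (set (zip (ans (query Q)) z)) (set ns) M"
proof -
  let ?Z = "set (zip (ans (query Q)) z)"
  obtain fs where fs: "justified (\<lambda>F. derives (onto Q) D (set F)) fs" "distinct fs" "set fs \<subseteq> facts_of (onto Q) D"
    "\<And>f. f \<in> facts_of (onto Q) D \<Longrightarrow> derives (onto Q) D (set fs) f \<Longrightarrow> f \<in> set fs"
    using justified_saturated[OF finite_facts_of[of "onto Q" D], of "derives (onto Q) D"] by metis
  interpret saturated "onto Q" D "concepts_of (onto Q) D" "roles_of (onto Q) D" "set fs"
    by (rule saturated_facts_of) (use fs in auto)
  let ?I = "map_interp (node_elem D :: node \<Rightarrow> 'd elem) (canonical D (set fs))"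
  obtain h where h: "query_hom h (query Q) ?I" "tuple_fits slot_const mu ?Z h"
    using assms model_canonical unfolding gpartial_def by blast
  obtain h' where h': "query_hom h' (query Q) (canonical D (set fs))"
    "\<And>x. x \<in> qvars (query Q) \<Longrightarrow> h x = node_elem D (h' x)"
    using query_hom_map_interp[OF inj_node_elem h(1)] by blast
  have Z: "fst ` ?Z \<subseteq> qvars (query Q)" by (auto simp: qvars_def dest: set_zip_leftD)
  have fits: "tuple_fits slot_const mu ?Z (\<lambda>x. node_elem D (h' x) :: 'd elem)"
  proof -
    have "x \<in> qvars (query Q)" if "(x, v) \<in> ?Z" for x v using Z that by force
    then show ?thesis using h(2) h'(2) unfolding tuple_fits_def by (simp add: split_beta) (metis prod.collapse)
  qed
  have ad: "k \<in> adom D" if "(x, v) \<in> ?Z" "slot_const v = Some k" for x v k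
  proof -
    from that have "v \<in> set z" "v = (False, k)"
      by (auto dest: set_zip_rightD simp: slot_const_def split: if_splits) (metis prod.collapse)
    then show ?thesis using assms by (auto simp: gpartial_def slots_ok_def)
  qed
  show thesis
    by (rule match_complete[OF h'(1) fits Z ad]) (use that fs in blast)+
qed

lemma gpartial_sound:
  assumes "length z = length (ans (query Q))" "slots_ok mu D z"
    and "justified (\<lambda>F. derives (onto Q) D (set F)) fs" "justified (entry_derives D (set fs)) ns"
    and "query_match D (set fs) (set ns) M (query Q)"
    and "tuple_match slot_const mu (set (zip (ans (query Q)) z)) (set ns) M"
  shows "gpartial T mu Q D z"
  unfolding gpartial_def using assms match_sound by metis

section \<open>The verifier\<close>

text \<open>The verifier works on records, which are lists of words; concepts and names are represented by
  their codes.\<close>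

type_synonym rcd = "bool list list"

abbreviation f0 :: "rcd \<Rightarrow> bool list" where "f0 r \<equiv> hd0 r"
abbreviation f1 :: "rcd \<Rightarrow> bool list" where "f1 r \<equiv> hd0 (tl r)"
abbreviation f2 :: "rcd \<Rightarrow> bool list" where "f2 r \<equiv> hd0 (tl (tl r))"
abbreviation f3 :: "rcd \<Rightarrow> bool list" where "f3 r \<equiv> hd0 (tl (tl (tl r)))"
abbreviation f4 :: "rcd \<Rightarrow> bool list" where "f4 r \<equiv> hd0 (tl (tl (tl (tl r))))"

abbreviation "FF \<equiv> [False, False]"
abbreviation "FT \<equiv> [False, True]"
abbreviation "TF \<equiv> [True, False]"
abbreviation "TT \<equiv> [True, True]"

definition wName :: "bool list \<Rightarrow> bool list" where "wName a = False # True # self_delim a"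
definition wAnd :: "bool list \<Rightarrow> bool list \<Rightarrow> bool list" where "wAnd u v = True # False # u @ v"
definition wEx :: "bool list \<Rightarrow> bool list \<Rightarrow> bool list" where "wEx r u = True # True # self_delim r @ u"

text \<open>The verifier never parses a concept. The certificate contains a table with the outermost
  constructor of each concept and the codes of its arguments, from which the code of the concept is
  rebuilt and compared.\<close>

definition shape_word :: "rcd \<Rightarrow> bool list" where
  "shape_word r = (if f0 r = FF then FF else if f0 r = FT then wName (f1 r)
    else if f0 r = TF then wAnd (f1 r) (f2 r) else wEx (f1 r) (f2 r))"

text \<open>The most significant bit comes last, so the words that are binary codes of numbers are
  the empty word and those ending in \<open>True\<close>.\<close>

definition canon :: "bool list \<Rightarrow> bool" where
  "canon w = (case rev w of [] \<Rightarrow> True | b # u \<Rightarrow> b)"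

text \<open>Binary successor, where the flag is the carry. It serves to check that wildcard indices
  appear in order.\<close>

definition inc :: "bool list \<Rightarrow> bool list" where
  "inc w = (let a = foldl (\<lambda>a b. if fst a then (b, (\<not> b) # snd a) else (False, b # snd a)) (True, []) w
    in rev (snd a) @ (if fst a then [True] else []))"

text \<open>The first field is a tag and is written as it is; the others are binary numbers that
  need delimiters. Codes of concepts are prefix-free already, hence the separate treatment of
  concept inclusions below.\<close>

definition flat :: "rcd \<Rightarrow> bool list" where
  "flat r = hd0 r @ concat (map self_delim (tl r))"

definition flat_inclusion :: "rcd \<Rightarrow> bool list" where
  "flat_inclusion r = (if f0 r = [False] then concat r else flat r)"

definition wlist :: "bool list list \<Rightarrow> bool list" where
  "wlist ws = concat (map (\<lambda>w. True # w) ws) @ [False]"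

definition wslot :: "bool \<Rightarrow> bool list \<Rightarrow> bool list \<Rightarrow> bool list" where
  "wslot mu k a = k @ (if mu \<or> k = [False] then self_delim a else [])"

definition w_const :: "rcd list \<Rightarrow> bool list \<Rightarrow> bool" where
  "w_const D c \<longleftrightarrow> (\<exists>d \<in> set D. c \<in> set (tl (tl d)))"

definition v_shape :: "rcd list \<Rightarrow> rcd \<Rightarrow> bool" where
  "v_shape T r \<longleftrightarrow> r = [FF] \<or> (r = [FT, f1 r] \<and> canon (f1 r)) \<or>
    (r = [TF, f1 r, f2 r] \<and> f1 r \<in> set (map shape_word T) \<and> f2 r \<in> set (map shape_word T)) \<or>
    (r = [TT, f1 r, f2 r] \<and> canon (f1 r) \<and> f2 r \<in> set (map shape_word T))"

definition v_inclusion :: "rcd list \<Rightarrow> rcd \<Rightarrow> bool" where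
  "v_inclusion T r \<longleftrightarrow>
    (r = [[False], f1 r, f2 r] \<and> f1 r \<in> set (map shape_word T) \<and> f2 r \<in> set (map shape_word T)) \<or>
    (r = [[True], f1 r, f2 r] \<and> canon (f1 r) \<and> canon (f2 r))"

definition v_name :: "rcd \<Rightarrow> bool" where
  "v_name r \<longleftrightarrow> r = [[], f1 r] \<and> canon (f1 r)"

definition v_atom :: "rcd \<Rightarrow> bool" where
  "v_atom r \<longleftrightarrow> (r = [[False], f1 r, f2 r] \<and> canon (f1 r) \<and> canon (f2 r)) \<or>
    (r = [[True], f1 r, f2 r, f3 r] \<and> canon (f1 r) \<and> canon (f2 r) \<and> canon (f3 r))"

definition v_fact :: "rcd list \<Rightarrow> rcd \<Rightarrow> bool" where
  "v_fact T r \<longleftrightarrow>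
    (r = [FF, f1 r, f2 r] \<and> canon (f1 r) \<and> f2 r \<in> set (map shape_word T)) \<or>
    (r = [FT, f1 r, f2 r] \<and> f1 r \<in> set (map shape_word T) \<and> f2 r \<in> set (map shape_word T)) \<or>
    (r = [TF, f1 r] \<and> f1 r \<in> set (map shape_word T)) \<or>
    (r = [TT, f1 r, f2 r] \<and> canon (f1 r) \<and> canon (f2 r))"

definition v_node :: "rcd list \<Rightarrow> rcd \<Rightarrow> bool" where
  "v_node T r \<longleftrightarrow>
    (r = [FF, f1 r, f2 r] \<and> canon (f1 r) \<and> canon (f2 r)) \<or>
    (r = [FT, f1 r, f2 r] \<and> canon (f1 r) \<and> f2 r \<in> set (map shape_word T)) \<or>
    (r = [TT, f1 r, f2 r, f3 r, f4 r] \<and> canon (f1 r) \<and> canon (f2 r) \<and> canon (f3 r) \<and>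
      f4 r \<in> set (map shape_word T))"

definition v_pair :: "rcd \<Rightarrow> bool" where
  "v_pair r \<longleftrightarrow> r = [f0 r, f1 r] \<and> canon (f0 r) \<and> canon (f1 r)"

definition v_row :: "rcd \<Rightarrow> bool" where
  "v_row r \<longleftrightarrow> r = [f0 r, f1 r, f2 r, f3 r, f4 r] \<and> canon (f0 r) \<and> canon (f2 r) \<and> canon (f4 r) \<and>
    (f1 r = [False] \<or> f1 r = [True]) \<and> (f3 r = [False] \<or> f3 r = [True])"

text \<open>The predicates from here on mirror \<open>derives\<close>, \<open>entry_derives\<close>
  and the match conditions on records. All quantifiers range over given lists, so that the closure
  rules for \<open>pt\<close> apply.\<close>

definition w_FR :: "rcd list \<Rightarrow> rcd list \<Rightarrow> bool list \<Rightarrow> bool list \<Rightarrow> bool" where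
  "w_FR Ow F a e \<longleftrightarrow> a = e \<or> (\<exists>g \<in> set F. g = [TT, a, f2 g] \<and> [[True], f2 g, e] \<in> set Ow)"

definition w_FN :: "rcd list \<Rightarrow> rcd list \<Rightarrow> bool list \<Rightarrow> bool" where
  "w_FN T F e \<longleftrightarrow> e = FF \<or> (\<exists>g \<in> set F. g = [FF, f1 g, e]) \<or>
    (\<exists>g \<in> set F. g = [FT, f1 g, e] \<and> [TF, f1 g] \<in> set F) \<or>
    (\<exists>g \<in> set F. \<exists>t \<in> set T. g = [TF, shape_word t] \<and> t = [TT, f1 t, e])"

definition w_FA :: "rcd list \<Rightarrow> rcd list \<Rightarrow> rcd list \<Rightarrow> rcd list \<Rightarrow> bool list \<Rightarrow> bool list \<Rightarrow> bool list \<Rightarrow> bool" where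
  "w_FA Ow D T F k a e \<longleftrightarrow> (k = FT \<and> a = e) \<or> (e = FF \<and> (k = FF \<longrightarrow> w_const D a)) \<or>
    (\<exists>d \<in> set D. k = FF \<and> d = [[False], f1 d, a] \<and> e = wName (f1 d)) \<or>
    (\<exists>g \<in> set F. \<exists>h \<in> set F. g = [k, a, f2 g] \<and> h = [k, a, f2 h] \<and> e = wAnd (f2 g) (f2 h)) \<or>
    (\<exists>g \<in> set F. \<exists>t \<in> set T. g = [k, a, shape_word t] \<and> (t = [TF, e, f2 t] \<or> t = [TF, f1 t, e])) \<or>
    (\<exists>g \<in> set F. g = [k, a, f2 g] \<and> [[False], f2 g, e] \<in> set Ow) \<or>
    (\<exists>d \<in> set D. \<exists>g \<in> set F. \<exists>h \<in> set F. k = FF \<and> d = [[True], f1 d, a, f3 d] \<and> g = [TT, f1 d, f2 g] \<and>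
      h = [FF, f3 d, f2 h] \<and> e = wEx (f2 g) (f2 h)) \<or>
    (\<exists>g \<in> set F. \<exists>h \<in> set F. \<exists>l \<in> set F. \<exists>t \<in> set T. g = [k, a, shape_word t] \<and> t = [TT, f1 t, f2 t] \<and>
      h = [FT, f2 t, f2 h] \<and> l = [TT, f1 t, f2 l] \<and> e = wEx (f2 l) (f2 h))"

definition w_derives :: "rcd list \<Rightarrow> rcd list \<Rightarrow> rcd list \<Rightarrow> rcd list \<Rightarrow> rcd \<Rightarrow> bool" where
  "w_derives Ow D T F r = (if f0 r = TT then w_FR Ow F (f1 r) (f2 r)
    else if f0 r = TF then w_FN T F (f1 r) else w_FA Ow D T F (f0 r) (f1 r) (f2 r))"

definition w_kind :: "rcd \<Rightarrow> bool list" where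
  "w_kind g = (if f0 g = FF then FF else FT)"

definition w_subj :: "rcd \<Rightarrow> bool list" where
  "w_subj g = (if f0 g = TT then f4 g else f2 g)"

definition w_entry :: "rcd list \<Rightarrow> rcd list \<Rightarrow> rcd list \<Rightarrow> rcd \<Rightarrow> bool" where
  "w_entry D F N g \<longleftrightarrow> f1 g \<notin> set (map (\<lambda>h. f1 h) N) \<and>
    (if f0 g = FF then w_const D (f2 g) else if f0 g = FT then [TF, f2 g] \<in> set F
     else (\<exists>h \<in> set N. f1 h = f2 g \<and> [w_kind h, w_subj h, wEx (f3 g) (f4 g)] \<in> set F))"

definition w_atom :: "rcd list \<Rightarrow> rcd list \<Rightarrow> rcd list \<Rightarrow> rcd list \<Rightarrow> rcd \<Rightarrow> bool" where
  "w_atom D F N M r = (if f0 r = [False]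
    then (\<exists>m \<in> set M. \<exists>g \<in> set N. f0 m = f2 r \<and> f1 g = f1 m \<and> [w_kind g, w_subj g, wName (f1 r)] \<in> set F)
    else (\<exists>m \<in> set M. \<exists>m' \<in> set M. \<exists>g \<in> set N. \<exists>g' \<in> set N. f0 m = f2 r \<and> f0 m' = f3 r \<and>
      f1 g = f1 m \<and> f1 g' = f1 m' \<and>
      ((g = [FF, f1 g, f2 g] \<and> g' = [FF, f1 g', f2 g'] \<and>
         (\<exists>d \<in> set D. d = [[True], f1 d, f2 g, f2 g'] \<and> [TT, f1 d, f1 r] \<in> set F)) \<or>
       (g' = [TT, f1 g', f1 g, f3 g', f4 g'] \<and> [TT, f3 g', f1 r] \<in> set F))))"

definition w_query :: "rcd list \<Rightarrow> rcd list \<Rightarrow> rcd list \<Rightarrow> rcd list \<Rightarrow> rcd list \<Rightarrow> rcd list \<Rightarrow> bool" where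
  "w_query D F N M R B \<longleftrightarrow>
    (\<forall>m \<in> set M. f1 m \<in> set (map (\<lambda>h. f1 h) N) \<and> (\<forall>m' \<in> set M. f0 m = f0 m' \<longrightarrow> f1 m = f1 m')) \<and>
    (\<forall>r \<in> set R. f0 r \<in> set (map (\<lambda>m. f0 m) M)) \<and> (\<forall>a \<in> set B. w_atom D F N M a)"

definition w_tuple :: "bool \<Rightarrow> rcd list \<Rightarrow> rcd list \<Rightarrow> rcd list \<Rightarrow> bool" where
  "w_tuple mu N M R \<longleftrightarrow>
    (\<forall>r \<in> set R. f3 r = [False] \<longrightarrow> (\<exists>m \<in> set M. f0 m = f0 r \<and> [FF, f1 m, f4 r] \<in> set N)) \<and>
    (mu \<longrightarrow> (\<forall>r \<in> set R. \<forall>r' \<in> set R. f3 r = f3 r' \<and> f4 r = f4 r' \<longrightarrow>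
      (\<exists>m \<in> set M. f0 m = f0 r \<and> [f0 r', f1 m] \<in> set M)))"

definition w_slots :: "bool \<Rightarrow> rcd list \<Rightarrow> rcd list \<Rightarrow> bool" where
  "w_slots mu D R \<longleftrightarrow> (\<forall>r \<in> set R. f3 r = [False] \<longrightarrow> w_const D (f4 r)) \<and>
    (if mu then justified (\<lambda>P r. f3 r = [True] \<and> f4 r \<noteq> [] \<longrightarrow> (\<exists>p \<in> set P. f3 p = [True] \<and> f4 r = inc (f4 p))) R
     else (\<forall>r \<in> set R. (f3 r = [True] \<longrightarrow> f4 r = []) \<and> (f1 r = [True] \<longrightarrow> f2 r = [])))"

text \<open>A row consists of an answer variable, the slot of the input tuple and the slot of the
  tuple certified to be a partial answer. The switch \<open>B\<close> asks for a strictly smaller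
  tuple; without it the two tuples coincide.\<close>

definition w_smaller :: "bool \<Rightarrow> bool \<Rightarrow> rcd list \<Rightarrow> bool" where
  "w_smaller mu B R = (if B
    then (\<forall>r \<in> set R. (f3 r = f1 r \<and> f4 r = f2 r) \<or> f1 r = [True]) \<and>
      (mu \<longrightarrow> (\<forall>r \<in> set R. \<forall>r' \<in> set R. f1 r = f1 r' \<and> f2 r = f2 r' \<longrightarrow> f3 r = f3 r' \<and> f4 r = f4 r')) \<and>
      (\<exists>r \<in> set R. \<not> (f3 r = f1 r \<and> f4 r = f2 r))
    else (\<forall>r \<in> set R. f3 r = f1 r \<and> f4 r = f2 r))"

definition w_sig :: "rcd list \<Rightarrow> rcd list \<Rightarrow> rcd list \<Rightarrow> bool" where
  "w_sig D cs rs \<longleftrightarrow> (\<forall>d \<in> set D. if f0 d = [False] then [[], f1 d] \<in> set cs else [[], f1 d] \<in> set rs)"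

text \<open>Instead of parsing its input, the verifier encodes the parsed form supplied by the
  certificate and compares the result with the input.\<close>

definition w_input :: "bool \<Rightarrow> rcd list \<Rightarrow> rcd list \<Rightarrow> rcd list \<Rightarrow> rcd list \<Rightarrow> rcd list \<Rightarrow> rcd list \<Rightarrow> bool list" where
  "w_input mu Ow cs rs B D R =
    wlist (map flat_inclusion Ow) @ wlist (map flat cs) @ wlist (map flat rs) @
    wlist (map (\<lambda>r. self_delim (f0 r)) R) @ wlist (map flat B) @ wlist (map flat D) @
    wlist (map (\<lambda>r. wslot mu (f1 r) (f2 r)) R)"

definition w_valid :: "bool \<Rightarrow> rcd list \<Rightarrow> rcd list \<Rightarrow> rcd list \<Rightarrow> rcd list \<Rightarrow> rcd list \<Rightarrow> rcd list \<Rightarrow>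
    rcd list \<Rightarrow> rcd list \<Rightarrow> rcd list \<Rightarrow> rcd list \<Rightarrow> bool" where
  "w_valid el Ow cs rs B D R T F N M \<longleftrightarrow> (\<forall>r \<in> set T. v_shape T r) \<and>
    (\<forall>r \<in> set Ow. v_inclusion T r \<and> (el \<longrightarrow> f0 r = [False])) \<and> (\<forall>r \<in> set cs. v_name r) \<and> (\<forall>r \<in> set rs. v_name r) \<and>
    (\<forall>r \<in> set B. v_atom r) \<and> (\<forall>r \<in> set D. v_atom r) \<and> (\<forall>r \<in> set R. v_row r) \<and>
    (\<forall>r \<in> set F. v_fact T r) \<and> (\<forall>r \<in> set N. v_node T r) \<and> (\<forall>r \<in> set M. v_pair r)"

definition w_check :: "bool \<Rightarrow> bool \<Rightarrow> rcd list \<Rightarrow> rcd list \<Rightarrow> rcd list \<Rightarrow> rcd list \<Rightarrow> rcd list \<Rightarrow>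
    rcd list \<Rightarrow> rcd list \<Rightarrow> rcd list \<Rightarrow> rcd list \<Rightarrow> rcd list \<Rightarrow> bool" where
  "w_check mu Bo Ow cs rs B D R T F N M \<longleftrightarrow> justified (w_derives Ow D T) F \<and> justified (w_entry D F) N \<and>
    w_query D F N M R B \<and> w_tuple mu N M R \<and> w_slots mu D R \<and> w_smaller mu Bo R \<and> w_sig D cs rs"

definition cert_check :: "bool \<Rightarrow> bool \<Rightarrow> bool \<Rightarrow> bool list \<Rightarrow> rcd list list \<Rightarrow> bool" where
  "cert_check el mu Bo x c \<longleftrightarrow> (let Ow = hd0 c; cs = hd0 (tl c); rs = hd0 (tl (tl c)); B = hd0 (tl (tl (tl c)));
      D = hd0 (tl (tl (tl (tl c)))); R = hd0 (tl (tl (tl (tl (tl c))))); T = hd0 (tl (tl (tl (tl (tl (tl c))))));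
      F = hd0 (tl (tl (tl (tl (tl (tl (tl c))))))); N = hd0 (tl (tl (tl (tl (tl (tl (tl (tl c))))))));
      M = hd0 (tl (tl (tl (tl (tl (tl (tl (tl (tl c)))))))))
    in x = w_input mu Ow cs rs B D R \<and> w_valid el Ow cs rs B D R T F N M \<and> w_check mu Bo Ow cs rs B D R T F N M)"

section \<open>The verifier runs in polynomial time\<close>

lemmas pt_more = pt_intros pt_case_list

lemma pt_shape_word: "pt shape_word"
  unfolding shape_word_def wName_def wAnd_def wEx_def by (intro pt_intros)

lemma pt_canon: "pt canon"
  unfolding canon_def by (intro pt_more)

lemma pt_inc: "pt inc"
  unfolding inc_def Let_def
proof -
  have "pt (\<lambda>w :: bool list. foldl (\<lambda>a b. if fst a then (b, (\<not> b) # snd a) else (False, b # snd a)) (True, []) w)"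
  proof (rule pt_foldl_additive[where p = "\<lambda>_. 3"])
    show "esize (if fst a then (b, (\<not> b) # snd a) else (False, b # snd a)) \<le> esize a + 3"
      for x :: "bool list" and a :: "bool \<times> bool list" and b
      by (cases a) auto
  qed (intro pt_intros polyb_const)+
  then show "pt (\<lambda>w. rev (snd (foldl (\<lambda>a b. if fst a then (b, (\<not> b) # snd a) else (False, b # snd a)) (True, []) w)) @
    (if fst (foldl (\<lambda>a b. if fst a then (b, (\<not> b) # snd a) else (False, b # snd a)) (True, []) w) then [True] else []))"
    by (intro pt_rev pt_append pt_If pt_fst pt_snd pt_const)
qed

lemma pt_flat: "pt flat"
  unfolding flat_def by (intro pt_intros)

lemma pt_flat_inclusion: "pt flat_inclusion"
  unfolding flat_inclusion_def by (intro pt_intros pt_comp[OF pt_flat])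

lemma pt_wlist: "pt wlist"
  unfolding wlist_def by (intro pt_intros)

lemma pt_wslot: "pt (\<lambda>z. wslot mu (fst z) (snd z))"
  unfolding wslot_def by (intro pt_intros)

lemma pt_w_const: "pt (\<lambda>z. w_const (fst z) (snd z))"
  unfolding w_const_def by (intro pt_intros)

lemmas pt_words = pt_comp[OF pt_shape_word] pt_comp[OF pt_canon] pt_comp[OF pt_inc]
  pt_comp[OF pt_flat] pt_comp[OF pt_flat_inclusion] pt_comp[OF pt_wlist]

text \<open>\<open>pt\<close> concerns functions of one argument. These rules allow a predicate
  treated once on tuples to be applied to arbitrary polynomial-time arguments.\<close>

lemma pt_comp2: "pt (\<lambda>z. f (fst z) (snd z)) \<Longrightarrow> pt a \<Longrightarrow> pt b \<Longrightarrow> pt (\<lambda>x. f (a x) (b x))"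
  using pt_comp[of "\<lambda>z. f (fst z) (snd z)" "\<lambda>x. (a x, b x)"] by (simp add: pt_Pair)

lemma pt_comp3: "pt (\<lambda>z. f (fst z) (fst (snd z)) (snd (snd z))) \<Longrightarrow> pt a \<Longrightarrow> pt b \<Longrightarrow> pt c \<Longrightarrow>
    pt (\<lambda>x. f (a x) (b x) (c x))"
  using pt_comp2[of "\<lambda>u v. f u (fst v) (snd v)" a "\<lambda>x. (b x, c x)"] by (simp add: pt_Pair)

lemma pt_comp4: "pt (\<lambda>z. f (fst z) (fst (snd z)) (fst (snd (snd z))) (snd (snd (snd z)))) \<Longrightarrow>
    pt a \<Longrightarrow> pt b \<Longrightarrow> pt c \<Longrightarrow> pt d \<Longrightarrow> pt (\<lambda>x. f (a x) (b x) (c x) (d x))"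
  using pt_comp3[of "\<lambda>u v w. f u v (fst w) (snd w)" a b "\<lambda>x. (c x, d x)"] by (simp add: pt_Pair)

lemma pt_comp5: "pt (\<lambda>z. f (fst z) (fst (snd z)) (fst (snd (snd z))) (fst (snd (snd (snd z)))) (snd (snd (snd (snd z))))) \<Longrightarrow>
    pt a \<Longrightarrow> pt b \<Longrightarrow> pt c \<Longrightarrow> pt d \<Longrightarrow> pt e \<Longrightarrow> pt (\<lambda>x. f (a x) (b x) (c x) (d x) (e x))"
  using pt_comp4[of "\<lambda>u v w t. f u v w (fst t) (snd t)" a b c "\<lambda>x. (d x, e x)"] by (simp add: pt_Pair)

lemma pt_comp6: "pt (\<lambda>z. f (fst z) (fst (snd z)) (fst (snd (snd z))) (fst (snd (snd (snd z)))) (fst (snd (snd (snd (snd z)))))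
      (snd (snd (snd (snd (snd z)))))) \<Longrightarrow>
    pt a \<Longrightarrow> pt b \<Longrightarrow> pt c \<Longrightarrow> pt d \<Longrightarrow> pt e \<Longrightarrow> pt g \<Longrightarrow> pt (\<lambda>x. f (a x) (b x) (c x) (d x) (e x) (g x))"
  using pt_comp5[of "\<lambda>u v w t s. f u v w t (fst s) (snd s)" a b c d "\<lambda>x. (e x, g x)"] by (simp add: pt_Pair)

lemma pt_comp7: "pt (\<lambda>z. f (fst z) (fst (snd z)) (fst (snd (snd z))) (fst (snd (snd (snd z)))) (fst (snd (snd (snd (snd z)))))
      (fst (snd (snd (snd (snd (snd z)))))) (snd (snd (snd (snd (snd (snd z))))))) \<Longrightarrow>
    pt a \<Longrightarrow> pt b \<Longrightarrow> pt c \<Longrightarrow> pt d \<Longrightarrow> pt e \<Longrightarrow> pt g \<Longrightarrow> pt h \<Longrightarrow>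
    pt (\<lambda>x. f (a x) (b x) (c x) (d x) (e x) (g x) (h x))"
  using pt_comp6[of "\<lambda>u v w t s r. f u v w t s (fst r) (snd r)" a b c d e "\<lambda>x. (g x, h x)"] by (simp add: pt_Pair)

lemmas pt_wslot' = pt_comp2[OF pt_wslot]
lemmas pt_w_const' = pt_comp2[OF pt_w_const]

lemma pt_v_shape: "pt (\<lambda>z. v_shape (fst z) (snd z))"
  unfolding v_shape_def by (intro pt_intros pt_words)

lemma pt_v_inclusion: "pt (\<lambda>z. v_inclusion (fst z) (snd z))"
  unfolding v_inclusion_def by (intro pt_intros pt_words)

lemma pt_v_name: "pt v_name"
  unfolding v_name_def by (intro pt_intros pt_words)

lemma pt_v_atom: "pt v_atom"
  unfolding v_atom_def by (intro pt_intros pt_words)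

lemma pt_v_fact: "pt (\<lambda>z. v_fact (fst z) (snd z))"
  unfolding v_fact_def by (intro pt_intros pt_words)

lemma pt_v_node: "pt (\<lambda>z. v_node (fst z) (snd z))"
  unfolding v_node_def by (intro pt_intros pt_words)

lemma pt_v_pair: "pt v_pair"
  unfolding v_pair_def by (intro pt_intros pt_words)

lemma pt_v_row: "pt v_row"
  unfolding v_row_def by (intro pt_intros pt_words)

lemma pt_w_FR: "pt (\<lambda>z. w_FR (fst z) (fst (snd z)) (fst (snd (snd z))) (snd (snd (snd z))))"
  unfolding w_FR_def by (intro pt_intros)

lemma pt_w_FN: "pt (\<lambda>z. w_FN (fst z) (fst (snd z)) (snd (snd z)))"
  unfolding w_FN_def by (intro pt_intros pt_words)

lemma pt_w_FA: "pt (\<lambda>z. w_FA (fst z) (fst (snd z)) (fst (snd (snd z))) (fst (snd (snd (snd z))))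
  (fst (snd (snd (snd (snd z))))) (fst (snd (snd (snd (snd (snd z)))))) (snd (snd (snd (snd (snd (snd z)))))))"
  unfolding w_FA_def wName_def wAnd_def wEx_def
  by (intro pt_intros pt_words pt_w_const')

lemma pt_w_derives: "pt (\<lambda>z. w_derives (fst z) (fst (snd z)) (fst (snd (snd z))) (fst (snd (snd (snd z))))
  (snd (snd (snd (snd z)))))"
  unfolding w_derives_def by (intro pt_intros pt_comp4[OF pt_w_FR] pt_comp3[OF pt_w_FN] pt_comp7[OF pt_w_FA])

lemma pt_w_entry: "pt (\<lambda>z. w_entry (fst z) (fst (snd z)) (fst (snd (snd z))) (snd (snd (snd z))))"
  unfolding w_entry_def w_kind_def w_subj_def wEx_def by (intro pt_intros pt_w_const')

lemma pt_w_atom: "pt (\<lambda>z. w_atom (fst z) (fst (snd z)) (fst (snd (snd z))) (fst (snd (snd (snd z))))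
  (snd (snd (snd (snd z)))))"
  unfolding w_atom_def w_kind_def w_subj_def wName_def by (intro pt_intros)

lemma pt_w_query: "pt (\<lambda>z. w_query (fst z) (fst (snd z)) (fst (snd (snd z))) (fst (snd (snd (snd z))))
  (fst (snd (snd (snd (snd z))))) (snd (snd (snd (snd (snd z))))))"
  unfolding w_query_def by (intro pt_intros pt_comp5[OF pt_w_atom])

lemma pt_w_tuple: "pt (\<lambda>z. w_tuple mu (fst z) (fst (snd z)) (snd (snd z)))"
  unfolding w_tuple_def by (intro pt_intros)

lemma pt_w_slots: "pt (\<lambda>z. w_slots mu (fst z) (snd z))"
  unfolding w_slots_def by (intro pt_intros pt_w_const' pt_words)

lemma pt_w_smaller: "pt (w_smaller mu B)"
  unfolding w_smaller_def by (intro pt_intros)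

lemma pt_w_sig: "pt (\<lambda>z. w_sig (fst z) (fst (snd z)) (snd (snd z)))"
  unfolding w_sig_def by (intro pt_intros)

lemma pt_cert_check: "pt (\<lambda>z. cert_check el mu Bo (fst z) (snd z))"
  unfolding cert_check_def Let_def w_input_def w_valid_def w_check_def
  by (intro pt_intros pt_words pt_wslot' pt_comp2[OF pt_v_shape] pt_comp2[OF pt_v_inclusion]
      pt_comp[OF pt_v_name] pt_comp[OF pt_v_atom] pt_comp2[OF pt_v_fact] pt_comp2[OF pt_v_node]
      pt_comp[OF pt_v_pair] pt_comp[OF pt_v_row] pt_comp5[OF pt_w_derives] pt_comp4[OF pt_w_entry]
      pt_comp6[OF pt_w_query] pt_comp3[OF pt_w_tuple] pt_comp2[OF pt_w_slots] pt_comp[OF pt_w_smaller]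
      pt_comp3[OF pt_w_sig])

section \<open>Correctness of the checks on records\<close>

lemma bits_eq_iff [simp]: "bits m = bits n \<longleftrightarrow> m = n"
  using bits_inject by blast

lemma enc_concept_eq_iff [simp]: "enc_concept B = enc_concept C \<longleftrightarrow> B = C"
  using prefix_freeD[OF prefix_free_concept, of B "[]" C "[]"] by simp

lemma bits_0 [simp]: "bits 0 = []"
  by (subst bits.simps) simp

lemma bits_eq_Nil [simp]: "bits n = [] \<longleftrightarrow> n = 0"
  using bits_inject[of n 0] by auto

lemma bits_pos: "0 < n \<Longrightarrow> bits n = odd n # bits (n div 2)"
  by (subst bits.simps) simp

lemma canon_iff: "canon w \<longleftrightarrow> w = [] \<or> last w"
  by (cases w rule: rev_cases) (auto simp: canon_def)

lemma canon_bits: "canon (bits n)"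
proof (induction n rule: less_induct)
  case (less n)
  show ?case
  proof (cases "n \<le> 1")
    case True
    then consider "n = 0" | "n = 1" by linarith
    then show ?thesis by cases (simp_all add: canon_iff bits_pos)
  next
    case False
    then have "canon (bits (n div 2))" "bits (n div 2) \<noteq> []" using less by auto
    then show ?thesis using False by (simp add: canon_iff bits_pos[of n] del: bits_eq_Nil)
  qed
qed

lemma canonD: "canon w \<Longrightarrow> \<exists>n. w = bits n"
proof (induction w)
  case Nil
  show ?case by (rule exI[of _ 0]) simp
next
  case (Cons b w)
  show ?case
  proof (cases "w = []")
    case True
    with Cons.prems have "b" by (simp add: canon_iff)
    with True show ?thesis by (intro exI[of _ 1]) (simp add: bits_pos)
  next
    case False
    then have "canon w" using Cons.prems by (simp add: canon_iff)
    with Cons.IH obtain n where n: "w = bits n" by blast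
    with False have "n \<noteq> 0" by auto
    then show ?thesis by (intro exI[of _ "2 * n + of_bool b"]) (simp add: bits_pos n)
  qed
qed

lemma inc_bits: "inc (bits n) = bits (Suc n)"
proof -
  define g :: "bool \<times> bool list \<Rightarrow> bool \<Rightarrow> bool \<times> bool list" where
    "g = (\<lambda>a b. if fst a then (b, (\<not> b) # snd a) else (False, b # snd a))"
  have g: "g (True, u) b = (b, (\<not> b) # u)" "g (False, u) b = (False, b # u)" for u b
    by (simp_all add: g_def)
  have F: "foldl g (False, u) w = (False, rev w @ u)" for u w
    by (induction w arbitrary: u) (auto simp: g)
  have "rev (snd (foldl g (True, u) (bits n))) @ (if fst (foldl g (True, u) (bits n)) then [True] else []) = rev u @ bits (Suc n)" for u
  proof (induction n arbitrary: u rule: less_induct)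
    case (less n)
    show ?case
    proof (cases "n = 0")
      case True
      then show ?thesis by (simp add: bits_pos)
    next
      case False
      then have n: "bits n = odd n # bits (n div 2)" by (simp add: bits_pos)
      show ?thesis
      proof (cases "odd n")
        case True
        then have "bits (Suc n) = False # bits (Suc (n div 2))" by (simp add: bits_pos)
        with less[of "n div 2" "False # u"] False True show ?thesis by (simp add: n g)
      next
        case ev: False
        then have "bits (Suc n) = True # bits (n div 2)" by (simp add: bits_pos)
        with ev show ?thesis by (simp add: n g F)
      qed
    qed
  qed
  from this[of "[]"] show ?thesis by (simp add: inc_def g_def Let_def)
qed

lemma wName_bits [simp]: "wName (bits A) = enc_concept (Name A)"
  by (simp add: wName_def enc_nat_def)

lemma wAnd_enc [simp]: "wAnd (enc_concept B) (enc_concept C) = enc_concept (And B C)"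
  by (simp add: wAnd_def)

lemma wEx_enc [simp]: "wEx (bits r) (enc_concept C) = enc_concept (Ex r C)"
  by (simp add: wEx_def enc_nat_def)

text \<open>The functions with prefix \<open>e_\<close> produce the records of genuine objects. The
  checks are analysed on such records only, because the validity checks enforce this form.\<close>

fun e_shape :: "concept \<Rightarrow> rcd" where
  "e_shape Top = [FF]"
| "e_shape (Name A) = [FT, bits A]"
| "e_shape (And B C) = [TF, enc_concept B, enc_concept C]"
| "e_shape (Ex r C) = [TT, bits r, enc_concept C]"

fun e_inclusion :: "inclusion \<Rightarrow> rcd" where
  "e_inclusion (CI B C) = [[False], enc_concept B, enc_concept C]"
| "e_inclusion (RI r s) = [[True], bits r, bits s]"

definition e_name :: "nat \<Rightarrow> rcd" where
  "e_name n = [[], bits n]"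

fun e_atom :: "nat atom \<Rightarrow> rcd" where
  "e_atom (CAtom A x) = [[False], bits A, bits x]"
| "e_atom (RAtom r x y) = [[True], bits r, bits x, bits y]"

fun s_kind :: "subj \<Rightarrow> bool list" where
  "s_kind (SC c) = FF"
| "s_kind (SN C) = FT"

fun s_word :: "subj \<Rightarrow> bool list" where
  "s_word (SC c) = bits c"
| "s_word (SN C) = enc_concept C"

fun e_fact :: "fact \<Rightarrow> rcd" where
  "e_fact (FA X C) = [s_kind X, s_word X, enc_concept C]"
| "e_fact (FN C) = [TF, enc_concept C]"
| "e_fact (FR r s) = [TT, bits r, bits s]"

fun e_entry :: "nat \<Rightarrow> entry \<Rightarrow> rcd" where
  "e_entry n (EConst c) = [FF, bits n, bits c]"
| "e_entry n (ERoot C) = [FT, bits n, enc_concept C]"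
| "e_entry n (EChild p r C) = [TT, bits n, bits p, bits r, enc_concept C]"

definition e_node :: "nat \<times> entry \<Rightarrow> rcd" where
  "e_node g = e_entry (fst g) (snd g)"

definition e_pair :: "nat \<times> nat \<Rightarrow> rcd" where
  "e_pair m = [bits (fst m), bits (snd m)]"

type_synonym row = "nat \<times> slot \<times> slot"

definition e_row :: "row \<Rightarrow> rcd" where
  "e_row r = [bits (fst r), [fst (fst (snd r))], bits (snd (fst (snd r))),
    [fst (snd (snd r))], bits (snd (snd (snd r)))]"

lemma s_eq: "s_kind X = s_kind Y \<and> s_word X = s_word Y \<longleftrightarrow> X = Y"
  by (cases X; cases Y) auto

lemma s_eqD: "s_kind X = s_kind Y \<Longrightarrow> s_word X = s_word Y \<Longrightarrow> X = Y"
  using s_eq by blast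

lemma s_kind_neq [simp]: "s_kind X \<noteq> TF" "s_kind X \<noteq> TT" "TF \<noteq> s_kind X" "TT \<noteq> s_kind X"
  by (cases X; simp)+

lemma shape_word_e_shape [simp]: "shape_word (e_shape C) = enc_concept C"
  by (cases C) (simp_all add: shape_word_def)

lemma e_inclusion_inject [simp]: "e_inclusion a = e_inclusion b \<longleftrightarrow> a = b"
  by (cases a; cases b) auto

lemma e_name_inject [simp]: "e_name a = e_name b \<longleftrightarrow> a = b"
  by (auto simp: e_name_def)

lemma e_atom_inject [simp]: "e_atom a = e_atom b \<longleftrightarrow> a = b"
  by (cases a; cases b) auto

lemma e_fact_inject [simp]: "e_fact a = e_fact b \<longleftrightarrow> a = b"
  by (cases a; cases b) (auto dest: s_eqD)

lemma e_node_inject [simp]: "e_node a = e_node b \<longleftrightarrow> a = b"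
  by (cases a; cases b; cases "snd a"; cases "snd b") (auto simp: e_node_def)

lemma e_pair_inject [simp]: "e_pair a = e_pair b \<longleftrightarrow> a = b"
  by (cases a; cases b) (auto simp: e_pair_def)

lemma mem_map: "(\<And>a b. e a = e b \<longleftrightarrow> a = b) \<Longrightarrow> e a \<in> set (map e xs) \<longleftrightarrow> a \<in> set xs"
  by auto

lemma Bex_map: "(\<exists>y \<in> set (map e xs). P y) \<longleftrightarrow> (\<exists>x \<in> set xs. P (e x))"
  by auto

lemma Ball_map: "(\<forall>y \<in> set (map e xs). P y) \<longleftrightarrow> (\<forall>x \<in> set xs. P (e x))"
  by auto

fun fact_concepts :: "fact \<Rightarrow> concept set" where
  "fact_concepts (FA (SC c) C) = {C}"
| "fact_concepts (FA (SN B) C) = {B, C}"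
| "fact_concepts (FN C) = {C}"
| "fact_concepts (FR r s) = {}"

lemma fact_concepts_FA: "C \<in> fact_concepts (FA X C)"
  by (cases X) auto

lemma w_const_iff: "w_const (map e_atom D) (bits c) \<longleftrightarrow> c \<in> adom D"
proof -
  have "bits c \<in> set (tl (tl (e_atom a))) \<longleftrightarrow> c \<in> set_atom a" for a by (cases a) auto
  then show ?thesis by (simp add: w_const_def adom_def)
qed

lemma e_inclusion_iff:
  "e_inclusion a = [[False], u, enc_concept C] \<longleftrightarrow> (\<exists>B. a = CI B C \<and> u = enc_concept B)"
  "[[False], enc_concept B, enc_concept C] = e_inclusion a \<longleftrightarrow> a = CI B C"
  "[[True], bits r, bits s] = e_inclusion a \<longleftrightarrow> a = RI r s"
  by (cases a; auto)+

lemma e_fact_iff: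
  "e_fact f = [s_kind X, s_word X, w] \<longleftrightarrow> (\<exists>C. f = FA X C \<and> w = enc_concept C)"
  "e_fact f = [FF, bits c, w] \<longleftrightarrow> (\<exists>C. f = FA (SC c) C \<and> w = enc_concept C)"
  "e_fact f = [FT, enc_concept B, w] \<longleftrightarrow> (\<exists>C. f = FA (SN B) C \<and> w = enc_concept C)"
  "e_fact f = [FF, u, enc_concept C] \<longleftrightarrow> (\<exists>c. f = FA (SC c) C \<and> u = bits c)"
  "e_fact f = [FT, u, enc_concept C] \<longleftrightarrow> (\<exists>B. f = FA (SN B) C \<and> u = enc_concept B)"
  "e_fact f = [TF, w] \<longleftrightarrow> (\<exists>C. f = FN C \<and> w = enc_concept C)"
  "e_fact f = [TT, bits r, w] \<longleftrightarrow> (\<exists>s. f = FR r s \<and> w = bits s)"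
proof -
  show X: "e_fact f = [s_kind X, s_word X, w] \<longleftrightarrow> (\<exists>C. f = FA X C \<and> w = enc_concept C)" for X
    by (cases f) (auto dest: s_eqD)
  show "e_fact f = [FF, bits c, w] \<longleftrightarrow> (\<exists>C. f = FA (SC c) C \<and> w = enc_concept C)"
    using X[of "SC c"] by simp
  show "e_fact f = [FT, enc_concept B, w] \<longleftrightarrow> (\<exists>C. f = FA (SN B) C \<and> w = enc_concept C)"
    using X[of "SN B"] by simp
  show "e_fact f = [FF, u, enc_concept C] \<longleftrightarrow> (\<exists>c. f = FA (SC c) C \<and> u = bits c)"
  proof (cases f)
    case (FA X E)
    then show ?thesis by (cases X) auto
  qed auto
  show "e_fact f = [FT, u, enc_concept C] \<longleftrightarrow> (\<exists>B. f = FA (SN B) C \<and> u = enc_concept B)"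
  proof (cases f)
    case (FA X E)
    then show ?thesis by (cases X) auto
  qed auto
  show "e_fact f = [TF, w] \<longleftrightarrow> (\<exists>C. f = FN C \<and> w = enc_concept C)"
    "e_fact f = [TT, bits r, w] \<longleftrightarrow> (\<exists>s. f = FR r s \<and> w = bits s)"
    by (cases f; auto)+
qed

lemma e_shape_iff:
  "e_shape C = [TF, u, w] \<longleftrightarrow> (\<exists>A B. C = And A B \<and> u = enc_concept A \<and> w = enc_concept B)"
  "e_shape C = [TT, u, w] \<longleftrightarrow> (\<exists>r B. C = Ex r B \<and> u = bits r \<and> w = enc_concept B)"
  by (cases C; auto)+

lemma e_atom_iff:
  "e_atom a = [[False], u, bits x] \<longleftrightarrow> (\<exists>A. a = CAtom A x \<and> u = bits A)"
  "e_atom a = [[True], u, bits x, w] \<longleftrightarrow> (\<exists>r y. a = RAtom r x y \<and> u = bits r \<and> w = bits y)"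
  by (cases a; auto)+

lemma enc_concept_Top: "enc_concept C = FF \<longleftrightarrow> C = Top"
  using enc_concept_eq_iff[of C Top] by simp

lemmas e_iff = e_inclusion_iff e_fact_iff e_shape_iff e_atom_iff enc_concept_Top
lemmas no_e = e_inclusion.simps e_fact.simps e_shape.simps e_atom.simps enc_concept.simps s_kind.simps

lemma w_FR_iff: "w_FR (map e_inclusion Ont) (map e_fact F) (bits r) (bits s) \<longleftrightarrow> derives Ont D (set F) (FR r s)"
proof -
  have "(\<exists>g \<in> set (map e_fact F). g = [TT, bits r, f2 g] \<and> [[True], f2 g, bits s] \<in> set (map e_inclusion Ont)) \<longleftrightarrow>
    (\<exists>t. FR r t \<in> set F \<and> RI t s \<in> set Ont)"
    unfolding Bex_map e_iff by (auto simp: image_iff e_iff simp del: no_e) (force simp: e_iff simp del: e_inclusion.simps)+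
  then show ?thesis by (simp add: w_FR_def del: set_map)
qed


text \<open>The table has to list the concepts of the facts: a premise \<open>FN (Ex r C)\<close> is
  recognised only through the shape record of \<open>Ex r C\<close>.\<close>

lemma w_FN_iff:
  assumes F: "\<And>f. f \<in> set F \<Longrightarrow> fact_concepts f \<subseteq> set Cs"
  shows "w_FN (map e_shape Cs) (map e_fact F) (enc_concept C) \<longleftrightarrow> derives Ont D (set F) (FN C)"
proof -
  let ?F = "map e_fact F"
  have 1: "(\<exists>g \<in> set ?F. g = [FF, f1 g, enc_concept C]) \<longleftrightarrow> (\<exists>c. FA (SC c) C \<in> set F)"
    unfolding Bex_map e_iff by (auto simp del: no_e) (force simp: e_iff)
  have 2: "(\<exists>g \<in> set ?F. g = [FT, f1 g, enc_concept C] \<and> [TF, f1 g] \<in> set ?F) \<longleftrightarrow>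
    (\<exists>B. FN B \<in> set F \<and> FA (SN B) C \<in> set F)"
  proof -
    have "(\<exists>g \<in> set ?F. g = [FT, f1 g, enc_concept C] \<and> [TF, f1 g] \<in> set ?F) \<longleftrightarrow>
      (\<exists>g \<in> set F. \<exists>B. g = FA (SN B) C \<and> e_fact (FN B) \<in> set ?F)"
      unfolding Bex_map e_iff by (intro bex_cong refl) auto
    also have "\<dots> \<longleftrightarrow> (\<exists>B. FN B \<in> set F \<and> FA (SN B) C \<in> set F)"
      unfolding mem_map[of e_fact, OF e_fact_inject] by auto
    finally show ?thesis .
  qed
  have 3: "(\<exists>g \<in> set ?F. \<exists>t \<in> set (map e_shape Cs). g = [TF, shape_word t] \<and> t = [TT, f1 t, enc_concept C]) \<longleftrightarrow>
    (\<exists>r. FN (Ex r C) \<in> set F)"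
  proof -
    have "(\<exists>g \<in> set ?F. \<exists>t \<in> set (map e_shape Cs). g = [TF, shape_word t] \<and> t = [TT, f1 t, enc_concept C]) \<longleftrightarrow>
      (\<exists>g \<in> set F. \<exists>t \<in> set Cs. g = FN t \<and> (\<exists>r. t = Ex r C))"
      unfolding Bex_map e_iff by (intro bex_cong refl) auto
    also have "\<dots> \<longleftrightarrow> (\<exists>r. FN (Ex r C) \<in> set F)"
    proof -
      have "B \<in> set Cs" if "FN B \<in> set F" for B using F[OF that] by simp
      then show ?thesis by blast
    qed
    finally show ?thesis .
  qed
  show ?thesis unfolding w_FN_def 1 2 3 enc_concept_Top by auto
qed

text \<open>The eight disjuncts of \<open>w_FA\<close> are matched with the rules of
  \<open>derives\<close> in the same order. Existential quantifiers over concepts turn into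
  quantifiers over facts and shape records.\<close>

lemma w_FA_iff:
  assumes F: "\<And>f. f \<in> set F \<Longrightarrow> fact_concepts f \<subseteq> set Cs" and E: "E \<in> set Cs"
  shows "w_FA (map e_inclusion Ont) (map e_atom D) (map e_shape Cs) (map e_fact F) (s_kind X) (s_word X) (enc_concept E)
    \<longleftrightarrow> derives Ont D (set F) (FA X E)"
proof -
  let ?k = "s_kind X" and ?a = "s_word X" and ?e = "enc_concept E"
  let ?F = "map e_fact F" and ?D = "map e_atom D" and ?T = "map e_shape Cs" and ?O = "map e_inclusion Ont"
  have FX: "C \<in> set Cs" if "FA Y C \<in> set F" for Y C
    using F[OF that] fact_concepts_FA[of C Y] by blast
  have 1: "?k = FT \<and> ?a = ?e \<longleftrightarrow> X = SN E" by (cases X) auto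
  have 2: "?e = FF \<and> (?k = FF \<longrightarrow> w_const ?D ?a) \<longleftrightarrow> E = Top \<and> subj_ok D X"
    unfolding enc_concept_Top by (cases X) (auto simp: w_const_iff)
  have 3: "(\<exists>d \<in> set ?D. ?k = FF \<and> d = [[False], f1 d, ?a] \<and> ?e = wName (f1 d)) \<longleftrightarrow>
    (\<exists>A c. X = SC c \<and> E = Name A \<and> CAtom A c \<in> set D)"
  proof (cases X)
    case (SC c)
    have "(\<exists>d \<in> set ?D. ?k = FF \<and> d = [[False], f1 d, ?a] \<and> ?e = wName (f1 d)) \<longleftrightarrow>
      (\<exists>d \<in> set D. \<exists>A. d = CAtom A c \<and> E = Name A)"
      unfolding Bex_map SC s_kind.simps s_word.simps e_iff
      by (intro bex_cong refl) (auto simp del: enc_concept.simps)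
    also have "\<dots> \<longleftrightarrow> (\<exists>A c. X = SC c \<and> E = Name A \<and> CAtom A c \<in> set D)" using SC by auto
    finally show ?thesis .
  qed auto
  have 4: "(\<exists>g \<in> set ?F. \<exists>h \<in> set ?F. g = [?k, ?a, f2 g] \<and> h = [?k, ?a, f2 h] \<and> ?e = wAnd (f2 g) (f2 h)) \<longleftrightarrow>
    (\<exists>B C. E = And B C \<and> FA X B \<in> set F \<and> FA X C \<in> set F)"
  proof -
    have "(\<exists>g \<in> set ?F. \<exists>h \<in> set ?F. g = [?k, ?a, f2 g] \<and> h = [?k, ?a, f2 h] \<and> ?e = wAnd (f2 g) (f2 h)) \<longleftrightarrow>
      (\<exists>g \<in> set F. \<exists>h \<in> set F. \<exists>B C. g = FA X B \<and> h = FA X C \<and> E = And B C)"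
      unfolding Bex_map e_iff by (intro bex_cong refl) (auto simp del: enc_concept.simps)
    also have "\<dots> \<longleftrightarrow> (\<exists>B C. E = And B C \<and> FA X B \<in> set F \<and> FA X C \<in> set F)" by auto
    finally show ?thesis .
  qed
  have 5: "(\<exists>g \<in> set ?F. \<exists>t \<in> set ?T. g = [?k, ?a, shape_word t] \<and> (t = [TF, ?e, f2 t] \<or> t = [TF, f1 t, ?e])) \<longleftrightarrow>
    (\<exists>C. FA X (And E C) \<in> set F \<or> FA X (And C E) \<in> set F)"
  proof -
    have "(\<exists>g \<in> set ?F. \<exists>t \<in> set ?T. g = [?k, ?a, shape_word t] \<and> (t = [TF, ?e, f2 t] \<or> t = [TF, f1 t, ?e])) \<longleftrightarrow>
      (\<exists>g \<in> set F. \<exists>t \<in> set Cs. g = FA X t \<and> (\<exists>C. t = And E C \<or> t = And C E))"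
      unfolding Bex_map e_iff by (intro bex_cong refl) (auto simp del: enc_concept.simps)
    also have "\<dots> \<longleftrightarrow> (\<exists>C. FA X (And E C) \<in> set F \<or> FA X (And C E) \<in> set F)" using FX by blast
    finally show ?thesis .
  qed
  have 6: "(\<exists>g \<in> set ?F. g = [?k, ?a, f2 g] \<and> [[False], f2 g, ?e] \<in> set ?O) \<longleftrightarrow> (\<exists>C. FA X C \<in> set F \<and> CI C E \<in> set Ont)"
  proof -
    have "(\<exists>g \<in> set ?F. g = [?k, ?a, f2 g] \<and> [[False], f2 g, ?e] \<in> set ?O) \<longleftrightarrow>
      (\<exists>g \<in> set F. \<exists>C. g = FA X C \<and> e_inclusion (CI C E) \<in> set ?O)"
      unfolding Bex_map e_iff by (intro bex_cong refl) auto
    also have "\<dots> \<longleftrightarrow> (\<exists>C. FA X C \<in> set F \<and> CI C E \<in> set Ont)" unfolding mem_map[of e_inclusion, OF e_inclusion_inject] by auto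
    finally show ?thesis .
  qed
  have 7: "(\<exists>d \<in> set ?D. \<exists>g \<in> set ?F. \<exists>h \<in> set ?F. ?k = FF \<and> d = [[True], f1 d, ?a, f3 d] \<and> g = [TT, f1 d, f2 g] \<and>
      h = [FF, f3 d, f2 h] \<and> ?e = wEx (f2 g) (f2 h)) \<longleftrightarrow>
    (\<exists>c r c' s C. X = SC c \<and> E = Ex s C \<and> RAtom r c c' \<in> set D \<and> FR r s \<in> set F \<and> FA (SC c') C \<in> set F)"
  proof (cases X)
    case (SC c)
    have at: "e_atom d = [[True], f1 (e_atom d), bits c, f3 (e_atom d)] \<longleftrightarrow> (\<exists>r c'. d = RAtom r c c')" for d
      by (cases d) auto
    have "(\<exists>d \<in> set ?D. \<exists>g \<in> set ?F. \<exists>h \<in> set ?F. ?k = FF \<and> d = [[True], f1 d, ?a, f3 d] \<and> g = [TT, f1 d, f2 g] \<and>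
      h = [FF, f3 d, f2 h] \<and> ?e = wEx (f2 g) (f2 h)) \<longleftrightarrow>
      (\<exists>d \<in> set D. \<exists>g \<in> set F. \<exists>h \<in> set F. \<exists>r c' s C. d = RAtom r c c' \<and> g = FR r s \<and> h = FA (SC c') C \<and> E = Ex s C)"
      unfolding Bex_map SC s_kind.simps s_word.simps at
      by (intro bex_cong refl) (auto simp: e_fact_iff simp del: enc_concept.simps)
    also have "\<dots> \<longleftrightarrow> (\<exists>c r c' s C. X = SC c \<and> E = Ex s C \<and> RAtom r c c' \<in> set D \<and> FR r s \<in> set F \<and> FA (SC c') C \<in> set F)" using SC by blast
    finally show ?thesis .
  qed auto
  have 8: "(\<exists>g \<in> set ?F. \<exists>h \<in> set ?F. \<exists>l \<in> set ?F. \<exists>t \<in> set ?T. g = [?k, ?a, shape_word t] \<and> t = [TT, f1 t, f2 t] \<and>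
      h = [FT, f2 t, f2 h] \<and> l = [TT, f1 t, f2 l] \<and> ?e = wEx (f2 l) (f2 h)) \<longleftrightarrow>
    (\<exists>r B s C. E = Ex s C \<and> FA X (Ex r B) \<in> set F \<and> FA (SN B) C \<in> set F \<and> FR r s \<in> set F)"
  proof -
    have sh: "e_shape t = [TT, f1 (e_shape t), f2 (e_shape t)] \<longleftrightarrow> (\<exists>r B. t = Ex r B)" for t
      by (cases t) auto
    have "(\<exists>g \<in> set ?F. \<exists>h \<in> set ?F. \<exists>l \<in> set ?F. \<exists>t \<in> set ?T. g = [?k, ?a, shape_word t] \<and> t = [TT, f1 t, f2 t] \<and>
      h = [FT, f2 t, f2 h] \<and> l = [TT, f1 t, f2 l] \<and> ?e = wEx (f2 l) (f2 h)) \<longleftrightarrow>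
      (\<exists>g \<in> set F. \<exists>h \<in> set F. \<exists>l \<in> set F. \<exists>t \<in> set Cs. \<exists>r B s C. g = FA X t \<and> t = Ex r B \<and> h = FA (SN B) C \<and>
        l = FR r s \<and> E = Ex s C)"
      unfolding Bex_map sh
      by (intro bex_cong refl) (auto simp: e_fact_iff simp del: enc_concept.simps)
    also have "\<dots> \<longleftrightarrow> (\<exists>r B s C. E = Ex s C \<and> FA X (Ex r B) \<in> set F \<and> FA (SN B) C \<in> set F \<and> FR r s \<in> set F)" using FX by blast
    finally show ?thesis .
  qed
  show ?thesis unfolding w_FA_def 1 2 3 4 5 6 7 8 derives.simps by (rule refl)
qed

lemma w_derives_iff:
  assumes F: "\<And>g. g \<in> set F \<Longrightarrow> fact_concepts g \<subseteq> set Cs" and f: "fact_concepts f \<subseteq> set Cs"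
  shows "w_derives (map e_inclusion Ont) (map e_atom D) (map e_shape Cs) (map e_fact F) (e_fact f) \<longleftrightarrow>
    derives Ont D (set F) f"
proof (cases f)
  case (FA X E)
  then have "E \<in> set Cs" using f fact_concepts_FA[of E X] by blast
  from w_FA_iff[OF F this] FA show ?thesis by (simp add: w_derives_def del: derives.simps)
qed (use w_FN_iff[OF F] w_FR_iff in \<open>simp_all add: w_derives_def del: derives.simps\<close>)

lemma justified_map_cong:
  assumes "\<And>ys x. set ys \<subseteq> set xs \<Longrightarrow> x \<in> set xs \<Longrightarrow> P (map e ys) (e x) \<longleftrightarrow> Q ys x"
  shows "justified P (map e xs) \<longleftrightarrow> justified Q xs"
proof -
  have "P (rev (take i (map e xs))) (map e xs ! i) \<longleftrightarrow> Q (rev (take i xs)) (xs ! i)" if "i < length xs" for i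
    using assms[of "rev (take i xs)" "xs ! i"] that by (simp add: take_map rev_map set_take_subset)
  then show ?thesis unfolding justified_iff by simp
qed

lemma justified_w_derives:
  assumes F: "\<And>g. g \<in> set F \<Longrightarrow> fact_concepts g \<subseteq> set Cs"
  shows "justified (w_derives (map e_inclusion Ont) (map e_atom D) (map e_shape Cs)) (map e_fact F) \<longleftrightarrow>
    justified (\<lambda>F. derives Ont D (set F)) F"
proof (rule justified_map_cong)
  fix ys x assume "set ys \<subseteq> set F" "x \<in> set F"
  with F show "w_derives (map e_inclusion Ont) (map e_atom D) (map e_shape Cs) (map e_fact ys) (e_fact x) \<longleftrightarrow>
    derives Ont D (set ys) x"
    by (intro w_derives_iff) blast+
qed

lemma w_subj_node: "w_kind (e_node (n, e)) = s_kind (entry_subj e)" "w_subj (e_node (n, e)) = s_word (entry_subj e)"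
  by (cases e; simp add: w_kind_def w_subj_def e_node_def)+

lemma f1_e_node [simp]: "f1 (e_node g) = bits (fst g)"
  by (cases g; cases "snd g") (auto simp: e_node_def)

lemma mem_fact_FA: "[s_kind X, s_word X, enc_concept C] \<in> set (map e_fact F) \<longleftrightarrow> FA X C \<in> set F"
  using mem_map[of e_fact "FA X C" F, OF e_fact_inject] by simp

lemma mem_fact_FN: "[TF, enc_concept C] \<in> set (map e_fact F) \<longleftrightarrow> FN C \<in> set F"
  using mem_map[of e_fact "FN C" F, OF e_fact_inject] by simp

lemma mem_fact_FR: "[TT, bits r, bits s] \<in> set (map e_fact F) \<longleftrightarrow> FR r s \<in> set F"
  using mem_map[of e_fact "FR r s" F, OF e_fact_inject] by simp

lemma justified_w_entry:
  "justified (w_entry (map e_atom D) (map e_fact F)) (map e_node N) \<longleftrightarrow> justified (entry_derives D (set F)) N"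
proof (rule justified_map_cong)
  fix ys and x :: "nat \<times> entry"
  obtain n e where x: "x = (n, e)" by (cases x)
  have fst: "f1 (e_node x) \<in> set (map (\<lambda>h. f1 h) (map e_node ys)) \<longleftrightarrow> n \<in> fst ` set ys"
    by (auto simp: x image_iff)
  show "w_entry (map e_atom D) (map e_fact F) (map e_node ys) (e_node x) \<longleftrightarrow> entry_derives D (set F) ys x"
  proof (cases e)
    case (EConst c)
    then show ?thesis unfolding w_entry_def entry_derives_def fst
      by (simp add: x e_node_def w_const_iff)
  next
    case (ERoot C)
    then show ?thesis unfolding w_entry_def entry_derives_def fst
      by (simp add: x e_node_def mem_fact_FN del: set_map)
  next
    case (EChild p r C)
    have "(\<exists>h \<in> set (map e_node ys). f1 h = bits p \<and> [w_kind h, w_subj h, enc_concept (Ex r C)] \<in> set (map e_fact F)) \<longleftrightarrow>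
      (\<exists>e'. (p, e') \<in> set ys \<and> FA (entry_subj e') (Ex r C) \<in> set F)"
      unfolding Bex_map by (force simp: w_subj_node mem_fact_FA simp del: set_map enc_concept.simps)
    with EChild show ?thesis unfolding w_entry_def entry_derives_def fst
      by (simp add: x e_node_def del: set_map enc_concept.simps)
  qed
qed

lemma f_e_pair [simp]: "f0 (e_pair m) = bits (fst m)" "f1 (e_pair m) = bits (snd m)"
  by (simp_all add: e_pair_def)

lemma f_e_row [simp]: "f0 (e_row r) = bits (fst r)" "f1 (e_row r) = [fst (fst (snd r))]"
  "f2 (e_row r) = bits (snd (fst (snd r)))" "f3 (e_row r) = [fst (snd (snd r))]"
  "f4 (e_row r) = bits (snd (snd (snd r)))"
  by (simp_all add: e_row_def)

lemma w_subj_e_node: "w_kind (e_node g) = s_kind (entry_subj (snd g))" "w_subj (e_node g) = s_word (entry_subj (snd g))"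
  using w_subj_node[of "fst g" "snd g"] by simp_all

lemma Bex_pair: "(\<exists>p \<in> S. P p) \<longleftrightarrow> (\<exists>a b. (a, b) \<in> S \<and> P (a, b))"
  by auto

lemma w_atom_iff: "w_atom (map e_atom D) (map e_fact F) (map e_node N) (map e_pair M) (e_atom a) \<longleftrightarrow>
  atom_match D (set F) (set N) (set M) a"
proof (cases a)
  case (CAtom A x)
  have "w_atom (map e_atom D) (map e_fact F) (map e_node N) (map e_pair M) (e_atom a) \<longleftrightarrow>
    (\<exists>m \<in> set M. \<exists>g \<in> set N. fst m = x \<and> fst g = snd m \<and> FA (entry_subj (snd g)) (Name A) \<in> set F)"
    unfolding w_atom_def Bex_map CAtom
    by (simp add: w_subj_e_node mem_fact_FA del: set_map enc_concept.simps)
  also have "\<dots> \<longleftrightarrow> atom_match D (set F) (set N) (set M) a"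
    unfolding CAtom atom_match.simps Bex_pair fst_conv snd_conv by blast
  finally show ?thesis .
next
  case (RAtom s x y)
  have d: "(\<exists>d \<in> set (map e_atom D). d = [[True], f1 d, bits c, bits c'] \<and> [TT, f1 d, bits s] \<in> set (map e_fact F)) \<longleftrightarrow>
    (\<exists>r. RAtom r c c' \<in> set D \<and> FR r s \<in> set F)" for c c'
  proof -
    have "(\<exists>d \<in> set (map e_atom D). d = [[True], f1 d, bits c, bits c'] \<and> [TT, f1 d, bits s] \<in> set (map e_fact F)) \<longleftrightarrow>
      (\<exists>d \<in> set D. \<exists>r. d = RAtom r c c' \<and> FR r s \<in> set F)"
      unfolding Bex_map e_atom_iff by (intro bex_cong refl) (auto simp: mem_fact_FR simp del: set_map)
    then show ?thesis by auto
  qed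
  have g: "(e_node g = [FF, f1 (e_node g), f2 (e_node g)] \<and> e_node g' = [FF, f1 (e_node g'), f2 (e_node g')] \<and>
         (\<exists>d \<in> set (map e_atom D). d = [[True], f1 d, f2 (e_node g), f2 (e_node g')] \<and> [TT, f1 d, bits s] \<in> set (map e_fact F))) \<longleftrightarrow>
      (\<exists>c c' r. snd g = EConst c \<and> snd g' = EConst c' \<and> RAtom r c c' \<in> set D \<and> FR r s \<in> set F)" for g g'
    using d by (cases "snd g"; cases "snd g'") (simp_all add: e_node_def del: set_map)
  have h: "(e_node g' = [TT, f1 (e_node g'), f1 (e_node g), f3 (e_node g'), f4 (e_node g')] \<and> [TT, f3 (e_node g'), bits s] \<in> set (map e_fact F)) \<longleftrightarrow>
      (\<exists>r C. snd g' = EChild (fst g) r C \<and> FR r s \<in> set F)" for g g' :: "nat \<times> entry"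
  proof (cases "snd g'")
    case (EChild p r C)
    have "e_node g' = [TT, bits (fst g'), bits p, bits r, enc_concept C]"
      by (simp add: e_node_def EChild)
    then show ?thesis using EChild mem_fact_FR[of r s F] by (auto simp del: set_map)
  qed (simp_all add: e_node_def)
  have "w_atom (map e_atom D) (map e_fact F) (map e_node N) (map e_pair M) (e_atom a) \<longleftrightarrow>
    (\<exists>m \<in> set M. \<exists>m' \<in> set M. \<exists>g \<in> set N. \<exists>g' \<in> set N. fst m = x \<and> fst m' = y \<and> fst g = snd m \<and> fst g' = snd m' \<and>
      ((\<exists>c c' r. snd g = EConst c \<and> snd g' = EConst c' \<and> RAtom r c c' \<in> set D \<and> FR r s \<in> set F) \<or>
       (\<exists>r C. snd g' = EChild (fst g) r C \<and> FR r s \<in> set F)))"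
    unfolding w_atom_def RAtom e_atom.simps hd0.simps list.sel Bex_map[of e_pair] Bex_map[of e_node] g h
    by simp
  also have "\<dots> \<longleftrightarrow> atom_match D (set F) (set N) (set M) a"
    unfolding RAtom atom_match.simps Bex_pair fst_conv snd_conv by blast
  finally show ?thesis .
qed

lemma w_query_iff:
  assumes "ans q = map fst R" "body q = B"
  shows "w_query (map e_atom D) (map e_fact F) (map e_node N) (map e_pair M) (map e_row R) (map e_atom B) \<longleftrightarrow>
    query_match D (set F) (set N) (set M) q"
proof -
  have 1: "bits n \<in> set (map (\<lambda>h. f1 h) (map e_node N)) \<longleftrightarrow> n \<in> fst ` set N" for n
    by (auto simp: image_iff)
  have 2: "bits x \<in> set (map (\<lambda>m. f0 m) (map e_pair M)) \<longleftrightarrow> x \<in> fst ` set M" for x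
    by (auto simp: image_iff)
  have 3: "set (map fst R) \<subseteq> fst ` set M \<longleftrightarrow> (\<forall>r \<in> set R. fst r \<in> fst ` set M)" by auto
  have 4: "(\<forall>p \<in> S. P p) \<longleftrightarrow> (\<forall>a b. (a, b) \<in> S \<longrightarrow> P (a, b))" for S and P :: "nat \<times> nat \<Rightarrow> bool" by auto
  show ?thesis
    unfolding w_query_def query_match_def Ball_map f_e_pair f_e_row 1 2 w_atom_iff assms 3 4[of "set M"]
      fst_conv snd_conv bits_eq_iff by blast
qed

lemma w_tuple_iff:
  "w_tuple mu (map e_node N) (map e_pair M) (map e_row R) \<longleftrightarrow>
    tuple_match slot_const mu (set (zip (map fst R) (map (\<lambda>r. snd (snd r)) R))) (set N) (set M)"
proof -
  have z: "set (zip (map fst R) (map (\<lambda>r. snd (snd r)) R)) = (\<lambda>r. (fst r, snd (snd r))) ` set R"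
    by (induction R) auto
  have n: "[FF, bits n, bits c] \<in> set (map e_node N) \<longleftrightarrow> (n, EConst c) \<in> set N" for n c
    using mem_map[of e_node "(n, EConst c)" N, OF e_node_inject] by (simp add: e_node_def)
  have m: "[bits x, bits n] \<in> set (map e_pair M) \<longleftrightarrow> (x, n) \<in> set M" for x n
    using mem_map[of e_pair "(x, n)" M, OF e_pair_inject] by (simp add: e_pair_def)
  have "w_tuple mu (map e_node N) (map e_pair M) (map e_row R) \<longleftrightarrow>
    (\<forall>r \<in> set R. \<not> fst (snd (snd r)) \<longrightarrow> (\<exists>m \<in> set M. fst m = fst r \<and> (snd m, EConst (snd (snd (snd r)))) \<in> set N)) \<and>
    (mu \<longrightarrow> (\<forall>r \<in> set R. \<forall>r' \<in> set R. snd (snd r) = snd (snd r') \<longrightarrow>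
      (\<exists>m \<in> set M. fst m = fst r \<and> (fst r', snd m) \<in> set M)))"
    unfolding w_tuple_def Ball_map Bex_map f_e_pair f_e_row n m by (simp add: prod_eq_iff[of "snd (snd _)"])
  also have "\<dots> \<longleftrightarrow> tuple_match slot_const mu ((\<lambda>r. (fst r, snd (snd r))) ` set R) (set N) (set M)"
  proof -
    have *: "(\<exists>n. (x, n) \<in> set M \<and> P n) \<longleftrightarrow> (\<exists>m \<in> set M. fst m = x \<and> P (snd m))" for x P by force
    show ?thesis unfolding tuple_match_def * by (simp add: slot_const_def)
  qed
  finally show ?thesis unfolding z .
qed

lemma w_slots_iff:
  "w_slots mu (map e_atom D) (map e_row R) \<longleftrightarrow> slots_ok mu D (map (\<lambda>r. snd (snd r)) R) \<and>
    (\<not> mu \<longrightarrow> (\<forall>v \<in> set (map (\<lambda>r. fst (snd r)) R). fst v \<longrightarrow> snd v = 0))"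
proof -
  have j: "justified (\<lambda>P r. f3 r = [True] \<and> f4 r \<noteq> [] \<longrightarrow> (\<exists>p \<in> set P. f3 p = [True] \<and> f4 r = inc (f4 p))) (map e_row R) \<longleftrightarrow>
    justified (\<lambda>P v. fst v \<and> snd v \<noteq> 0 \<longrightarrow> (\<exists>u \<in> set P. fst u \<and> snd v = Suc (snd u))) (map (\<lambda>r. snd (snd r)) R)"
    unfolding justified_iff by (simp add: take_map rev_map[symmetric] inc_bits)
  show ?thesis unfolding w_slots_def slots_ok_def j Ball_map by (auto simp: w_const_iff)
qed

lemma w_smaller_iff:
  fixes R :: "row list"
  defines "z \<equiv> map (\<lambda>r. fst (snd r)) R" and "z' \<equiv> map (\<lambda>r. snd (snd r)) R"
  shows "w_smaller mu Bo (map e_row R) \<longleftrightarrow> (if Bo then slots_le mu z' z \<and> z' \<noteq> z else z' = z)"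
proof -
  have zip: "set (zip z' z) = (\<lambda>r. (snd (snd r), fst (snd r))) ` set R"
    unfolding z_def z'_def by (induction R) auto
  have eq: "f3 (e_row r) = f1 (e_row r) \<and> f4 (e_row r) = f2 (e_row r) \<longleftrightarrow> snd (snd r) = fst (snd r)" for r
    by (simp add: prod_eq_iff)
  have eq1: "f1 (e_row r) = f1 (e_row r') \<and> f2 (e_row r) = f2 (e_row r') \<longleftrightarrow> fst (snd r) = fst (snd r')" for r r'
    by (simp add: prod_eq_iff)
  have eq2: "f3 (e_row r) = f3 (e_row r') \<and> f4 (e_row r) = f4 (e_row r') \<longleftrightarrow> snd (snd r) = snd (snd r')" for r r'
    by (simp add: prod_eq_iff)
  have ne: "z' = z \<longleftrightarrow> (\<forall>r \<in> set R. snd (snd r) = fst (snd r))"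
    unfolding z_def z'_def by (induction R) auto
  have len: "length z' = length z" by (simp add: z_def z'_def)
  show ?thesis unfolding w_smaller_def Ball_map Bex_map eq eq1 eq2 slots_le_def zip ne
    by (auto simp: len)
qed

lemma w_sig_iff:
  "w_sig (map e_atom D) (map e_name (csig Q)) (map e_name (rsig Q)) \<longleftrightarrow> sig_database Q D"
proof -
  have n: "[[], bits A] \<in> set (map e_name xs) \<longleftrightarrow> A \<in> set xs" for A xs
    using mem_map[of e_name A xs, OF e_name_inject] by (simp add: e_name_def)
  have "(if f0 (e_atom d) = [False] then [[], f1 (e_atom d)] \<in> set (map e_name (csig Q))
    else [[], f1 (e_atom d)] \<in> set (map e_name (rsig Q))) \<longleftrightarrow> atom_over (set (csig Q)) (set (rsig Q)) d" for d
    by (cases d) (simp_all add: n del: set_map)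
  then show ?thesis unfolding w_sig_def sig_database_def Ball_map by simp
qed

section \<open>Inputs as words\<close>

definition slot_word :: "bool \<Rightarrow> slot \<Rightarrow> bool list" where
  "slot_word mu v = fst v # (if mu \<or> \<not> fst v then enc_nat (snd v) else [])"

definition ginput :: "bool \<Rightarrow> omq \<Rightarrow> database \<Rightarrow> slot list \<Rightarrow> bool list" where
  "ginput mu Q D z = enc_omq Q @ Defs.enc_list enc_atom D @ Defs.enc_list (slot_word mu) z"

lemma slot_word_s: "slot_word False (slot_s v) = enc_swild v"
  by (cases v) (auto simp: slot_word_def)

lemma slot_word_m: "slot_word True (slot_m v) = enc_mwild v"
  by (cases v) (auto simp: slot_word_def)

lemma enc_list_wlist: "Defs.enc_list e xs = wlist (map e xs)"
  by (simp add: Defs.enc_list_def wlist_def o_def)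

lemma ginput_s: "ginput False Q D (map slot_s c) = enc_input enc_swild Q D c"
  by (simp add: ginput_def enc_input_def enc_list_wlist o_def slot_word_s)

lemma ginput_m: "ginput True Q D (map slot_m c) = enc_input enc_mwild Q D c"
  by (simp add: ginput_def enc_input_def enc_list_wlist o_def slot_word_m)

lemma flat_e:
  "flat_inclusion (e_inclusion a) = enc_inclusion a" "flat (e_name n) = enc_nat n" "flat (e_atom d) = enc_atom d"
proof -
  show "flat_inclusion (e_inclusion a) = enc_inclusion a"
    by (cases a) (simp_all add: flat_inclusion_def flat_def enc_nat_def)
  show "flat (e_name n) = enc_nat n" by (simp add: flat_def e_name_def enc_nat_def)
  show "flat (e_atom d) = enc_atom d" by (cases d) (simp_all add: flat_def enc_nat_def)
qed

lemma w_input_iff: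
  assumes "ans (query Q) = map fst R"
  shows "w_input mu (map e_inclusion (onto Q)) (map e_name (csig Q)) (map e_name (rsig Q)) (map e_atom (body (query Q)))
    (map e_atom D) (map e_row R) = ginput mu Q D (map (\<lambda>r. fst (snd r)) R)"
proof -
  have "wslot mu (f1 (e_row r)) (f2 (e_row r)) = slot_word mu (fst (snd r))" for r
    by (simp add: wslot_def slot_word_def enc_nat_def)
  then show ?thesis
    unfolding w_input_def ginput_def enc_omq_def enc_cq_def enc_list_wlist assms
    by (simp add: o_def flat_e enc_nat_def[symmetric])
qed

section \<open>Records accepted by the verifier\<close>

lemma list_decode:
  assumes "\<forall>r \<in> set rs. \<exists>a. r = e a \<and> P a"
  obtains as where "rs = map e as" "\<forall>a \<in> set as. P a"
proof -
  have "\<exists>as. rs = map e as \<and> (\<forall>a \<in> set as. P a)" using assms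
  proof (induction rs)
    case (Cons r rs)
    then obtain as a where "rs = map e as" "\<forall>a \<in> set as. P a" "r = e a" "P a" by auto
    then show ?case by (intro exI[of _ "a # as"]) auto
  qed simp
  then show thesis using that by blast
qed

definition words_ok :: "rcd list \<Rightarrow> bool" where
  "words_ok T \<longleftrightarrow> (\<forall>r \<in> set T. v_shape T r)"

text \<open>The table need not be ordered, and entries might seem to support each other in a circle.
  This is impossible because an argument has a shorter code than the concept, which also gives the
  induction.\<close>

lemma shape_decode:
  assumes "words_ok T" "w \<in> set (map shape_word T)"
  shows "\<exists>C. w = enc_concept C"
  using assms(2)
proof (induction "length w" arbitrary: w rule: less_induct)
  case less
  then obtain r where r: "r \<in> set T" "w = shape_word r" by auto
  with assms(1) have "v_shape T r" by (simp add: words_ok_def)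
  then consider "r = [FF]" | a where "r = [FT, a]" "canon a"
    | u v where "r = [TF, u, v]" "u \<in> set (map shape_word T)" "v \<in> set (map shape_word T)"
    | a v where "r = [TT, a, v]" "canon a" "v \<in> set (map shape_word T)"
    unfolding v_shape_def by blast
  then show ?case
  proof cases
    case 1
    then have "w = enc_concept Top" using r by (simp add: shape_word_def)
    then show ?thesis by blast
  next
    case (2 a)
    then obtain n where "a = bits n" using canonD by blast
    then have "w = enc_concept (Name n)" using r 2 by (simp add: shape_word_def)
    then show ?thesis by blast
  next
    case (3 u v)
    then have w: "w = wAnd u v" using r by (simp add: shape_word_def)
    then have "length u < length w" "length v < length w" by (simp_all add: wAnd_def)
    with less.hyps 3 obtain B C where "u = enc_concept B" "v = enc_concept C" by blast
    with w have "w = enc_concept (And B C)" by simp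
    then show ?thesis by blast
  next
    case (4 a v)
    then have w: "w = wEx a v" using r by (simp add: shape_word_def)
    then have "length v < length w" by (simp add: wEx_def)
    with less.hyps 4 obtain C where "v = enc_concept C" by blast
    moreover obtain n where "a = bits n" using canonD 4 by blast
    ultimately have "w = enc_concept (Ex n C)" using w by simp
    then show ?thesis by blast
  qed
qed

lemma shapes_decode:
  assumes ok: "words_ok T"
  obtains Cs where "T = map e_shape Cs" "\<And>w. w \<in> set (map shape_word T) \<Longrightarrow> \<exists>C \<in> set Cs. w = enc_concept C"
proof -
  have "\<exists>C. r = e_shape C \<and> True" if "r \<in> set T" for r
  proof -
    from ok that have "v_shape T r" by (simp add: words_ok_def)
    then consider "r = [FF]" | a where "r = [FT, a]" "canon a"
      | u v where "r = [TF, u, v]" "u \<in> set (map shape_word T)" "v \<in> set (map shape_word T)"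
      | a v where "r = [TT, a, v]" "canon a" "v \<in> set (map shape_word T)"
      unfolding v_shape_def by blast
    then show ?thesis
    proof cases
      case 1
      then have "r = e_shape Top" by simp
      then show ?thesis by blast
    next
      case (2 a)
      then obtain n where "a = bits n" using canonD by blast
      then have "r = e_shape (Name n)" using 2 by simp
      then show ?thesis by blast
    next
      case (3 u v)
      with shape_decode[OF ok] obtain B C where "u = enc_concept B" "v = enc_concept C" by blast
      then have "r = e_shape (And B C)" using 3 by simp
      then show ?thesis by blast
    next
      case (4 a v)
      with shape_decode[OF ok] obtain C where "v = enc_concept C" by blast
      moreover obtain n where "a = bits n" using canonD 4 by blast
      ultimately have "r = e_shape (Ex n C)" using 4 by simp
      then show ?thesis by blast
    qed
  qed
  then have "\<forall>r \<in> set T. \<exists>C. r = e_shape C \<and> True" by blast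
  then obtain Cs where "T = map e_shape Cs" by (rule list_decode) blast
  then show thesis by (intro that[of Cs]) auto
qed

text \<open>A certificate may be any word. The validity checks force its records into the images of
  the \<open>e_\<close> functions, so that the equivalences above apply.\<close>

lemma valid_decode:
  assumes v: "w_valid el Ow cs rs B D R T F N M"
  obtains Cs Ont csg rsg Bt Dt Rt Ft Nt Mt where
    "T = map e_shape Cs" "Ow = map e_inclusion Ont" "cs = map e_name csg" "rs = map e_name rsg"
    "B = map e_atom Bt" "D = map e_atom Dt" "R = map e_row Rt" "F = map e_fact Ft" "N = map e_node Nt"
    "M = map e_pair Mt" "\<forall>f \<in> set Ft. fact_concepts f \<subseteq> set Cs" "el \<longrightarrow> Ont \<in> EL"
proof -
  from v have T: "words_ok T" by (simp add: w_valid_def words_ok_def)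
  obtain Cs where Cs: "T = map e_shape Cs"
    and cw: "\<And>w. w \<in> set (map shape_word T) \<Longrightarrow> \<exists>C \<in> set Cs. w = enc_concept C"
    using shapes_decode[OF T] by metis
  have "\<exists>a. r = e_inclusion a \<and> (el \<longrightarrow> (\<exists>B C. a = CI B C))" if "v_inclusion T r \<and> (el \<longrightarrow> f0 r = [False])" for r
  proof -
    from that consider u w where "r = [[False], u, w]" "u \<in> set (map shape_word T)" "w \<in> set (map shape_word T)"
      | u w where "r = [[True], u, w]" "canon u" "canon w" "\<not> el" unfolding v_inclusion_def by (metis hd0.simps(2) list.inject)
    then show ?thesis
    proof cases
      case (1 u w)
      with cw obtain B C where "u = enc_concept B" "w = enc_concept C" by meson
      with 1 have "r = e_inclusion (CI B C)" by simp
      then show ?thesis by blast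
    next
      case (2 u w)
      with canonD obtain m n where "u = bits m" "w = bits n" by meson
      with 2 have "r = e_inclusion (RI m n)" by simp
      with 2 show ?thesis by blast
    qed
  qed
  with v have "\<forall>r \<in> set Ow. \<exists>a. r = e_inclusion a \<and> (el \<longrightarrow> (\<exists>B C. a = CI B C))" unfolding w_valid_def by blast
  then obtain Ont where Ont: "Ow = map e_inclusion Ont" "\<forall>a \<in> set Ont. el \<longrightarrow> (\<exists>B C. a = CI B C)"
    by (rule list_decode)
  have name: "\<exists>n. r = e_name n \<and> True" if "v_name r" for r
    using that canonD unfolding v_name_def e_name_def by metis
  from v name have "\<forall>r \<in> set cs. \<exists>n. r = e_name n \<and> True" unfolding w_valid_def by blast
  then obtain csg where csg: "cs = map e_name csg" by (rule list_decode)
  from v name have "\<forall>r \<in> set rs. \<exists>n. r = e_name n \<and> True" unfolding w_valid_def by blast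
  then obtain rsg where rsg: "rs = map e_name rsg" by (rule list_decode)
  have atom: "\<exists>a. r = e_atom a \<and> True" if "v_atom r" for r
  proof -
    from that consider u w where "r = [[False], u, w]" "canon u" "canon w"
      | u w t where "r = [[True], u, w, t]" "canon u" "canon w" "canon t" unfolding v_atom_def by blast
    then show ?thesis
    proof cases
      case (1 u w)
      with canonD obtain m n where "u = bits m" "w = bits n" by meson
      with 1 have "r = e_atom (CAtom m n)" by simp
      then show ?thesis by blast
    next
      case (2 u w t)
      with canonD obtain m n l where "u = bits m" "w = bits n" "t = bits l" by meson
      with 2 have "r = e_atom (RAtom m n l)" by simp
      then show ?thesis by blast
    qed
  qed
  from v atom have "\<forall>r \<in> set B. \<exists>n. r = e_atom n \<and> True" unfolding w_valid_def by blast
  then obtain Bt where Bt: "B = map e_atom Bt" by (rule list_decode)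
  from v atom have "\<forall>r \<in> set D. \<exists>n. r = e_atom n \<and> True" unfolding w_valid_def by blast
  then obtain Dt where Dt: "D = map e_atom Dt" by (rule list_decode)
  have "\<exists>a. r = e_row a \<and> True" if r: "v_row r" for r
  proof -
    from r obtain x k l where "f0 r = bits x" "f2 r = bits k" "f4 r = bits l" unfolding v_row_def using canonD by meson
    moreover from r obtain b b' where "f1 r = [b]" "f3 r = [b']" unfolding v_row_def by blast
    moreover have "r = [f0 r, f1 r, f2 r, f3 r, f4 r]" using r unfolding v_row_def by blast
    ultimately have "r = e_row (x, (b, k), (b', l))" by (simp add: e_row_def)
    then show ?thesis by blast
  qed
  with v have "\<forall>r \<in> set R. \<exists>n. r = e_row n \<and> True" unfolding w_valid_def by blast
  then obtain Rt where Rt: "R = map e_row Rt" by (rule list_decode)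
  have "\<exists>m. r = e_pair m \<and> True" if r: "v_pair r" for r
  proof -
    from r obtain m n where "f0 r = bits m" "f1 r = bits n" unfolding v_pair_def using canonD by meson
    with r have "r = e_pair (m, n)" unfolding v_pair_def e_pair_def by simp
    then show ?thesis by blast
  qed
  with v have "\<forall>r \<in> set M. \<exists>n. r = e_pair n \<and> True" unfolding w_valid_def by blast
  then obtain Mt where Mt: "M = map e_pair Mt" by (rule list_decode)
  have "\<exists>f. r = e_fact f \<and> fact_concepts f \<subseteq> set Cs" if "v_fact T r" for r
  proof -
    from that consider u w where "r = [FF, u, w]" "canon u" "w \<in> set (map shape_word T)"
      | u w where "r = [FT, u, w]" "u \<in> set (map shape_word T)" "w \<in> set (map shape_word T)"
      | w where "r = [TF, w]" "w \<in> set (map shape_word T)"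
      | u w where "r = [TT, u, w]" "canon u" "canon w" unfolding v_fact_def by blast
    then show ?thesis
    proof cases
      case (1 u w)
      with canonD cw obtain m C where "u = bits m" "C \<in> set Cs" "w = enc_concept C" by meson
      with 1 have "r = e_fact (FA (SC m) C)" "fact_concepts (FA (SC m) C) \<subseteq> set Cs" by simp_all
      then show ?thesis by blast
    next
      case (2 u w)
      with cw obtain E C where "E \<in> set Cs" "u = enc_concept E" "C \<in> set Cs" "w = enc_concept C" by meson
      with 2 have "r = e_fact (FA (SN E) C)" "fact_concepts (FA (SN E) C) \<subseteq> set Cs" by simp_all
      then show ?thesis by blast
    next
      case (3 w)
      with cw obtain C where "C \<in> set Cs" "w = enc_concept C" by meson
      with 3 have "r = e_fact (FN C)" "fact_concepts (FN C) \<subseteq> set Cs" by simp_all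
      then show ?thesis by blast
    next
      case (4 u w)
      with canonD obtain m n where "u = bits m" "w = bits n" by meson
      with 4 have "r = e_fact (FR m n)" "fact_concepts (FR m n) \<subseteq> set Cs" by simp_all
      then show ?thesis by blast
    qed
  qed
  with v have "\<forall>r \<in> set F. \<exists>f. r = e_fact f \<and> fact_concepts f \<subseteq> set Cs" unfolding w_valid_def by blast
  then obtain Ft where Ft: "F = map e_fact Ft" "\<forall>f \<in> set Ft. fact_concepts f \<subseteq> set Cs" by (rule list_decode)
  have "\<exists>g. r = e_node g \<and> True" if "v_node T r" for r
  proof -
    from that consider u w where "r = [FF, u, w]" "canon u" "canon w"
      | u w where "r = [FT, u, w]" "canon u" "w \<in> set (map shape_word T)"
      | u p t w where "r = [TT, u, p, t, w]" "canon u" "canon p" "canon t" "w \<in> set (map shape_word T)"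
      unfolding v_node_def by blast
    then show ?thesis
    proof cases
      case (1 u w)
      with canonD obtain m n where "u = bits m" "w = bits n" by meson
      with 1 have "r = e_node (m, EConst n)" by (simp add: e_node_def)
      then show ?thesis by blast
    next
      case (2 u w)
      with canonD cw obtain m C where "u = bits m" "w = enc_concept C" by meson
      with 2 have "r = e_node (m, ERoot C)" by (simp add: e_node_def)
      then show ?thesis by blast
    next
      case (3 u p t w)
      with canonD cw obtain m n l C where "u = bits m" "p = bits n" "t = bits l" "w = enc_concept C" by meson
      with 3 have "r = e_node (m, EChild n l C)" by (simp add: e_node_def)
      then show ?thesis by blast
    qed
  qed
  with v have "\<forall>r \<in> set N. \<exists>g. r = e_node g \<and> True" unfolding w_valid_def by blast
  then obtain Nt where Nt: "N = map e_node Nt" by (rule list_decode)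
  show thesis
    by (rule that[OF Cs Ont(1) csg rsg Bt Dt Rt Ft(1) Nt Mt Ft(2)]) (use Ont(2) in \<open>auto simp: EL_def\<close>)
qed

fun entry_concepts :: "entry \<Rightarrow> concept set" where
  "entry_concepts (EConst c) = {}"
| "entry_concepts (ERoot C) = {C}"
| "entry_concepts (EChild p r C) = {C}"

lemma valid_encode:
  assumes Cs: "\<And>B C. And B C \<in> set Cs \<Longrightarrow> B \<in> set Cs \<and> C \<in> set Cs" "\<And>r C. Ex r C \<in> set Cs \<Longrightarrow> C \<in> set Cs"
    and Ont: "\<And>B C. CI B C \<in> set Ont \<Longrightarrow> B \<in> set Cs \<and> C \<in> set Cs" "el \<longrightarrow> Ont \<in> EL"
    and F: "\<And>f. f \<in> set F \<Longrightarrow> fact_concepts f \<subseteq> set Cs"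
    and N: "\<And>n e. (n, e) \<in> set N \<Longrightarrow> entry_concepts e \<subseteq> set Cs"
  shows "w_valid el (map e_inclusion Ont) (map e_name cs) (map e_name rs) (map e_atom B) (map e_atom D)
    (map e_row R) (map e_shape Cs) (map e_fact F) (map e_node N) (map e_pair M)"
proof -
  have w: "set (map shape_word (map e_shape Cs)) = enc_concept ` set Cs" by auto
  have 1: "v_shape (map e_shape Cs) (e_shape C)" if "C \<in> set Cs" for C
  proof (cases C)
    case (And A B)
    with that Cs(1)[of A B] show ?thesis unfolding v_shape_def w by simp
  next
    case (Ex r B)
    with that Cs(2)[of r B] show ?thesis unfolding v_shape_def w by (simp add: canon_bits)
  qed (simp_all add: v_shape_def canon_bits)
  have 2: "v_inclusion (map e_shape Cs) (e_inclusion a) \<and> (el \<longrightarrow> f0 (e_inclusion a) = [False])" if "a \<in> set Ont" for a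
  proof (cases a)
    case (CI A B)
    with that Ont(1)[of A B] show ?thesis unfolding v_inclusion_def w by simp
  next
    case (RI r s)
    with that Ont(2) show ?thesis unfolding v_inclusion_def w by (auto simp: canon_bits EL_def)
  qed
  have 3: "v_name (e_name n)" for n by (simp add: v_name_def e_name_def canon_bits)
  have 4: "v_atom (e_atom a)" for a by (cases a) (simp_all add: v_atom_def canon_bits)
  have 5: "v_row (e_row a)" for a by (auto simp: v_row_def e_row_def canon_bits)
  have 6: "v_fact (map e_shape Cs) (e_fact f)" if "f \<in> set F" for f
  proof (cases f)
    case (FA X C)
    with F[OF that] show ?thesis unfolding v_fact_def w by (cases X) (auto simp: canon_bits)
  qed (use F[OF that] in \<open>unfold v_fact_def w, auto simp: canon_bits\<close>)
  have 7: "v_node (map e_shape Cs) (e_node g)" if "g \<in> set N" for g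
  proof -
    have "entry_concepts (snd g) \<subseteq> set Cs" using N[of "fst g" "snd g"] that by simp
    then show ?thesis
      unfolding v_node_def w by (cases "snd g") (auto simp: e_node_def canon_bits)
  qed
  have 8: "v_pair (e_pair m)" for m by (simp add: v_pair_def e_pair_def canon_bits)
  show ?thesis unfolding w_valid_def Ball_map using 1 2 3 4 5 6 7 8 by blast
qed

text \<open>Minimality is membership for \<open>Bo = False\<close> together with non-membership for
  \<open>Bo = True\<close>. For single wildcards the index is not written, so it is fixed as 0 to
  keep tuples determined by their codes.\<close>

definition partial_language :: "'d itself \<Rightarrow> bool \<Rightarrow> bool \<Rightarrow> bool \<Rightarrow> language" where
  "partial_language T el mu Bo = {ginput mu Q D z | Q D z. (el \<longrightarrow> onto Q \<in> EL) \<and> sig_database Q D \<and>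
    (\<not> mu \<longrightarrow> (\<forall>v \<in> set z. fst v \<longrightarrow> snd v = 0)) \<and>
    (\<exists>z'. gpartial T mu Q D z' \<and> (if Bo then slots_le mu z' z \<and> z' \<noteq> z else z' = z))}"

lemma cert_check_sound:
  assumes "cert_check el mu Bo x c"
  shows "x \<in> partial_language T el mu Bo"
proof -
  from assms obtain Ow cs rs B D R W F N M where x: "x = w_input mu Ow cs rs B D R"
    and v: "w_valid el Ow cs rs B D R W F N M" and ch: "w_check mu Bo Ow cs rs B D R W F N M"
    unfolding cert_check_def Let_def by blast
  obtain Cs Ont csg rsg Bt Dt Rt Ft Nt Mt where
    e: "W = map e_shape Cs" "Ow = map e_inclusion Ont" "cs = map e_name csg" "rs = map e_name rsg"
    "B = map e_atom Bt" "D = map e_atom Dt" "R = map e_row Rt" "F = map e_fact Ft" "N = map e_node Nt"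
    "M = map e_pair Mt" and fc: "\<forall>f \<in> set Ft. fact_concepts f \<subseteq> set Cs" and el: "el \<longrightarrow> Ont \<in> EL"
    by (rule valid_decode[OF v])
  define Q where "Q = \<lparr>onto = Ont, csig = csg, rsig = rsg, query = \<lparr>ans = map fst Rt, body = Bt\<rparr>\<rparr>"
  have Q: "onto Q = Ont" "csig Q = csg" "rsig Q = rsg" "ans (query Q) = map fst Rt" "body (query Q) = Bt"
    by (simp_all add: Q_def)
  let ?z = "map (\<lambda>r. fst (snd r)) Rt" and ?z' = "map (\<lambda>r. snd (snd r)) Rt"
  have "x = ginput mu Q Dt ?z"
    unfolding x e using w_input_iff[OF Q(4), of mu Dt] by (simp add: Q)
  moreover have "sig_database Q Dt" using ch w_sig_iff[of Dt Q] by (simp add: w_check_def e Q)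
  moreover have "slots_ok mu Dt ?z'" "\<not> mu \<longrightarrow> (\<forall>v \<in> set ?z. fst v \<longrightarrow> snd v = 0)"
    using ch w_slots_iff[of mu Dt Rt] unfolding w_check_def e by blast+
  moreover have "gpartial T mu Q Dt ?z'"
  proof (rule gpartial_sound)
    show "justified (\<lambda>F. derives (onto Q) Dt (set F)) Ft"
      using ch justified_w_derives[of Ft Cs Ont Dt] fc unfolding w_check_def e Q by blast
    show "justified (entry_derives Dt (set Ft)) Nt"
      using ch justified_w_entry unfolding w_check_def e by blast
    show "query_match Dt (set Ft) (set Nt) (set Mt) (query Q)"
      using ch w_query_iff[OF Q(4,5)] unfolding w_check_def e by blast
    show "tuple_match slot_const mu (set (zip (ans (query Q)) ?z')) (set Nt) (set Mt)"
      using ch w_tuple_iff unfolding w_check_def e Q by blast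
  qed (use \<open>slots_ok mu Dt ?z'\<close> Q in simp_all)
  moreover have "if Bo then slots_le mu ?z' ?z \<and> ?z' \<noteq> ?z else ?z' = ?z"
    using ch w_smaller_iff[of mu Bo Rt] unfolding w_check_def e by blast
  ultimately show ?thesis unfolding partial_language_def using el Q(1) by blast
qed

section \<open>Certificates as words and their length\<close>

definition join_cert :: "rcd list list \<Rightarrow> bool list" where
  "join_cert c = join_words (map (\<lambda>rs. join_words (map join_words rs)) c)"

definition split_cert :: "bool list \<Rightarrow> rcd list list" where
  "split_cert y = map (\<lambda>w. map split_words (split_words w)) (split_words y)"

lemma split_join_cert [simp]: "split_cert (join_cert c) = c"
  by (simp add: split_cert_def join_cert_def o_def)

lemma pt_split_cert: "pt f \<Longrightarrow> pt (\<lambda>x. split_cert (f x))"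
  unfolding split_cert_def by (intro pt_intros)

lemma length_join_words:
  assumes "\<And>w. w \<in> set ws \<Longrightarrow> length w \<le> m" "length ws \<le> l"
  shows "length (join_words ws) \<le> l * (2 * m + 1)"
proof -
  have "length (join_words ws) \<le> length ws * (2 * m + 1)" using assms(1)
  proof (induction ws)
    case (Cons w ws)
    then have "length w \<le> m" "length (join_words ws) \<le> length ws * (2 * m + 1)" by simp_all
    then show ?case by (simp add: join_words_def)
  qed (simp add: join_words_def)
  also have "\<dots> \<le> l * (2 * m + 1)" using assms(2) by (rule mult_le_mono1)
  finally show ?thesis .
qed

text \<open>A certificate consists of ten lists, and the longest records, rows and child nodes, have
  five words. The factor 2 and the summand 1 at each level come from
  \<open>self_delim\<close>.\<close>

lemma length_join_cert:
  assumes "length c \<le> 10" "\<And>rs. rs \<in> set c \<Longrightarrow> length rs \<le> k"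
    "\<And>rs r. rs \<in> set c \<Longrightarrow> r \<in> set rs \<Longrightarrow> length r \<le> 5 \<and> (\<forall>w \<in> set r. length w \<le> m)"
  shows "length (join_cert c) \<le> 10 * (2 * (k * (2 * (5 * (2 * m + 1)) + 1)) + 1)"
proof -
  have 1: "length (join_words r) \<le> 5 * (2 * m + 1)" if "rs \<in> set c" "r \<in> set rs" for rs r
    using assms(3)[OF that] by (intro length_join_words) auto
  have 2: "length (join_words (map join_words rs)) \<le> k * (2 * (5 * (2 * m + 1)) + 1)" if "rs \<in> set c" for rs
    using 1[OF that] assms(2)[OF that] by (intro length_join_words) auto
  show ?thesis
    unfolding join_cert_def using 2 assms(1) by (intro length_join_words) auto
qed

text \<open>The first component of \<open>pair_word x y\<close> ends at the first tag \<open>False\<close>; the flag pair records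
  whether this tag was passed and whether a bit of \<open>x\<close> comes next.\<close>

definition unpair_step :: "(bool \<times> bool) \<times> bool list \<times> bool list \<Rightarrow> bool \<Rightarrow> (bool \<times> bool) \<times> bool list \<times> bool list" where
  "unpair_step a b = (if fst (fst a) then (fst a, fst (snd a), b # snd (snd a))
    else if snd (fst a) then ((False, False), b # fst (snd a), snd (snd a))
    else if b then ((False, True), snd a) else ((True, False), snd a))"

definition unpair :: "bool list \<Rightarrow> bool list \<times> bool list" where
  "unpair w = (rev (fst (snd (foldl unpair_step ((False, False), [], []) w))),
    rev (snd (snd (foldl unpair_step ((False, False), [], []) w))))"

lemma unpair_pair_word [simp]: "unpair (pair_word x y) = (x, y)"
proof -
  have 1: "foldl unpair_step ((True, False), u, v) w = ((True, False), u, rev w @ v)" for u v w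
    by (induction w arbitrary: v) (auto simp: unpair_step_def)
  have "foldl unpair_step ((False, False), u, []) (pair_word x y) = ((True, False), rev x @ u, rev y)" for u
    by (induction x arbitrary: u) (auto simp: pair_word_def self_delim_def unpair_step_def 1)
  then show ?thesis by (simp add: unpair_def)
qed

lemma pt_unpair: "pt unpair"
proof -
  have "pt (\<lambda>w. foldl unpair_step ((False, False), [], []) w)"
  proof (rule pt_foldl_additive[where p = "\<lambda>_. 10"])
    show "pt (\<lambda>z :: bool list \<times> ((bool \<times> bool) \<times> bool list \<times> bool list) \<times> bool. unpair_step (fst (snd z)) (snd (snd z)))"
      unfolding unpair_step_def by (intro pt_intros)
    show "esize (unpair_step a y) \<le> esize a + 10" for x :: "bool list" and a y
      by (cases a) (auto simp: unpair_step_def)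
  qed (intro pt_intros polyb_const)+
  then show ?thesis unfolding unpair_def by (intro pt_Pair pt_rev pt_fst pt_snd)
qed

text \<open>The decoding functions are total, so every word is read as some certificate and
  \<open>sound\<close> takes care of all of them.\<close>

lemma NP_I:
  assumes chk: "pt (\<lambda>z. chk (fst z) (snd z) :: bool)"
    and sound: "\<And>x c. chk x c \<Longrightarrow> x \<in> L"
    and complete: "\<And>x. x \<in> L \<Longrightarrow> \<exists>c. chk x c \<and> length (join_cert c) \<le> p (length x)" and p: "polyb p"
  shows "L \<in> NP"
proof -
  from p obtain a d where ad: "\<And>n. p n \<le> a * n ^ d + a" unfolding polyb_def by blast
  define V where "V w = [chk (fst (unpair w)) (split_cert (snd (unpair w)))]" for w
  have "pt V"
    unfolding V_def by (intro pt_Cons pt_const pt_comp2[OF chk] pt_fst pt_snd pt_unpair pt_split_cert)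
  then have V: "polytime V" by (rule polytime_pt)
  have "x \<in> L \<longleftrightarrow> (\<exists>y. length y \<le> a * length x ^ d + a \<and> V (pair_word x y) = [True])" for x
  proof
    assume "x \<in> L"
    from complete[OF this] obtain c where c: "chk x c" "length (join_cert c) \<le> p (length x)" by blast
    then show "\<exists>y. length y \<le> a * length x ^ d + a \<and> V (pair_word x y) = [True]"
      using order_trans[OF c(2) ad] by (intro exI[of _ "join_cert c"]) (auto simp: V_def)
  qed (auto simp: V_def sound)
  with V show ?thesis unfolding NP_def by blast
qed

lemma length_enc_list: "x \<in> set xs \<Longrightarrow> length (e x) \<le> length (Defs.enc_list e xs)"
  "length xs \<le> length (Defs.enc_list e xs)"
  by (induction xs) (auto simp: Defs.enc_list_def)

lemma length_bits_enc_nat: "length (bits n) \<le> length (enc_nat n)"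
  by (simp add: enc_nat_def)

lemma length_bits: "length (bits n) \<le> n"
proof (induction n rule: less_induct)
  case (less n)
  show ?case
  proof (cases "n = 0")
    case False
    then have "length (bits (n div 2)) \<le> n div 2" by (intro less) simp
    with False show ?thesis by (simp add: bits_pos)
  qed simp
qed

text \<open>Each index other than 0 requires its predecessor at an earlier position, so an index
  cannot exceed its position.\<close>

lemma slots_wild_bound:
  assumes "slots_ok True D z" "i < length z" "z ! i = (True, k)"
  shows "k \<le> i"
  using assms(2,3)
proof (induction k arbitrary: i)
  case (Suc k)
  from assms(1) have "justified (\<lambda>P v. fst v \<and> snd v \<noteq> 0 \<longrightarrow> (\<exists>u \<in> set P. fst u \<and> snd v = Suc (snd u))) z"
    by (simp add: slots_ok_def)
  with Suc.prems obtain u where u: "u \<in> set (take i z)" "fst u" "k = snd u"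
    unfolding justified_iff by force
  then obtain j where j: "j < i" "z ! j = (True, k)" using Suc.prems(1)
    by (auto simp: in_set_conv_nth prod_eq_iff)
  then have "k \<le> j" using Suc.IH[of j] Suc.prems(1) by simp
  with j show ?case by simp
qed simp

lemma slots_ok_bound:
  assumes "slots_ok mu D z" "v \<in> set z"
  shows "(\<not> fst v \<and> snd v \<in> adom D) \<or> snd v \<le> length z"
proof (cases "fst v")
  case True
  show ?thesis
  proof (cases mu)
    case True
    obtain i where i: "i < length z" "z ! i = v" using assms(2) by (auto simp: in_set_conv_nth)
    with \<open>fst v\<close> have "z ! i = (True, snd v)" by (simp add: prod_eq_iff)
    with slots_wild_bound[of D z i "snd v"] assms(1) True i(1) have "snd v \<le> i" by simp
    with i show ?thesis by simp
  qed (use assms True in \<open>auto simp: slots_ok_def\<close>)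
qed (use assms in \<open>auto simp: slots_ok_def\<close>)

lemma card_UN_bound:
  assumes "\<And>x. x \<in> set xs \<Longrightarrow> card (f x) \<le> m"
  shows "card (\<Union>x \<in> set xs. f x) \<le> length xs * m"
proof -
  have "card (\<Union>x \<in> set xs. f x) \<le> (\<Sum>x \<in> set xs. card (f x))" by (rule card_UN_le) simp
  also have "\<dots> \<le> card (set xs) * m" using sum_bounded_above[of "set xs" "\<lambda>x. card (f x)" m] assms by simp
  also have "\<dots> \<le> length xs * m" by (intro mult_le_mono1 card_length)
  finally show ?thesis .
qed

lemma card_set_atom: "card (set_atom a) \<le> 2"
  by (cases a) (auto simp: card_insert_if)

lemma length_bits_atom: "x \<in> set_atom a \<Longrightarrow> length (bits x) \<le> length (enc_atom a)"
  by (cases a) (auto simp: enc_nat_def)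

lemma card_adom: "card (adom D) \<le> length D * 2"
  unfolding adom_def by (intro card_UN_bound card_set_atom)

lemma card_qvars: "card (qvars q) \<le> length (ans q) + length (body q) * 2"
proof -
  have "card (qvars q) \<le> card (set (ans q)) + card (\<Union>a \<in> set (body q). set_atom a)"
    unfolding qvars_def by (rule card_Un_le)
  also have "\<dots> \<le> length (ans q) + length (body q) * 2"
    by (intro add_mono card_length card_UN_bound card_set_atom)
  finally show ?thesis .
qed

context
  fixes n :: nat and Ont :: ontology and D :: database
  assumes Ont: "length (Defs.enc_list enc_inclusion Ont) \<le> n" and D: "length (Defs.enc_list enc_atom D) \<le> n"
begin

lemma Ont_bound: "length Ont \<le> n" "a \<in> set Ont \<Longrightarrow> length (enc_inclusion a) \<le> n"
  using length_enc_list(2)[of Ont enc_inclusion] length_enc_list(1)[of a Ont enc_inclusion] Ont by linarith+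

lemma D_bound: "length D \<le> n" "a \<in> set D \<Longrightarrow> length (enc_atom a) \<le> n"
  using length_enc_list(2)[of D enc_atom] length_enc_list(1)[of a D enc_atom] D by linarith+

lemma adom_bound: "card (adom D) \<le> 2 * n" "c \<in> adom D \<Longrightarrow> length (bits c) \<le> n"
proof -
  show "card (adom D) \<le> 2 * n" using card_adom[of D] D_bound(1) by linarith
  assume "c \<in> adom D"
  then obtain a where "a \<in> set D" "c \<in> set_atom a" by (auto simp: adom_def)
  with length_bits_atom[of c a] D_bound(2)[of a] show "length (bits c) \<le> n" by linarith
qed

lemma card_inclusion_subs: "card (inclusion_subs a) \<le> length (enc_inclusion a)"
proof (cases a)
  case (CI B C)
  have "card (inclusion_subs a) \<le> card (subs B) + card (subs C)" by (simp add: CI card_Un_le)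
  also have "\<dots> \<le> length (enc_inclusion a)" using card_subs[of B] card_subs[of C] by (simp add: CI)
  finally show ?thesis .
qed simp

lemma concepts_bound: "card (concepts_of Ont D) \<le> (n + 2) * (n + 2)"
  "C \<in> concepts_of Ont D \<Longrightarrow> length (enc_concept C) \<le> n + 2"
proof -
  have "card (\<Union>a \<in> set Ont. inclusion_subs a) \<le> length Ont * n"
    using card_inclusion_subs Ont_bound(2) by (intro card_UN_bound) (meson le_trans)
  also have "\<dots> \<le> n * n" using Ont_bound(1) by (rule mult_le_mono1)
  finally have 1: "card (\<Union>a \<in> set Ont. inclusion_subs a) \<le> n * n" .
  have "card (atom_concepts a) \<le> 1" for a by (cases a) auto
  then have "card (\<Union>a \<in> set D. atom_concepts a) \<le> length D * 1" by (intro card_UN_bound)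
  with D_bound(1) have 2: "card (\<Union>a \<in> set D. atom_concepts a) \<le> n" by simp
  have "card (concepts_of Ont D) \<le> Suc (card ((\<Union>a \<in> set Ont. inclusion_subs a) \<union> (\<Union>a \<in> set D. atom_concepts a)))"
    unfolding concepts_of_def by (rule card_insert_le_m1[of "Suc _", simplified]) simp
  also have "\<dots> \<le> Suc (n * n + n)" using 1 2 card_Un_le le_trans add_mono by (metis Suc_le_mono)
  also have "\<dots> \<le> (n + 2) * (n + 2)" by (simp add: algebra_simps)
  finally show "card (concepts_of Ont D) \<le> (n + 2) * (n + 2)" .
  assume "C \<in> concepts_of Ont D"
  then consider "C = Top" | a where "a \<in> set Ont" "C \<in> inclusion_subs a" | a where "a \<in> set D" "C \<in> atom_concepts a"
    unfolding concepts_of_def by blast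
  then show "length (enc_concept C) \<le> n + 2"
  proof cases
    case (2 a)
    have "length (enc_concept C) \<le> length (enc_inclusion a)"
    proof (cases a)
      case (CI A B)
      with 2(2) have "C \<in> subs A \<or> C \<in> subs B" by simp
      with length_subs[of C A] length_subs[of C B] CI show ?thesis by auto
    qed (use 2(2) in simp)
    with Ont_bound(2)[OF 2(1)] show ?thesis by simp
  next
    case (3 a)
    from 3(2) have "length (enc_concept C) \<le> length (enc_atom a) + 2" by (cases a) auto
    with D_bound(2)[OF 3(1)] show ?thesis by simp
  qed simp
qed

lemma roles_bound: "card (roles_of Ont D) \<le> (n + 2) * (n + 2) + 3 * n"
  "r \<in> roles_of Ont D \<Longrightarrow> length (bits r) \<le> n + 2"
proof -
  obtain Cs where Cs: "set Cs = concepts_of Ont D" "distinct Cs"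
    using finite_distinct_list[OF finite_concepts_of[of Ont D]] by (elim exE conjE)
  have lCs: "length Cs \<le> (n + 2) * (n + 2)" using concepts_bound(1) Cs distinct_card[of Cs] by simp
  have "card (top_role C) \<le> 1" for C by (cases C) auto
  then have "card (\<Union>C \<in> set Cs. top_role C) \<le> length Cs * 1" by (intro card_UN_bound)
  with lCs Cs have 1: "card (\<Union>C \<in> concepts_of Ont D. top_role C) \<le> (n + 2) * (n + 2)" by simp
  have "card (inclusion_roles a) \<le> 2" for a by (cases a) (auto simp: card_insert_if)
  then have "card (\<Union>a \<in> set Ont. inclusion_roles a) \<le> length Ont * 2" by (intro card_UN_bound)
  with Ont_bound(1) have 2: "card (\<Union>a \<in> set Ont. inclusion_roles a) \<le> 2 * n" by linarith
  have "card (atom_roles a) \<le> 1" for a by (cases a) auto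
  then have "card (\<Union>a \<in> set D. atom_roles a) \<le> length D * 1" by (intro card_UN_bound)
  with D_bound(1) have 3: "card (\<Union>a \<in> set D. atom_roles a) \<le> n" by simp
  have "card (roles_of Ont D) \<le> card (\<Union>C \<in> concepts_of Ont D. top_role C) + card (\<Union>a \<in> set Ont. inclusion_roles a) +
    card (\<Union>a \<in> set D. atom_roles a)"
    unfolding roles_of_def by (intro order_trans[OF card_Un_le] add_mono card_Un_le order_refl)
  with 1 2 3 show "card (roles_of Ont D) \<le> (n + 2) * (n + 2) + 3 * n" by linarith
  assume "r \<in> roles_of Ont D"
  then consider C where "C \<in> concepts_of Ont D" "r \<in> top_role C" | a where "a \<in> set Ont" "r \<in> inclusion_roles a"
    | a where "a \<in> set D" "r \<in> atom_roles a"
    unfolding roles_of_def by blast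
  then show "length (bits r) \<le> n + 2"
  proof cases
    case (1 C)
    from 1(2) have "length (bits r) \<le> length (enc_concept C)" by (cases C) (auto simp: enc_nat_def)
    with concepts_bound(2)[OF 1(1)] show ?thesis by simp
  next
    case (2 a)
    from 2(2) have "length (bits r) \<le> length (enc_inclusion a)" by (cases a) (auto simp: enc_nat_def)
    with Ont_bound(2)[OF 2(1)] show ?thesis by simp
  next
    case (3 a)
    from 3(2) have "length (bits r) \<le> length (enc_atom a)" by (cases a) (auto simp: enc_nat_def)
    with D_bound(2)[OF 3(1)] show ?thesis by simp
  qed
qed

lemma facts_bound:
  "card (facts_of Ont D) \<le> (2 * n + (n + 2) * (n + 2)) * ((n + 2) * (n + 2)) + (n + 2) * (n + 2) +
    ((n + 2) * (n + 2) + 3 * n) * ((n + 2) * (n + 2) + 3 * n)"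
proof -
  let ?S = "concepts_of Ont D" and ?R = "roles_of Ont D" and ?X = "SC ` adom D \<union> SN ` concepts_of Ont D"
  have "card ?X \<le> card (SC ` adom D) + card (SN ` ?S)" by (rule card_Un_le)
  also have "\<dots> \<le> card (adom D) + card ?S" by (intro add_mono card_image_le finite_adom finite_concepts_of)
  also have "\<dots> \<le> 2 * n + (n + 2) * (n + 2)" by (intro add_mono adom_bound concepts_bound)
  finally have X: "card ?X \<le> 2 * n + (n + 2) * (n + 2)" .
  have "card ((\<lambda>(X, C). FA X C) ` (?X \<times> ?S)) \<le> card (?X \<times> ?S)"
    by (intro card_image_le) (simp add: finite_adom finite_concepts_of)
  also have "\<dots> \<le> (2 * n + (n + 2) * (n + 2)) * ((n + 2) * (n + 2))"
    unfolding card_cartesian_product by (intro mult_le_mono X concepts_bound)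
  finally have 1: "card ((\<lambda>(X, C). FA X C) ` (?X \<times> ?S)) \<le> (2 * n + (n + 2) * (n + 2)) * ((n + 2) * (n + 2))" .
  have 2: "card (FN ` ?S) \<le> (n + 2) * (n + 2)"
    using card_image_le[OF finite_concepts_of, of FN Ont D] concepts_bound(1) by linarith
  have "card ((\<lambda>(r, s). FR r s) ` (?R \<times> ?R)) \<le> card (?R \<times> ?R)"
    by (intro card_image_le) (simp add: finite_roles_of)
  also have "\<dots> \<le> ((n + 2) * (n + 2) + 3 * n) * ((n + 2) * (n + 2) + 3 * n)"
    unfolding card_cartesian_product by (intro mult_le_mono roles_bound)
  finally have 3: "card ((\<lambda>(r, s). FR r s) ` (?R \<times> ?R)) \<le> ((n + 2) * (n + 2) + 3 * n) * ((n + 2) * (n + 2) + 3 * n)" .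
  show ?thesis unfolding facts_of_def
    by (intro order_trans[OF card_Un_le] add_mono 1 2 3)
qed

end

text \<open>The summands bound the lists of a certificate: the parts of the input, the concepts, the
  facts, the nodes and the assignment. A query has at most \<open>3 * n\<close> variables; a node is
  a variable together with a constant, a root concept, or a parent, a role and a concept.\<close>

definition size_bound :: "nat \<Rightarrow> nat" where
  "size_bound n = n + (n + 2) * (n + 2) + ((2 * n + (n + 2) * (n + 2)) * ((n + 2) * (n + 2)) + (n + 2) * (n + 2) +
      ((n + 2) * (n + 2) + 3 * n) * ((n + 2) * (n + 2) + 3 * n)) +
    3 * n * (2 * n + (n + 2) * (n + 2) + 3 * n * (((n + 2) * (n + 2) + 3 * n) * ((n + 2) * (n + 2)))) + 3 * n * (3 * n)"

lemma polyb_size_bound: "polyb size_bound"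
  unfolding size_bound_def by (intro polyb_intros)

text \<open>The lists of concepts, facts, nodes and pairs are duplicate-free, so counting their
  possible elements bounds their lengths.\<close>

lemma cert_check_complete:
  assumes "x \<in> partial_language TYPE('d) el mu Bo"
  shows "\<exists>c. cert_check el mu Bo x c \<and>
    length (join_cert c) \<le> 10 * (2 * (size_bound (length x) * (2 * (5 * (2 * (length x + 2) + 1)) + 1)) + 1)"
proof -
  from assms obtain Q D z z' where x: "x = ginput mu Q D z" and el: "el \<longrightarrow> onto Q \<in> EL"
    and sig: "sig_database Q D" and nf: "\<not> mu \<longrightarrow> (\<forall>v \<in> set z. fst v \<longrightarrow> snd v = 0)"
    and gp: "gpartial TYPE('d) mu Q D z'" and sm: "if Bo then slots_le mu z' z \<and> z' \<noteq> z else z' = z"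
    unfolding partial_language_def by blast
  let ?q = "query Q" and ?n = "length x" and ?S = "concepts_of (onto Q) D" and ?R = "roles_of (onto Q) D"
  have lz': "length z' = length (ans ?q)" and ok: "slots_ok mu D z'" using gp by (auto simp: gpartial_def)
  have lz: "length z = length z'" using sm by (auto simp: slots_le_def split: if_splits)
  obtain fs ns M where fs: "justified (\<lambda>F. derives (onto Q) D (set F)) fs" "distinct fs" "set fs \<subseteq> facts_of (onto Q) D"
    and ns: "justified (entry_derives D (set fs)) ns" "distinct ns"
    "set ns \<subseteq> qvars ?q \<times> (EConst ` adom D \<union> ERoot ` ?S \<union> (\<lambda>(p, r, C). EChild p r C) ` (qvars ?q \<times> ?R \<times> ?S))"
    and M: "finite M" "M \<subseteq> qvars ?q \<times> qvars ?q"
    and qm: "query_match D (set fs) (set ns) M ?q" and tm: "tuple_match slot_const mu (set (zip (ans ?q) z')) (set ns) M"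
    by (rule gpartial_certificate[OF gp])
  obtain Ml where Ml: "set Ml = M" "distinct Ml" using finite_distinct_list[OF M(1)] by (elim exE conjE)
  obtain Cs where Cs: "set Cs = ?S" "distinct Cs" using finite_distinct_list[OF finite_concepts_of[of "onto Q" D]] by (elim exE conjE)
  define R where "R = zip (ans ?q) (zip z z')"
  have R: "map fst R = ans ?q" "map (\<lambda>r. fst (snd r)) R = z" "map (\<lambda>r. snd (snd r)) R = z'"
    using lz lz' by (auto simp: R_def intro: nth_equalityI)
  let ?c = "[map e_inclusion (onto Q), map e_name (csig Q), map e_name (rsig Q), map e_atom (body ?q), map e_atom D,
    map e_row R, map e_shape Cs, map e_fact fs, map e_node ns, map e_pair Ml]"
  have Ob: "length (Defs.enc_list enc_inclusion (onto Q)) \<le> ?n" and Db: "length (Defs.enc_list enc_atom D) \<le> ?n"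
    and cb: "length (Defs.enc_list enc_nat (csig Q)) \<le> ?n" and rb: "length (Defs.enc_list enc_nat (rsig Q)) \<le> ?n"
    and ab: "length (Defs.enc_list enc_nat (ans ?q)) + length (Defs.enc_list enc_atom (body ?q)) \<le> ?n"
    and zb: "length (Defs.enc_list (slot_word mu) z) \<le> ?n"
    unfolding x ginput_def enc_omq_def enc_cq_def by simp_all
  have fc: "fact_concepts f \<subseteq> ?S" if "f \<in> set fs" for f
  proof (cases f)
    case (FA X C)
    with that fs(3) have "FA X C \<in> facts_of (onto Q) D" by blast
    then show ?thesis unfolding FA FA_in_facts_of by (cases X) auto
  next
    case (FN C)
    with that fs(3) have "FN C \<in> facts_of (onto Q) D" by blast
    then show ?thesis unfolding FN FN_in_facts_of by auto
  qed simp
  have nc: "n \<in> qvars ?q \<and> entry_concepts e \<subseteq> ?S" if "(n, e) \<in> set ns" for n e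
    using subsetD[OF ns(3) that] by auto
  have valid: "w_valid el (map e_inclusion (onto Q)) (map e_name (csig Q)) (map e_name (rsig Q)) (map e_atom (body ?q))
    (map e_atom D) (map e_row R) (map e_shape Cs) (map e_fact fs) (map e_node ns) (map e_pair Ml)"
  proof (rule valid_encode)
    fix B C assume "CI B C \<in> set (onto Q)"
    then have "inclusion_subs (CI B C) \<subseteq> ?S" unfolding concepts_of_def by blast
    then show "B \<in> set Cs \<and> C \<in> set Cs" by (auto simp: Cs subs_refl)
  qed (use concepts_of_closed fc nc el Cs in blast)+
  have check: "w_check mu Bo (map e_inclusion (onto Q)) (map e_name (csig Q)) (map e_name (rsig Q)) (map e_atom (body ?q))
    (map e_atom D) (map e_row R) (map e_shape Cs) (map e_fact fs) (map e_node ns) (map e_pair Ml)"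
    unfolding w_check_def
  proof (intro conjI)
    show "justified (w_derives (map e_inclusion (onto Q)) (map e_atom D) (map e_shape Cs)) (map e_fact fs)"
      using justified_w_derives[of fs Cs "onto Q" D] fc fs(1) Cs by blast
    show "justified (w_entry (map e_atom D) (map e_fact fs)) (map e_node ns)"
      using justified_w_entry ns(1) by blast
    show "w_query (map e_atom D) (map e_fact fs) (map e_node ns) (map e_pair Ml) (map e_row R) (map e_atom (body ?q))"
      using w_query_iff[OF R(1)[symmetric] refl] qm Ml(1) by simp
    show "w_tuple mu (map e_node ns) (map e_pair Ml) (map e_row R)"
      unfolding w_tuple_iff R Ml by (rule tm)
    show "w_slots mu (map e_atom D) (map e_row R)"
      unfolding w_slots_iff R using ok nf by blast
    show "w_smaller mu Bo (map e_row R)" unfolding w_smaller_iff R by (rule sm)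
    show "w_sig (map e_atom D) (map e_name (csig Q)) (map e_name (rsig Q))" using w_sig_iff sig by blast
  qed
  have "x = w_input mu (map e_inclusion (onto Q)) (map e_name (csig Q)) (map e_name (rsig Q)) (map e_atom (body ?q))
    (map e_atom D) (map e_row R)"
    unfolding w_input_iff[OF R(1)[symmetric]] R by (rule x)
  with valid check have cc: "cert_check el mu Bo x ?c" by (simp add: cert_check_def Let_def)
  let ?m = "?n + 2"
  have adom: "card (adom D) \<le> 2 * ?n" "\<And>c. c \<in> adom D \<Longrightarrow> length (bits c) \<le> ?m"
    using adom_bound[OF Ob Db] le_trans[OF _ le_add1] by blast+
  have S: "card ?S \<le> ?m * ?m" "\<And>C. C \<in> ?S \<Longrightarrow> length (enc_concept C) \<le> ?m"
    using concepts_bound[OF Ob Db] by blast+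
  have Rb: "card ?R \<le> ?m * ?m + 3 * ?n" "\<And>r. r \<in> ?R \<Longrightarrow> length (bits r) \<le> ?m"
    using roles_bound[OF Ob Db] by blast+
  have la: "length (ans ?q) \<le> ?n" "length (body ?q) \<le> ?n"
    using length_enc_list(2)[of "ans ?q" enc_nat] length_enc_list(2)[of "body ?q" enc_atom] ab by linarith+
  have "card (qvars ?q) \<le> length (ans ?q) + length (body ?q) * 2" by (rule card_qvars)
  with la have qv: "card (qvars ?q) \<le> 3 * ?n" by linarith
  have body: "length (enc_atom a) \<le> ?n" if "a \<in> set (body ?q)" for a
    using length_enc_list(1)[OF that, of enc_atom] ab by linarith
  have ansb: "length (bits v) \<le> ?n" if "v \<in> set (ans ?q)" for v
    using length_enc_list(1)[OF that, of enc_nat] length_bits_enc_nat[of v] ab by linarith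
  have qb: "length (bits v) \<le> ?m" if v: "v \<in> qvars ?q" for v
  proof -
    from v consider "v \<in> set (ans ?q)" | a where "a \<in> set (body ?q)" "v \<in> set_atom a" unfolding qvars_def by blast
    then have "length (bits v) \<le> ?n"
    proof cases
      case (2 a)
      with body[OF 2(1)] length_bits_atom[OF 2(2)] show ?thesis by linarith
    qed (rule ansb)
    then show ?thesis by simp
  qed
  have at: "length r \<le> 5 \<and> (\<forall>w \<in> set r. length w \<le> ?m)" if "r = e_atom a" "length (enc_atom a) \<le> ?n" for r a
    using that by (cases a) (auto simp: enc_nat_def)
  have words: "length r \<le> 5 \<and> (\<forall>w \<in> set r. length w \<le> ?m)" if "rs \<in> set ?c" "r \<in> set rs" for rs r
  proof -
    from that have "r \<in> e_inclusion ` set (onto Q) \<union> e_name ` (set (csig Q) \<union> set (rsig Q)) \<union>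
      e_atom ` (set (body ?q) \<union> set D) \<union> e_row ` set R \<union> e_shape ` ?S \<union> e_fact ` set fs \<union> e_node ` set ns \<union> e_pair ` M"
      using Cs(1) Ml(1) by auto
    then consider a where "a \<in> set (onto Q)" "r = e_inclusion a"
      | a where "a \<in> set (csig Q) \<union> set (rsig Q)" "r = e_name a"
      | a where "a \<in> set (body ?q) \<union> set D" "r = e_atom a" | a where "a \<in> set R" "r = e_row a"
      | C where "C \<in> ?S" "r = e_shape C" | f where "f \<in> set fs" "r = e_fact f"
      | g where "g \<in> set ns" "r = e_node g" | p where "p \<in> M" "r = e_pair p"
      by blast
    then show ?thesis
    proof cases
      case (1 a)
      from Ont_bound(2)[OF Ob Db 1(1)] show ?thesis unfolding 1(2) by (cases a) (auto simp: enc_nat_def)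
    next
      case (2 a)
      then have "length (enc_nat a) \<le> ?n"
        using length_enc_list(1)[of a "csig Q" enc_nat] length_enc_list(1)[of a "rsig Q" enc_nat] cb rb by auto
      with 2 show ?thesis by (simp add: e_name_def enc_nat_def)
    next
      case (3 a)
      with body D_bound(2)[OF Ob Db] have "length (enc_atom a) \<le> ?n" by blast
      with 3 at show ?thesis by blast
    next
      case (4 a)
      obtain v s s' where a: "a = (v, s, s')" by (cases a)
      have "fst a \<in> set (map fst R)" "fst (snd a) \<in> set (map (\<lambda>r. fst (snd r)) R)"
        "snd (snd a) \<in> set (map (\<lambda>r. snd (snd r)) R)"
        using 4(1) by simp_all
      then have v: "v \<in> set (ans ?q)" "s \<in> set z" "s' \<in> set z'" unfolding R a by simp_all
      have "length (slot_word mu s) \<le> ?n" using length_enc_list(1)[OF v(2), of "slot_word mu"] zb by linarith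
      then have s: "length (bits (snd s)) \<le> ?n"
        using nf v(2) by (cases "mu \<or> \<not> fst s") (auto simp: slot_word_def enc_nat_def)
      \<comment> \<open>The certified tuple need not be part of the input. Its constants come from
        the database, and its wildcard indices are at most its length.\<close>
      have "length (bits (snd s')) \<le> ?m"
        using slots_ok_bound[OF ok v(3)]
      proof
        assume "snd s' \<le> length z'"
        with length_bits[of "snd s'"] lz' la show ?thesis by linarith
      qed (use adom in blast)
      with s ansb[OF v(1)] show ?thesis unfolding 4 a by (simp add: e_row_def)
    next
      case (5 C)
      with S(2)[OF 5(1)] show ?thesis by (cases C) (auto simp: enc_nat_def)
    next
      case (6 f)
      with fs(3) have f: "f \<in> facts_of (onto Q) D" by blast
      show ?thesis
      proof (cases f)
        case (FA X C)
        with f S(2) adom(2) show ?thesis unfolding FA FA_in_facts_of 6(2) by (cases X) auto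
      next
        case (FN C)
        with f S(2) show ?thesis unfolding FN FN_in_facts_of 6(2) by auto
      next
        case (FR r s)
        with f Rb(2) show ?thesis unfolding FR FR_in_facts_of 6(2) by auto
      qed
    next
      case (7 g)
      obtain v e where g: "g = (v, e)" by (cases g)
      from subsetD[OF ns(3), of g] 7 g have v: "v \<in> qvars ?q" and
        e: "e \<in> EConst ` adom D \<union> ERoot ` ?S \<union> (\<lambda>(p, r, C). EChild p r C) ` (qvars ?q \<times> ?R \<times> ?S)" by auto
      show ?thesis
        using e qb[OF v] qb adom(2) S(2) Rb(2) unfolding 7 g by (auto simp: e_node_def)
    next
      case (8 p)
      with M(2) qb show ?thesis by (auto simp: e_pair_def)
    qed
  qed
  have lfs: "length fs \<le> card (facts_of (onto Q) D)"
    using fs(2,3) finite_facts_of by (metis card_mono distinct_card)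
  have lns: "length ns \<le> 3 * ?n * (2 * ?n + ?m * ?m + 3 * ?n * ((?m * ?m + 3 * ?n) * (?m * ?m)))"
  proof -
    let ?E = "EConst ` adom D \<union> ERoot ` ?S \<union> (\<lambda>(p, r, C). EChild p r C) ` (qvars ?q \<times> ?R \<times> ?S)"
    have fin: "finite ?E" by (simp add: finite_adom finite_concepts_of finite_roles_of finite_qvars)
    have "card ?E \<le> card (EConst ` adom D) + card (ERoot ` ?S) + card ((\<lambda>(p, r, C). EChild p r C) ` (qvars ?q \<times> ?R \<times> ?S))"
      by (intro order_trans[OF card_Un_le] add_mono card_Un_le order_refl)
    also have "\<dots> \<le> card (adom D) + card ?S + card (qvars ?q \<times> ?R \<times> ?S)"
      by (intro add_mono card_image_le) (simp_all add: finite_adom finite_concepts_of finite_roles_of finite_qvars)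
    also have "\<dots> \<le> 2 * ?n + ?m * ?m + 3 * ?n * ((?m * ?m + 3 * ?n) * (?m * ?m))"
      unfolding card_cartesian_product by (intro add_mono mult_le_mono adom S qv Rb)
    finally have E: "card ?E \<le> 2 * ?n + ?m * ?m + 3 * ?n * ((?m * ?m + 3 * ?n) * (?m * ?m))" .
    have "length ns \<le> card (qvars ?q \<times> ?E)"
      using ns(2,3) fin finite_qvars by (metis card_mono distinct_card finite_cartesian_product)
    also have "\<dots> \<le> 3 * ?n * (2 * ?n + ?m * ?m + 3 * ?n * ((?m * ?m + 3 * ?n) * (?m * ?m)))"
      unfolding card_cartesian_product by (intro mult_le_mono qv E)
    finally show ?thesis .
  qed
  have lM: "length Ml \<le> 3 * ?n * (3 * ?n)"
  proof -
    have "length Ml \<le> card (qvars ?q \<times> qvars ?q)"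
      using M Ml finite_qvars by (metis card_mono distinct_card finite_cartesian_product)
    also have "\<dots> \<le> 3 * ?n * (3 * ?n)" unfolding card_cartesian_product by (intro mult_le_mono qv)
    finally show ?thesis .
  qed
  have lCs: "length Cs \<le> ?m * ?m" using S(1) Cs distinct_card[of Cs] by simp
  have lR: "length R \<le> ?n" using la by (simp add: R_def)
  have lO: "length (onto Q) \<le> ?n" "length D \<le> ?n" using Ont_bound(1)[OF Ob Db] D_bound(1)[OF Ob Db] by auto
  have ls: "length (csig Q) \<le> ?n" "length (rsig Q) \<le> ?n"
    using length_enc_list(2)[of "csig Q" enc_nat] length_enc_list(2)[of "rsig Q" enc_nat] cb rb by linarith+
  have sb: "?n \<le> size_bound ?n" "?m * ?m \<le> size_bound ?n" "length fs \<le> size_bound ?n"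
    "length ns \<le> size_bound ?n" "length Ml \<le> size_bound ?n"
    unfolding size_bound_def using lfs facts_bound[OF Ob Db] lns lM by linarith+
  have lens: "length rs \<le> size_bound ?n" if "rs \<in> set ?c" for rs
  proof -
    from that have "length rs \<in> {length (onto Q), length (csig Q), length (rsig Q), length (body ?q), length D,
      length R, length Cs, length fs, length ns, length Ml}" by auto
    then show ?thesis using sb lCs lR lO ls la(2) by (auto intro: le_trans)
  qed
  have "length (join_cert ?c) \<le> 10 * (2 * (size_bound ?n * (2 * (5 * (2 * ?m + 1)) + 1)) + 1)"
    using lens words by (intro length_join_cert) simp
  with cc show ?thesis by blast
qed

theorem partial_language_NP: "partial_language TYPE('d) el mu Bo \<in> NP"
proof (rule NP_I[OF pt_cert_check cert_check_sound cert_check_complete])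
  show "polyb (\<lambda>n. 10 * (2 * (size_bound n * (2 * (5 * (2 * (n + 2) + 1)) + 1)) + 1))"
    by (intro polyb_intros polyb_size_bound)
qed

section \<open>Membership in DP\<close>

lemma slot_s_surj: "\<forall>v \<in> set z. fst v \<longrightarrow> snd v = 0 \<Longrightarrow> \<exists>c. z = map slot_s c"
proof (induction z)
  case (Cons v z)
  then obtain c where c: "z = map slot_s c" by auto
  have "v = slot_s (if fst v then Star else SVal (snd v))" using Cons.prems by (cases v) auto
  with c show ?case by (intro exI[of _ "(if fst v then Star else SVal (snd v)) # c"]) auto
qed simp

lemma slot_m_surj: "\<exists>c. z = map slot_m c"
proof (induction z)
  case (Cons v z)
  then obtain c where c: "z = map slot_m c" by auto
  have "v = slot_m (if fst v then Wild (snd v) else MVal (snd v))" by (cases v) auto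
  with c show ?case by (intro exI[of _ "(if fst v then Wild (snd v) else MVal (snd v)) # c"]) auto
qed simp

lemma map_slot_s_inject [simp]: "map slot_s c = map slot_s c' \<longleftrightarrow> c = c'"
  by (rule inj_map_eq_map) (simp add: inj_def)

lemma map_slot_m_inject [simp]: "map slot_m c = map slot_m c' \<longleftrightarrow> c = c'"
  by (rule inj_map_eq_map) (simp add: inj_def)

lemma partial_language_s:
  "partial_language T el False Bo = {enc_input enc_swild Q D c | Q D c. (el \<longrightarrow> onto Q \<in> EL) \<and> sig_database Q D \<and>
    (\<exists>c'. partial_answer_s T Q D c' \<and> (if Bo then sle c' c \<and> c' \<noteq> c else c' = c))}" (is "?L = ?R")
proof
  show "?L \<subseteq> ?R"
  proof
    fix x assume "x \<in> ?L"
    then obtain Q D z z' where *: "x = ginput False Q D z" "el \<longrightarrow> onto Q \<in> EL" "sig_database Q D"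
      "\<forall>v \<in> set z. fst v \<longrightarrow> snd v = 0" "gpartial T False Q D z'" "if Bo then slots_le False z' z \<and> z' \<noteq> z else z' = z"
      unfolding partial_language_def by auto
    from *(5) have "\<forall>v \<in> set z'. fst v \<longrightarrow> snd v = 0" by (simp add: gpartial_def slots_ok_def)
    with *(4) slot_s_surj obtain c c' where c: "z = map slot_s c" "z' = map slot_s c'" by metis
    from * show "x \<in> ?R" unfolding c ginput_s gpartial_s slots_le_s map_slot_s_inject by blast
  qed
  show "?R \<subseteq> ?L"
  proof
    fix x assume "x \<in> ?R"
    then obtain Q D c c' where *: "x = enc_input enc_swild Q D c" "el \<longrightarrow> onto Q \<in> EL" "sig_database Q D"
      "partial_answer_s T Q D c'" "if Bo then sle c' c \<and> c' \<noteq> c else c' = c" by blast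
    have "\<forall>v \<in> set (map slot_s c). fst v \<longrightarrow> snd v = 0"
    proof -
      have "fst (slot_s v) \<longrightarrow> snd (slot_s v) = 0" for v by (cases v) auto
      then show ?thesis by simp
    qed
    with * show "x \<in> ?L"
      unfolding partial_language_def ginput_s[symmetric] gpartial_s[symmetric] slots_le_s[symmetric]
        map_slot_s_inject[symmetric] by blast
  qed
qed

lemma partial_language_m:
  "partial_language T el True Bo = {enc_input enc_mwild Q D c | Q D c. (el \<longrightarrow> onto Q \<in> EL) \<and> sig_database Q D \<and>
    (\<exists>c'. partial_answer_m T Q D c' \<and> (if Bo then mle c' c \<and> c' \<noteq> c else c' = c))}" (is "?L = ?R")
proof
  show "?L \<subseteq> ?R"
  proof
    fix x assume "x \<in> ?L"
    then obtain Q D z z' where *: "x = ginput True Q D z" "el \<longrightarrow> onto Q \<in> EL" "sig_database Q D"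
      "gpartial T True Q D z'" "if Bo then slots_le True z' z \<and> z' \<noteq> z else z' = z"
      unfolding partial_language_def by auto
    from slot_m_surj obtain c c' where c: "z = map slot_m c" "z' = map slot_m c'" by metis
    from * show "x \<in> ?R" unfolding c ginput_m gpartial_m slots_le_m map_slot_m_inject by blast
  qed
  show "?R \<subseteq> ?L"
  proof
    fix x assume "x \<in> ?R"
    then obtain Q D c c' where *: "x = enc_input enc_mwild Q D c" "el \<longrightarrow> onto Q \<in> EL" "sig_database Q D"
      "partial_answer_m T Q D c'" "if Bo then mle c' c \<and> c' \<noteq> c else c' = c" by blast
    then show "x \<in> ?L"
      unfolding partial_language_def ginput_m[symmetric] gpartial_m[symmetric] slots_le_m[symmetric]
        map_slot_m_inject[symmetric] by blast
  qed
qed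

lemma ELH_UNIV: "onto Q \<in> ELH"
  unfolding ELH_def by (auto) (metis inclusion.exhaust)

lemma DP_I: "L1 \<in> NP \<Longrightarrow> L2 \<in> coNP \<Longrightarrow> L1 \<inter> L2 \<in> DP"
  unfolding DP_def by blast

lemma single_testing_s_DP:
  assumes "\<O> = (if el then EL else ELH)"
  shows "single_testing_s TYPE('d) \<O> \<in> DP"
proof -
  have "x \<in> single_testing_s TYPE('d) \<O> \<longleftrightarrow>
    x \<in> partial_language TYPE('d) el False False \<inter> - partial_language TYPE('d) el False True" for x
  \<comment> \<open>A word that encodes no input lies in the complement of the second language, but
    is excluded by the first one.\<close>
  proof (cases "\<exists>Q D c. x = enc_input enc_swild Q D c")
    case True
    then obtain Q D c where x: "x = enc_input enc_swild Q D c" by blast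
    have eq: "x \<in> {enc_input enc_swild Q D c | Q D c. P Q D c} \<longleftrightarrow> P Q D c" for P
      unfolding x using enc_input_inject[OF prefix_free_swild] by blast
    have O: "onto Q \<in> \<O> \<longleftrightarrow> (el \<longrightarrow> onto Q \<in> EL)" by (simp add: assms ELH_UNIV)
    show ?thesis
      unfolding partial_language_s single_testing_s_def minimal_partial_answer_s_def Int_iff Compl_iff eq O if_False if_True
      by blast
  qed (auto simp: single_testing_s_def partial_language_s)
  then have "single_testing_s TYPE('d) \<O> = partial_language TYPE('d) el False False \<inter> - partial_language TYPE('d) el False True"
    by blast
  moreover have "- partial_language TYPE('d) el False True \<in> coNP"
    by (simp add: coNP_def partial_language_NP)
  ultimately show ?thesis using DP_I[OF partial_language_NP] by simp
qed

lemma single_testing_m_DP: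
  assumes "\<O> = (if el then EL else ELH)"
  shows "single_testing_m TYPE('d) \<O> \<in> DP"
proof -
  have "x \<in> single_testing_m TYPE('d) \<O> \<longleftrightarrow>
    x \<in> partial_language TYPE('d) el True False \<inter> - partial_language TYPE('d) el True True" for x
  proof (cases "\<exists>Q D c. x = enc_input enc_mwild Q D c")
    case True
    then obtain Q D c where x: "x = enc_input enc_mwild Q D c" by blast
    have eq: "x \<in> {enc_input enc_mwild Q D c | Q D c. P Q D c} \<longleftrightarrow> P Q D c" for P
      unfolding x using enc_input_inject[OF prefix_free_mwild] by blast
    have O: "onto Q \<in> \<O> \<longleftrightarrow> (el \<longrightarrow> onto Q \<in> EL)" by (simp add: assms ELH_UNIV)
    show ?thesis
      unfolding partial_language_m single_testing_m_def minimal_partial_answer_m_def Int_iff Compl_iff eq O if_False if_True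
      by blast
  qed (auto simp: single_testing_m_def partial_language_m)
  then have "single_testing_m TYPE('d) \<O> = partial_language TYPE('d) el True False \<inter> - partial_language TYPE('d) el True True"
    by blast
  moreover have "- partial_language TYPE('d) el True True \<in> coNP"
    by (simp add: coNP_def partial_language_NP)
  ultimately show ?thesis using DP_I[OF partial_language_NP] by simp
qed

section \<open>Constraint satisfaction problems as queries\<close>

text \<open>The digits of this number are \<open>w\<close>, least significant first, followed by a 1
  that protects the final zeros of \<open>w\<close>. Its binary code is thus
  \<open>w @ [True]\<close>, and names can be produced without arithmetic.\<close>

definition word_nat :: "bool list \<Rightarrow> nat" where
  "word_nat w = foldr (\<lambda>b n. 2 * n + of_bool b) w 1"

lemma bits_word_nat: "bits (word_nat w) = w @ [True]"
proof (induction w)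
  case Nil
  show ?case by (simp add: word_nat_def bits_pos)
next
  case (Cons b w)
  then have "word_nat w \<noteq> 0" by (metis append_is_Nil_conv bits_0 list.distinct(1))
  then have "0 < word_nat (b # w)" by (simp add: word_nat_def)
  with Cons show ?case by (simp add: bits_pos) (simp add: word_nat_def)
qed

definition name :: "'a::enc \<Rightarrow> nat" where
  "name x = word_nat (enc x)"

lemma name_inject [simp]: "name x = name y \<longleftrightarrow> x = y"
proof
  assume "name x = name y"
  then have "bits (word_nat (enc x)) = bits (word_nat (enc y))" by (simp add: name_def)
  then show "x = y" unfolding bits_word_nat by (auto dest: enc_inject)
qed simp

lemma pt_enc_nat_name: "pt f \<Longrightarrow> pt (\<lambda>x. enc_nat (name (f x)))"
  unfolding enc_nat_def name_def bits_word_nat by (intro pt_intros pt_comp[OF pt_enc])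

text \<open>A constraint consists of a relation and of the list of its variables, each with its position in
  unary.  A template lists the tuples of each relation.\<close>

type_synonym con = "bool list \<times> (bool list \<times> rcd) list"

type_synonym template = "(bool list \<times> nat list) list"

definition unary :: "nat \<Rightarrow> bool list" where
  "unary k = replicate k True"

definition well_indexed :: "con \<Rightarrow> bool" where
  "well_indexed c \<longleftrightarrow> map fst (snd c) = map unary [0..<length (snd c)]"

definition satisfies :: "template \<Rightarrow> con list \<Rightarrow> (rcd \<Rightarrow> nat) \<Rightarrow> bool" where
  "satisfies Tm I \<alpha> \<longleftrightarrow> (\<forall>c \<in> set I. (fst c, map (\<lambda>p. \<alpha> (snd p)) (snd c)) \<in> set Tm)"

lemma unary_inject [simp]: "unary k = unary l \<longleftrightarrow> k = l"
  by (metis unary_def length_replicate)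

text \<open>The query variables: the root, and for each of the two instances (distinguished by the first
  component) the variables of the instance, a variable per constraint and one per constraint position.\<close>

type_synonym qkey = "bool \<times> bool list \<times> bool list \<times> (bool list \<times> rcd) list \<times> bool list"

abbreviation "k_root s \<equiv> (s, TT, [], [], []) :: qkey"
abbreviation "k_con s c \<equiv> (s, FT, fst c, snd c, []) :: qkey"
abbreviation "k_pos s c k \<equiv> (s, TF, fst c, snd c, k) :: qkey"
abbreviation "k_var s v \<equiv> (s, FF, [], [([], v)], []) :: qkey"

abbreviation "l_start \<equiv> name (False, [] :: bool list, [] :: bool list)"
abbreviation "l_rel s R \<equiv> name (s :: bool, [False], R :: bool list)"
abbreviation "l_pos s k \<equiv> name (s :: bool, [True], k :: bool list)"

text \<open>Constraints of any arity are expressed with one role by layers: root, constraint,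
  positions, variables. Since all edges go from one layer to the next, the whole query can be
  collapsed onto a path; only the two middle layers carry labels.\<close>

definition con_atoms :: "bool \<Rightarrow> con \<Rightarrow> nat atom list" where
  "con_atoms s c = [RAtom 0 (name (k_root s)) (name (k_con s c)), CAtom (l_rel s (fst c)) (name (k_con s c))] @
    concat (map (\<lambda>p. [RAtom 0 (name (k_con s c)) (name (k_pos s c (fst p))), CAtom (l_pos s (fst p)) (name (k_pos s c (fst p))),
      RAtom 0 (name (k_pos s c (fst p))) (name (k_var s (snd p)))]) (snd c))"

definition con_words :: "bool \<Rightarrow> con \<Rightarrow> bool list list" where
  "con_words s c = map enc_atom (con_atoms s c)"

lemma pt_enc_RAtom: "pt f \<Longrightarrow> pt g \<Longrightarrow> pt (\<lambda>x. enc_atom (RAtom 0 (name (f x)) (name (g x))))"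
  unfolding enc_atom.simps by (intro pt_intros pt_enc_nat_name)

lemma pt_enc_CAtom: "pt f \<Longrightarrow> pt g \<Longrightarrow> pt (\<lambda>x. enc_atom (CAtom (name (f x)) (name (g x))))"
  unfolding enc_atom.simps by (intro pt_intros pt_enc_nat_name)

lemma pt_con_words: "pt (con_words s)"
proof -
  have e: "con_words s = (\<lambda>c. [enc_atom (RAtom 0 (name (k_root s)) (name (k_con s c))), enc_atom (CAtom (l_rel s (fst c)) (name (k_con s c)))] @
    concat (map (\<lambda>p. [enc_atom (RAtom 0 (name (k_con s c)) (name (k_pos s c (fst p)))),
      enc_atom (CAtom (l_pos s (fst p)) (name (k_pos s c (fst p)))),
      enc_atom (RAtom 0 (name (k_pos s c (fst p))) (name (k_var s (snd p))))]) (snd c)))"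
    by (rule ext) (simp add: con_words_def con_atoms_def map_concat o_def del: enc_atom.simps)
  show ?thesis unfolding e by (intro pt_intros pt_enc_RAtom pt_enc_CAtom)
qed

section \<open>The fixed database and ontology\<close>

datatype cname = CStart | CRoot bool | CCon bool "bool list" "nat list" | CPos bool "bool list" "nat list" nat | CVal bool nat

instance cname :: countable by countable_datatype

abbreviation cn :: "cname \<Rightarrow> nat" where "cn \<equiv> to_nat"

text \<open>Every allowed tuple has its own constants for the constraint and its positions, so a
  match cannot combine coordinates of different tuples. Only the values are shared.\<close>

definition tuple_atoms :: "bool \<Rightarrow> bool list \<times> nat list \<Rightarrow> nat atom list" where
  "tuple_atoms s t = [RAtom 0 (cn (CRoot s)) (cn (CCon s (fst t) (snd t))), CAtom (l_rel s (fst t)) (cn (CCon s (fst t) (snd t)))] @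
    concat (map (\<lambda>k. [RAtom 0 (cn (CCon s (fst t) (snd t))) (cn (CPos s (fst t) (snd t) k)),
      CAtom (l_pos s (unary k)) (cn (CPos s (fst t) (snd t) k)),
      RAtom 0 (cn (CPos s (fst t) (snd t) k)) (cn (CVal s (snd t ! k)))]) [0..<length (snd t)])"

definition template_db :: "template \<Rightarrow> template \<Rightarrow> database" where
  "template_db T1 T2 = CAtom l_start (cn CStart) # concat (map (tuple_atoms False) T1) @ concat (map (tuple_atoms True) T2)"

fun conj :: "nat list \<Rightarrow> concept \<Rightarrow> concept" where
  "conj [] C = C"
| "conj (A # As) C = And (Name A) (conj As C)"

definition rel_labels :: "template \<Rightarrow> nat list" where
  "rel_labels T2 = map (\<lambda>t. l_rel True (fst t)) T2"

definition pos_labels :: "template \<Rightarrow> nat list" where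
  "pos_labels T2 = concat (map (\<lambda>t. map (\<lambda>k. l_pos True (unary k)) [0..<length (snd t)]) T2)"

text \<open>The constant labelled \<open>l_start\<close> starts an anonymous path; its second and third new
  elements carry the labels of all constraints and of all positions of the second instance. The part of
  the query for this instance therefore always maps into the path, provided that its root does not have
  to be a constant.\<close>

definition template_onto :: "template \<Rightarrow> ontology" where
  "template_onto T2 = [CI (Name l_start) (Ex 0 (Ex 0 (conj (rel_labels T2) (Ex 0 (conj (pos_labels T2) (Ex 0 Top))))))]"

definition atom_csig :: "database \<Rightarrow> nat list" where
  "atom_csig D = concat (map (\<lambda>a. case a of CAtom A x \<Rightarrow> [A] | RAtom r x y \<Rightarrow> []) D)"

definition con_omq :: "template \<Rightarrow> template \<Rightarrow> con list \<Rightarrow> con list \<Rightarrow> omq" where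
  "con_omq T1 T2 I1 I2 = \<lparr>onto = template_onto T2, csig = atom_csig (template_db T1 T2), rsig = [0],
    query = \<lparr>ans = [name (k_root True)], body = concat (map (con_atoms False) I1) @ concat (map (con_atoms True) I2)\<rparr>\<rparr>"

lemma ext_conj: "d \<in> ext I (conj As C) \<longleftrightarrow> (\<forall>A \<in> set As. d \<in> cext I A) \<and> d \<in> ext I C"
  by (induction As) auto

lemma Ball_con_atoms: "(\<forall>a \<in> set (con_atoms s c). P a) \<longleftrightarrow>
    P (RAtom 0 (name (k_root s)) (name (k_con s c))) \<and> P (CAtom (l_rel s (fst c)) (name (k_con s c))) \<and>
    (\<forall>p \<in> set (snd c). P (RAtom 0 (name (k_con s c)) (name (k_pos s c (fst p)))) \<and>
      P (CAtom (l_pos s (fst p)) (name (k_pos s c (fst p)))) \<and>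
      P (RAtom 0 (name (k_pos s c (fst p))) (name (k_var s (snd p)))))"
  by (auto simp: con_atoms_def)

lemma con_query_hom:
  assumes "query (con_omq T1 T2 I1 I2) = q"
    and "\<And>s c. c \<in> set (if s then I2 else I1) \<Longrightarrow> (g (k_root s), g (k_con s c)) \<in> rext I 0 \<and> g (k_con s c) \<in> cext I (l_rel s (fst c)) \<and>
      (\<forall>p \<in> set (snd c). (g (k_con s c), g (k_pos s c (fst p))) \<in> rext I 0 \<and> g (k_pos s c (fst p)) \<in> cext I (l_pos s (fst p)) \<and>
      (g (k_pos s c (fst p)), g (k_var s (snd p))) \<in> rext I 0)"
    and "wf_interp I" "g (k_root True) \<in> domain I"
  shows "\<exists>h. query_hom h q I \<and> h (name (k_root True)) = g (k_root True)"
proof -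
  define h where "h = (\<lambda>n. g (inv name n))"
  have h: "h (name k) = g k" for k :: qkey
    unfolding h_def by (simp add: inv_f_f inj_def)
  have q: "body q = concat (map (con_atoms False) I1) @ concat (map (con_atoms True) I2)" "ans q = [name (k_root True)]"
    by (simp_all add: con_omq_def flip: assms(1))
  have "sat_atom I (map_atom h a)" if "a \<in> set (con_atoms s c)" "c \<in> set (if s then I2 else I1)" for a s c
  proof -
    have "\<forall>a \<in> set (con_atoms s c). sat_atom I (map_atom h a)"
      unfolding Ball_con_atoms using assms(2)[OF that(2)] by (simp add: h)
    with that(1) show ?thesis by blast
  qed
  note at = this
  have sat: "sat_atom I (map_atom h a)" if a: "a \<in> set (body q)" for a
  proof -
    from a consider c where "c \<in> set I1" "a \<in> set (con_atoms False c)" | c where "c \<in> set I2" "a \<in> set (con_atoms True c)"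
      unfolding q by auto
    then show ?thesis using at[of a False] at[of a True] by cases simp_all
  qed
  have "h x \<in> domain I" if "x \<in> set_atom a" "a \<in> set (body q)" for x a
    using sat[OF that(2)] that(1) assms(3) by (cases a) (auto simp: wf_interp_def)
  then have "h ` qvars q \<subseteq> domain I" using assms(4) by (auto simp: qvars_def q h)
  with sat h show ?thesis by (intro exI[of _ h]) (auto simp: query_hom_def)
qed

lemma con_query_homD:
  assumes "query_hom h (query (con_omq T1 T2 I1 I2)) I" "c \<in> set (if s then I2 else I1)"
  shows "(h (name (k_root s)), h (name (k_con s c))) \<in> rext I 0" "h (name (k_con s c)) \<in> cext I (l_rel s (fst c))"
    "p \<in> set (snd c) \<Longrightarrow> (h (name (k_con s c)), h (name (k_pos s c (fst p)))) \<in> rext I 0"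
    "p \<in> set (snd c) \<Longrightarrow> h (name (k_pos s c (fst p))) \<in> cext I (l_pos s (fst p))"
    "p \<in> set (snd c) \<Longrightarrow> (h (name (k_pos s c (fst p))), h (name (k_var s (snd p)))) \<in> rext I 0"
proof -
  have "set (con_atoms s c) \<subseteq> set (body (query (con_omq T1 T2 I1 I2)))"
    using assms(2) by (auto simp: con_omq_def split: if_splits)
  with assms(1) have "\<forall>a \<in> set (con_atoms s c). sat_atom I (map_atom h a)" by (auto simp: query_hom_def)
  then show "(h (name (k_root s)), h (name (k_con s c))) \<in> rext I 0" "h (name (k_con s c)) \<in> cext I (l_rel s (fst c))"
    "p \<in> set (snd c) \<Longrightarrow> (h (name (k_con s c)), h (name (k_pos s c (fst p)))) \<in> rext I 0"
    "p \<in> set (snd c) \<Longrightarrow> h (name (k_pos s c (fst p))) \<in> cext I (l_pos s (fst p))"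
    "p \<in> set (snd c) \<Longrightarrow> (h (name (k_pos s c (fst p))), h (name (k_var s (snd p)))) \<in> rext I 0"
    unfolding Ball_con_atoms by auto
qed

lemma in_template_db:
  "RAtom r a b \<in> set (template_db T1 T2) \<longleftrightarrow> r = 0 \<and> (\<exists>s t. t \<in> set (if s then T2 else T1) \<and>
    ((a = cn (CRoot s) \<and> b = cn (CCon s (fst t) (snd t))) \<or>
     (\<exists>k < length (snd t). (a = cn (CCon s (fst t) (snd t)) \<and> b = cn (CPos s (fst t) (snd t) k)) \<or>
       (a = cn (CPos s (fst t) (snd t) k) \<and> b = cn (CVal s (snd t ! k))))))"
  "CAtom A a \<in> set (template_db T1 T2) \<longleftrightarrow> (A = l_start \<and> a = cn CStart) \<or> (\<exists>s t. t \<in> set (if s then T2 else T1) \<and>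
    ((A = l_rel s (fst t) \<and> a = cn (CCon s (fst t) (snd t))) \<or>
     (\<exists>k < length (snd t). A = l_pos s (unary k) \<and> a = cn (CPos s (fst t) (snd t) k))))"
proof -
  have 1: "x \<in> set (template_db T1 T2) \<longleftrightarrow> x = CAtom l_start (cn CStart) \<or> (\<exists>s t. t \<in> set (if s then T2 else T1) \<and> x \<in> set (tuple_atoms s t))" for x
    unfolding template_db_def ex_bool_eq by auto
  have 2: "x \<in> set (tuple_atoms s t) \<longleftrightarrow> x = RAtom 0 (cn (CRoot s)) (cn (CCon s (fst t) (snd t))) \<or>
    x = CAtom (l_rel s (fst t)) (cn (CCon s (fst t) (snd t))) \<or>
    (\<exists>k < length (snd t). x = RAtom 0 (cn (CCon s (fst t) (snd t))) (cn (CPos s (fst t) (snd t) k)) \<or>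
      x = CAtom (l_pos s (unary k)) (cn (CPos s (fst t) (snd t) k)) \<or>
      x = RAtom 0 (cn (CPos s (fst t) (snd t) k)) (cn (CVal s (snd t ! k))))" for x s t
    unfolding tuple_atoms_def by auto
  show "RAtom r a b \<in> set (template_db T1 T2) \<longleftrightarrow> r = 0 \<and> (\<exists>s t. t \<in> set (if s then T2 else T1) \<and>
    ((a = cn (CRoot s) \<and> b = cn (CCon s (fst t) (snd t))) \<or>
     (\<exists>k < length (snd t). (a = cn (CCon s (fst t) (snd t)) \<and> b = cn (CPos s (fst t) (snd t) k)) \<or>
       (a = cn (CPos s (fst t) (snd t) k) \<and> b = cn (CVal s (snd t ! k))))))"
    unfolding 1 2 by blast
  show "CAtom A a \<in> set (template_db T1 T2) \<longleftrightarrow> (A = l_start \<and> a = cn CStart) \<or> (\<exists>s t. t \<in> set (if s then T2 else T1) \<and>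
    ((A = l_rel s (fst t) \<and> a = cn (CCon s (fst t) (snd t))) \<or>
     (\<exists>k < length (snd t). A = l_pos s (unary k) \<and> a = cn (CPos s (fst t) (snd t) k))))"
    unfolding 1 2 by blast
qed

definition arity_ok :: "template \<Rightarrow> con list \<Rightarrow> bool" where
  "arity_ok Tm I \<longleftrightarrow> (\<forall>c \<in> set I. well_indexed c \<and> (\<forall>t. (fst c, t) \<in> set Tm \<longrightarrow> length t = length (snd c)))"

definition con_tuple :: "(rcd \<Rightarrow> nat) \<Rightarrow> (bool list \<times> rcd) list \<Rightarrow> nat list" where
  "con_tuple \<alpha> ps = map (\<lambda>p. \<alpha> (snd p)) ps"

definition const_of :: "(rcd \<Rightarrow> nat) \<Rightarrow> qkey \<Rightarrow> cname" where
  "const_of \<alpha> key = (case key of (s, tag, R, ps, k) \<Rightarrow>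
    if tag = TT then CRoot s else if tag = FT then CCon s R (con_tuple \<alpha> ps)
    else if tag = TF then CPos s R (con_tuple \<alpha> ps) (length k) else CVal s (\<alpha> (snd (hd ps))))"

lemma const_of_simps [simp]:
  "const_of \<alpha> (k_root s) = CRoot s" "const_of \<alpha> (k_con s c) = CCon s (fst c) (con_tuple \<alpha> (snd c))"
  "const_of \<alpha> (k_pos s c k) = CPos s (fst c) (con_tuple \<alpha> (snd c)) (length k)" "const_of \<alpha> (k_var s v) = CVal s (\<alpha> v)"
  by (simp_all add: const_of_def)

lemma well_indexed_nth: "well_indexed c \<Longrightarrow> p \<in> set (snd c) \<Longrightarrow> \<exists>k < length (snd c). p = snd c ! k \<and> fst p = unary k"
proof -
  assume w: "well_indexed c" and "p \<in> set (snd c)"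
  then obtain k where k: "k < length (snd c)" "p = snd c ! k" by (metis in_set_conv_nth)
  have "map fst (snd c) ! k = map unary [0..<length (snd c)] ! k" using w by (simp add: well_indexed_def)
  with k show ?thesis by auto
qed

lemma length_unary [simp]: "length (unary k) = k"
  by (simp add: unary_def)

lemma satisfies_edges:
  assumes I: "model Ont (template_db T1 T2) I" and sat: "satisfies (if s then T2 else T1) Is \<alpha>"
    and ok: "arity_ok (if s then T2 else T1) Is" and c: "c \<in> set Is"
  defines "g \<equiv> \<lambda>k. Const (cn (const_of \<alpha> k))"
  shows "(g (k_root s), g (k_con s c)) \<in> rext I 0" "g (k_con s c) \<in> cext I (l_rel s (fst c))"
    "p \<in> set (snd c) \<Longrightarrow> (g (k_con s c), g (k_pos s c (fst p))) \<in> rext I 0"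
    "p \<in> set (snd c) \<Longrightarrow> g (k_pos s c (fst p)) \<in> cext I (l_pos s (fst p))"
    "p \<in> set (snd c) \<Longrightarrow> (g (k_pos s c (fst p)), g (k_var s (snd p))) \<in> rext I 0"
proof -
  let ?t = "(fst c, con_tuple \<alpha> (snd c))"
  have t: "?t \<in> set (if s then T2 else T1)" using sat c by (simp add: satisfies_def con_tuple_def)
  have "RAtom 0 (cn (CRoot s)) (cn (CCon s (fst ?t) (snd ?t))) \<in> set (template_db T1 T2)"
    unfolding in_template_db using t by blast
  from model_RAtom[OF I this] show "(g (k_root s), g (k_con s c)) \<in> rext I 0" by (simp add: g_def)
  have "CAtom (l_rel s (fst ?t)) (cn (CCon s (fst ?t) (snd ?t))) \<in> set (template_db T1 T2)"
    unfolding in_template_db using t by blast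
  from model_CAtom[OF I this] show "g (k_con s c) \<in> cext I (l_rel s (fst c))" by (simp add: g_def)
  assume p: "p \<in> set (snd c)"
  have "well_indexed c" using ok c by (simp add: arity_ok_def)
  from well_indexed_nth[OF this p] obtain k where k: "k < length (snd c)" "p = snd c ! k" "fst p = unary k" by blast
  then have len: "k < length (snd ?t)" "snd ?t ! k = \<alpha> (snd p)" by (simp_all add: con_tuple_def)
  have "RAtom 0 (cn (CCon s (fst ?t) (snd ?t))) (cn (CPos s (fst ?t) (snd ?t) k)) \<in> set (template_db T1 T2)"
    unfolding in_template_db using t len by blast
  from model_RAtom[OF I this] show "(g (k_con s c), g (k_pos s c (fst p))) \<in> rext I 0" by (simp add: g_def k(3))
  have "CAtom (l_pos s (unary k)) (cn (CPos s (fst ?t) (snd ?t) k)) \<in> set (template_db T1 T2)"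
    unfolding in_template_db using t len by blast
  from model_CAtom[OF I this] show "g (k_pos s c (fst p)) \<in> cext I (l_pos s (fst p))" by (simp add: g_def k(3))
  have "RAtom 0 (cn (CPos s (fst ?t) (snd ?t) k)) (cn (CVal s (snd ?t ! k))) \<in> set (template_db T1 T2)"
    unfolding in_template_db using t len by blast
  from model_RAtom[OF I this[unfolded len(2)]]
  show "(g (k_pos s c (fst p)), g (k_var s (snd p))) \<in> rext I 0" by (simp add: g_def k(3))
qed

definition fresh :: "database \<Rightarrow> nat \<Rightarrow> nat" where
  "fresh D i = Suc (Max (insert 0 (adom D))) + i"

lemma fresh_notin: "fresh D i \<notin> adom D"
proof
  assume "fresh D i \<in> adom D"
  then have "fresh D i \<le> Max (insert 0 (adom D))" using finite_adom[of D] by (intro Max_ge) auto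
  then show False by (simp add: fresh_def)
qed

lemma fresh_inject [simp]: "fresh D i = fresh D j \<longleftrightarrow> i = j"
  by (simp add: fresh_def)

definition chain_edges :: "database \<Rightarrow> (nat \<times> nat) set" where
  "chain_edges D = {(cn CStart, fresh D 0), (fresh D 0, fresh D 1), (fresh D 1, fresh D 2), (fresh D 2, fresh D 3)}"

text \<open>A finite model with exactly one path, placed on four constants that do not occur in the
  database. It is the model against which claimed answers are refuted.\<close>

definition chain_model :: "template \<Rightarrow> database \<Rightarrow> 'd elem interp" where
  "chain_model T2 D = \<lparr>domain = Const ` (adom D \<union> {fresh D 0, fresh D 1, fresh D 2, fresh D 3}),
    cext = \<lambda>A. Const ` ({c. CAtom A c \<in> set D} \<union> {c. c = fresh D 1 \<and> A \<in> set (rel_labels T2)} \<union>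
      {c. c = fresh D 2 \<and> A \<in> set (pos_labels T2)}),
    rext = \<lambda>r. {(Const a, Const b) | a b. RAtom r a b \<in> set D \<or> (r = 0 \<and> (a, b) \<in> chain_edges D)}\<rparr>"

lemma adomI: "CAtom A a \<in> set D \<Longrightarrow> a \<in> adom D" "RAtom r a b \<in> set D \<Longrightarrow> a \<in> adom D" "RAtom r a b \<in> set D \<Longrightarrow> b \<in> adom D"
  by (force simp: adom_def)+

lemma start_atom: "CAtom l_start c \<in> set (template_db T1 T2) \<longleftrightarrow> c = cn CStart"
  unfolding in_template_db by simp

lemma l_start_labels: "l_start \<notin> set (rel_labels T2)" "l_start \<notin> set (pos_labels T2)"
  by (auto simp: rel_labels_def pos_labels_def)

lemma model_chain_model:
  fixes T1 T2
  defines "D \<equiv> template_db T1 T2"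
  shows "model (template_onto T2) D (chain_model T2 D :: 'd elem interp)"
proof -
  let ?I = "chain_model T2 D :: 'd elem interp"
  have start: "cn CStart \<in> adom D" using start_atom[of "cn CStart" T1 T2] adomI(1) unfolding D_def by blast
  have ce: "a \<in> adom D \<union> {fresh D 0, fresh D 1, fresh D 2, fresh D 3} \<and> b \<in> adom D \<union> {fresh D 0, fresh D 1, fresh D 2, fresh D 3}"
    if "(a, b) \<in> chain_edges D" for a b using that start by (auto simp: chain_edges_def)
  have wf: "wf_interp ?I"
    unfolding wf_interp_def
  proof (intro conjI allI)
    show "cext ?I A \<subseteq> domain ?I" for A using adomI(1) by (auto simp: chain_model_def)
    show "rext ?I r \<subseteq> domain ?I \<times> domain ?I" for r
    proof
      fix x assume "x \<in> rext ?I r"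
      then obtain a b where x: "x = (Const a, Const b)" "RAtom r a b \<in> set D \<or> (a, b) \<in> chain_edges D"
        by (auto simp: chain_model_def)
      then have "a \<in> adom D \<union> {fresh D 0, fresh D 1, fresh D 2, fresh D 3} \<and> b \<in> adom D \<union> {fresh D 0, fresh D 1, fresh D 2, fresh D 3}"
        using ce[of a b] adomI(2,3)[of r a b D] by blast
      moreover have "domain ?I = Const ` (adom D \<union> {fresh D 0, fresh D 1, fresh D 2, fresh D 3})"
        by (simp add: chain_model_def)
      ultimately show "x \<in> domain ?I \<times> domain ?I" unfolding x(1) by (intro SigmaI) (simp_all only: imageI)
    qed
  qed (use start in \<open>auto simp: chain_model_def\<close>)
  have ex: "Const a \<in> ext ?I (Ex 0 C)" if "(a, b) \<in> chain_edges D" "Const b \<in> ext ?I C" for a b C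
  proof -
    have "(Const a, Const b) \<in> rext ?I 0" using that(1) by (auto simp: chain_model_def)
    moreover from this wf have "Const a \<in> domain ?I" by (auto simp: wf_interp_def)
    ultimately show ?thesis using that(2) by auto
  qed
  have "ext ?I (Name l_start) \<subseteq> ext ?I (Ex 0 (Ex 0 (conj (rel_labels T2) (Ex 0 (conj (pos_labels T2) (Ex 0 Top))))))"
  proof
    fix d assume "d \<in> ext ?I (Name l_start)"
    then have d: "d = Const (cn CStart)"
      using l_start_labels[of T2] by (auto simp: chain_model_def D_def start_atom)
    have "Const (fresh D 3) \<in> ext ?I Top" by (simp add: chain_model_def)
    then have "Const (fresh D 2) \<in> ext ?I (conj (pos_labels T2) (Ex 0 Top))"
      unfolding ext_conj by (intro conjI ballI ex[of _ "fresh D 3"]) (auto simp: chain_edges_def chain_model_def)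
    then have "Const (fresh D 1) \<in> ext ?I (conj (rel_labels T2) (Ex 0 (conj (pos_labels T2) (Ex 0 Top))))"
      unfolding ext_conj[of _ _ "rel_labels T2"]
      by (intro conjI ballI ex[of _ "fresh D 2"]) (auto simp: chain_edges_def chain_model_def)
    then show "d \<in> ext ?I (Ex 0 (Ex 0 (conj (rel_labels T2) (Ex 0 (conj (pos_labels T2) (Ex 0 Top))))))"
      unfolding d by (intro ex[of _ "fresh D 0"] ex[of "fresh D 0" "fresh D 1"]) (auto simp: chain_edges_def)
  qed
  moreover have "sat_atom ?I (map_atom Const a)" if "a \<in> set D" for a
    using that by (cases a rule: atom.exhaust) (auto simp: chain_model_def)
  ultimately show ?thesis using wf by (auto simp: model_def template_onto_def)
qed

text \<open>An assignment can be read off if the constraints are matched in the database. The labels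
  of the first instance do not occur on the path at all; for the second instance a constant of the
  database as root keeps the match off the path.\<close>

lemma chain_model_match:
  fixes T1 T2
  defines "D \<equiv> template_db T1 T2"
  assumes h: "query_hom h (query (con_omq T1 T2 I1 I2)) (chain_model T2 D :: 'd elem interp)"
    and root: "s \<longrightarrow> (\<exists>c \<in> adom D. h (name (k_root True)) = Const c)"
    and ok: "arity_ok (if s then T2 else T1) (if s then I2 else I1)"
  shows "\<exists>\<alpha>. satisfies (if s then T2 else T1) (if s then I2 else I1) \<alpha>"
proof -
  let ?I = "chain_model T2 D :: 'd elem interp" and ?T = "if s then T2 else T1" and ?Is = "if s then I2 else I1"
  define \<alpha> where "\<alpha> v = (SOME x. h (name (k_var s v)) = Const (cn (CVal s x)))" for v
  have fr: "fresh D i \<notin> adom D" for i by (rule fresh_notin)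
  have "(fst c, con_tuple \<alpha> (snd c)) \<in> set ?T" if c: "c \<in> set ?Is" for c
  proof -
    note hc = con_query_homD[OF h c]
    have "\<exists>t. t \<in> set ?T \<and> fst t = fst c \<and> h (name (k_con s c)) = Const (cn (CCon s (fst t) (snd t)))"
    proof -
      from hc(2) obtain a where a: "h (name (k_con s c)) = Const a"
        and or: "CAtom (l_rel s (fst c)) a \<in> set D \<or> (a = fresh D 1 \<and> l_rel s (fst c) \<in> set (rel_labels T2)) \<or>
          (a = fresh D 2 \<and> l_rel s (fst c) \<in> set (pos_labels T2))"
        by (auto simp: chain_model_def)
      have "l_rel s (fst c) \<notin> set (pos_labels T2)" by (auto simp: pos_labels_def)
      \<comment> \<open>The path element with relation labels has only the predecessor
        \<open>fresh D 0\<close>, which is not in the database and so cannot be the image of the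
        root.\<close>
      moreover have "\<not> (a = fresh D 1 \<and> l_rel s (fst c) \<in> set (rel_labels T2))"
      proof
        assume "a = fresh D 1 \<and> l_rel s (fst c) \<in> set (rel_labels T2)"
        then have s: s and "a = fresh D 1" by (auto simp: rel_labels_def)
        with root obtain r where r: "r \<in> adom D" "h (name (k_root s)) = Const r" by auto
        with hc(1) a have "RAtom 0 r a \<in> set D \<or> (r, a) \<in> chain_edges D" by (auto simp: chain_model_def)
        with r(1) \<open>a = fresh D 1\<close> fr adomI(3)[of 0 r a D] show False by (auto simp: chain_edges_def)
      qed
      ultimately have "CAtom (l_rel s (fst c)) a \<in> set D" using or by blast
      then have "\<exists>t. t \<in> set ?T \<and> fst t = fst c \<and> a = cn (CCon s (fst t) (snd t))"
        unfolding D_def in_template_db by auto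
      with a show ?thesis by auto
    qed
    then obtain t where t: "t \<in> set ?T" "fst t = fst c" "h (name (k_con s c)) = Const (cn (CCon s (fst t) (snd t)))"
      by blast
    have wi: "well_indexed c" and len: "length (snd t) = length (snd c)"
      using ok c t(1,2) by (auto simp: arity_ok_def) (metis prod.collapse)+
    \<comment> \<open>\<open>CStart\<close> is the only constant of the database with an edge into
      the path, so from a constraint constant the match continues within the database.\<close>
    have edgeD: "RAtom 0 (cn x) b \<in> set D" if "(Const (cn x), Const b) \<in> rext ?I 0" "cn x \<in> adom D" "x \<noteq> CStart" for x b
      using that fr by (auto simp: chain_model_def chain_edges_def)
    have "snd t = con_tuple \<alpha> (snd c)"
    proof (rule nth_equalityI)
      show "length (snd t) = length (con_tuple \<alpha> (snd c))" by (simp add: len con_tuple_def)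
      fix k assume "k < length (snd t)"
      then have k: "k < length (snd c)" by (simp add: len)
      let ?p = "snd c ! k"
      have p: "?p \<in> set (snd c)" "fst ?p = unary k"
      proof -
        have "map fst (snd c) ! k = map unary [0..<length (snd c)] ! k" using wi by (simp add: well_indexed_def)
        with k show "fst ?p = unary k" by simp
      qed (use k in simp)
      from hc(3)[OF p(1)] t(3) obtain b where b: "h (name (k_pos s c (fst ?p))) = Const b"
        "(Const (cn (CCon s (fst t) (snd t))), Const b) \<in> rext ?I 0"
        by (auto simp: chain_model_def)
      have "RAtom 0 (cn (CRoot s)) (cn (CCon s (fst t) (snd t))) \<in> set D"
        unfolding D_def in_template_db using t(1) by blast
      then have ad: "cn (CCon s (fst t) (snd t)) \<in> adom D" by (rule adomI(3))
      from edgeD[OF b(2) ad] have "RAtom 0 (cn (CCon s (fst t) (snd t))) b \<in> set D" by simp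
      then obtain l where l: "l < length (snd t)" "b = cn (CPos s (fst t) (snd t) l)"
        unfolding D_def in_template_db by auto
      have adb: "b \<in> adom D" using \<open>RAtom 0 (cn (CCon s (fst t) (snd t))) b \<in> set D\<close> by (rule adomI(3))
      from hc(4)[OF p(1)] b have "CAtom (l_pos s (unary k)) b \<in> set D"
        using adb fr by (auto simp: chain_model_def p(2))
      \<comment> \<open>The position label excludes a match of position \<open>k\<close> at another
        coordinate of the same tuple.\<close>
      then have "l = k" unfolding D_def in_template_db l by auto
      from hc(5)[OF p(1)] b(1) obtain d where d: "h (name (k_var s (snd ?p))) = Const d" "(Const b, Const d) \<in> rext ?I 0"
        by (auto simp: chain_model_def)
      from edgeD[of "CPos s (fst t) (snd t) l" d] d(2) adb have "RAtom 0 (cn (CPos s (fst t) (snd t) l)) d \<in> set D"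
        unfolding l by simp
      then have "d = cn (CVal s (snd t ! k))" unfolding D_def in_template_db \<open>l = k\<close> by auto
      with d(1) have "\<alpha> (snd ?p) = snd t ! k" by (auto simp: \<alpha>_def)
      with k show "snd t ! k = con_tuple \<alpha> (snd c) ! k" by (simp add: con_tuple_def)
    qed
    with t show ?thesis by (metis prod.collapse)
  qed
  then show ?thesis unfolding satisfies_def con_tuple_def by blast
qed

lemma ans_con_omq: "ans (query (con_omq T1 T2 I1 I2)) = [name (k_root True)]"
  by (simp add: con_omq_def)

lemma onto_con_omq: "onto (con_omq T1 T2 I1 I2) = template_onto T2"
  by (simp add: con_omq_def)

lemma model_template_chain:
  assumes "model (template_onto T2) (template_db T1 T2) I"
  obtains e m p v where "(e, m) \<in> rext I 0" "\<forall>A \<in> set (rel_labels T2). m \<in> cext I A" "(m, p) \<in> rext I 0"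
    "\<forall>A \<in> set (pos_labels T2). p \<in> cext I A" "(p, v) \<in> rext I 0" "e \<in> domain I"
proof -
  let ?C = "Ex 0 (Ex 0 (conj (rel_labels T2) (Ex 0 (conj (pos_labels T2) (Ex 0 Top)))))"
  have "CAtom l_start (cn CStart) \<in> set (template_db T1 T2)" by (simp add: start_atom)
  from model_CAtom[OF assms this] have "Const (cn CStart) \<in> ext I (Name l_start)" by simp
  moreover have "sat_inclusion I (CI (Name l_start) ?C)" using assms by (auto simp: model_def template_onto_def)
  ultimately have "Const (cn CStart) \<in> ext I ?C" by auto
  then obtain e m where em: "(e, m) \<in> rext I 0" "e \<in> domain I"
    "m \<in> ext I (conj (rel_labels T2) (Ex 0 (conj (pos_labels T2) (Ex 0 Top))))" by auto
  from em(3) have m: "\<forall>A \<in> set (rel_labels T2). m \<in> cext I A" "m \<in> ext I (Ex 0 (conj (pos_labels T2) (Ex 0 Top)))"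
    unfolding ext_conj by blast+
  from m(2) obtain p where p: "(m, p) \<in> rext I 0" "p \<in> ext I (conj (pos_labels T2) (Ex 0 Top))" by auto
  from p(2) have p': "\<forall>A \<in> set (pos_labels T2). p \<in> cext I A" "p \<in> ext I (Ex 0 Top)"
    unfolding ext_conj by blast+
  from p'(2) obtain v where v: "(p, v) \<in> rext I 0" by auto
  show thesis by (rule that[OF em(1) m(1) p(1) p'(1) v em(2)])
qed

lemma satisfies_mem:
  assumes "satisfies Tm I \<alpha>" "c \<in> set I"
  shows "(fst c, con_tuple \<alpha> (snd c)) \<in> set Tm"
  using assms by (simp add: satisfies_def con_tuple_def)

definition side_hom :: "(rcd \<Rightarrow> nat) \<Rightarrow> (qkey \<Rightarrow> 'd elem) \<Rightarrow> qkey \<Rightarrow> 'd elem" where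
  "side_hom \<alpha> g k = (if fst k then g k else Const (cn (const_of \<alpha> k)))"

text \<open>The first query follows its assignment into the database, and the second is sent to the
  path layer by layer, regardless of its satisfiability. By \<open>lab\<close> each relation has a
  tuple in the template, which provides its label and those of its positions.\<close>

lemma match_wild:
  assumes I: "model (template_onto T2) (template_db T1 T2) (I :: 'd elem interp)" and sat: "satisfies T1 I1 \<alpha>"
    and ok: "arity_ok T1 I1" "arity_ok T2 I2" and lab: "\<And>c. c \<in> set I2 \<Longrightarrow> fst c \<in> fst ` set T2"
  shows "\<exists>h. query_hom h (query (con_omq T1 T2 I1 I2)) I"
proof -
  obtain e m p v where chain: "(e, m) \<in> rext I 0" "\<forall>A \<in> set (rel_labels T2). m \<in> cext I A" "(m, p) \<in> rext I 0"
    "\<forall>A \<in> set (pos_labels T2). p \<in> cext I A" "(p, v) \<in> rext I 0" "e \<in> domain I"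
    by (rule model_template_chain[OF I])
  define g where "g = side_hom \<alpha> (\<lambda>k. if fst (snd k) = TT then e else if fst (snd k) = FT then m
    else if fst (snd k) = TF then p else v)"
  have edges: "(g (k_root s), g (k_con s c)) \<in> rext I 0 \<and> g (k_con s c) \<in> cext I (l_rel s (fst c)) \<and>
      (\<forall>q \<in> set (snd c). (g (k_con s c), g (k_pos s c (fst q))) \<in> rext I 0 \<and> g (k_pos s c (fst q)) \<in> cext I (l_pos s (fst q)) \<and>
      (g (k_pos s c (fst q)), g (k_var s (snd q))) \<in> rext I 0)" if c: "c \<in> set (if s then I2 else I1)" for s c
  proof (cases s)
    case False
    with satisfies_edges[OF I, of False I1 \<alpha> c] sat ok c show ?thesis by (simp add: g_def side_hom_def)
  next
    case True
    then have c2: "c \<in> set I2" using c by simp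
    from lab[OF c2] obtain t where t: "fst c = fst t" "t \<in> set T2" by (rule imageE)
    have 1: "l_rel True (fst c) \<in> set (rel_labels T2)" unfolding t(1) rel_labels_def using t(2) by simp
    have "well_indexed c \<and> ((fst c, snd t) \<in> set T2 \<longrightarrow> length (snd t) = length (snd c))"
      using ok(2) c2 unfolding arity_ok_def by blast
    then have w: "well_indexed c" "length (snd t) = length (snd c)" using t by simp_all
    have 2: "l_pos True (fst q) \<in> set (pos_labels T2)" if q: "q \<in> set (snd c)" for q
    proof -
      from well_indexed_nth[OF w(1) q] obtain k where "k < length (snd t)" "fst q = unary k" unfolding w(2) by blast
      with t(2) show ?thesis by (auto simp: pos_labels_def intro!: bexI[of _ t])
    qed
    show ?thesis using True chain 1 2 by (simp add: g_def side_hom_def)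
  qed
  have wf: "wf_interp I" using I by (simp add: model_def)
  have dom: "g (k_root True) \<in> domain I" using chain by (simp add: g_def side_hom_def)
  from con_query_hom[OF refl edges wf dom] show ?thesis by blast
qed

lemma match_const:
  assumes I: "model (template_onto T2) (template_db T1 T2) (I :: 'd elem interp)" and sat: "satisfies T1 I1 \<alpha>" "satisfies T2 I2 \<beta>"
    and ok: "arity_ok T1 I1" "arity_ok T2 I2" and ne: "I2 \<noteq> []"
  shows "\<exists>h. query_hom h (query (con_omq T1 T2 I1 I2)) I \<and> h (name (k_root True)) = Const (cn (CRoot True))"
proof -
  define g :: "qkey \<Rightarrow> 'd elem" where "g = side_hom \<alpha> (\<lambda>k. Const (cn (const_of \<beta> k)))"
  have edges: "(g (k_root s), g (k_con s c)) \<in> rext I 0 \<and> g (k_con s c) \<in> cext I (l_rel s (fst c)) \<and>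
      (\<forall>q \<in> set (snd c). (g (k_con s c), g (k_pos s c (fst q))) \<in> rext I 0 \<and> g (k_pos s c (fst q)) \<in> cext I (l_pos s (fst q)) \<and>
      (g (k_pos s c (fst q)), g (k_var s (snd q))) \<in> rext I 0)" if c: "c \<in> set (if s then I2 else I1)" for s c
    using satisfies_edges[OF I, of False I1 \<alpha> c] satisfies_edges[OF I, of True I2 \<beta> c] sat ok c
    by (cases s) (simp_all add: g_def side_hom_def)
  have wf: "wf_interp I" using I by (simp add: model_def)
  \<comment> \<open>An existing constraint places the root on an edge, which shows that its image is
    in the domain.\<close>
  from ne obtain c where "c \<in> set I2" by (cases I2) auto
  with edges[of c True] have "(g (k_root True), g (k_con True c)) \<in> rext I 0" by simp
  with wf have dom: "g (k_root True) \<in> domain I" by (auto simp: wf_interp_def)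
  from con_query_hom[OF refl edges wf dom] show ?thesis by (simp add: g_def side_hom_def)
qed

lemma adom_root:
  assumes "satisfies T2 I2 \<beta>" "I2 \<noteq> []"
  shows "cn (CRoot True) \<in> adom (template_db T1 T2)"
proof -
  from assms(2) obtain c where "c \<in> set I2" by (cases I2) auto
  from satisfies_mem[OF assms(1) this] obtain t where t: "t \<in> set T2" by blast
  have "RAtom 0 (cn (CRoot True)) (cn (CCon True (fst t) (snd t))) \<in> set (template_db T1 T2)"
    unfolding in_template_db using t by (auto intro!: exI[of _ True])
  then show ?thesis by (rule adomI(2))
qed

lemma justified_single: "justified P [x] \<longleftrightarrow> P [] x"
  using justified_snoc[of P "[]" x] by simp

lemma gpartial_wild_iff:
  assumes ok: "arity_ok T1 I1" "arity_ok T2 I2" and lab: "\<And>c. c \<in> set I2 \<Longrightarrow> fst c \<in> fst ` set T2"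
  shows "gpartial TYPE('d) mu (con_omq T1 T2 I1 I2) (template_db T1 T2) [(True, 0)] \<longleftrightarrow> (\<exists>\<alpha>. satisfies T1 I1 \<alpha>)"
proof
  have "slots_ok mu D [(True, 0)]" for D by (simp add: slots_ok_def justified_single)
  moreover have "tuple_fits slot_const mu {(x, (True, 0))} h" for x and h :: "nat \<Rightarrow> 'd elem"
    by (auto simp: tuple_fits_def slot_const_def)
  ultimately show "\<exists>\<alpha>. satisfies T1 I1 \<alpha> \<Longrightarrow> gpartial TYPE('d) mu (con_omq T1 T2 I1 I2) (template_db T1 T2) [(True, 0)]"
    using match_wild[OF _ _ ok lab] unfolding gpartial_def by (auto simp: ans_con_omq onto_con_omq)
next
  assume "gpartial TYPE('d) mu (con_omq T1 T2 I1 I2) (template_db T1 T2) [(True, 0)]"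
  then obtain h where "query_hom h (query (con_omq T1 T2 I1 I2)) (chain_model T2 (template_db T1 T2) :: 'd elem interp)"
    unfolding gpartial_def onto_con_omq using model_chain_model by blast
  from chain_model_match[OF this, of False] ok show "\<exists>\<alpha>. satisfies T1 I1 \<alpha>" by simp
qed

text \<open>In \<open>chain_model\<close> a constant answer keeps the second query off the path, so
  both assignments can be recovered. Conversely the same constant \<open>CRoot True\<close> works in
  all models; it occurs in the database because the second instance is nonempty and
  satisfiable.\<close>

lemma gpartial_const_iff:
  assumes ok: "arity_ok T1 I1" "arity_ok T2 I2" and ne: "I2 \<noteq> []"
  shows "(\<exists>c. gpartial TYPE('d) mu (con_omq T1 T2 I1 I2) (template_db T1 T2) [(False, c)]) \<longleftrightarrow>
    (\<exists>\<alpha>. satisfies T1 I1 \<alpha>) \<and> (\<exists>\<beta>. satisfies T2 I2 \<beta>)"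
proof
  let ?D = "template_db T1 T2" and ?Q = "con_omq T1 T2 I1 I2"
  assume "(\<exists>\<alpha>. satisfies T1 I1 \<alpha>) \<and> (\<exists>\<beta>. satisfies T2 I2 \<beta>)"
  then obtain \<alpha> \<beta> where sat: "satisfies T1 I1 \<alpha>" "satisfies T2 I2 \<beta>" by blast
  let ?c = "cn (CRoot True)"
  have "slots_ok mu ?D [(False, ?c)]"
    using adom_root[OF sat(2) ne] by (simp add: slots_ok_def justified_single)
  moreover have "\<exists>h. query_hom h (query ?Q) I \<and> tuple_fits slot_const mu {(name (k_root True), (False, ?c))} h"
    if I: "model (template_onto T2) ?D I" for I :: "'d elem interp"
  proof -
    from match_const[OF I sat ok ne] obtain h where h: "query_hom h (query ?Q) I" "h (name (k_root True)) = Const ?c"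
      by blast
    have "tuple_fits slot_const mu {(name (k_root True), (False, ?c))} h"
      using h(2) by (auto simp: tuple_fits_def slot_const_def)
    with h(1) show ?thesis by blast
  qed
  ultimately have "gpartial TYPE('d) mu ?Q ?D [(False, ?c)]"
    unfolding gpartial_def by (simp add: ans_con_omq onto_con_omq)
  then show "\<exists>c. gpartial TYPE('d) mu ?Q ?D [(False, c)]" by blast
next
  let ?D = "template_db T1 T2" and ?Q = "con_omq T1 T2 I1 I2"
  assume "\<exists>c. gpartial TYPE('d) mu ?Q ?D [(False, c)]"
  then obtain c where gp: "gpartial TYPE('d) mu ?Q ?D [(False, c)]" by blast
  then obtain h where h: "query_hom h (query ?Q) (chain_model T2 ?D :: 'd elem interp)"
    and fit: "tuple_fits slot_const mu (set (zip (ans (query ?Q)) [(False, c)])) h"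
    unfolding gpartial_def onto_con_omq using model_chain_model by blast
  have "c \<in> adom ?D" using gp by (simp add: gpartial_def slots_ok_def)
  moreover have "h (name (k_root True)) = Const c" using fit by (simp add: ans_con_omq tuple_fits_def slot_const_def)
  ultimately show "(\<exists>\<alpha>. satisfies T1 I1 \<alpha>) \<and> (\<exists>\<beta>. satisfies T2 I2 \<beta>)"
    using chain_model_match[OF h, of False] chain_model_match[OF h, of True] ok by auto
qed

section \<open>The reduction from languages in DP\<close>

lemma length_1_cases: "length c = Suc 0 \<Longrightarrow> \<exists>x. c = [x]"
  by (cases c) auto

lemma minimal_s_iff:
  assumes "length (ans (query Q)) = 1"
  shows "minimal_partial_answer_s T Q D [Star] \<longleftrightarrow>
    gpartial T False Q D [(True, 0)] \<and> \<not> (\<exists>c. gpartial T False Q D [(False, c)])"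
proof -
  have "c' \<noteq> [Star] \<and> sle c' [Star] \<longleftrightarrow> (\<exists>k. c' = [SVal k])" for c' :: "nat swild list"
  proof
    assume *: "c' \<noteq> [Star] \<and> sle c' [Star]"
    then obtain x where "c' = [x]" using length_1_cases[of c'] by (auto simp: sle_def)
    with * show "\<exists>k. c' = [SVal k]" by (cases x) auto
  qed (auto simp: sle_def)
  then show ?thesis unfolding minimal_partial_answer_s_def
    using gpartial_s[of T Q D "[Star]"] gpartial_s[of T Q D "[SVal _]"] by auto
qed

lemma minimal_m_iff:
  assumes "length (ans (query Q)) = 1"
  shows "minimal_partial_answer_m T Q D [Wild 0] \<longleftrightarrow>
    gpartial T True Q D [(True, 0)] \<and> \<not> (\<exists>c. gpartial T True Q D [(False, c)])"
proof -
  have "partial_answer_m T Q D c' \<and> c' \<noteq> [Wild 0] \<and> mle c' [Wild 0] \<longleftrightarrow> (\<exists>k. c' = [MVal k] \<and> partial_answer_m T Q D c')" for c'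
  proof
    assume *: "partial_answer_m T Q D c' \<and> c' \<noteq> [Wild 0] \<and> mle c' [Wild 0]"
    then obtain x where x: "c' = [x]" using length_1_cases[of c'] by (auto simp: mle_def)
    \<comment> \<open>In a tuple of length one only the first wildcard is admissible, since any
      other would need an earlier occurrence of its predecessor.\<close>
    have "x \<noteq> Wild j" for j
    proof
      assume "x = Wild j"
      with x * obtain i where "x = Wild (Suc i)" by (cases j) auto
      with x * show False by (auto simp: partial_answer_m_def mtuple_def)
    qed
    with x * show "\<exists>k. c' = [MVal k] \<and> partial_answer_m T Q D c'" by (cases x) auto
  qed (auto simp: mle_def)
  then show ?thesis unfolding minimal_partial_answer_m_def
    using gpartial_m[of T Q D "[Wild 0]"] gpartial_m[of T Q D "[MVal _]"] by auto
qed

text \<open>Only the atoms of the query depend on the word; ontology, signature, database and tuple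
  contribute constant words.\<close>

lemma pt_ginput:
  assumes "pt F1" "pt F2"
  shows "pt (\<lambda>x. ginput mu (con_omq T1 T2 (F1 x) (F2 x)) D z)"
proof -
  have "ginput mu (con_omq T1 T2 (F1 x) (F2 x)) D z =
    (Defs.enc_list enc_inclusion (template_onto T2) @ Defs.enc_list enc_nat (atom_csig (template_db T1 T2)) @
      Defs.enc_list enc_nat [0] @ Defs.enc_list enc_nat [name (k_root True)]) @
    wlist (concat (map (con_words False) (F1 x)) @ concat (map (con_words True) (F2 x))) @
    (Defs.enc_list enc_atom D @ Defs.enc_list (slot_word mu) z)" for x
    by (simp add: ginput_def enc_omq_def enc_cq_def con_omq_def con_words_def[abs_def] enc_list_wlist[of enc_atom "concat _ @ _"]
        map_concat o_def)
  then show ?thesis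
    by (simp only:) (intro pt_append pt_const pt_comp[OF pt_wlist] pt_concat pt_map pt_comp[OF pt_con_words] pt_snd pt_id assms)
qed

lemma sig_con_omq: "sig_database (con_omq T1 T2 I1 I2) (template_db T1 T2)"
proof -
  have "atom_over (set (atom_csig (template_db T1 T2))) {0} a" if "a \<in> set (template_db T1 T2)" for a
  proof (cases a)
    case (CAtom A x)
    with that show ?thesis by (force simp: atom_csig_def)
  next
    case (RAtom r x y)
    with that show ?thesis by (simp add: in_template_db)
  qed
  then show ?thesis by (simp add: sig_database_def con_omq_def)
qed

text \<open>The template depends on the language but not on the word, so database and ontology stay
  fixed. The side conditions ensure that the labels of all constraints occur on the path and that
  the root occurs in an atom.\<close>

definition csp_reducible :: "language \<Rightarrow> bool" where
  "csp_reducible L \<longleftrightarrow> (\<exists>Tm F. pt F \<and> (\<forall>x. arity_ok Tm (F x) \<and> F x \<noteq> [] \<and> (\<forall>c \<in> set (F x). fst c \<in> fst ` set Tm) \<and>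
    (x \<in> L \<longleftrightarrow> (\<exists>\<alpha>. satisfies Tm (F x) \<alpha>))))"

text \<open>The second instance comes from the complement of \<open>L2\<close>. The image is
  accepted iff \<open>x \<in> L1\<close> and not both \<open>x \<in> L1\<close> and
  \<open>x \<notin> L2\<close>, which amounts to \<open>x \<in> L1 \<inter> L2\<close>.\<close>

lemma DP_hard:
  assumes NP: "\<And>L. L \<in> NP \<Longrightarrow> csp_reducible L" and L: "L \<in> DP"
    and K: "\<And>Q D. onto Q \<in> EL \<Longrightarrow> sig_database Q D \<Longrightarrow> length (ans (query Q)) = 1 \<Longrightarrow>
      ginput mu Q D [(True, 0)] \<in> K \<longleftrightarrow>
      gpartial TYPE('d) mu Q D [(True, 0)] \<and> \<not> (\<exists>c. gpartial TYPE('d) mu Q D [(False, c)])"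
  shows "L \<le>\<^sub>p K"
proof -
  from L obtain L1 L2 where L12: "L = L1 \<inter> L2" "L1 \<in> NP" "- L2 \<in> NP" unfolding DP_def coNP_def by auto
  from NP[OF L12(2)] obtain T1 F1 where 1: "pt F1" "\<And>x. arity_ok T1 (F1 x)" "\<And>x. x \<in> L1 \<longleftrightarrow> (\<exists>\<alpha>. satisfies T1 (F1 x) \<alpha>)"
    unfolding csp_reducible_def by blast
  from NP[OF L12(3)] obtain T2 F2 where 2: "pt F2" "\<And>x. arity_ok T2 (F2 x)" "\<And>x. F2 x \<noteq> []"
    "\<And>x c. c \<in> set (F2 x) \<Longrightarrow> fst c \<in> fst ` set T2" "\<And>x. x \<in> - L2 \<longleftrightarrow> (\<exists>\<alpha>. satisfies T2 (F2 x) \<alpha>)"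
    unfolding csp_reducible_def by blast
  let ?D = "template_db T1 T2"
  define f where "f x = ginput mu (con_omq T1 T2 (F1 x) (F2 x)) ?D [(True, 0)]" for x
  have "polytime f" unfolding f_def by (intro polytime_pt pt_ginput 1 2)
  moreover have "x \<in> L \<longleftrightarrow> f x \<in> K" for x
  proof -
    have "onto (con_omq T1 T2 (F1 x) (F2 x)) \<in> EL" by (simp add: onto_con_omq template_onto_def EL_def)
    moreover have "gpartial TYPE('d) mu (con_omq T1 T2 (F1 x) (F2 x)) ?D [(True, 0)] \<longleftrightarrow> (\<exists>\<alpha>. satisfies T1 (F1 x) \<alpha>)"
      by (rule gpartial_wild_iff[OF 1(2) 2(2)]) (rule 2(4))
    ultimately have "f x \<in> K \<longleftrightarrow> (\<exists>\<alpha>. satisfies T1 (F1 x) \<alpha>) \<and>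
      \<not> ((\<exists>\<alpha>. satisfies T1 (F1 x) \<alpha>) \<and> (\<exists>\<beta>. satisfies T2 (F2 x) \<beta>))"
      using K[OF _ sig_con_omq] gpartial_const_iff[where 'd = 'd and mu = mu, OF 1(2)[of x] 2(2)[of x] 2(3)[of x]]
      by (simp add: f_def ans_con_omq) blast
    with 1(3)[of x] 2(5)[of x] L12(1) show ?thesis by blast
  qed
  ultimately show ?thesis unfolding poly_reducible_def by blast
qed

lemma single_testing_s_hard:
  assumes "\<And>L. L \<in> NP \<Longrightarrow> csp_reducible L" "L \<in> DP" "EL \<subseteq> \<O>"
  shows "L \<le>\<^sub>p single_testing_s TYPE('d) \<O>"
proof (rule DP_hard[OF assms(1,2), where mu = False])
  fix Q D assume *: "onto Q \<in> EL" "sig_database Q D" "length (ans (query Q)) = 1"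
  have e: "ginput False Q D [(True, 0)] = enc_input enc_swild Q D [Star]" using ginput_s[of Q D "[Star]"] by simp
  have "ginput False Q D [(True, 0)] \<in> single_testing_s TYPE('d) \<O> \<longleftrightarrow> minimal_partial_answer_s TYPE('d) Q D [Star]"
  proof
    assume "ginput False Q D [(True, 0)] \<in> single_testing_s TYPE('d) \<O>"
    then obtain Q' D' c where "enc_input enc_swild Q D [Star] = enc_input enc_swild Q' D' c"
      and "minimal_partial_answer_s TYPE('d) Q' D' c" unfolding single_testing_s_def e by blast
    with enc_input_inject[OF prefix_free_swild] show "minimal_partial_answer_s TYPE('d) Q D [Star]" by blast
  next
    assume "minimal_partial_answer_s TYPE('d) Q D [Star]"
    with * assms(3) show "ginput False Q D [(True, 0)] \<in> single_testing_s TYPE('d) \<O>"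
      unfolding single_testing_s_def e by blast
  qed
  then show "ginput False Q D [(True, 0)] \<in> single_testing_s TYPE('d) \<O> \<longleftrightarrow>
      gpartial TYPE('d) False Q D [(True, 0)] \<and> \<not> (\<exists>c. gpartial TYPE('d) False Q D [(False, c)])"
    using minimal_s_iff[OF *(3)] by blast
qed

lemma single_testing_m_hard:
  assumes "\<And>L. L \<in> NP \<Longrightarrow> csp_reducible L" "L \<in> DP" "EL \<subseteq> \<O>"
  shows "L \<le>\<^sub>p single_testing_m TYPE('d) \<O>"
proof (rule DP_hard[OF assms(1,2), where mu = True])
  fix Q D assume *: "onto Q \<in> EL" "sig_database Q D" "length (ans (query Q)) = 1"
  have e: "ginput True Q D [(True, 0)] = enc_input enc_mwild Q D [Wild 0]" using ginput_m[of Q D "[Wild 0]"] by simp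
  have "ginput True Q D [(True, 0)] \<in> single_testing_m TYPE('d) \<O> \<longleftrightarrow> minimal_partial_answer_m TYPE('d) Q D [Wild 0]"
  proof
    assume "ginput True Q D [(True, 0)] \<in> single_testing_m TYPE('d) \<O>"
    then obtain Q' D' c where "enc_input enc_mwild Q D [Wild 0] = enc_input enc_mwild Q' D' c"
      and "minimal_partial_answer_m TYPE('d) Q' D' c" unfolding single_testing_m_def e by blast
    with enc_input_inject[OF prefix_free_mwild] show "minimal_partial_answer_m TYPE('d) Q D [Wild 0]" by blast
  next
    assume "minimal_partial_answer_m TYPE('d) Q D [Wild 0]"
    with * assms(3) show "ginput True Q D [(True, 0)] \<in> single_testing_m TYPE('d) \<O>"
      unfolding single_testing_m_def e by blast
  qed
  then show "ginput True Q D [(True, 0)] \<in> single_testing_m TYPE('d) \<O> \<longleftrightarrow>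
      gpartial TYPE('d) True Q D [(True, 0)] \<and> \<not> (\<exists>c. gpartial TYPE('d) True Q D [(False, c)])"
    using minimal_m_iff[OF *(3)] by blast
qed

section \<open>Tableaux of Turing machines\<close>

text \<open>Halting is turned into an action that changes nothing, so that runs of different lengths
  can be described up to a common time.\<close>

definition next_action :: "tm \<Rightarrow> nat \<times> nat list \<Rightarrow> nat \<times> (nat \<times> dir) list" where
  "next_action M \<sigma> = (if fst \<sigma> < states M then delta M (fst \<sigma>) (snd \<sigma>) else (fst \<sigma>, map (\<lambda>s. (s, Stay)) (snd \<sigma>)))"

definition local_state :: "config \<Rightarrow> nat \<times> nat list" where
  "local_state cfg = (fst cfg, map read (snd cfg))"

lemma step_next_action:
  "step M cfg = (fst (next_action M (local_state cfg)), map2 act (snd (next_action M (local_state cfg))) (snd cfg))"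
proof -
  have "map2 act (map (\<lambda>s. (s, Stay)) (map read ts)) ts = ts" for ts
  proof (induction ts)
    case (Cons t ts)
    then show ?case by (cases t) simp
  qed simp
  then show ?thesis by (cases cfg) (auto simp: next_action_def local_state_def split: prod.split)
qed

text \<open>A cell consists of its symbol and of a flag for the head, so that its successor is determined
  by the cell, its two neighbours and the action.\<close>

definition cell :: "tape \<Rightarrow> int \<Rightarrow> nat \<times> bool" where
  "cell tp p = (snd tp p, fst tp = p)"

definition next_cell :: "nat \<times> dir \<Rightarrow> nat \<times> bool \<Rightarrow> nat \<times> bool \<Rightarrow> nat \<times> bool \<Rightarrow> nat \<times> bool" where
  "next_cell a l m r = (if snd m then fst a else fst m, case snd a of ToLeft \<Rightarrow> snd r | Stay \<Rightarrow> snd m | ToRight \<Rightarrow> snd l)"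

lemma cell_act: "cell (act a tp) p = next_cell a (cell tp (p - 1)) (cell tp p) (cell tp (p + 1))"
  by (cases a; cases tp; cases "snd a") (auto simp: cell_def next_cell_def)

definition local_states :: "tm \<Rightarrow> (nat \<times> nat list) set" where
  "local_states M = {..states M} \<times> {ss. set ss \<subseteq> {..<symbols M} \<and> length ss = tapes M}"

definition cells :: "tm \<Rightarrow> (nat \<times> bool) set" where
  "cells M = {..<symbols M} \<times> UNIV"

lemma finite_local_states [simp]: "finite (local_states M)"
  unfolding local_states_def by (intro finite_cartesian_product finite_lists_length_eq) auto

lemma finite_cells [simp]: "finite (cells M)"
  by (simp add: cells_def)

definition valid_config :: "tm \<Rightarrow> config \<Rightarrow> bool" where
  "valid_config M cfg \<longleftrightarrow> fst cfg \<le> states M \<and> length (snd cfg) = tapes M \<and> (\<forall>tp \<in> set (snd cfg). \<forall>i. snd tp i < symbols M)"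

lemma read_cell: "read tp = snd tp (fst tp)"
  by (cases tp) simp

lemma valid_local_state: "valid_config M cfg \<Longrightarrow> local_state cfg \<in> local_states M"
  by (auto simp: valid_config_def local_state_def local_states_def read_cell)

lemma next_action_ok:
  assumes "wf_tm M" "\<sigma> \<in> local_states M"
  shows "fst (next_action M \<sigma>) \<le> states M" "length (snd (next_action M \<sigma>)) = tapes M"
    "fst ` set (snd (next_action M \<sigma>)) \<subseteq> {..<symbols M}"
proof -
  have ss: "length (snd \<sigma>) = tapes M" "set (snd \<sigma>) \<subseteq> {..<symbols M}" "fst \<sigma> \<le> states M"
    using assms(2) by (auto simp: local_states_def)
  have "fst (next_action M \<sigma>) \<le> states M \<and> length (snd (next_action M \<sigma>)) = tapes M \<and>
    fst ` set (snd (next_action M \<sigma>)) \<subseteq> {..<symbols M}"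
  proof (cases "fst \<sigma> < states M")
    case True
    with assms(1) ss show ?thesis by (simp add: wf_tm_def next_action_def)
  next
    case False
    with ss show ?thesis by (auto simp: next_action_def)
  qed
  then show "fst (next_action M \<sigma>) \<le> states M" "length (snd (next_action M \<sigma>)) = tapes M"
    "fst ` set (snd (next_action M \<sigma>)) \<subseteq> {..<symbols M}" by blast+
qed

lemma valid_step:
  assumes M: "wf_tm M" and v: "valid_config M cfg"
  shows "valid_config M (step M cfg)"
proof -
  note ok = next_action_ok[OF M valid_local_state[OF v]]
  have "snd (act a tp) i < symbols M" if "a \<in> set (snd (next_action M (local_state cfg)))" "tp \<in> set (snd cfg)" for a tp i
  proof -
    have "fst a < symbols M" "snd tp i < symbols M" using that ok(3) v by (auto simp: valid_config_def)
    then show ?thesis by (cases a; cases tp) simp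
  qed
  then have "snd tp i < symbols M" if "tp \<in> set (snd (step M cfg))" for tp i
    using that by (auto simp only: step_next_action snd_conv set_map split_paired_all case_prod_conv)
      (blast dest: set_zip_leftD set_zip_rightD)
  then show ?thesis using ok(1,2) v by (simp add: step_next_action valid_config_def)
qed

definition run :: "tm \<Rightarrow> bool list \<Rightarrow> nat \<Rightarrow> config" where
  "run M w t = (step M ^^ t) (init_config M w)"

lemma run_Suc: "run M w (Suc t) = step M (run M w t)"
  by (simp add: run_def)

lemma valid_run:
  assumes "wf_tm M"
  shows "valid_config M (run M w t)"
proof (induction t)
  case 0
  show ?case using assms by (auto simp: run_def init_config_def valid_config_def word_cells_def wf_tm_def)
next
  case (Suc t)
  then show ?case unfolding run_Suc by (rule valid_step[OF assms])
qed

lemma length_run: "wf_tm M \<Longrightarrow> length (snd (run M w t)) = tapes M"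
  using valid_run[of M w t] by (simp add: valid_config_def)

definition run_cell :: "tm \<Rightarrow> bool list \<Rightarrow> nat \<Rightarrow> nat \<Rightarrow> int \<Rightarrow> nat \<times> bool" where
  "run_cell M w t j p = cell (snd (run M w t) ! j) p"

abbreviation run_state :: "tm \<Rightarrow> bool list \<Rightarrow> nat \<Rightarrow> nat \<times> nat list" where
  "run_state M w t \<equiv> local_state (run M w t)"

lemma run_state_mem: "wf_tm M \<Longrightarrow> run_state M w t \<in> local_states M"
  by (intro valid_local_state valid_run)

lemma run_cell_mem:
  assumes "wf_tm M" "j < tapes M"
  shows "run_cell M w t j p \<in> cells M"
  using valid_run[OF assms(1), of w t] assms(2)
  by (auto simp: run_cell_def cell_def cells_def valid_config_def)

lemma fst_run_state_Suc: "fst (run_state M w (Suc t)) = fst (next_action M (run_state M w t))"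
  by (simp add: run_Suc step_next_action) (simp add: local_state_def)

lemma run_tape_Suc:
  assumes "wf_tm M" "j < tapes M"
  shows "snd (run M w (Suc t)) ! j = act (snd (next_action M (run_state M w t)) ! j) (snd (run M w t) ! j)"
  using assms next_action_ok(2)[OF assms(1) run_state_mem[OF assms(1), of w t]]
  by (simp add: run_Suc step_next_action length_run)

lemma run_cell_Suc:
  assumes "wf_tm M" "j < tapes M"
  shows "run_cell M w (Suc t) j p = next_cell (snd (next_action M (run_state M w t)) ! j)
    (run_cell M w t j (p - 1)) (run_cell M w t j p) (run_cell M w t j (p + 1))"
  unfolding run_cell_def run_tape_Suc[OF assms] cell_act ..

lemma run_cell_read:
  assumes "wf_tm M" "j < tapes M" "snd (run_cell M w t j p)"
  shows "fst (run_cell M w t j p) = snd (run_state M w t) ! j"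
  using assms by (simp add: run_cell_def cell_def local_state_def length_run read_cell)

text \<open>This determines how wide a window of the tape a tableau must describe.\<close>

lemma run_head:
  assumes "wf_tm M" "j < tapes M"
  shows "\<bar>fst (snd (run M w t) ! j)\<bar> \<le> int t"
proof (induction t)
  case 0
  show ?case using assms(2) by (cases j) (simp_all add: run_def init_config_def)
next
  case (Suc t)
  have "\<bar>fst (act a tp)\<bar> \<le> \<bar>fst tp\<bar> + 1" for a tp by (cases a; cases tp; cases "snd a") auto
  from this[of "snd (next_action M (run_state M w t)) ! j" "snd (run M w t) ! j"] Suc show ?case
    unfolding run_tape_Suc[OF assms] by simp
qed

lemma run_cell_0:
  assumes "j < tapes M"
  shows "run_cell M w 0 j p = (if j = 0 then word_cells w p else 0, p = 0)"
  using assms by (cases j) (auto simp: run_cell_def run_def init_config_def cell_def)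

text \<open>The output \<open>[True]\<close> is the symbol 2 in cell 0 followed by a blank in cell
  1. A halted configuration no longer changes, so it may be inspected at any later time.\<close>

lemma run_accepts:
  assumes M: "wf_tm M" and t: "halts_with M (run M w t) v" "t \<le> T"
  shows "v = [True] \<longleftrightarrow> fst (run_cell M w T 1 0) = 2 \<and> fst (run_cell M w T 1 1) = 0"
    "fst (run_state M w T) = states M"
proof -
  have "run M w (t + n) = run M w t" for n
  proof (induction n)
    case (Suc n)
    have "step M (run M w t) = run M w t" using t(1) by (cases "run M w t") (simp add: halts_with_def)
    with Suc show ?case by (simp add: run_Suc)
  qed simp
  from this[of "T - t"] t have h: "halts_with M (run M w T) v" by simp
  then show "fst (run_state M w T) = states M" by (simp add: halts_with_def local_state_def)
  from h have c: "fst (run_cell M w T 1 i) = word_cells v i" if "0 \<le> i" "i \<le> int (length v)" for i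
    using that by (simp add: halts_with_def run_cell_def cell_def)
  show "v = [True] \<longleftrightarrow> fst (run_cell M w T 1 0) = 2 \<and> fst (run_cell M w T 1 1) = 0"
  proof (cases v)
    case Nil
    with c[of 0] show ?thesis by (simp add: word_cells_def)
  next
    case (Cons b u)
    with c[of 0] c[of 1] show ?thesis by (auto simp: word_cells_def split: if_splits)
  qed
qed

datatype rel = RStep nat | RState | RCell "nat \<times> bool" | RFree | RStart | RHalt | RSym nat

instance rel :: countable by countable_datatype

abbreviation st :: "nat \<times> nat list \<Rightarrow> nat" where "st \<equiv> to_nat"

abbreviation ce :: "nat \<times> bool \<Rightarrow> nat" where "ce \<equiv> to_nat"

text \<open>\<open>RState\<close> fixes only the next control state and leaves the symbols read
  there to be guessed. The guess is checked by \<open>RStep j\<close>: if the middle cell carries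
  the head, its symbol must be the one in the local state. \<open>RFree\<close> describes the cells
  of the guessed certificate, where a blank is followed by blanks only.\<close>

fun tuples :: "tm \<Rightarrow> rel \<Rightarrow> nat list set" where
  "tuples M (RStep j) = (\<lambda>(\<sigma>, l, m, r). [st \<sigma>, ce l, ce m, ce r, ce (next_cell (snd (next_action M \<sigma>) ! j) l m r)]) `
    {(\<sigma>, l, m, r) \<in> local_states M \<times> cells M \<times> cells M \<times> cells M. snd m \<longrightarrow> fst m = snd \<sigma> ! j}"
| "tuples M RState = (\<lambda>(\<sigma>, \<sigma>'). [st \<sigma>, st \<sigma>']) `
    {(\<sigma>, \<sigma>') \<in> local_states M \<times> local_states M. fst \<sigma>' = fst (next_action M \<sigma>)}"
| "tuples M (RCell c) = {[ce c]}"
| "tuples M RFree = (\<lambda>(a, b). [ce (a, False), ce (b, False)]) ` {(a, b) \<in> {..2} \<times> {..2}. a = 0 \<longrightarrow> b = 0}"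
| "tuples M RStart = (\<lambda>\<sigma>. [st \<sigma>]) ` {\<sigma> \<in> local_states M. fst \<sigma> = 0}"
| "tuples M RHalt = (\<lambda>\<sigma>. [st \<sigma>]) ` {\<sigma> \<in> local_states M. fst \<sigma> = states M}"
| "tuples M (RSym a) = {[ce (a, False)], [ce (a, True)]}"

lemma finite_tuples: "finite (tuples M R)"
proof (cases R)
  case (RStep j)
  have "finite (local_states M \<times> cells M \<times> cells M \<times> cells M)" by simp
  then show ?thesis unfolding RStep tuples.simps by (rule finite_imageI[OF finite_subset, rotated]) blast
next
  case RState
  have "finite (local_states M \<times> local_states M)" by simp
  then show ?thesis unfolding RState tuples.simps by (rule finite_imageI[OF finite_subset, rotated]) blast
next
  case RFree
  have "finite ({..2 :: nat} \<times> {..2 :: nat})" by simp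
  then show ?thesis unfolding RFree tuples.simps by (rule finite_imageI[OF finite_subset, rotated]) blast
qed simp_all

definition symbol :: "bool \<Rightarrow> nat" where
  "symbol b = (if b then 2 else 1)"

text \<open>\<open>A t\<close> is the value for the local state at time \<open>t\<close>, and \<open>C t j p\<close> the value for the cell of
  tape \<open>j\<close> at position \<open>p - N\<close>.\<close>

definition tableau :: "tm \<Rightarrow> nat \<Rightarrow> nat \<Rightarrow> nat \<Rightarrow> bool list \<Rightarrow> (nat \<Rightarrow> nat) \<Rightarrow> (nat \<Rightarrow> nat \<Rightarrow> nat \<Rightarrow> nat) \<Rightarrow> bool" where
  "tableau M N T B w A C \<longleftrightarrow>
    [A 0] \<in> tuples M RStart \<and> [A T] \<in> tuples M RHalt \<and> [C T 1 N] \<in> tuples M (RSym 2) \<and> [C T 1 (Suc N)] \<in> tuples M (RSym 0) \<and>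
    (\<forall>t < T. [A t, A (Suc t)] \<in> tuples M RState) \<and>
    (\<forall>t < T. \<forall>p < 2 * N. \<forall>j < tapes M. [A t, C t j p, C t j (Suc p), C t j (Suc (Suc p)), C (Suc t) j (Suc p)] \<in> tuples M (RStep j)) \<and>
    (\<forall>p < N. C 0 0 p = ce (0, False)) \<and>
    (\<forall>i < length w. C 0 0 (N + i) = ce (symbol (w ! i), i = 0)) \<and>
    (\<forall>i < B. [C 0 0 (N + length w + i), C 0 0 (Suc (N + length w + i))] \<in> tuples M RFree) \<and>
    (\<forall>i < Suc N. C 0 0 (N + length w + B + i) = ce (0, False)) \<and>
    (\<forall>p < 2 * N + 2. \<forall>j \<in> {1..<tapes M}. C 0 j p = ce (0, p = N))"

lemma tableau_complete:
  assumes M: "wf_tm M" and w: "w \<noteq> []" and y: "length y \<le> B"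
    and acc: "fst (run_state M (w @ y) T) = states M" "fst (run_cell M (w @ y) T 1 0) = 2" "fst (run_cell M (w @ y) T 1 1) = 0"
  shows "tableau M N T B w (\<lambda>t. st (run_state M (w @ y) t)) (\<lambda>t j p. ce (run_cell M (w @ y) t j (int p - int N)))"
proof -
  let ?A = "run_state M (w @ y)" and ?C = "\<lambda>t j p. run_cell M (w @ y) t j (int p - int N)"
  have k: "2 \<le> tapes M" using M by (simp add: wf_tm_def)
  have "[st (?A t), ce (?C t j p), ce (?C t j (Suc p)), ce (?C t j (Suc (Suc p))), ce (?C (Suc t) j (Suc p))] \<in> tuples M (RStep j)"
    if "j < tapes M" for t j p
  proof -
    have "?C (Suc t) j (Suc p) = next_cell (snd (next_action M (?A t)) ! j) (?C t j p) (?C t j (Suc p)) (?C t j (Suc (Suc p)))"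
      unfolding run_cell_Suc[OF M that] by (simp add: algebra_simps)
    with run_state_mem[OF M, of "w @ y" t] run_cell_mem[OF M that] run_cell_read[OF M that, of "w @ y" t "int (Suc p) - int N"]
    show ?thesis unfolding tuples.simps by (intro image_eqI[of _ _ "(?A t, ?C t j p, ?C t j (Suc p), ?C t j (Suc (Suc p)))"]) auto
  qed
  moreover have "[st (?A t), st (?A (Suc t))] \<in> tuples M RState" for t
    using run_state_mem[OF M, of "w @ y"] fst_run_state_Suc[of M "w @ y" t] by force
  moreover have "fst (?A 0) = 0" by (simp add: run_def init_config_def local_state_def)
  then have "[st (?A 0)] \<in> tuples M RStart" using run_state_mem[OF M, of "w @ y" 0] by simp
  moreover have "[st (?A T)] \<in> tuples M RHalt" using run_state_mem[OF M, of "w @ y" T] acc(1) by simp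
  moreover have "[ce (?C T 1 N)] \<in> tuples M (RSym 2)"
    using acc(2) by (cases "?C T 1 N") auto
  moreover have "[ce (?C T 1 (Suc N))] \<in> tuples M (RSym 0)"
    using acc(3) by (cases "?C T 1 (Suc N)") auto
  moreover have "?C 0 0 (N + i) = (word_cells (w @ y) (int i), i = 0)" for i
    using k by (simp add: run_cell_0)
  note cell0 = this
  \<comment> \<open>The head starts at cell \<open>N\<close>. As \<open>w\<close> is nonempty, this
    is a cell of \<open>w\<close>, and the free cells carry no head.\<close>
  have "[ce (?C 0 0 (N + length w + i)), ce (?C 0 0 (Suc (N + length w + i)))] \<in> tuples M RFree" for i
  proof -
    have "?C 0 0 (N + (length w + i)) = (word_cells (w @ y) (int (length w + i)), False)"
      "?C 0 0 (N + Suc (length w + i)) = (word_cells (w @ y) (int (Suc (length w + i))), False)"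
      using cell0[of "length w + i"] cell0[of "Suc (length w + i)"] w by auto
    then show ?thesis unfolding tuples.simps
      by (intro image_eqI[of _ _ "(word_cells (w @ y) (int (length w + i)), word_cells (w @ y) (int (Suc (length w + i))))"])
        (auto simp: word_cells_def add.assoc)
  qed
  moreover have "?C 0 0 (N + i) = (symbol (w ! i), i = 0)" if "i < length w" for i
    unfolding cell0 using that by (simp add: word_cells_def symbol_def nth_append)
  moreover have "?C 0 0 (N + length w + B + i) = (0, False)" for i
    using cell0[of "length w + B + i"] w y by (simp add: word_cells_def add.assoc)
  moreover have "?C 0 0 p = (0, False)" if "p < N" for p
    using that k by (simp add: run_cell_0 word_cells_def)
  moreover have "?C 0 j p = (0, p = N)" if "j \<in> {1..<tapes M}" for j p
    using that by (simp add: run_cell_0)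
  ultimately show ?thesis unfolding tableau_def by simp
qed

text \<open>After the first blank all cells are blank, so the guessed cells spell a word of length
  at most \<open>B\<close>; the blank at position \<open>B\<close> ends it in any case.\<close>

lemma free_word:
  assumes "\<And>i. i < B \<Longrightarrow> [a i, a (Suc i)] \<in> tuples M RFree" "a B = ce (0, False)"
  shows "\<exists>y. length y \<le> B \<and> (\<forall>i \<le> B. a i = ce (if i < length y then symbol (y ! i) else 0, False))"
  using assms
proof (induction B arbitrary: a)
  case 0
  then show ?case by (intro exI[of _ "[]"]) simp
next
  case (Suc B)
  have "\<exists>y. length y \<le> B \<and> (\<forall>i \<le> B. a (Suc i) = ce (if i < length y then symbol (y ! i) else 0, False))"
    using Suc.prems by (intro Suc.IH[of "\<lambda>i. a (Suc i)"]) auto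
  then obtain y where y: "length y \<le> B" "\<And>i. i \<le> B \<Longrightarrow> a (Suc i) = ce (if i < length y then symbol (y ! i) else 0, False)"
    by blast
  from Suc.prems(1)[of 0] obtain u v where uv: "a 0 = ce (u, False)" "a (Suc 0) = ce (v, False)" "u \<le> 2" "u = 0 \<longrightarrow> v = 0"
    by auto
  show ?case
  proof (cases "u = 0")
    case True
    with uv y(2)[of 0] have "y = []" by (cases y) (auto simp: symbol_def split: if_splits)
    then have "a i = ce (0, False)" if "i \<le> Suc B" for i using that y(2) uv(1) True by (cases i) auto
    then show ?thesis by (intro exI[of _ "[]"]) simp
  next
    case False
    with uv(3) have "u = symbol (u = 2)" by (auto simp: symbol_def)
    then have "a i = ce (if i < length ((u = 2) # y) then symbol (((u = 2) # y) ! i) else 0, False)" if "i \<le> Suc B" for i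
      using that y(2) uv(1) by (cases i) auto
    then show ?thesis using y(1) by (intro exI[of _ "(u = 2) # y"]) simp
  qed
qed

text \<open>The border cells of the window are unconstrained after time 0, so the region known to
  agree with the run shrinks by one cell on each side per step. With \<open>N = Suc (2 * T)\<close>
  the head, at distance at most \<open>t\<close> from the middle, and the two output cells stay
  inside this region.\<close>

lemma tableau_sound:
  assumes M: "wf_tm M" and w: "w \<noteq> []" and N: "N = Suc (2 * T)" and tab: "tableau M N T B w A C"
  shows "\<exists>y. length y \<le> B \<and> fst (run_state M (w @ y) T) = states M \<and>
    fst (run_cell M (w @ y) T 1 0) = 2 \<and> fst (run_cell M (w @ y) T 1 1) = 0"
proof -
  have start: "[A 0] \<in> tuples M RStart" and halt: "[A T] \<in> tuples M RHalt"
    and out: "[C T 1 N] \<in> tuples M (RSym 2)" "[C T 1 (Suc N)] \<in> tuples M (RSym 0)"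
    and state: "\<forall>t < T. [A t, A (Suc t)] \<in> tuples M RState"
    and stepc: "\<forall>t < T. \<forall>p < 2 * N. \<forall>j < tapes M.
      [A t, C t j p, C t j (Suc p), C t j (Suc (Suc p)), C (Suc t) j (Suc p)] \<in> tuples M (RStep j)"
    and left: "\<forall>p < N. C 0 0 p = ce (0, False)" and input: "\<forall>i < length w. C 0 0 (N + i) = ce (symbol (w ! i), i = 0)"
    and free: "\<forall>i < B. [C 0 0 (N + length w + i), C 0 0 (Suc (N + length w + i))] \<in> tuples M RFree"
    and right: "\<forall>i < Suc N. C 0 0 (N + length w + B + i) = ce (0, False)"
    and blank: "\<forall>p < 2 * N + 2. \<forall>j \<in> {1..<tapes M}. C 0 j p = ce (0, p = N)"
    using tab unfolding tableau_def by blast+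
  have k: "2 \<le> tapes M" using M by (simp add: wf_tm_def)
  obtain y where y: "length y \<le> B" "\<And>i. i \<le> B \<Longrightarrow> C 0 0 (N + length w + i) = ce (if i < length y then symbol (y ! i) else 0, False)"
    using free_word[of B "\<lambda>i. C 0 0 (N + length w + i)" M] free right[rule_format, of 0] by (auto simp del: tuples.simps)
  let ?A = "run_state M (w @ y)" and ?C = "\<lambda>t j p. run_cell M (w @ y) t j (int p - int N)"
  have init: "C 0 j p = ce (?C 0 j p)" if j: "j < tapes M" and p: "p \<le> 2 * N" for j p
  proof (cases "j = 0")
    case False
    with j have "j \<in> {1..<tapes M}" by simp
    with blank p have "C 0 j p = ce (0, p = N)" by simp
    with False j show ?thesis by (simp add: run_cell_0)
  next
    case True
    consider "p < N" | i where "p = N + i" "i < length w" | i where "p = N + length w + i" "i \<le> B"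
      | i where "p = N + length w + B + i" "0 < i" "i < Suc N"
    proof -
      assume *: "p < N \<Longrightarrow> thesis" "\<And>i. p = N + i \<Longrightarrow> i < length w \<Longrightarrow> thesis" "\<And>i. p = N + length w + i \<Longrightarrow> i \<le> B \<Longrightarrow> thesis"
        "\<And>i. p = N + length w + B + i \<Longrightarrow> 0 < i \<Longrightarrow> i < Suc N \<Longrightarrow> thesis"
      show thesis
      proof (cases "p < N")
        case False
        show ?thesis
        proof (cases "p < N + length w")
          case True
          with False show ?thesis by (intro *(2)[of "p - N"]) auto
        next
          case f: False
          show ?thesis
          proof (cases "p \<le> N + length w + B")
            case True
            with f show ?thesis by (intro *(3)[of "p - (N + length w)"]) auto
          next
            case False
            with f p show ?thesis by (intro *(4)[of "p - (N + length w + B)"]) auto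
          qed
        qed
      qed (rule *(1))
    qed
    then show ?thesis
    proof cases
      case 1
      with left have "C 0 0 p = ce (0, False)" by simp
      with 1 True k show ?thesis by (simp add: run_cell_0 word_cells_def)
    next
      case 2
      with input have "C 0 0 p = ce (symbol (w ! i), i = 0)" by simp
      with 2 True k show ?thesis by (simp add: run_cell_0 word_cells_def symbol_def nth_append)
    next
      case 3
      with y(2) have "C 0 0 p = ce (if i < length y then symbol (y ! i) else 0, False)" by simp
      moreover have "word_cells (w @ y) (int (length w + i)) = (if i < length y then symbol (y ! i) else 0)"
        by (auto simp: word_cells_def symbol_def nth_append nat_int_add)
      moreover have "int (length w) + int i \<noteq> 0" using w by (cases w) auto
      ultimately show ?thesis using 3 True k by (simp add: run_cell_0 add.assoc)
    next
      case 4
      with right have "C 0 0 p = ce (0, False)" by simp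
      with 4 True k w y(1) show ?thesis by (simp add: run_cell_0 word_cells_def)
    qed
  qed
  \<comment> \<open>For \<open>A t\<close> only the control state is claimed. Its symbols are still
    guesses, which the constraints for the step at time \<open>t\<close> settle in the induction
    step.\<close>
  have inv: "(\<exists>\<sigma>. A t = st \<sigma> \<and> fst \<sigma> = fst (?A t)) \<and>
    (\<forall>j < tapes M. \<forall>p. t \<le> p \<and> p + t \<le> 2 * N \<longrightarrow> C t j p = ce (?C t j p))" if "t \<le> T" for t
    using that
  proof (induction t)
    case 0
    from start obtain \<sigma> where "A 0 = st \<sigma>" "fst \<sigma> = 0" by auto
    moreover have "fst (?A 0) = 0" by (simp add: run_def init_config_def local_state_def)
    ultimately show ?case using init by auto
  next
    case (Suc t)
    then obtain \<sigma> where \<sigma>: "A t = st \<sigma>" "fst \<sigma> = fst (?A t)"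
      and cells: "\<And>j p. j < tapes M \<Longrightarrow> t \<le> p \<Longrightarrow> p + t \<le> 2 * N \<Longrightarrow> C t j p = ce (?C t j p)" by auto
    from Suc.prems state have "[A t, A (Suc t)] \<in> tuples M RState" by (simp del: tuples.simps)
    then obtain \<sigma>' where \<sigma>': "\<sigma> \<in> local_states M" "A (Suc t) = st \<sigma>'" "fst \<sigma>' = fst (next_action M \<sigma>)"
      using \<sigma>(1) by auto
    have stp: "(snd (?C t j (Suc p)) \<longrightarrow> fst (?C t j (Suc p)) = snd \<sigma> ! j) \<and>
      C (Suc t) j (Suc p) = ce (next_cell (snd (next_action M \<sigma>) ! j) (?C t j p) (?C t j (Suc p)) (?C t j (Suc (Suc p))))"
      if j: "j < tapes M" and p: "t \<le> p" "p + t + 2 \<le> 2 * N" for j p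
    proof -
      have "[A t, C t j p, C t j (Suc p), C t j (Suc (Suc p)), C (Suc t) j (Suc p)] \<in> tuples M (RStep j)"
        using stepc Suc.prems j p by (simp del: tuples.simps)
      moreover have "C t j p = ce (?C t j p)" "C t j (Suc p) = ce (?C t j (Suc p))" "C t j (Suc (Suc p)) = ce (?C t j (Suc (Suc p)))"
        using p by (intro cells j; simp)+
      ultimately show ?thesis unfolding \<sigma>(1) by (auto simp del: of_nat_Suc)
    qed
    have "snd \<sigma> ! j = snd (?A t) ! j" if j: "j < tapes M" for j
    proof -
      let ?h = "fst (snd (run M (w @ y) t) ! j)"
      from run_head[OF M j, of "w @ y" t] have h: "\<bar>?h\<bar> \<le> int t" .
      \<comment> \<open>The constraint with index \<open>p\<close> has its middle cell at
        \<open>Suc p\<close>; the offset by one puts the head there.\<close>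
      define p where "p = nat (int N + ?h - 1)"
      have p: "int (Suc p) - int N = ?h" "t \<le> p" "p + t + 2 \<le> 2 * N" using h N Suc.prems by (auto simp: p_def)
      have "snd (run_cell M (w @ y) t j ?h)" by (simp add: run_cell_def cell_def)
      with stp[OF j p(2,3)] run_cell_read[OF M j, of "w @ y" t ?h] show ?thesis unfolding p(1) by simp
    qed
    moreover have "length (snd \<sigma>) = tapes M" "length (snd (?A t)) = tapes M"
      using \<sigma>'(1) run_state_mem[OF M, of "w @ y" t] by (auto simp: local_states_def)
    ultimately have "\<sigma> = ?A t" using \<sigma>(2) by (intro prod_eqI nth_equalityI) auto
    have "C (Suc t) j p = ce (?C (Suc t) j p)" if j: "j < tapes M" and p: "Suc t \<le> p" "p + Suc t \<le> 2 * N" for j p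
    proof -
      from p obtain q where q: "p = Suc q" by (cases p) auto
      have "?C (Suc t) j (Suc q) = next_cell (snd (next_action M (?A t)) ! j) (?C t j q) (?C t j (Suc q)) (?C t j (Suc (Suc q)))"
        unfolding run_cell_Suc[OF M j] by (simp add: algebra_simps)
      with stp[OF j, of q] p show ?thesis unfolding q \<open>\<sigma> = ?A t\<close> by simp
    qed
    with \<sigma>'(2,3) \<open>\<sigma> = ?A t\<close> show ?case by (auto simp: fst_run_state_Suc)
  qed
  from inv[of T] obtain \<sigma> where \<sigma>: "A T = st \<sigma>" "fst \<sigma> = fst (?A T)"
    and cells: "\<And>j p. j < tapes M \<Longrightarrow> T \<le> p \<Longrightarrow> p + T \<le> 2 * N \<Longrightarrow> C T j p = ce (?C T j p)" by auto
  from halt \<sigma> have "fst (?A T) = states M" by auto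
  moreover have "C T 1 N = ce (?C T 1 N)" "C T 1 (Suc N) = ce (?C T 1 (Suc N))" using k N by (intro cells; simp)+
  ultimately show ?thesis using y(1) out by (intro exI[of _ y]) auto
qed

section \<open>Computing the constraint instance\<close>

lemma unary_simps: "unary 0 = []" "unary (Suc n) = True # unary n" "unary (m + n) = unary m @ unary n"
  "unary (m * n) = concat (map (\<lambda>_. unary m) (unary n))" "unary (length xs) = map (\<lambda>_. True) xs"
proof -
  show "unary (m * n) = concat (map (\<lambda>_. unary m) (unary n))"
    by (induction n) (simp_all add: unary_def replicate_add)
qed (simp_all add: unary_def replicate_add map_replicate_const)

lemma pt_unary_add: "pt (\<lambda>x. unary (m x)) \<Longrightarrow> pt (\<lambda>x. unary (n x)) \<Longrightarrow> pt (\<lambda>x. unary (m x + n x))"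
  unfolding unary_simps by (rule pt_append)

lemma pt_unary_Suc: "pt (\<lambda>x. unary (n x)) \<Longrightarrow> pt (\<lambda>x. unary (Suc (n x)))"
  unfolding unary_simps by (intro pt_Cons pt_const)

lemma pt_unary_mult:
  assumes "pt (\<lambda>x :: 'a::enc. unary (m x))" "pt (\<lambda>x. unary (n x))"
  shows "pt (\<lambda>x. unary (m x * n x))"
  unfolding unary_simps
  by (intro pt_concat pt_map assms pt_comp[OF assms(1), of fst] pt_fst pt_id)

lemma pt_unary_power: "pt (\<lambda>x. unary (n x)) \<Longrightarrow> pt (\<lambda>x. unary (n x ^ d))"
  by (induction d) (simp_all add: pt_unary_mult pt_const)

lemma pt_unary_length: "pt l \<Longrightarrow> pt (\<lambda>x. unary (length (l x)))"
  unfolding unary_simps by (intro pt_map pt_const)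

definition below :: "nat \<Rightarrow> bool list list" where
  "below n = map unary [0..<n]"

text \<open>Each round appends the current number to the result, so its growth depends on the
  accumulator. The sizes are therefore bounded explicitly by means of the length of the processed
  prefix.\<close>

lemma pt_below:
  assumes "pt (\<lambda>x :: 'a::enc. unary (n x))"
  shows "pt (\<lambda>x. below (n x))"
proof -
  let ?g = "\<lambda>a _. (True # fst a, fst a # snd a)"
  have f: "foldl ?g ([], []) u = (unary (length u), rev (below (length u)))" for u :: "bool list"
    by (induction u rule: rev_induct) (simp_all add: below_def unary_simps(1,2))
  have e: "esize (rev (below n)) \<le> n * (6 * n + 1)" for n
  proof -
    have "esize (below k) \<le> k * (6 * n + 1)" if "k \<le> n" for k
      using that by (induction k) (simp_all add: below_def)
    then show ?thesis by simp
  qed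
  from assms obtain p where p: "polyb p" "\<And>x. esize (unary (n x)) \<le> p (esize x)" by (rule ptE) blast
  have "pt (\<lambda>x. foldl ?g ([], []) (unary (n x)))"
  proof (rule pt_foldl_bounded[where b = "\<lambda>m. 6 * p m + 1 + p m * (6 * p m + 1)"])
    fix x u v assume "unary (n x) = u @ v"
    with p(2)[of x] have le: "length u \<le> p (esize x)" by simp
    have "esize (foldl ?g ([], []) u) \<le> 6 * length u + 1 + length u * (6 * length u + 1)"
      using e[of "length u"] by (simp add: f)
    also have "\<dots> \<le> 6 * p (esize x) + 1 + p (esize x) * (6 * p (esize x) + 1)"
      using le by (intro add_mono mult_mono) simp_all
    finally show "esize (foldl ?g ([], []) u) \<le> 6 * p (esize x) + 1 + p (esize x) * (6 * p (esize x) + 1)" .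
  qed (intro assms pt_const pt_Pair pt_Cons pt_fst pt_snd pt_id polyb_add polyb_mult polyb_const p(1))+
  then have "pt (\<lambda>x. rev (snd (foldl ?g ([], []) (unary (n x)))))" by (intro pt_rev pt_snd)
  then show ?thesis by (simp add: f)
qed

lemma Ball_below: "(\<forall>u \<in> set (below n). P u) \<longleftrightarrow> (\<forall>i < n. P (unary i))"
  by (auto simp: below_def)

text \<open>Dropping a unary number of elements is a fold over that number; the head of the result
  is the bit at this index.\<close>

definition udrop :: "bool list \<Rightarrow> bool list \<Rightarrow> bool list" where
  "udrop u w = foldl (\<lambda>a _. tl a) w u"

lemma udrop: "udrop u w = drop (length u) w"
  by (induction u arbitrary: w) (simp_all add: udrop_def drop_Suc)

lemma pt_udrop: "pt u \<Longrightarrow> pt w \<Longrightarrow> pt (\<lambda>x. udrop (u x) (w x))"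
  unfolding udrop_def
proof (rule pt_foldl_additive[where p = "\<lambda>_. 0"])
  show "esize (tl a) \<le> esize a + 0" for a :: "bool list" by simp
qed (intro pt_tl pt_fst pt_snd pt_id polyb_const | assumption)+

definition st_key :: "bool list \<Rightarrow> rcd" where
  "st_key t = [[False], t]"

text \<open>The tape index is bounded by the machine and hence a constant of the reduction. Times
  and positions depend on the input and are unary words, which \<open>below\<close>
  enumerates.\<close>

definition cell_key :: "bool list \<Rightarrow> nat \<Rightarrow> bool list \<Rightarrow> rcd" where
  "cell_key t j p = [[True], t, unary j, p]"

definition mk_con :: "rel \<Rightarrow> rcd list \<Rightarrow> con" where
  "mk_con R vs = (unary (to_nat R), zip (below (length vs)) vs)"

lemma pt_mk_con1: "pt v1 \<Longrightarrow> pt (\<lambda>x. mk_con R [v1 x])"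
  and pt_mk_con2: "pt v1 \<Longrightarrow> pt v2 \<Longrightarrow> pt (\<lambda>x. mk_con R [v1 x, v2 x])"
  and pt_mk_con5: "pt v1 \<Longrightarrow> pt v2 \<Longrightarrow> pt v3 \<Longrightarrow> pt v4 \<Longrightarrow> pt v5 \<Longrightarrow> pt (\<lambda>x. mk_con R [v1 x, v2 x, v3 x, v4 x, v5 x])"
  unfolding mk_con_def by (simp_all add: below_def upt_rec) (intro pt_Pair pt_Cons pt_const; assumption)+

text \<open>A relation is not an encoded value. Where it depends on a computed bit, a case
  distinction makes it a constant in each branch.\<close>

lemma pt_bool_arg: "pt b \<Longrightarrow> pt (f True) \<Longrightarrow> pt (f False) \<Longrightarrow> pt (\<lambda>x. f (b x) x)"
proof -
  have "f (b x) x = (if b x then f True x else f False x)" for x by simp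
  then show "pt b \<Longrightarrow> pt (f True) \<Longrightarrow> pt (f False) \<Longrightarrow> pt (\<lambda>x. f (b x) x)"
    using pt_If[of b "f True" "f False"] by simp
qed

lemma pt_map_const: "(\<And>a. pt (f a)) \<Longrightarrow> pt (\<lambda>x. map (\<lambda>a. f a x) as)"
  by (induction as) (auto intro!: pt_const pt_Cons)

definition relations :: "tm \<Rightarrow> rel set" where
  "relations M = RStep ` {..<tapes M} \<union> RCell ` ({..2} \<times> UNIV) \<union> {RState, RFree, RStart, RHalt, RSym 0, RSym 2}"

definition input_cons :: "nat \<Rightarrow> bool list \<Rightarrow> bool list \<Rightarrow> con list" where
  "input_cons N w i = (case udrop i w of [] \<Rightarrow> [] | b # _ \<Rightarrow>
    [mk_con (RCell (symbol b, i = [])) [cell_key [] 0 (unary N @ i)]])"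

definition csp_instance :: "nat \<Rightarrow> nat \<Rightarrow> nat \<Rightarrow> nat \<Rightarrow> bool list \<Rightarrow> con list" where
  "csp_instance k N T B w =
    [mk_con RStart [st_key []], mk_con RHalt [st_key (unary T)],
      mk_con (RSym 2) [cell_key (unary T) 1 (unary N)], mk_con (RSym 0) [cell_key (unary T) 1 (unary (Suc N))]] @
    map (\<lambda>t. mk_con RState [st_key t, st_key (True # t)]) (below T) @
    concat (map (\<lambda>t. concat (map (\<lambda>p. map (\<lambda>j.
      mk_con (RStep j) [st_key t, cell_key t j p, cell_key t j (True # p), cell_key t j (True # True # p), cell_key (True # t) j (True # p)])
      [0..<k]) (below (2 * N)))) (below T)) @
    map (\<lambda>p. mk_con (RCell (0, False)) [cell_key [] 0 p]) (below N) @
    concat (map (input_cons N w) (below (length w))) @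
    map (\<lambda>i. mk_con RFree [cell_key [] 0 (unary (N + length w) @ i), cell_key [] 0 (True # unary (N + length w) @ i)]) (below B) @
    map (\<lambda>i. mk_con (RCell (0, False)) [cell_key [] 0 (unary (N + length w + B) @ i)]) (below (Suc N)) @
    concat (map (\<lambda>p. map (\<lambda>j. mk_con (RCell (0, p = unary N)) [cell_key [] j p]) [1..<k]) (below (2 * N + 2)))"

lemma pt_cell_key: "pt t \<Longrightarrow> pt p \<Longrightarrow> pt (\<lambda>x. cell_key (t x) j (p x))"
  unfolding cell_key_def by (intro pt_Cons pt_const)

lemma pt_st_key: "pt t \<Longrightarrow> pt (\<lambda>x. st_key (t x))"
  unfolding st_key_def by (intro pt_Cons pt_const)

lemma pt_csp_instance:
  assumes N: "pt (\<lambda>x. unary (N x))" and T: "pt (\<lambda>x. unary (T x))" and B: "pt (\<lambda>x. unary (B x))" and w: "pt w"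
  shows "pt (\<lambda>x. csp_instance k (N x) (T x) (B x) (w x))"
proof -
  have symb: "pt (\<lambda>z. mk_con (RCell (symbol (b z), h z)) [v z])" if "pt b" "pt h" "pt v" for b h v
  proof -
    have "pt (\<lambda>z. mk_con (RCell (symbol c, h z)) [v z])" for c
      by (rule pt_bool_arg[where f = "\<lambda>h z. mk_con (RCell (symbol c, h)) [v z]"]) (intro that pt_mk_con1)+
    then show ?thesis by (intro pt_bool_arg[where b = b and f = "\<lambda>c z. mk_con (RCell (symbol c, h z)) [v z]", OF that(1)])
  qed
  have blank: "pt (\<lambda>z. mk_con (RCell (0, h z)) [v z])" if "pt h" "pt v" for h v
    by (rule pt_bool_arg[where f = "\<lambda>h z. mk_con (RCell (0, h)) [v z]"]) (intro that pt_mk_con1)+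
  show ?thesis
    unfolding csp_instance_def input_cons_def
    by (intro pt_append pt_concat pt_map pt_Cons pt_map_const pt_case_list symb blank pt_mk_con1 pt_mk_con2 pt_mk_con5 pt_st_key pt_cell_key pt_below
        pt_udrop pt_eq pt_unary_add pt_unary_Suc pt_unary_mult pt_unary_length pt_comp[OF N] pt_comp[OF T] pt_comp[OF B] pt_comp[OF w]
        pt_fst pt_snd pt_id pt_const)
qed

definition csp_template :: "tm \<Rightarrow> template \<Rightarrow> bool" where
  "csp_template M Tm \<longleftrightarrow> set Tm = (\<Union>R \<in> relations M. Pair (unary (to_nat R)) ` tuples M R)"

lemma csp_template_exists: "\<exists>Tm. csp_template M Tm"
  unfolding csp_template_def by (rule finite_list) (intro finite_UN_I finite_imageI finite_tuples, simp add: relations_def)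

lemma satisfies_mk_con:
  assumes "csp_template M Tm" "R \<in> relations M"
  shows "(fst (mk_con R vs), map (\<lambda>p. \<alpha> (snd p)) (snd (mk_con R vs))) \<in> set Tm \<longleftrightarrow> map \<alpha> vs \<in> tuples M R"
proof -
  have "map (\<lambda>p. \<alpha> (snd p)) (zip (below (length vs)) vs) = map \<alpha> (map snd (zip (below (length vs)) vs))" by simp
  also have "\<dots> = map \<alpha> vs" by (subst map_snd_zip) (simp_all add: below_def)
  finally show ?thesis using assms by (auto simp: csp_template_def mk_con_def)
qed

fun arity :: "rel \<Rightarrow> nat" where
  "arity (RStep j) = 5" | "arity RState = 2" | "arity RFree = 2" | "arity R = 1"

lemma length_tuples: "ts \<in> tuples M R \<Longrightarrow> length ts = arity R"
  by (cases R) auto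

text \<open>A relation without tuples would leave no label in the template, and the second query
  could then fail to map into the path.\<close>

lemma tuples_nonempty:
  assumes M: "wf_tm M" and R: "R \<in> relations M"
  shows "tuples M R \<noteq> {}"
proof -
  let ?\<sigma> = "\<lambda>q. (q, replicate (tapes M) (0 :: nat))"
  have st: "?\<sigma> q \<in> local_states M" if "q \<le> states M" for q
    using that M by (auto simp: local_states_def wf_tm_def)
  have ce: "(0, False) \<in> cells M" using M by (auto simp: cells_def wf_tm_def)
  show ?thesis
  proof (cases R)
    case (RStep j)
    have "(?\<sigma> 0, (0, False), (0, False), (0, False)) \<in>
      {(\<sigma>, l, m, r) \<in> local_states M \<times> cells M \<times> cells M \<times> cells M. snd m \<longrightarrow> fst m = snd \<sigma> ! j}"
      using st[of 0] ce by simp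
    then show ?thesis unfolding RStep tuples.simps by blast
  next
    case RState
    have "(?\<sigma> 0, ?\<sigma> (fst (next_action M (?\<sigma> 0)))) \<in> {(\<sigma>, \<sigma>') \<in> local_states M \<times> local_states M. fst \<sigma>' = fst (next_action M \<sigma>)}"
      using st[of 0] st[OF next_action_ok(1)[OF M st[of 0]]] by simp
    then show ?thesis unfolding RState tuples.simps by blast
  next
    case RStart
    have "?\<sigma> 0 \<in> {\<sigma> \<in> local_states M. fst \<sigma> = 0}" using st[of 0] by simp
    then show ?thesis unfolding RStart tuples.simps by blast
  next
    case RHalt
    have "?\<sigma> (states M) \<in> {\<sigma> \<in> local_states M. fst \<sigma> = states M}" using st[of "states M"] by simp
    then show ?thesis unfolding RHalt tuples.simps by blast
  qed auto
qed

lemma csp_instance_relations: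
  assumes M: "wf_tm M" and c: "c \<in> set (csp_instance (tapes M) N T B w)"
  shows "\<exists>R vs. c = mk_con R vs \<and> R \<in> relations M \<and> length vs = arity R"
proof -
  define ok where "ok c \<longleftrightarrow> (\<exists>R vs. c = mk_con R vs \<and> R \<in> relations M \<and> length vs = arity R)" for c
  have ok: "ok (mk_con R vs)" if "R \<in> relations M" "length vs = arity R" for R vs
    using that unfolding ok_def by blast
  have "symbol b \<le> 2" for b by (simp add: symbol_def)
  then have "\<forall>c \<in> set (input_cons N w i). ok c" for i
    unfolding input_cons_def by (cases "udrop i w") (simp_all add: ok relations_def)
  then have "\<forall>c \<in> set (csp_instance (tapes M) N T B w). ok c"
    unfolding csp_instance_def by (simp add: ball_Un ok relations_def)
  with c show ?thesis unfolding ok_def by blast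
qed

text \<open>Each group of constraints expresses one conjunct of \<open>tableau\<close>, with the
  keys naming its entries.\<close>

lemma satisfies_csp_instance:
  assumes M: "wf_tm M" and Tm: "csp_template M Tm"
  shows "satisfies Tm (csp_instance (tapes M) N T B w) \<alpha> \<longleftrightarrow>
    tableau M N T B w (\<lambda>t. \<alpha> (st_key (unary t))) (\<lambda>t j p. \<alpha> (cell_key (unary t) j (unary p)))"
proof -
  let ?ok = "\<lambda>c. (fst c, map (\<lambda>p. \<alpha> (snd p)) (snd c)) \<in> set Tm"
  have rel: "R \<in> {RState, RFree, RStart, RHalt, RSym 0, RSym 2} \<Longrightarrow> R \<in> relations M"
    "j < tapes M \<Longrightarrow> RStep j \<in> relations M" "RCell (0, h) \<in> relations M" "RCell (symbol b, h) \<in> relations M" for R j b h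
    by (auto simp: relations_def symbol_def)
  note ok = satisfies_mk_con[OF Tm]
  have w: "(\<forall>c \<in> set (input_cons N w (unary i)). ?ok c) \<longleftrightarrow>
    \<alpha> (cell_key [] 0 (unary N @ unary i)) = ce (symbol (w ! i), i = 0)" if "i < length w" for i
  proof -
    have "udrop (unary i) w = w ! i # drop (Suc i) w" using that by (simp add: udrop Cons_nth_drop_Suc)
    moreover have "unary i = [] \<longleftrightarrow> i = 0" by (simp add: unary_def)
    ultimately show ?thesis by (simp add: input_cons_def ok rel)
  qed
  show ?thesis
    unfolding satisfies_def csp_instance_def tableau_def
    by (simp add: ball_Un Ball_below w ok rel unary_simps del: tuples.simps(1,2,4,5,6,7)) (simp only: Ball_def atLeastLessThan_iff le0 simp_thms)
qed

lemma NP_csp_reducible: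
  assumes "L \<in> NP"
  shows "csp_reducible L"
proof -
  from assms obtain V c d where V: "polytime V"
    "\<And>x. x \<in> L \<longleftrightarrow> (\<exists>y. length y \<le> c * length x ^ d + c \<and> V (pair_word x y) = [True])"
    unfolding NP_def by blast
  from V(1) obtain M c' d' where M: "wf_tm M"
    and halts: "\<And>w. \<exists>t \<le> c' * length w ^ d' + c'. halts_with M (run M w t) (V w)"
    unfolding polytime_def run_def by blast
  obtain Tm where Tm: "csp_template M Tm" using csp_template_exists by blast
  define B where "B x = c * length x ^ d + c" for x :: "bool list"
  \<comment> \<open>The verifier runs on \<open>self_delim x @ y\<close>. Its time bound is taken at
    the greatest admissible length of \<open>y\<close>, so that one horizon serves all
    certificates.\<close>
  define T where "T x = c' * (length (self_delim x) + B x) ^ d' + c'" for x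
  define F where "F x = csp_instance (tapes M) (Suc (2 * T x)) (T x) (B x) (self_delim x)" for x
  have B: "pt (\<lambda>x. unary (B x))"
    unfolding B_def by (intro pt_unary_add pt_unary_mult pt_unary_power pt_unary_length pt_id pt_const)
  have T: "pt (\<lambda>x. unary (T x))"
    unfolding T_def
    by (intro pt_unary_add pt_unary_mult pt_unary_power pt_unary_length
      pt_self_delim pt_id pt_const B)
  have "pt F" unfolding F_def by (intro pt_csp_instance pt_unary_Suc pt_unary_mult T B pt_self_delim pt_id pt_const)
  moreover have "arity_ok Tm (F x) \<and> F x \<noteq> [] \<and> (\<forall>c \<in> set (F x). fst c \<in> fst ` set Tm) \<and> (x \<in> L \<longleftrightarrow> (\<exists>\<alpha>. satisfies Tm (F x) \<alpha>))" for x
  proof (intro conjI)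
    have rel: "\<exists>R vs. con = mk_con R vs \<and> R \<in> relations M \<and> length vs = arity R" if "con \<in> set (F x)" for con
      using csp_instance_relations[OF M that[unfolded F_def]] .
    show "F x \<noteq> []" by (simp add: F_def csp_instance_def)
    show "\<forall>c \<in> set (F x). fst c \<in> fst ` set Tm"
    proof
      fix con assume "con \<in> set (F x)"
      from rel[OF this] obtain R vs where "con = mk_con R vs" "R \<in> relations M" by blast
      with tuples_nonempty[OF M this(2)] show "fst con \<in> fst ` set Tm"
        using Tm by (force simp: csp_template_def mk_con_def)
    qed
    show "arity_ok Tm (F x)"
      unfolding arity_ok_def
    proof (intro ballI conjI allI impI)
      fix con assume "con \<in> set (F x)"
      from rel[OF this] obtain R vs where R: "con = mk_con R vs" "length vs = arity R" by blast
      show "well_indexed con" by (simp add: R(1) mk_con_def well_indexed_def below_def)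
      fix t assume "(fst con, t) \<in> set Tm"
      with Tm have "t \<in> tuples M R" by (auto simp: csp_template_def R(1) mk_con_def)
      then show "length t = length (snd con)" by (simp add: length_tuples R mk_con_def below_def)
    qed
    let ?w = "self_delim x"
    have w: "?w \<noteq> []" by (simp add: self_delim_def)
    have acc: "V (pair_word x y) = [True] \<longleftrightarrow> fst (run_state M (?w @ y) (T x)) = states M \<and>
      fst (run_cell M (?w @ y) (T x) 1 0) = 2 \<and> fst (run_cell M (?w @ y) (T x) 1 1) = 0" if y: "length y \<le> B x" for y
    proof -
      obtain t where t: "t \<le> c' * length (?w @ y) ^ d' + c'" "halts_with M (run M (?w @ y) t) (V (?w @ y))"
        using halts by blast
      have "c' * length (?w @ y) ^ d' + c' \<le> T x"
        unfolding T_def using y by (intro add_mono mult_mono power_mono) simp_all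
      with t(1) have "t \<le> T x" by simp
      from run_accepts[OF M t(2) this] show ?thesis by (simp add: pair_word_def)
    qed
    show "x \<in> L \<longleftrightarrow> (\<exists>\<alpha>. satisfies Tm (F x) \<alpha>)"
    proof
      assume "x \<in> L"
      then obtain y where y: "length y \<le> B x" "V (pair_word x y) = [True]" unfolding V(2) B_def by blast
      let ?A = "\<lambda>t. st (run_state M (?w @ y) t)"
        and ?C = "\<lambda>t j p. ce (run_cell M (?w @ y) t j (int p - int (Suc (2 * T x))))"
      \<comment> \<open>All indices in a key are unary words, so their lengths give the indices
        back.\<close>
      define \<alpha> where "\<alpha> v = (if hd v = [False] then ?A (length (v ! 1)) else ?C (length (v ! 1)) (length (v ! 2)) (length (v ! 3)))"
        for v :: rcd
      have "\<alpha> (st_key (unary t)) = ?A t" for t by (simp add: \<alpha>_def st_key_def)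
      moreover have "\<alpha> (cell_key (unary t) j (unary p)) = ?C t j p" for t j p by (simp add: \<alpha>_def cell_key_def)
      moreover have "tableau M (Suc (2 * T x)) (T x) (B x) ?w ?A ?C"
        using acc[OF y(1)] y(2) by (intro tableau_complete M w y(1)) blast+
      ultimately show "\<exists>\<alpha>. satisfies Tm (F x) \<alpha>"
        unfolding F_def satisfies_csp_instance[OF M Tm] by (intro exI[of _ \<alpha>]) simp
    next
      assume "\<exists>\<alpha>. satisfies Tm (F x) \<alpha>"
      then obtain y where "length y \<le> B x" "V (pair_word x y) = [True]"
        unfolding F_def satisfies_csp_instance[OF M Tm] using tableau_sound[OF M w refl] acc by blast
      then show "x \<in> L" unfolding V(2) B_def by blast
    qed
  qed
  ultimately show ?thesis unfolding csp_reducible_def by blast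
qed

theorem theorem8:
  "DP_complete (single_testing_s TYPE('d) EL) \<and>
   DP_complete (single_testing_m TYPE('d) EL) \<and>
   DP_complete (single_testing_s TYPE('d) ELH) \<and>
   DP_complete (single_testing_m TYPE('d) ELH)"
proof -
  have "EL \<subseteq> ELH" by (auto simp: EL_def ELH_def)
  then show ?thesis
    unfolding DP_complete_def
    using single_testing_s_DP[of EL True, where 'd = 'd] single_testing_m_DP[of EL True, where 'd = 'd]
      single_testing_s_DP[of ELH False, where 'd = 'd] single_testing_m_DP[of ELH False, where 'd = 'd]
    by (intro conjI ballI single_testing_s_hard single_testing_m_hard NP_csp_reducible) simp_all
qed

end
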